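(* Fix a partition $I\cup J=\{1,\dots,n\}$, $I\cap J=\varnothing$, $I=\{i_1<\dots<i_k\}$, $J=\{j_1<\dots<j_m\}$, $m=n-k$. The $2$-parametric family of Poisson brackets on $\mathrm{Mat}_{k,m}$ with the property that for any choice of the parameters $\alpha_{ij},\beta_{ij}$ it contains a unique Poisson bracket such that for any network $N\in\mathrm{Net}_{I,J}$ the boundary measurement map $M_N:(\mathbb R\setminus 0)^{|E|}\to\mathrm{Mat}_{k,m}$ is Poisson with respect to $\{\cdot,\cdot\}_N$, is given by $$\{M_{pq},M_{\bar p\bar q}\}_{I,J}=(\alpha-\beta)\,s_=(i_p,j_q,i_{\bar p},j_{\bar q})\,M_{p\bar q}M_{\bar p q}+(\alpha+\beta)\,s_\times(i_p,j_q,i_{\bar p},j_{\bar q})\,M_{pq}M_{\bar p\bar q}$$ for $p,\bar p\in\{1,\dots,k\}$, $q,\bar q\in\{1,\dots,m\}$, where $M_{pq}$ are the matrix entries on $\mathrm{Mat}_{k,m}$, and the bracket corresponding to the parameters $\alpha_{ij},\beta_{ij}$ is the one with $$\alpha=\alpha_{23}+\alpha_{13}-\alpha_{12},\qquad \beta=\beta_{23}+\beta_{13}-\beta_{12}.$$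
   Context: **Networks.** $G=(V,E)$ is a directed planar graph without loops and parallel edges drawn in a disk. Exactly $n$ vertices $b_1,\dots,b_n$ lie on the boundary circle, labelled counterclockwise; $b_i$ is a source (exactly one outgoing edge, no incoming edges) for $i\in I$ and a sink (exactly one incoming edge, no outgoing edges) for $i\in J$. All internal vertices have degree 3 and are either white (exactly one incoming edge) or black (exactly one outgoing edge). $\mathrm{Net}_{I,J}$ is the set of all perfect planar networks $N=(G,w)$ with such $G$ and edge weights as follows. **Weights and brackets.** A flag is a pair $(v,e)$ with $v$ an endpoint of $e$. To each internal vertex $v$ attach coordinates $x_v^1,x_v^2,x_v^3\in\mathbb R\setminus 0$ labelling the three flags at $v$: $x_v^1$ labels the flag of the unique incoming edge if $v$ is white, of the unique outgoing edge if $v$ is black, and the flags labelled $x_v^1,x_v^2,x_v^3$ follow each other clockwise around $v$. To each boundary vertex attach one coordinate in $\mathbb R\setminus 0$ labelling its unique flag. $\mathcal R$ is the product of all these coordinate spaces. The weight $w_e$ of an edge is the product of the coordinates labelling its two flags, so the space of edge weights is $(\mathbb R\setminus 0)^{|E|}$. For constants $\alpha_{ij}=-\alpha_{ji}$, $\beta_{ij}=-\beta_{ji}$ ($i,j\in\{1,2,3\}$), the bracket on $\mathcal R$ is given by $\{x_v^i,x_v^j\}=\alpha_{ij}x_v^ix_v^j$ at white $v$, $\{x_v^i,x_v^j\}=\beta_{ij}x_v^ix_v^j$ at black $v$, all other brackets of coordinates being zero. $\{\cdot,\cdot\}_N$ denotes its pushforward to $(\mathbb R\setminus 0)^{|E|}$,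 which is a well-defined Poisson bracket. **Path weights.** For a closed oriented polygonal plane curve $C$ (collinear consecutive segments having the same direction) and an oriented line $l$ not collinear to any segment of $C$, let $c_l(C)\in\mathbb Z/2\mathbb Z$ be the number mod 2 of pairs $(e',e'')$ of consecutive segments such that the direction vector of $l$ lies in the interior of the cone spanned by $e'$ and $e''$; it does not depend on $l$ and is denoted $c(C)$ (the concordance number). Draw $N$ with straight edges and with all internal vertices in the interior of the convex hull of the boundary vertices. For a path $P$ from a source $b_i$ to a sink $b_j$ (edges may repeat), $C_P$ is the closed curve obtained by adding to $P$ the path from $b_j$ to $b_i$ going counterclockwise along the boundary of the convex hull of the boundary vertices, and $w_P=(-1)^{c(C_P)-1}\prod_{e\in P}w_e$. **Boundary measurements.** $M(i,j)$ is the sum of $w_P$ over all paths from $b_i$ to $b_j$; this formal series represents a rational function of the edge weights. $M_N=(M(i_p,j_q))_{p,q}$ defines the rational boundary measurement map. **The functions $s_=$ and $s_\times$.** $a\prec b\prec c\prec\cdots$ means that the (distinct) indices occur in this counterclockwise cyclic order on the boundary circle. For $i,i'\in I$, $j,j'\in J$, $$s_=(i,j,i',j')=\begin{cases}1&\text{if } i\prec i'\prec j'\prec j,\\ -1&\text{if } i'\prec i\prec j\prec j',\\ \tfrac12&\text{if } i=i'\prec j'\prec j\text{ or } i\prec i'\prec j'=j,\\ -\tfrac12&\text{if } i'=i\prec j\prec j'\text{ or } i'\prec i\prec j=j',\\ 0&\text{otherwise,}\end{cases}$$ $$s_\times(i,j,i',j')=\begin{cases}1&\text{if } i'\prec i\prec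 j'\prec j,\\ -1&\text{if } i\prec i'\prec j\prec j',\\ \tfrac12&\text{if } i'=i\prec j'\prec j\text{ or } i'\prec i\prec j'=j,\\ -\tfrac12&\text{if } i=i'\prec j\prec j'\text{ or } i\prec i'\prec j=j',\\ 0&\text{otherwise.}\end{cases}$$ *)

theory Defs
  imports "HOL-Analysis.Analysis" "HOL-Library.Poly_Mapping"
begin

section \<open>Poisson brackets on coordinate spaces\<close>

text \<open>
  For a finite index set \<open>S\<close>, the space of real \<open>S\<close>-tuples is \<open>S \<rightarrow>\<^sub>E UNIV\<close>; functions on it are
  in turn \<^const>\<open>extensional\<close>, so that equality of functions and of brackets is equality in HOL.
\<close>

definition coord_space :: "'s set \<Rightarrow> ('s \<Rightarrow> real) set" where
  "coord_space S = S \<rightarrow>\<^sub>E UNIV"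

definition pderiv_at :: "'s \<Rightarrow> (('s \<Rightarrow> real) \<Rightarrow> real) \<Rightarrow> ('s \<Rightarrow> real) \<Rightarrow> real" where
  "pderiv_at s f x = deriv (\<lambda>t. f (x(s := t))) (x s)"

text \<open>\<open>C\<^sup>\<infinity>\<close>: all iterated partial derivatives exist and are continuous.\<close>

definition smooth_funs :: "'s set \<Rightarrow> (('s \<Rightarrow> real) \<Rightarrow> real) set" where
  "smooth_funs S = {f \<in> extensional (coord_space S). \<forall>ss. set ss \<subseteq> S \<longrightarrow>
      continuous_on (coord_space S) (foldr pderiv_at ss f) \<and>
      (\<forall>s\<in>S. \<forall>x\<in>coord_space S.
         (\<lambda>t. foldr pderiv_at ss f (x(s := t))) differentiable (at (x s)))}"

type_synonym 's bracket =
  "(('s \<Rightarrow> real) \<Rightarrow> real) \<Rightarrow> (('s \<Rightarrow> real) \<Rightarrow> real) \<Rightarrow> ('s \<Rightarrow> real) \<Rightarrow> real"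

definition poisson_bracket :: "'s set \<Rightarrow> 's bracket \<Rightarrow> bool" where
  "poisson_bracket S B \<longleftrightarrow>
     B \<in> smooth_funs S \<rightarrow>\<^sub>E smooth_funs S \<rightarrow>\<^sub>E smooth_funs S \<and>
     (\<forall>f\<in>smooth_funs S. \<forall>g\<in>smooth_funs S. \<forall>h\<in>smooth_funs S. \<forall>c. \<forall>x\<in>coord_space S.
        B f g x = - B g f x \<and>
        B (\<lambda>y\<in>coord_space S. c * f y + g y) h x = c * B f h x + B g h x \<and>
        B (\<lambda>y\<in>coord_space S. f y * g y) h x = f x * B g h x + g x * B f h x \<and>
        B f (B g h) x + B g (B h f) x + B h (B f g) x = 0)"


section \<open>Perfect planar networks\<close>

text \<open>
  The disk is the closed unit disk in the complex plane, and a network is given by a drawing with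
  straight edges: a vertex is a point, and an edge is the pair of its tail and its head.
\<close>

type_synonym edge = "complex \<times> complex"
type_synonym flag = "complex \<times> edge"

record network =
  bnum :: nat
  bpt :: "nat \<Rightarrow> complex"
  inner_verts :: "complex set"
  edges :: "edge set"

definition bdry_verts :: "network \<Rightarrow> complex set" where
  "bdry_verts N = bpt N ` {1..bnum N}"

definition verts :: "network \<Rightarrow> complex set" where
  "verts N = bdry_verts N \<union> inner_verts N"

definition in_edges :: "network \<Rightarrow> complex \<Rightarrow> edge set" where
  "in_edges N v = {e \<in> edges N. snd e = v}"

definition out_edges :: "network \<Rightarrow> complex \<Rightarrow> edge set" where
  "out_edges N v = {e \<in> edges N. fst e = v}"

definition white :: "network \<Rightarrow> complex \<Rightarrow> bool" where
  "white N v \<longleftrightarrow> card (in_edges N v) = 1"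

definition black :: "network \<Rightarrow> complex \<Rightarrow> bool" where
  "black N v \<longleftrightarrow> card (out_edges N v) = 1"

definition ccw_on_circle :: "nat \<Rightarrow> (nat \<Rightarrow> complex) \<Rightarrow> bool" where
  "ccw_on_circle n b \<longleftrightarrow> (\<exists>\<theta> :: nat \<Rightarrow> real.
     (\<forall>i\<in>{1..n}. b i = cis (\<theta> i)) \<and>
     (\<forall>i\<in>{1..n}. \<forall>j\<in>{1..n}. i < j \<longrightarrow> \<theta> i < \<theta> j \<and> \<theta> j < \<theta> i + 2 * pi))"

text \<open>
  The disjointness of straight edges in the definition also excludes parallel and antiparallel edges.
\<close>

definition Net :: "nat \<Rightarrow> nat set \<Rightarrow> nat set \<Rightarrow> network set" where
  "Net n I J = {N.
     bnum N = n \<and>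
     ccw_on_circle n (bpt N) \<and>
     finite (inner_verts N) \<and>
     inner_verts N \<subseteq> interior (convex hull (bdry_verts N)) \<and>
     edges N \<subseteq> verts N \<times> verts N \<and>
     (\<forall>e\<in>edges N. fst e \<noteq> snd e) \<and>
     (\<forall>e\<in>edges N. \<forall>e'\<in>edges N. e \<noteq> e' \<longrightarrow>
        closed_segment (fst e) (snd e) \<inter> closed_segment (fst e') (snd e')
          \<subseteq> {fst e, snd e} \<inter> {fst e', snd e'}) \<and>
     (\<forall>i\<in>I. card (out_edges N (bpt N i)) = 1 \<and> in_edges N (bpt N i) = {}) \<and>
     (\<forall>j\<in>J. card (in_edges N (bpt N j)) = 1 \<and> out_edges N (bpt N j) = {}) \<and>
     (\<forall>v\<in>inner_verts N. card (in_edges N v \<union> out_edges N v) = 3 \<and> (white N v \<or> black N v))}"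


section \<open>Flag coordinates, weights, and the brackets\<close>

definition flags :: "network \<Rightarrow> flag set" where
  "flags N = {(v, e). e \<in> edges N \<and> (v = fst e \<or> v = snd e)}"

definition flag_space :: "network \<Rightarrow> (flag \<Rightarrow> real) set" where
  "flag_space N = flags N \<rightarrow>\<^sub>E (UNIV - {0})"

definition weight_space :: "network \<Rightarrow> (edge \<Rightarrow> real) set" where
  "weight_space N = edges N \<rightarrow>\<^sub>E (UNIV - {0})"

definition weights :: "network \<Rightarrow> (flag \<Rightarrow> real) \<Rightarrow> edge \<Rightarrow> real" where
  "weights N x = (\<lambda>e\<in>edges N. x (fst e, e) * x (snd e, e))"

text \<open>The angle of the clockwise rotation at \<open>v\<close> that takes edge \<open>e\<close> to edge \<open>e'\<close>.\<close>

definition edge_dir :: "complex \<Rightarrow> edge \<Rightarrow> complex" where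
  "edge_dir v e = (if fst e = v then snd e - v else fst e - v)"

definition cw_angle :: "complex \<Rightarrow> edge \<Rightarrow> edge \<Rightarrow> real" where
  "cw_angle v e e' = Arg2pi (edge_dir v e / edge_dir v e')"

text \<open>
  \<open>flag_edge N v i\<close> is the edge of the flag at \<open>v\<close> labelled \<open>x\<^sub>v\<^sup>i\<close>; at an internal vertex these
  conditions determine its values at 1, 2, 3.
\<close>

definition flag_edge :: "network \<Rightarrow> complex \<Rightarrow> nat \<Rightarrow> edge" where
  "flag_edge N v = (SOME h.
     h ` {1, 2, 3} = in_edges N v \<union> out_edges N v \<and>
     h 1 \<in> (if white N v then in_edges N v else out_edges N v) \<and>
     0 < cw_angle v (h 1) (h 2) \<and> cw_angle v (h 1) (h 2) < cw_angle v (h 1) (h 3))"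

definition skew3 :: "(nat \<Rightarrow> nat \<Rightarrow> real) \<Rightarrow> bool" where
  "skew3 a \<longleftrightarrow> (\<forall>i\<in>{1..3}. \<forall>j\<in>{1..3}. a i j = - a j i)"

definition flag_bracket ::
  "network \<Rightarrow> (nat \<Rightarrow> nat \<Rightarrow> real) \<Rightarrow> (nat \<Rightarrow> nat \<Rightarrow> real) \<Rightarrow> flag bracket" where
  "flag_bracket N a b F G x =
     (\<Sum>v\<in>inner_verts N. \<Sum>i\<in>{1..3}. \<Sum>j\<in>{1..3}.
        let s = (v, flag_edge N v i); t = (v, flag_edge N v j) in
        (if white N v then a i j else b i j) * x s * x t * pderiv_at s F x * pderiv_at t G x)"

text \<open>
  The pushforward along \<^const>\<open>weights\<close>; the value does not depend on the chosen preimage.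
\<close>

definition net_bracket ::
  "network \<Rightarrow> (nat \<Rightarrow> nat \<Rightarrow> real) \<Rightarrow> (nat \<Rightarrow> nat \<Rightarrow> real) \<Rightarrow> edge bracket" where
  "net_bracket N a b \<phi> \<psi> w =
     flag_bracket N a b (\<phi> \<circ> weights N) (\<psi> \<circ> weights N)
       (SOME x. x \<in> flag_space N \<and> weights N x = w)"


section \<open>Paths and concordance numbers\<close>

text \<open>
  A closed polygonal curve is the list of its corners, the last one being joined to the first one.
\<close>

definition seg :: "complex list \<Rightarrow> nat \<Rightarrow> complex" where
  "seg C t = C ! (Suc t mod length C) - C ! (t mod length C)"

text \<open>
  The interior of the cone spanned by \<open>u\<close> and \<open>v\<close>.  Concordance numbers are only defined for curves
  without two consecutive segments of opposite direction.  The one exception among the curves used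
  below is an edge from a boundary vertex to its clockwise neighbour, which the hull path retraces
  backwards; there the half turn is read as a left turn, as for a thin counterclockwise polygon.
\<close>

definition cone_interior :: "complex \<Rightarrow> complex \<Rightarrow> complex set" where
  "cone_interior u v =
     (if \<exists>c<0. v = c *\<^sub>R u then {d. 0 < Im (cnj u * d)}
      else interior {s *\<^sub>R u + t *\<^sub>R v | s t. 0 \<le> s \<and> 0 \<le> t})"

text \<open>The result does not depend on the direction \<open>d\<close> of the auxiliary line.\<close>

definition concordance :: "complex list \<Rightarrow> nat" where
  "concordance C =
     (let d = (SOME d. \<forall>t<length C. \<not> collinear {0, d, seg C t})
      in card {t. t < length C \<and> d \<in> cone_interior (seg C t) (seg C (Suc t))} mod 2)"

text \<open>A path is the list of its vertices.\<close>

definition net_paths :: "network \<Rightarrow> nat \<Rightarrow> nat \<Rightarrow> complex list set" where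
  "net_paths N i j = {vs. vs \<noteq> [] \<and> hd vs = bpt N i \<and> last vs = bpt N j \<and>
     successively (\<lambda>u v. (u, v) \<in> edges N) vs}"

definition path_edges :: "complex list \<Rightarrow> edge list" where
  "path_edges vs = zip vs (tl vs)"

text \<open>
  The boundary vertices strictly between \<open>b\<^sub>j\<close> and \<open>b\<^sub>i\<close> in counterclockwise order.  As the boundary
  vertices lie on a circle, these are the corners of the boundary of their convex hull met on the
  way from \<open>b\<^sub>j\<close> to \<open>b\<^sub>i\<close>.
\<close>

definition hull_path :: "network \<Rightarrow> nat \<Rightarrow> nat \<Rightarrow> complex list" where
  "hull_path N j i =
     map (\<lambda>t. bpt N ((j + t - 1) mod bnum N + 1)) [1..<(i + bnum N - j) mod bnum N]"

definition path_sign :: "network \<Rightarrow> nat \<Rightarrow> nat \<Rightarrow> complex list \<Rightarrow> real" where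
  "path_sign N i j vs = (- 1) powi (int (concordance (vs @ hull_path N j i)) - 1)"


section \<open>Boundary measurements\<close>

text \<open>
  Monomials in the edge weights are elements of \<open>edge \<Rightarrow>\<^sub>0 nat\<close>, polynomials are finitely supported
  and formal power series are arbitrary functions from monomials to the reals.  \<open>bm_series N i j\<close>
  is the formal series \<open>M(i,j)\<close>.
\<close>

definition path_monom :: "complex list \<Rightarrow> edge \<Rightarrow>\<^sub>0 nat" where
  "path_monom vs = (\<Sum>e\<leftarrow>path_edges vs. Poly_Mapping.single e 1)"

definition bm_series :: "network \<Rightarrow> nat \<Rightarrow> nat \<Rightarrow> (edge \<Rightarrow>\<^sub>0 nat) \<Rightarrow> real" where
  "bm_series N i j d = (\<Sum>vs | vs \<in> net_paths N i j \<and> path_monom vs = d. path_sign N i j vs)"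

definition weight_polys :: "network \<Rightarrow> ((edge \<Rightarrow>\<^sub>0 nat) \<Rightarrow>\<^sub>0 real) set" where
  "weight_polys N = {P. \<forall>d\<in>Poly_Mapping.keys P. Poly_Mapping.keys d \<subseteq> edges N}"

definition peval :: "((edge \<Rightarrow>\<^sub>0 nat) \<Rightarrow>\<^sub>0 real) \<Rightarrow> (edge \<Rightarrow> real) \<Rightarrow> real" where
  "peval P w = (\<Sum>d\<in>Poly_Mapping.keys P. Poly_Mapping.lookup P d *
     (\<Prod>e\<in>Poly_Mapping.keys d. w e ^ Poly_Mapping.lookup d e))"

text \<open>\<open>P / Q\<close> represents the series \<open>M(i,j)\<close>, i.e. \<open>Q M(i,j) = P\<close> as formal power series.\<close>

definition bm_represents ::
  "network \<Rightarrow> nat \<Rightarrow> nat \<Rightarrow> ((edge \<Rightarrow>\<^sub>0 nat) \<Rightarrow>\<^sub>0 real) \<Rightarrow> ((edge \<Rightarrow>\<^sub>0 nat) \<Rightarrow>\<^sub>0 real) \<Rightarrow> bool" where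
  "bm_represents N i j P Q \<longleftrightarrow>
     P \<in> weight_polys N \<and> Q \<in> weight_polys N \<and> Q \<noteq> 0 \<and>
     (\<forall>d. (\<Sum>(d1, d2) | d1 + d2 = d. Poly_Mapping.lookup Q d1 * bm_series N i j d2)
            = Poly_Mapping.lookup P d)"

definition bm_defined :: "network \<Rightarrow> nat \<Rightarrow> nat \<Rightarrow> (edge \<Rightarrow> real) \<Rightarrow> bool" where
  "bm_defined N i j w \<longleftrightarrow> (\<exists>P Q. bm_represents N i j P Q \<and> peval Q w \<noteq> 0)"

definition bm :: "network \<Rightarrow> nat \<Rightarrow> nat \<Rightarrow> (edge \<Rightarrow> real) \<Rightarrow> real" where
  "bm N i j w =
     (THE r. \<exists>P Q. bm_represents N i j P Q \<and> peval Q w \<noteq> 0 \<and> r = peval P w / peval Q w)"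

text \<open>\<open>nth_elem A p\<close> is the \<open>p\<close>-th smallest element of \<open>A\<close>, counting from 1.\<close>

definition nth_elem :: "nat set \<Rightarrow> nat \<Rightarrow> nat" where
  "nth_elem A p = sorted_list_of_set A ! (p - 1)"

text \<open>\<open>Mat\<^sub>k\<^sub>,\<^sub>m\<close> is \<open>coord_space (mat_index k m)\<close>, and \<open>entry k m p q\<close> is the function \<open>M\<^sub>p\<^sub>q\<close> on it.\<close>

definition mat_index :: "nat \<Rightarrow> nat \<Rightarrow> (nat \<times> nat) set" where
  "mat_index k m = {1..k} \<times> {1..m}"

definition entry :: "nat \<Rightarrow> nat \<Rightarrow> nat \<Rightarrow> nat \<Rightarrow> (nat \<times> nat \<Rightarrow> real) \<Rightarrow> real" where
  "entry k m p q = (\<lambda>X\<in>coord_space (mat_index k m). X (p, q))"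

definition bm_map ::
  "nat set \<Rightarrow> nat set \<Rightarrow> network \<Rightarrow> (edge \<Rightarrow> real) \<Rightarrow> nat \<times> nat \<Rightarrow> real" where
  "bm_map I J N w =
     (\<lambda>(p, q)\<in>mat_index (card I) (card J). bm N (nth_elem I p) (nth_elem J q) w)"

definition bm_domain :: "nat set \<Rightarrow> nat set \<Rightarrow> network \<Rightarrow> (edge \<Rightarrow> real) set" where
  "bm_domain I J N = {w \<in> weight_space N. \<forall>i\<in>I. \<forall>j\<in>J. bm_defined N i j w}"

text \<open>
  The boundary measurement map is a rational map and respects the brackets wherever it is defined.
\<close>

definition bm_map_poisson ::
  "nat set \<Rightarrow> nat set \<Rightarrow> (nat \<Rightarrow> nat \<Rightarrow> real) \<Rightarrow> (nat \<Rightarrow> nat \<Rightarrow> real) \<Rightarrow> (nat \<times> nat) bracket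
     \<Rightarrow> network \<Rightarrow> bool" where
  "bm_map_poisson I J a b B N \<longleftrightarrow>
     (\<forall>i\<in>I. \<forall>j\<in>J. \<exists>P Q. bm_represents N i j P Q) \<and>
     (\<forall>f\<in>smooth_funs (mat_index (card I) (card J)).
      \<forall>g\<in>smooth_funs (mat_index (card I) (card J)). \<forall>w\<in>bm_domain I J N.
        net_bracket N a b (f \<circ> bm_map I J N) (g \<circ> bm_map I J N) w = B f g (bm_map I J N w))"


section \<open>The functions \<open>s\<^sub>=\<close> and \<open>s\<^sub>\<times>\<close>\<close>

definition cyc :: "nat list \<Rightarrow> bool" where
  "cyc xs \<longleftrightarrow> (\<exists>r. sorted_wrt (<) (rotate r xs))"

definition s_par :: "nat \<Rightarrow> nat \<Rightarrow> nat \<Rightarrow> nat \<Rightarrow> real" where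
  "s_par i j i' j' =
     (if cyc [i, i', j', j] then 1
      else if cyc [i', i, j, j'] then - 1
      else if i = i' \<and> cyc [i, j', j] \<or> j' = j \<and> cyc [i, i', j] then 1 / 2
      else if i' = i \<and> cyc [i, j, j'] \<or> j = j' \<and> cyc [i', i, j] then - (1 / 2)
      else 0)"

definition s_cross :: "nat \<Rightarrow> nat \<Rightarrow> nat \<Rightarrow> nat \<Rightarrow> real" where
  "s_cross i j i' j' =
     (if cyc [i', i, j', j] then 1
      else if cyc [i, i', j, j'] then - 1
      else if i' = i \<and> cyc [i, j', j] \<or> j' = j \<and> cyc [i', i, j] then 1 / 2
      else if i = i' \<and> cyc [i, j, j'] \<or> j = j' \<and> cyc [i, i', j] then - (1 / 2)
      else 0)"

end

theory Submission
  imports Defs "Jordan_Normal_Form.Determinant"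
begin

text \<open>
  The sign of a path is, up to a factor that depends only on its ends, a product of signs of its
  edges, so \<open>M(i,j)\<close> is up to sign an entry of \<open>(1 - A)\<^sup>-\<^sup>1\<close> for a signed weighted adjacency matrix \<open>A\<close>.
  Hence \<open>w\<^sub>e \<partial>M(i,j)/\<partial>w\<^sub>e\<close> is, as a function of \<open>e\<close>, a flow of strength \<open>M(i,j)\<close> from \<open>b\<^sub>i\<close> to \<open>b\<^sub>j\<close>, and the
  bracket of two boundary measurements is a sum over the inner vertices of \<open>\<alpha>\<close> (white) or \<open>\<beta>\<close> (black)
  times the wedge of the two flows in the second and third flag.  For any two flows on a plane graph
  the sum of all these wedges depends only on the divergences at the boundary, as one sees by summing
  the angles under which the edges see each other in two ways.  Exchanging the sinks of the two flows
  changes the sign of the wedge at the white vertices only, which separates the two colours.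

  For the uniqueness, consider networks made of one wire per boundary vertex and of rungs between
  neighbouring wires.  Each rung acts on the values along a circle as a transvection of two
  neighbouring coordinates.  These generate all transvections, so that one network of this kind has
  boundary measurements that are dense in the space of matrices, and a bracket is determined by its
  values on a dense set.
\<close>

section \<open>Cyclic order\<close>

text \<open>The Jacobi identity is not inherited from the networks: it is checked on the
  coefficients, where everything cancels formally except for one relation between products of signs.
  The numbers \<alpha> and \<beta> arise because conservation of a flow at a trivalent vertex leaves
  a single independent wedge, so that a skew form in three flags collapses to a multiple of it. The
  sum of all wedges yields the \<open>s_cross\<close> term, the same sum after the exchange of sinks
  the \<open>s_par\<close> term. Two obstacles shape the proof. The sign that splits off from a path
  is not a source factor times a sink factor: it also contains a full round of the boundary if
  \<open>i < j\<close>, which is harmless only because \<open>s_par\<close> vanishes whenever the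
  exchange of sinks would change the product of these signs. And \<open>bm\<close> may be defined
  where the common determinant vanishes, since numerator and denominator may cancel; such weights
  are reached as limits. Density costs one more perturbation, because the ladder weights that
  realise a given matrix contain zeros.\<close>

lemma cyc3: "cyc [a,b,c] \<longleftrightarrow> a < b \<and> b < c \<or> b < c \<and> c < a \<or> c < a \<and> a < b"
proof
  assume "cyc [a,b,c]"
  then obtain r where r: "sorted_wrt (<) (rotate r [a,b,c])" by (auto simp: cyc_def)
  have "rotate r [a,b,c] = rotate (r mod 3) [a,b,c]"
  proof -
    have "length [a,b,c] = 3" by simp
    then show ?thesis using rotate_conv_mod[of r "[a,b,c]"] by metis
  qed
  with r have r: "sorted_wrt (<) (rotate (r mod 3) [a,b,c])" by simp
  moreover have "r mod 3 = 0 \<or> r mod 3 = 1 \<or> r mod 3 = 2" by linarith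
  ultimately show "a < b \<and> b < c \<or> b < c \<and> c < a \<or> c < a \<and> a < b"
    by (elim disjE) (simp_all only:, simp_all add: rotate_def numeral_2_eq_2)
next
  assume "a < b \<and> b < c \<or> b < c \<and> c < a \<or> c < a \<and> a < b"
  then have "sorted_wrt (<) (rotate 0 [a,b,c]) \<or> sorted_wrt (<) (rotate 1 [a,b,c]) \<or> sorted_wrt (<) (rotate 2 [a,b,c])"
    by (auto simp: rotate_def numeral_2_eq_2)
  then show "cyc [a,b,c]" unfolding cyc_def by blast
qed

lemma cyc4: "cyc [a,b,c,d] \<longleftrightarrow> a < b \<and> b < c \<and> c < d \<or> b < c \<and> c < d \<and> d < a
    \<or> c < d \<and> d < a \<and> a < b \<or> d < a \<and> a < b \<and> b < c"
proof
  assume "cyc [a,b,c,d]"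
  then obtain r where r: "sorted_wrt (<) (rotate r [a,b,c,d])" by (auto simp: cyc_def)
  have "rotate r [a,b,c,d] = rotate (r mod 4) [a,b,c,d]"
  proof -
    have "length [a,b,c,d] = 4" by simp
    then show ?thesis using rotate_conv_mod[of r "[a,b,c,d]"] by metis
  qed
  with r have r: "sorted_wrt (<) (rotate (r mod 4) [a,b,c,d])" by simp
  moreover have "r mod 4 = 0 \<or> r mod 4 = 1 \<or> r mod 4 = 2 \<or> r mod 4 = 3" by linarith
  ultimately show "a < b \<and> b < c \<and> c < d \<or> b < c \<and> c < d \<and> d < a
    \<or> c < d \<and> d < a \<and> a < b \<or> d < a \<and> a < b \<and> b < c"
    by (elim disjE) (simp_all only:, simp_all add: rotate_def numeral_2_eq_2 numeral_3_eq_3)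
next
  assume "a < b \<and> b < c \<and> c < d \<or> b < c \<and> c < d \<and> d < a
    \<or> c < d \<and> d < a \<and> a < b \<or> d < a \<and> a < b \<and> b < c"
  moreover have "rotate 0 [a,b,c,d] = [a,b,c,d]" "rotate 1 [a,b,c,d] = [b,c,d,a]"
    "rotate 2 [a,b,c,d] = [c,d,a,b]" "rotate 3 [a,b,c,d] = [d,a,b,c]"
    by (simp_all add: rotate_def numeral_2_eq_2 numeral_3_eq_3)
  ultimately have "sorted_wrt (<) (rotate 0 [a,b,c,d]) \<or> sorted_wrt (<) (rotate 1 [a,b,c,d])
    \<or> sorted_wrt (<) (rotate 2 [a,b,c,d]) \<or> sorted_wrt (<) (rotate 3 [a,b,c,d])"
    by (elim disjE conjE) simp_all
  then show "cyc [a,b,c,d]" unfolding cyc_def by blast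
qed

definition sg :: "nat \<Rightarrow> nat \<Rightarrow> real" where
  "sg a b = (if a < b then - 1 else if b < a then 1 else 0)"

lemma sg_skew: "sg b a = - sg a b" by (simp add: sg_def)
lemma sg_refl [simp]: "sg a a = 0" by (simp add: sg_def)

text \<open>Half the value on \<open>i - j\<close> and \<open>i' - j'\<close> of the bilinear
  extension of \<open>sg\<close> to formal sums of boundary points. It is the signed crossing number
  of the chords from \<open>i\<close> to \<open>j\<close> and from \<open>i'\<close> to
  \<open>j'\<close>, where one common end counts one half.\<close>

definition chi :: "nat \<Rightarrow> nat \<Rightarrow> nat \<Rightarrow> nat \<Rightarrow> real" where
  "chi i j i' j' = (sg i i' + sg j j' - sg i j' - sg j i') / 2"

lemma chi_skew: "chi i' j' i j = - chi i j i' j'"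
  unfolding chi_def sg_skew[of i' i] sg_skew[of j' j] sg_skew[of i' j] sg_skew[of j' i] by (simp add: field_simps)

text \<open>The rank of an index, the number of smaller elements of the set, is below 4 and keeps
  the order. As all functions concerned depend on relative order only, their comparison is reduced
  to finitely many quadruples.\<close>

lemma order_ranks4:
  fixes i j i' j' :: nat
  obtains f :: "nat \<Rightarrow> nat" where "\<And>x y. x \<in> {i,j,i',j'} \<Longrightarrow> y \<in> {i,j,i',j'} \<Longrightarrow> x < y \<longleftrightarrow> f x < f y"
    "\<And>x. x \<in> {i,j,i',j'} \<Longrightarrow> f x < 4"
proof
  define A where "A = {i,j,i',j'}"
  define f where "f x = card {z \<in> A. z < x}" for x
  have fin: "finite A" by (simp add: A_def)
  have mono: "f x < f y" if "x \<in> A" "y \<in> A" "x < y" for x y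
    unfolding f_def by (rule psubset_card_mono) (use fin that in auto)
  show "x < y \<longleftrightarrow> f x < f y" if "x \<in> {i,j,i',j'}" "y \<in> {i,j,i',j'}" for x y
    using mono[of x y] mono[of y x] that by (metis A_def linorder_neqE_nat less_asym less_irrefl)
  show "f x < 4" if "x \<in> {i,j,i',j'}" for x
  proof -
    have "f x < card A" unfolding f_def by (rule psubset_card_mono) (use fin that in \<open>auto simp: A_def\<close>)
    also have "card A \<le> card (set [i,j,i',j'])" by (simp add: A_def)
    also have "\<dots> \<le> 4" using card_length[of "[i,j,i',j']"] by simp
    finally show ?thesis .
  qed
qed

lemma s_cross_s_par_small:
  assumes "i < 4" "j < 4" "i' < 4" "j' < (4::nat)"
    and "i \<noteq> j" "i \<noteq> j'" "i' \<noteq> j" "i' \<noteq> j'"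
  shows "s_cross i j i' j' = chi i j i' j' \<and> s_par i j i' j' = - chi i j' i' j"
proof -
  have "i = 0 \<or> i = 1 \<or> i = 2 \<or> i = 3" "j = 0 \<or> j = 1 \<or> j = 2 \<or> j = 3"
    "i' = 0 \<or> i' = 1 \<or> i' = 2 \<or> i' = 3" "j' = 0 \<or> j' = 1 \<or> j' = 2 \<or> j' = 3"
    using assms(1-4) by linarith+
  then show ?thesis using assms(5-8)
    by (elim disjE) (simp_all add: s_cross_def s_par_def cyc3 cyc4 chi_def sg_def)
qed

lemma
  assumes "i \<noteq> j" "i \<noteq> j'" "i' \<noteq> j" "i' \<noteq> j'"
  shows s_cross_eq: "s_cross i j i' j' = chi i j i' j'"
    and s_par_eq: "s_par i j i' j' = - chi i j' i' j"
proof -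
  obtain f :: "nat \<Rightarrow> nat" where f: "\<And>x y. x \<in> {i,j,i',j'} \<Longrightarrow> y \<in> {i,j,i',j'} \<Longrightarrow> x < y \<longleftrightarrow> f x < f y"
    and f4: "\<And>x. x \<in> {i,j,i',j'} \<Longrightarrow> f x < 4"
    by (rule order_ranks4[of i j i' j']) blast
  have eq: "x = y \<longleftrightarrow> f x = f y" if "x \<in> {i,j,i',j'}" "y \<in> {i,j,i',j'}" for x y
    using f[OF that] f[OF that(2,1)] by (metis linorder_neqE_nat less_irrefl)
  have fs: "sg x y = sg (f x) (f y)" if "x \<in> {i,j,i',j'}" "y \<in> {i,j,i',j'}" for x y
    using f[OF that] f[OF that(2,1)] by (simp add: sg_def)
  have c3: "cyc [x,y,z] = cyc [f x, f y, f z]" if "x \<in> {i,j,i',j'}" "y \<in> {i,j,i',j'}" "z \<in> {i,j,i',j'}" for x y z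
    unfolding cyc3 using f[OF that(1,2)] f[OF that(2,3)] f[OF that(3,1)] by simp
  have c4: "cyc [x,y,z,w] = cyc [f x, f y, f z, f w]"
    if "x \<in> {i,j,i',j'}" "y \<in> {i,j,i',j'}" "z \<in> {i,j,i',j'}" "w \<in> {i,j,i',j'}" for x y z w
    unfolding cyc4 using f[OF that(1,2)] f[OF that(2,3)] f[OF that(3,4)] f[OF that(4,1)] by simp
  have ne: "f i \<noteq> f j" "f i \<noteq> f j'" "f i' \<noteq> f j" "f i' \<noteq> f j'"
    by (subst eq[symmetric]; use assms in blast)+
  have *: "s_cross (f i) (f j) (f i') (f j') = chi (f i) (f j) (f i') (f j') \<and>
     s_par (f i) (f j) (f i') (f j') = - chi (f i) (f j') (f i') (f j)"
    by (rule s_cross_s_par_small[OF f4 f4 f4 f4 ne]) simp_all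
  have e: "i = i' \<longleftrightarrow> f i = f i'" "i' = i \<longleftrightarrow> f i' = f i" "j = j' \<longleftrightarrow> f j = f j'" "j' = j \<longleftrightarrow> f j' = f j"
    by (rule eq; blast)+
  have "s_cross i j i' j' = s_cross (f i) (f j) (f i') (f j')"
    unfolding s_cross_def by (simp only: c3 c4 e insert_iff simp_thms)
  moreover have "s_par i j i' j' = s_par (f i) (f j) (f i') (f j')"
    unfolding s_par_def by (simp only: c3 c4 e insert_iff simp_thms)
  moreover have "chi i j i' j' = chi (f i) (f j) (f i') (f j')" "chi i j' i' j = chi (f i) (f j') (f i') (f j)"
    unfolding chi_def by (simp_all add: fs[of i i'] fs[of j j'] fs[of i j'] fs[of j i'] fs[of j' j] fs[of i j] fs[of j' i'])
  ultimately show "s_cross i j i' j' = chi i j i' j'" "s_par i j i' j' = - chi i j' i' j" using * by auto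
qed

text \<open>The three cyclic signs of distinct indices are never all equal, so one of the three
  products is 1 and two are -1. If exactly two indices agree, the only surviving product is minus a
  square. The Jacobi identity of the quadratic bracket rests on this relation.\<close>

lemma sg_triple:
  "sg a b * sg b c + sg b c * sg c a + sg c a * sg a b = (if a = b \<and> b = c then 0 else - 1)"
  unfolding sg_def by auto

section \<open>Smooth functions on coordinate spaces\<close>

lemma tendsto_fun_iff:
  fixes f :: "'a \<Rightarrow> 's \<Rightarrow> real"
  shows "(f \<longlongrightarrow> l) F \<longleftrightarrow> (\<forall>i. ((\<lambda>c. f c i) \<longlongrightarrow> l i) F)"
  using limitin_componentwise[of "\<lambda>_::'s. euclidean :: real topology" UNIV f l F]
  by (simp add: euclidean_product_topology limitin_canonical_iff)

lemma coord_space_upd: "x \<in> coord_space S \<Longrightarrow> s \<in> S \<Longrightarrow> x(s := t) \<in> coord_space S"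
  unfolding coord_space_def by (auto simp: PiE_def extensional_def)

lemma coord_space_ext: "x \<in> coord_space S \<Longrightarrow> s \<notin> S \<Longrightarrow> x s = undefined"
  unfolding coord_space_def by (auto simp: PiE_def extensional_def)

text \<open>A version of \<open>smooth_funs\<close> graded by the order of differentiability and
  free of the extensionality condition, so that closure under sums and products can be proved by
  induction on the order.\<close>

primrec diff_of_order :: "nat \<Rightarrow> 's set \<Rightarrow> (('s \<Rightarrow> real) \<Rightarrow> real) \<Rightarrow> bool" where
  "diff_of_order 0 S f \<longleftrightarrow> continuous_on (coord_space S) f"
| "diff_of_order (Suc n) S f \<longleftrightarrow> continuous_on (coord_space S) f \<and>
     (\<forall>s\<in>S. (\<forall>x\<in>coord_space S. (\<lambda>t. f (x(s := t))) differentiable (at (x s))) \<and>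
       diff_of_order n S (pderiv_at s f))"

lemma diff_of_order_Suc_imp: "diff_of_order (Suc n) S f \<Longrightarrow> diff_of_order n S f"
proof (induction n arbitrary: f)
  case 0 then show ?case by simp
next
  case (Suc n)
  from Suc.prems have *: "continuous_on (coord_space S) f"
    "\<And>s x. s \<in> S \<Longrightarrow> x \<in> coord_space S \<Longrightarrow> (\<lambda>t. f (x(s := t))) differentiable (at (x s))"
    "\<And>s. s \<in> S \<Longrightarrow> diff_of_order (Suc n) S (pderiv_at s f)"
    by (simp_all only: diff_of_order.simps(2)[of "Suc n"])
  show ?case unfolding diff_of_order.simps(2)[of n] using * Suc.IH by blast
qed

lemma diff_of_order_cong:
  "diff_of_order n S f \<Longrightarrow> (\<And>x. x \<in> coord_space S \<Longrightarrow> f x = g x) \<Longrightarrow> diff_of_order n S g"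
proof (induction n arbitrary: f g)
  case 0
  then show ?case using continuous_on_cong[of "coord_space S" "coord_space S" f g] by simp
next
  case (Suc n)
  have e: "(\<lambda>t. f (x(s := t))) = (\<lambda>t. g (x(s := t)))" if "x \<in> coord_space S" "s \<in> S" for x s
    using Suc.prems(2) coord_space_upd[OF that] by auto
  have "pderiv_at s f x = pderiv_at s g x" if "x \<in> coord_space S" "s \<in> S" for x s
    unfolding pderiv_at_def e[OF that] ..
  then have "diff_of_order n S (pderiv_at s g)" if "s \<in> S" for s
    using Suc.IH[of "pderiv_at s f" "pderiv_at s g"] Suc.prems(1) that by simp
  moreover have "continuous_on (coord_space S) g"
    using Suc.prems continuous_on_cong[of "coord_space S" "coord_space S" f g] by simp
  ultimately show ?case using Suc.prems(1) e by (simp add: e)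
qed

text \<open>Derivatives are added to a list at its outer end. One direction is an induction on the
  list for all orders at once, the other an induction on the order for all lists at once.\<close>

lemma smooth_funs_iff:
  "f \<in> smooth_funs S \<longleftrightarrow> f \<in> extensional (coord_space S) \<and> (\<forall>n. diff_of_order n S f)"
proof -
  have "(\<forall>n. diff_of_order n S (foldr pderiv_at ss f))" if "\<forall>n. diff_of_order n S f" "set ss \<subseteq> S" for ss
    using that(2)
  proof (induction ss)
    case Nil then show ?case using that by simp
  next
    case (Cons a ss)
    then have "diff_of_order (Suc n) S (foldr pderiv_at ss f)" for n by simp
    with Cons.prems show ?case by simp
  qed
  then have 1: "(\<forall>ss. set ss \<subseteq> S \<longrightarrow> continuous_on (coord_space S) (foldr pderiv_at ss f) \<and>
      (\<forall>s\<in>S. \<forall>x\<in>coord_space S. (\<lambda>t. foldr pderiv_at ss f (x(s := t))) differentiable (at (x s))))"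
    if "\<forall>n. diff_of_order n S f"
    using that by (metis diff_of_order.simps(2))
  have 2: "diff_of_order n S (foldr pderiv_at ss f)" if "set ss \<subseteq> S" and
    *: "\<forall>ss. set ss \<subseteq> S \<longrightarrow> continuous_on (coord_space S) (foldr pderiv_at ss f) \<and>
      (\<forall>s\<in>S. \<forall>x\<in>coord_space S. (\<lambda>t. foldr pderiv_at ss f (x(s := t))) differentiable (at (x s)))" for n ss
    using that(1)
  proof (induction n arbitrary: ss)
    case 0 then show ?case using * by simp
  next
    case (Suc n)
    have "diff_of_order n S (pderiv_at s (foldr pderiv_at ss f))" if "s \<in> S" for s
      using Suc.IH[of "s # ss"] Suc.prems that by simp
    then show ?case using Suc.prems * by simp
  qed
  show ?thesis unfolding smooth_funs_def using 1 2[of "[]"] by auto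
qed

lemma pderiv_at_has_derivative:
  assumes "diff_of_order (Suc n) S f" "s \<in> S" "x \<in> coord_space S"
  shows "((\<lambda>t. f (x(s := t))) has_field_derivative pderiv_at s f (x(s := t0))) (at t0)"
proof -
  have "(\<lambda>t. f (y(s := t))) differentiable (at (y s))" if "y \<in> coord_space S" for y
    using assms that by simp
  from this[OF coord_space_upd[OF assms(3,2), of t0]] have "(\<lambda>t. f (x(s := t))) differentiable (at t0)" by simp
  then obtain D where D: "((\<lambda>t. f (x(s := t))) has_field_derivative D) (at t0)"
    using real_differentiable_def by blast
  then show ?thesis unfolding pderiv_at_def using DERIV_imp_deriv[OF D] by simp
qed

lemma pderiv_at_eqI:
  assumes "((\<lambda>t. f (x(s := t))) has_field_derivative D) (at (x s))"
  shows "pderiv_at s f x = D"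
  using assms unfolding pderiv_at_def by (rule DERIV_imp_deriv)

lemma diff_of_order_const [simp]: "diff_of_order n S (\<lambda>x. c)"
proof (induction n arbitrary: c)
  case (Suc n)
  have "pderiv_at s (\<lambda>x. c) = (\<lambda>x. 0)" for s :: 'a
    by (rule ext) (rule pderiv_at_eqI, simp)
  with Suc show ?case by simp
qed simp

lemma diff_of_order_SucI:
  assumes "continuous_on (coord_space S) f"
    and "\<And>s x. s \<in> S \<Longrightarrow> x \<in> coord_space S \<Longrightarrow> ((\<lambda>t. f (x(s := t))) has_field_derivative D s x) (at (x s))"
    and "\<And>s. s \<in> S \<Longrightarrow> diff_of_order n S (D s)"
  shows "diff_of_order (Suc n) S f"
proof -
  have "diff_of_order n S (pderiv_at s f)" if "s \<in> S" for s
    by (rule diff_of_order_cong[OF assms(3)[OF that]]) (simp add: pderiv_at_eqI[OF assms(2)] that)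
  then show ?thesis using assms(1,2) real_differentiable_def by auto
qed

lemma diff_of_order_coord: "diff_of_order n S (\<lambda>x. x s0)"
proof (cases n)
  case (Suc m)
  show ?thesis unfolding Suc
  proof (rule diff_of_order_SucI[where D = "\<lambda>s x. if s = s0 then 1 else 0"])
    show "continuous_on (coord_space S) (\<lambda>x. x s0)"
      by (rule continuous_on_subset[OF continuous_on_product_coordinates]) simp
  qed (auto intro!: derivative_eq_intros)
qed (auto intro: continuous_on_subset[OF continuous_on_product_coordinates])

lemma pderiv_at_has_derivative':
  assumes "diff_of_order (Suc n) S f" "s \<in> S" "x \<in> coord_space S"
  shows "((\<lambda>t. f (x(s := t))) has_field_derivative pderiv_at s f x) (at (x s))"
  using pderiv_at_has_derivative[OF assms, of "x s"] by simp

lemma diff_of_order_add: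
  "diff_of_order n S f \<Longrightarrow> diff_of_order n S g \<Longrightarrow> diff_of_order n S (\<lambda>x. f x + g x)"
proof (induction n arbitrary: f g)
  case 0 then show ?case by (simp add: continuous_on_add)
next
  case (Suc n)
  show ?case
  proof (rule diff_of_order_SucI[where D = "\<lambda>s x. pderiv_at s f x + pderiv_at s g x"])
    show "continuous_on (coord_space S) (\<lambda>x. f x + g x)"
      using Suc.prems by (auto intro: continuous_on_add)
    show "((\<lambda>t. f (x(s := t)) + g (x(s := t))) has_field_derivative pderiv_at s f x + pderiv_at s g x) (at (x s))"
      if "s \<in> S" "x \<in> coord_space S" for s x
      using Suc.prems that by (intro DERIV_add pderiv_at_has_derivative')
    show "diff_of_order n S (\<lambda>x. pderiv_at s f x + pderiv_at s g x)" if "s \<in> S" for s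
      using Suc that by auto
  qed
qed

lemma diff_of_order_mult:
  "diff_of_order n S f \<Longrightarrow> diff_of_order n S g \<Longrightarrow> diff_of_order n S (\<lambda>x. f x * g x)"
proof (induction n arbitrary: f g)
  case 0 then show ?case by (simp add: continuous_on_mult)
next
  case (Suc n)
  show ?case
  proof (rule diff_of_order_SucI[where D = "\<lambda>s x. pderiv_at s f x * g x + pderiv_at s g x * f x"])
    show "continuous_on (coord_space S) (\<lambda>x. f x * g x)"
      using Suc.prems by (auto intro: continuous_on_mult)
    show "((\<lambda>t. f (x(s := t)) * g (x(s := t))) has_field_derivative pderiv_at s f x * g x + pderiv_at s g x * f x) (at (x s))"
      if "s \<in> S" "x \<in> coord_space S" for s x
      by (rule DERIV_cong[OF DERIV_mult[OF pderiv_at_has_derivative'[OF Suc.prems(1) that] pderiv_at_has_derivative'[OF Suc.prems(2) that]]]) simp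
    show "diff_of_order n S (\<lambda>x. pderiv_at s f x * g x + pderiv_at s g x * f x)" if "s \<in> S" for s
      using Suc that diff_of_order_Suc_imp[OF Suc.prems(1)] diff_of_order_Suc_imp[OF Suc.prems(2)]
      by (intro diff_of_order_add Suc.IH) auto
  qed
qed

lemma diff_of_order_sum:
  "(\<And>i. i \<in> A \<Longrightarrow> diff_of_order n S (f i)) \<Longrightarrow> diff_of_order n S (\<lambda>x. \<Sum>i\<in>A. f i x)"
  by (induction A rule: infinite_finite_induct) (auto intro: diff_of_order_add)

lemma smooth_funs_order: "f \<in> smooth_funs S \<Longrightarrow> diff_of_order n S f"
  by (simp add: smooth_funs_iff)

lemma smooth_funs_pderiv: "f \<in> smooth_funs S \<Longrightarrow> s \<in> S \<Longrightarrow> diff_of_order n S (pderiv_at s f)"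
  using smooth_funs_order[of f S "Suc n"] by simp

lemma restrict_smooth_funs:
  "(\<And>n. diff_of_order n S f) \<Longrightarrow> restrict f (coord_space S) \<in> smooth_funs S"
  unfolding smooth_funs_iff by (auto intro: diff_of_order_cong[of _ S f])

lemma pderiv_at_restrict:
  assumes "s \<in> S" "x \<in> coord_space S"
  shows "pderiv_at s (restrict f (coord_space S)) x = pderiv_at s f x"
  unfolding pderiv_at_def by (simp add: coord_space_upd[OF assms(2,1)])

lemma entry_smooth: "(p,q) \<in> mat_index k m \<Longrightarrow> entry k m p q \<in> smooth_funs (mat_index k m)"
  unfolding entry_def by (intro restrict_smooth_funs diff_of_order_coord)

lemma pderiv_at_coord: "pderiv_at s (\<lambda>x. x s0) x = (if s = s0 then 1 else 0)"
  by (rule pderiv_at_eqI) (auto intro!: derivative_eq_intros)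

lemma pderiv_at_entry:
  assumes "s \<in> mat_index k m" "X \<in> coord_space (mat_index k m)"
  shows "pderiv_at s (entry k m p q) X = (if s = (p,q) then 1 else 0)"
  unfolding entry_def pderiv_at_restrict[OF assms] pderiv_at_coord ..

text \<open>The coordinates are released one at a time: \<open>\<delta> A t\<close> follows the
  curve in the coordinates of \<open>A\<close> and stays at the base point in the others. The mean
  value theorem in the new coordinate together with continuity of the partial derivatives gives the
  new summand.\<close>

lemma chain_rule_coord_space:
  fixes \<gamma> :: "real \<Rightarrow> 's \<Rightarrow> real"
  assumes fin: "finite S" and f: "diff_of_order 1 S f" and \<gamma>: "\<And>t. \<gamma> t \<in> coord_space S"
    and d: "\<And>s. s \<in> S \<Longrightarrow> ((\<lambda>t. \<gamma> t s) has_field_derivative D s) (at t0)"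
  shows "((\<lambda>t. f (\<gamma> t)) has_field_derivative (\<Sum>s\<in>S. pderiv_at s f (\<gamma> t0) * D s)) (at t0)"
proof -
  define x0 where "x0 = \<gamma> t0"
  define \<delta> where "\<delta> A t = (\<lambda>s. if s \<in> A then \<gamma> t s else x0 s)" for A t
  have f': "diff_of_order (Suc 0) S f" using f by simp
  have \<delta>in: "\<delta> A t \<in> coord_space S" for A t
    using \<gamma>[of t] \<gamma>[of t0] unfolding \<delta>_def x0_def coord_space_def by (auto simp: PiE_def extensional_def)
  have cont\<gamma>: "((\<lambda>t. \<gamma> t s) \<longlongrightarrow> x0 s) (at t0)" for s
  proof (cases "s \<in> S")
    case True
    then show ?thesis using DERIV_isCont[OF d[OF True]] by (simp add: isCont_def x0_def)
  next
    case False
    then show ?thesis using \<gamma> by (simp add: coord_space_ext[OF \<gamma> False] x0_def)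
  qed
  have "((\<lambda>t. f (\<delta> A t)) has_field_derivative (\<Sum>s\<in>A. pderiv_at s f x0 * D s)) (at t0)" if "finite A" "A \<subseteq> S" for A
    using that
  proof (induction A rule: finite_induct)
    case empty
    then show ?case by (simp add: \<delta>_def)
  next
    case (insert s A)
    have s: "s \<in> S" using insert.prems by simp
    \<comment> \<open>The sign condition says that \<open>z\<close> lies between the two values in
      either order; it also covers the case where they coincide and the mean value theorem does not
      apply.\<close>
    define P where "P t z \<longleftrightarrow> (z - x0 s) * (z - \<gamma> t s) \<le> 0 \<and> f ((\<delta> A t)(s := \<gamma> t s)) - f ((\<delta> A t)(s := x0 s)) = (\<gamma> t s - x0 s) * pderiv_at s f ((\<delta> A t)(s := z))" for t z
    have "\<exists>z. P t z" for t
    proof -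
      have der: "DERIV (\<lambda>u. f ((\<delta> A t)(s := u))) u :> pderiv_at s f ((\<delta> A t)(s := u))" for u
        by (rule pderiv_at_has_derivative[OF f' s \<delta>in])
      consider "\<gamma> t s = x0 s" | "x0 s < \<gamma> t s" | "\<gamma> t s < x0 s" by linarith
      then show ?thesis
      proof cases
        case 1 then show ?thesis unfolding P_def by (intro exI[of _ "x0 s"]) simp
      next
        case 2
        from MVT2[OF 2 der] obtain z where z: "z > x0 s" "z < \<gamma> t s"
          "f ((\<delta> A t)(s := \<gamma> t s)) - f ((\<delta> A t)(s := x0 s)) = (\<gamma> t s - x0 s) * pderiv_at s f ((\<delta> A t)(s := z))" by blast
        have "(z - x0 s) * (z - \<gamma> t s) \<le> 0" using z by (intro mult_nonneg_nonpos) auto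
        then show ?thesis unfolding P_def using z by blast
      next
        case 3
        from MVT2[OF 3 der] obtain z where z: "z < x0 s" "z > \<gamma> t s"
          "f ((\<delta> A t)(s := x0 s)) - f ((\<delta> A t)(s := \<gamma> t s)) = (x0 s - \<gamma> t s) * pderiv_at s f ((\<delta> A t)(s := z))" by blast
        have aux: "B - A = (v - u) * p" if "A - B = (u - v) * p" for A B u v p :: real using that by Groebner_Basis.algebra
        have "(z - x0 s) * (z - \<gamma> t s) \<le> 0" using z by (intro mult_nonpos_nonneg) auto
        then show ?thesis unfolding P_def using aux[OF z(3)] by blast
      qed
    qed
    then obtain z where "\<And>t. P t (z t)" by metis
    then have z: "(z t - x0 s) * (z t - \<gamma> t s) \<le> 0"
      and zeq: "f ((\<delta> A t)(s := \<gamma> t s)) - f ((\<delta> A t)(s := x0 s)) = (\<gamma> t s - x0 s) * pderiv_at s f ((\<delta> A t)(s := z t))" for t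
      unfolding P_def by blast+
    define q where "q t = pderiv_at s f ((\<delta> A t)(s := z t))" for t
    have zb: "\<bar>z t - x0 s\<bar> \<le> \<bar>\<gamma> t s - x0 s\<bar>" for t
      using z[of t] by (auto simp: mult_le_0_iff)
    have "((\<lambda>t. \<gamma> t s - x0 s) \<longlongrightarrow> 0) (at t0)" using tendsto_diff[OF cont\<gamma>[of s] tendsto_const[of "x0 s"]] by simp
    from tendsto_rabs_zero[OF this] have "((\<lambda>t. z t - x0 s) \<longlongrightarrow> 0) (at t0)"
      by (rule Lim_null_comparison[rotated]) (simp add: zb)
    then have zlim: "(z \<longlongrightarrow> x0 s) (at t0)" by (simp add: LIM_zero_iff)
    have l: "((\<lambda>t. (\<delta> A t)(s := z t)) \<longlongrightarrow> x0) (at t0)"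
      unfolding tendsto_fun_iff
    proof
      show "((\<lambda>c. ((\<delta> A c)(s := z c)) i) \<longlongrightarrow> x0 i) (at t0)" for i
        by (cases "i = s"; cases "i \<in> A") (simp_all add: \<delta>_def zlim cont\<gamma>)
    qed
    have c: "continuous_on (coord_space S) (pderiv_at s f)" using f' s by simp
    have x0: "x0 \<in> coord_space S" using \<gamma> by (simp add: x0_def)
    have ev: "\<forall>\<^sub>F t in at t0. (\<delta> A t)(s := z t) \<in> coord_space S"
      by (intro always_eventually allI coord_space_upd \<delta>in s)
    have qlim: "(q \<longlongrightarrow> pderiv_at s f x0) (at t0)"
      unfolding q_def by (rule continuous_on_tendsto_compose[OF c l x0 ev])
    \<comment> \<open>The first factor vanishes at \<open>t0\<close>, so the product is
      differentiable there although \<open>q\<close> is only known to converge.\<close>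
    have "((\<lambda>t. (\<gamma> t s - x0 s) * q t) has_field_derivative D s * pderiv_at s f x0) (at t0)"
    proof -
      have "((\<lambda>t. (\<gamma> t s - \<gamma> t0 s) / (t - t0)) \<longlongrightarrow> D s) (at t0)"
        using d[OF s] by (simp add: has_field_derivative_iff)
      from tendsto_mult[OF this qlim] show ?thesis
        by (simp add: has_field_derivative_iff x0_def)
    qed
    then have 1: "((\<lambda>t. f (\<delta> A t) + (\<gamma> t s - x0 s) * q t) has_field_derivative ((\<Sum>s\<in>A. pderiv_at s f x0 * D s) + D s * pderiv_at s f x0)) (at t0)"
      using insert.IH insert.prems by (intro DERIV_add) auto
    have 2: "f (\<delta> A t) + (\<gamma> t s - x0 s) * q t = f (\<delta> (insert s A) t)" for t
    proof -
      have a: "(\<delta> A t)(s := x0 s) = \<delta> A t" using insert.hyps by (intro ext) (simp add: \<delta>_def)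
      have b: "(\<delta> A t)(s := \<gamma> t s) = \<delta> (insert s A) t" by (intro ext) (simp add: \<delta>_def)
      show ?thesis using zeq[of t] unfolding q_def a b by linarith
    qed
    have 3: "(\<Sum>s\<in>A. pderiv_at s f x0 * D s) + D s * pderiv_at s f x0 = (\<Sum>s\<in>insert s A. pderiv_at s f x0 * D s)"
      using insert.hyps by simp
    show ?case using 1 unfolding 2 3 .
  qed
  note * = this[OF fin order.refl]
  have **: "\<delta> S t = \<gamma> t" for t
  proof
    fix s
    show "\<delta> S t s = \<gamma> t s"
    proof (cases "s \<in> S")
      case True
      then show ?thesis unfolding \<delta>_def by simp
    next
      case False
      have "\<gamma> t s = undefined" "\<gamma> t0 s = undefined" by (rule coord_space_ext[OF \<gamma> False])+
      then show ?thesis using False unfolding \<delta>_def x0_def by simp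
    qed
  qed
  show ?thesis using * unfolding ** unfolding x0_def .
qed

text \<open>The mean value theorem is applied to the difference in direction \<open>b\<close> as a
  function of coordinate \<open>a\<close>, and then to the first derivative as a function of
  coordinate \<open>b\<close>. The left-hand side is symmetric in \<open>a\<close> and
  \<open>b\<close>.\<close>

lemma second_difference_mvt:
  assumes f: "diff_of_order (Suc (Suc 0)) S f" and ab: "a \<in> S" "b \<in> S" "a \<noteq> b" and x: "x \<in> coord_space S" and h: "h > 0"
  shows "\<exists>u v. \<bar>u - x a\<bar> \<le> h \<and> \<bar>v - x b\<bar> \<le> h \<and>
    f (x(a := x a + h, b := x b + h)) - f (x(a := x a + h)) - f (x(b := x b + h)) + f x
      = h * h * pderiv_at b (pderiv_at a f) (x(a := u, b := v))"
proof -
  have fa: "diff_of_order (Suc 0) S (pderiv_at a f)" using f ab by simp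
  define \<phi> where "\<phi> u = f (x(b := x b + h, a := u)) - f (x(a := u))" for u
  have d1: "DERIV \<phi> u :> pderiv_at a f (x(b := x b + h, a := u)) - pderiv_at a f (x(a := u))" for u
    unfolding \<phi>_def by (intro DERIV_diff pderiv_at_has_derivative[OF f ab(1)] coord_space_upd x ab)
  have ha: "x a < x a + h" and hb: "x b < x b + h" using h by simp_all
  obtain u where u: "x a < u" "u < x a + h"
    and 1: "\<phi> (x a + h) - \<phi> (x a) = (x a + h - x a) * (pderiv_at a f (x(b := x b + h, a := u)) - pderiv_at a f (x(a := u)))"
    using MVT2[OF ha d1] by blast
  have d2: "DERIV (\<lambda>v. pderiv_at a f ((x(a := u))(b := v))) v :> pderiv_at b (pderiv_at a f) ((x(a := u))(b := v))" for v
    by (intro pderiv_at_has_derivative[OF fa ab(2)] coord_space_upd x ab)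
  obtain v where v: "x b < v" "v < x b + h"
    and 2: "pderiv_at a f (x(a := u, b := x b + h)) - pderiv_at a f (x(a := u, b := x b)) = (x b + h - x b) * pderiv_at b (pderiv_at a f) (x(a := u, b := v))"
    using MVT2[OF hb d2] by blast
  have hh: "x a + h - x a = h" "x b + h - x b = h" by simp_all
  have 3: "x(a := u, b := x b) = x(a := u)"
    by (rule fun_upd_idem) (use ab in simp)
  have 4: "x(b := x b + h, a := w) = x(a := w, b := x b + h)" for w
    by (rule fun_upd_twist) (use ab in simp)
  have 5: "x(a := x a, b := x b + h) = x(b := x b + h)" "x(a := x a) = x"
    by simp_all
  have "f (x(a := x a + h, b := x b + h)) - f (x(a := x a + h)) - f (x(b := x b + h)) + f x = \<phi> (x a + h) - \<phi> (x a)"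
    unfolding \<phi>_def 4 5 by linarith
  also have "\<dots> = h * (h * pderiv_at b (pderiv_at a f) (x(a := u, b := v)))"
    unfolding 1[unfolded hh] 4 2[unfolded 3 hh] ..
  finally have "f (x(a := x a + h, b := x b + h)) - f (x(a := x a + h)) - f (x(b := x b + h)) + f x
      = h * h * pderiv_at b (pderiv_at a f) (x(a := u, b := v))" by (simp only: mult.assoc)
  moreover have "\<bar>u - x a\<bar> \<le> h" "\<bar>v - x b\<bar> \<le> h" using u v by linarith+
  ultimately show ?thesis by blast
qed

text \<open>For every side length the symmetric second difference equals both mixed derivatives,
  each at some point of the square. Both points tend to \<open>x\<close> as the square shrinks, and
  the mixed derivatives are continuous.\<close>

lemma pderiv_at_commute:
  assumes f: "diff_of_order (Suc (Suc 0)) S f" and ab: "a \<in> S" "b \<in> S" and x: "x \<in> coord_space S"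
  shows "pderiv_at a (pderiv_at b f) x = pderiv_at b (pderiv_at a f) x"
proof (cases "a = b")
  case False
  define h where "h n = inverse (real (Suc n))" for n
  have h: "h n > 0" for n by (simp add: h_def)
  have h0: "h \<longlonglongrightarrow> 0" unfolding h_def by (rule LIMSEQ_inverse_real_of_nat)
  define P where "P g a b n u v \<longleftrightarrow> \<bar>u - x a\<bar> \<le> h n \<and> \<bar>v - x b\<bar> \<le> h n \<and>
    f (x(a := x a + h n, b := x b + h n)) - f (x(a := x a + h n)) - f (x(b := x b + h n)) + f x
      = h n * h n * g (x(a := u, b := v))" for g a b n u v
  have "\<exists>u v. P (pderiv_at b (pderiv_at a f)) a b n u v" for n
    unfolding P_def by (rule second_difference_mvt[OF f ab False x h])
  then obtain u v where uv0: "\<And>n. P (pderiv_at b (pderiv_at a f)) a b n (u n) (v n)" by metis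
  have "\<exists>u v. P (pderiv_at a (pderiv_at b f)) b a n u v" for n
    unfolding P_def by (rule second_difference_mvt[OF f ab(2,1) _ x h]) (use False in simp)
  then obtain u' v' where uv0': "\<And>n. P (pderiv_at a (pderiv_at b f)) b a n (u' n) (v' n)" by metis
  have uv: "\<bar>u n - x a\<bar> \<le> h n" "\<bar>v n - x b\<bar> \<le> h n"
    and uv': "\<bar>u' n - x b\<bar> \<le> h n" "\<bar>v' n - x a\<bar> \<le> h n"
    and 1: "f (x(a := x a + h n, b := x b + h n)) - f (x(a := x a + h n)) - f (x(b := x b + h n)) + f x
      = h n * h n * pderiv_at b (pderiv_at a f) (x(a := u n, b := v n))"
    and 2: "f (x(b := x b + h n, a := x a + h n)) - f (x(b := x b + h n)) - f (x(a := x a + h n)) + f x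
      = h n * h n * pderiv_at a (pderiv_at b f) (x(b := u' n, a := v' n))" for n
    using uv0[of n] uv0'[of n] unfolding P_def by blast+
  have lim: "w \<longlonglongrightarrow> c" if "\<And>n. \<bar>w n - c\<bar> \<le> h n" for w c
  proof -
    have "(\<lambda>n. w n - c) \<longlonglongrightarrow> 0" by (rule Lim_null_comparison[OF _ h0]) (simp add: that)
    then show ?thesis by (simp add: LIM_zero_iff)
  qed
  have eq: "pderiv_at b (pderiv_at a f) (x(a := u n, b := v n)) = pderiv_at a (pderiv_at b f) (x(b := u' n, a := v' n))" for n
  proof -
    have tw: "x(b := x b + h n, a := x a + h n) = x(a := x a + h n, b := x b + h n)"
      by (rule fun_upd_twist) (use False in simp)
    have "h n * h n * pderiv_at b (pderiv_at a f) (x(a := u n, b := v n)) = h n * h n * pderiv_at a (pderiv_at b f) (x(b := u' n, a := v' n))"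
      using 1[of n] 2[of n, unfolded tw] by linarith
    then show ?thesis using h[of n] by simp
  qed
  have l1: "(\<lambda>n. x(a := u n, b := v n)) \<longlonglongrightarrow> x"
    unfolding tendsto_fun_iff
  proof
    show "(\<lambda>n. (x(a := u n, b := v n)) i) \<longlonglongrightarrow> x i" for i
      using lim[OF uv(1)] lim[OF uv(2)] by (cases "i = a"; cases "i = b") simp_all
  qed
  have l2: "(\<lambda>n. x(b := u' n, a := v' n)) \<longlonglongrightarrow> x"
    unfolding tendsto_fun_iff
  proof
    show "(\<lambda>n. (x(b := u' n, a := v' n)) i) \<longlonglongrightarrow> x i" for i
      using lim[OF uv'(1)] lim[OF uv'(2)] by (cases "i = a"; cases "i = b") simp_all
  qed
  have c: "continuous_on (coord_space S) (pderiv_at b (pderiv_at a f))" "continuous_on (coord_space S) (pderiv_at a (pderiv_at b f))"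
    using f ab by simp_all
  have m1: "\<forall>\<^sub>F n in sequentially. x(a := u n, b := v n) \<in> coord_space S"
    and m2: "\<forall>\<^sub>F n in sequentially. x(b := u' n, a := v' n) \<in> coord_space S"
    by (intro always_eventually allI coord_space_upd x ab)+
  show ?thesis
    using continuous_on_tendsto_compose[OF c(1) l1 x m1] continuous_on_tendsto_compose[OF c(2) l2 x m2]
    unfolding eq by (rule LIMSEQ_unique[rotated])
qed simp

section \<open>The quadratic bracket and its Jacobi identity\<close>

text \<open>The bracket of the coordinates \<open>s\<close> and \<open>t\<close>, to be used with
  \<open>A\<close> = \<alpha> - \<beta> and \<open>C\<close> = \<alpha> + \<beta>. By
  \<open>s_cross_eq\<close> and \<open>s_par_eq\<close> the two signs are \<open>s_cross\<close> and
  minus \<open>s_par\<close>, which explains the minus sign in front of \<open>A\<close>.\<close>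

definition gsv_coeff :: "real \<Rightarrow> real \<Rightarrow> (nat \<Rightarrow> nat) \<Rightarrow> (nat \<Rightarrow> nat) \<Rightarrow> nat \<times> nat \<Rightarrow> nat \<times> nat \<Rightarrow> (nat \<times> nat \<Rightarrow> real) \<Rightarrow> real" where
  "gsv_coeff A C i j s t X =
     C * chi (i (fst s)) (j (snd s)) (i (fst t)) (j (snd t)) * (X s * X t)
     - A * chi (i (fst s)) (j (snd t)) (i (fst t)) (j (snd s)) * (X (fst s, snd t) * X (fst t, snd s))"

lemma gsv_coeff_skew: "gsv_coeff A C i j t s X = - gsv_coeff A C i j s t X"
  unfolding gsv_coeff_def
  unfolding chi_skew[of "i (fst t)" "j (snd t)" "i (fst s)" "j (snd s)"] chi_skew[of "i (fst t)" "j (snd s)" "i (fst s)" "j (snd t)"]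
  by (simp add: mult_ac)

text \<open>The bracket of the coordinate \<open>s\<close> with the coefficient \<open>gsv_coeff A C i j t u\<close>.\<close>

definition gsv_double :: "real \<Rightarrow> real \<Rightarrow> (nat \<Rightarrow> nat) \<Rightarrow> (nat \<Rightarrow> nat) \<Rightarrow> nat \<times> nat \<Rightarrow> nat \<times> nat \<Rightarrow> nat \<times> nat \<Rightarrow> (nat \<times> nat \<Rightarrow> real) \<Rightarrow> real" where
  "gsv_double A C i j s t u X =
     C * chi (i (fst t)) (j (snd t)) (i (fst u)) (j (snd u)) *
       (gsv_coeff A C i j s t X * X u + X t * gsv_coeff A C i j s u X)
     - A * chi (i (fst t)) (j (snd u)) (i (fst u)) (j (snd t)) *
       (gsv_coeff A C i j s (fst t, snd u) X * X (fst u, snd t) + X (fst t, snd u) * gsv_coeff A C i j s (fst u, snd t) X)"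

text \<open>For a fixed first chord, \<open>chi\<close> is a function of the source plus a function
  of the sink of the second chord.\<close>

lemma chi_exchange: "chi a b c d + chi a b c' d' = chi a b c d' + chi a b c' d"
  by (simp add: chi_def field_simps)

text \<open>\<open>K\<close> is the alternating sum of \<open>e\<close> over the eight ways to pick
  one end of each of the chords (\<open>a1\<close>,\<open>b3\<close>),
  (\<open>a2\<close>,\<open>b1\<close>), (\<open>a3\<close>,\<open>b2\<close>), with one minus sign
  for each \<open>b\<close>; \<open>L\<close> is the same for (\<open>a1\<close>,\<open>b2\<close>),
  (\<open>a2\<close>,\<open>b3\<close>), (\<open>a3\<close>,\<open>b1\<close>). In this form the
  coefficients of the two 3-cycle monomials are accessible to \<open>sg_triple\<close>; the factor 4
  clears the halves in \<open>chi\<close>.\<close>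

lemma chi_cycle:
  fixes a1 a2 a3 b1 b2 b3 :: nat
  defines "e \<equiv> \<lambda>a b c. sg a b * sg b c + sg b c * sg c a + sg c a * sg a b"
  defines "K \<equiv> e a1 a2 a3 - e a1 a2 b2 - e a1 a3 b1 + e a1 b1 b2 - e a2 a3 b3 + e a2 b2 b3 + e a3 b1 b3 - e b1 b2 b3"
  defines "L \<equiv> e a1 a2 a3 - e a1 a2 b1 - e a1 a3 b3 + e a1 b1 b3 - e a2 a3 b2 + e a2 b1 b2 + e a3 b2 b3 - e b1 b2 b3"
  shows "4 * (chi a2 b3 a3 b2 * chi a1 b3 a2 b1 + chi a3 b1 a1 b3 * chi a2 b1 a3 b2 + chi a1 b2 a2 b1 * chi a3 b2 a1 b3) = K"
    and "4 * (chi a2 b3 a3 b2 * chi a1 b2 a3 b1 + chi a3 b1 a1 b3 * chi a2 b3 a1 b2 + chi a1 b2 a2 b1 * chi a3 b1 a2 b3) = - L"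
proof -
  have four: "4 * (u / 2 * (v / 2) + w / 2 * (x / 2) + y / 2 * (z / 2)) = u * v + w * x + y * z" for u v w x y z :: real
    by (simp add: field_simps)
  note sk = sg_skew[of a1 a2] sg_skew[of a2 a3] sg_skew[of a1 a3]
      sg_skew[of b1 b2] sg_skew[of b2 b3] sg_skew[of b1 b3]
      sg_skew[of a1 b1] sg_skew[of a1 b2] sg_skew[of a1 b3]
      sg_skew[of a2 b1] sg_skew[of a2 b2] sg_skew[of a2 b3]
      sg_skew[of a3 b1] sg_skew[of a3 b2] sg_skew[of a3 b3]
  show "4 * (chi a2 b3 a3 b2 * chi a1 b3 a2 b1 + chi a3 b1 a1 b3 * chi a2 b1 a3 b2 + chi a1 b2 a2 b1 * chi a3 b2 a1 b3) = K"
    unfolding K_def e_def chi_def sk four by Groebner_Basis.algebra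
  show "4 * (chi a2 b3 a3 b2 * chi a1 b2 a3 b1 + chi a3 b1 a1 b3 * chi a2 b3 a1 b2 + chi a1 b2 a2 b1 * chi a3 b1 a2 b3) = - L"
    unfolding L_def e_def chi_def sk four by Groebner_Basis.algebra
qed

text \<open>The coefficients of the two 3-cycle monomials are the only ones that do not cancel
  formally; they do because of the relation between the signs of the three differences of a triple.\<close>

lemma gsv_jacobi_coeff:
  assumes i: "inj_on i Pset" and j: "inj_on j Qset" and ij: "\<And>p q. p \<in> Pset \<Longrightarrow> q \<in> Qset \<Longrightarrow> i p \<noteq> j q"
    and p: "p1 \<in> Pset" "p2 \<in> Pset" "p3 \<in> Pset" and q: "q1 \<in> Qset" "q2 \<in> Qset" "q3 \<in> Qset"
  shows "gsv_double A C i j (p1,q1) (p2,q2) (p3,q3) X + gsv_double A C i j (p2,q2) (p3,q3) (p1,q1) X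
    + gsv_double A C i j (p3,q3) (p1,q1) (p2,q2) X = 0"
proof -
  define c where "c = chi"
  define e where "e a b c = sg a b * sg b c + sg b c * sg c a + sg c a * sg a b" for a b c
  define K where "K = e (i p1) (i p2) (i p3) - e (i p1) (i p2) (j q2) - e (i p1) (i p3) (j q1)
    + e (i p1) (j q1) (j q2) - e (i p2) (i p3) (j q3) + e (i p2) (j q2) (j q3) + e (i p3) (j q1) (j q3)
    - e (j q1) (j q2) (j q3)"
  define L where "L = e (i p1) (i p2) (i p3) - e (i p1) (i p2) (j q1) - e (i p1) (i p3) (j q3)
    + e (i p1) (j q1) (j q3) - e (i p2) (i p3) (j q2) + e (i p2) (j q1) (j q2) + e (i p3) (j q2) (j q3)
    - e (j q1) (j q2) (j q3)"
  have eI: "e a b c = (if a = b \<and> b = c then 0 else - 1)" for a b c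
    unfolding e_def by (rule sg_triple)
  have ne: "i p \<noteq> j q" "j q \<noteq> i p" if "p \<in> {p1,p2,p3}" "q \<in> {q1,q2,q3}" for p q
    using ij[of p q] that p q by auto
  have eqs: "i p1 = i p2 \<longleftrightarrow> p1 = p2" "i p2 = i p3 \<longleftrightarrow> p2 = p3" "j q1 = j q2 \<longleftrightarrow> q1 = q2" "j q2 = j q3 \<longleftrightarrow> q2 = q3"
    using p q inj_on_eq_iff[OF i] inj_on_eq_iff[OF j] by blast+
  \<comment> \<open>Each \<open>e\<close> is -1 plus the indicator that its arguments agree. The
    eight constants cancel, and mixed triples never agree because sources differ from sinks.\<close>
  have K: "K = (if p1 = p2 \<and> p2 = p3 then 1 else 0) - (if q1 = q2 \<and> q2 = q3 then 1 else 0)"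
    unfolding K_def eI eqs using ne by simp
  have "L = K"
    unfolding K L_def eI eqs using ne by simp
  \<comment> \<open>If all rows or all columns coincide, the two monomials are equal; otherwise
    \<open>K\<close> is 0.\<close>
  have z: "K * (X (p1,q3) * X (p2,q1) * X (p3,q2)) = K * (X (p1,q2) * X (p2,q3) * X (p3,q1))"
    unfolding K by auto
  define k1 k2 where "k1 = c (i p2) (j q3) (i p3) (j q2) * c (i p1) (j q3) (i p2) (j q1) + c (i p3) (j q1) (i p1) (j q3) * c (i p2) (j q1) (i p3) (j q2) + c (i p1) (j q2) (i p2) (j q1) * c (i p3) (j q2) (i p1) (j q3)"
    and "k2 = c (i p2) (j q3) (i p3) (j q2) * c (i p1) (j q2) (i p3) (j q1) + c (i p3) (j q1) (i p1) (j q3) * c (i p2) (j q3) (i p1) (j q2) + c (i p1) (j q2) (i p2) (j q1) * c (i p3) (j q1) (i p2) (j q3)"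
  \<comment> \<open>Coefficients of the monomials belonging to the three transpositions, and with
    \<open>m0\<close> to the identity. They vanish by skew symmetry and \<open>chi_exchange\<close>
    alone.\<close>
  define m1 m2 m3 where "m1 = c (i p2) (j q3) (i p3) (j q2) * (c (i p1) (j q1) (i p2) (j q3) + c (i p1) (j q1) (i p3) (j q2)) + c (i p3) (j q3) (i p1) (j q1) * c (i p2) (j q3) (i p3) (j q2) + c (i p1) (j q1) (i p2) (j q2) * c (i p3) (j q2) (i p2) (j q3)"
   and "m2 = c (i p2) (j q2) (i p3) (j q3) * c (i p1) (j q2) (i p2) (j q1) + c (i p3) (j q3) (i p1) (j q1) * c (i p2) (j q1) (i p1) (j q2) + c (i p1) (j q2) (i p2) (j q1) * (c (i p3) (j q3) (i p1) (j q2) + c (i p3) (j q3) (i p2) (j q1))"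
   and "m3 = c (i p2) (j q2) (i p3) (j q3) * c (i p1) (j q3) (i p3) (j q1) + c (i p3) (j q1) (i p1) (j q3) * (c (i p2) (j q2) (i p3) (j q1) + c (i p2) (j q2) (i p1) (j q3)) + c (i p1) (j q1) (i p2) (j q2) * c (i p3) (j q1) (i p1) (j q3)"
  define m0 where "m0 = c (i p2) (j q2) (i p3) (j q3) * (c (i p1) (j q1) (i p2) (j q2) + c (i p1) (j q1) (i p3) (j q3)) + c (i p3) (j q3) (i p1) (j q1) * (c (i p2) (j q2) (i p3) (j q3) + c (i p2) (j q2) (i p1) (j q1)) + c (i p1) (j q1) (i p2) (j q2) * (c (i p3) (j q3) (i p1) (j q1) + c (i p3) (j q3) (i p2) (j q2))"
  have "4 * k1 = K" "4 * k2 = - L"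
    unfolding k1_def k2_def K_def L_def e_def c_def by (rule chi_cycle)+
  then have k: "4 * k1 = K" "4 * k2 = - K" unfolding \<open>L = K\<close> .
  have sk: "c b' a' b a = - c b a b' a'" for a b a' b' unfolding c_def by (rule chi_skew)
  have "m0 = 0"
    unfolding m0_def sk[of "i p1" "j q1" "i p3" "j q3"] sk[of "i p1" "j q1" "i p2" "j q2"] sk[of "i p2" "j q2" "i p3" "j q3"] by Groebner_Basis.algebra
  moreover have "m1 = 0"
    unfolding m1_def sk[of "i p1" "j q1" "i p3" "j q3"] sk[of "i p2" "j q3" "i p3" "j q2"]
      chi_exchange[of "i p1" "j q1" "i p2" "j q3" "i p3" "j q2", folded c_def] by Groebner_Basis.algebra
  moreover have "m2 = 0"
    unfolding m2_def sk[of "i p3" "j q3" "i p2" "j q2"] sk[of "i p1" "j q2" "i p2" "j q1"]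
      chi_exchange[of "i p3" "j q3" "i p1" "j q2" "i p2" "j q1", folded c_def] by Groebner_Basis.algebra
  moreover have "m3 = 0"
    unfolding m3_def sk[of "i p2" "j q2" "i p1" "j q1"] sk[of "i p3" "j q1" "i p1" "j q3"]
      chi_exchange[of "i p2" "j q2" "i p3" "j q1" "i p1" "j q3", folded c_def] by Groebner_Basis.algebra
  ultimately have 0: "m0 = 0" "m1 = 0" "m2 = 0" "m3 = 0" by auto
  have "gsv_double A C i j (p1,q1) (p2,q2) (p3,q3) X + gsv_double A C i j (p2,q2) (p3,q3) (p1,q1) X
    + gsv_double A C i j (p3,q3) (p1,q1) (p2,q2) X
    = A * A * (k1 * (X (p1,q3) * X (p2,q1) * X (p3,q2)) + k2 * (X (p1,q2) * X (p2,q3) * X (p3,q1)))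
      + C * C * m0 * (X (p1,q1) * X (p2,q2) * X (p3,q3))
      - A * C * (m1 * (X (p1,q1) * X (p2,q3) * X (p3,q2)) + m2 * (X (p1,q2) * X (p2,q1) * X (p3,q3)) + m3 * (X (p1,q3) * X (p2,q2) * X (p3,q1)))"
    unfolding gsv_double_def gsv_coeff_def fst_conv snd_conv c_def[symmetric] k1_def k2_def m0_def m1_def m2_def m3_def
    by Groebner_Basis.algebra
  also have "\<dots> = A * A * (k1 * (X (p1,q3) * X (p2,q1) * X (p3,q2)) + k2 * (X (p1,q2) * X (p2,q3) * X (p3,q1)))"
    unfolding 0 by simp
  also have "k1 * (X (p1,q3) * X (p2,q1) * X (p3,q2)) + k2 * (X (p1,q2) * X (p2,q3) * X (p3,q1)) = 0"
  proof -
    have "4 * (k1 * a + k2 * b) = (4 * k1) * a + (4 * k2) * b" for a b by (simp add: algebra_simps)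
    then have "4 * (k1 * a + k2 * b) = K * a - K * b" for a b unfolding k by simp
    from this[of "X (p1,q3) * X (p2,q1) * X (p3,q2)" "X (p1,q2) * X (p2,q3) * X (p3,q1)", unfolded z]
    show ?thesis by (metis diff_self mult_eq_0_iff zero_neq_numeral)
  qed
  finally show ?thesis by simp
qed

section \<open>Brackets given by a matrix of coefficient functions\<close>

definition coeff_bracket :: "'s set \<Rightarrow> ('s \<Rightarrow> 's \<Rightarrow> ('s \<Rightarrow> real) \<Rightarrow> real) \<Rightarrow> 's bracket" where
  "coeff_bracket S P = (\<lambda>f\<in>smooth_funs S. \<lambda>g\<in>smooth_funs S. \<lambda>x\<in>coord_space S.
     \<Sum>s\<in>S. \<Sum>t\<in>S. P s t x * pderiv_at s f x * pderiv_at t g x)"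

lemma coeff_bracket_eq:
  "f \<in> smooth_funs S \<Longrightarrow> g \<in> smooth_funs S \<Longrightarrow> x \<in> coord_space S \<Longrightarrow>
    coeff_bracket S P f g x = (\<Sum>s\<in>S. \<Sum>t\<in>S. P s t x * pderiv_at s f x * pderiv_at t g x)"
  by (simp add: coeff_bracket_def)

lemma coeff_bracket_smooth:
  assumes P: "\<And>n s t. s \<in> S \<Longrightarrow> t \<in> S \<Longrightarrow> diff_of_order n S (P s t)"
    and f: "f \<in> smooth_funs S" and g: "g \<in> smooth_funs S"
  shows "coeff_bracket S P f g \<in> smooth_funs S"
  unfolding coeff_bracket_def using f g
  by (simp, intro restrict_smooth_funs diff_of_order_sum diff_of_order_mult P smooth_funs_pderiv) auto

lemma coeff_bracket_pderiv:
  assumes P: "\<And>n s t. s \<in> S \<Longrightarrow> t \<in> S \<Longrightarrow> diff_of_order n S (P s t)"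
    and f: "f \<in> smooth_funs S" and g: "g \<in> smooth_funs S" and r: "r \<in> S" and x: "x \<in> coord_space S"
  shows "pderiv_at r (coeff_bracket S P f g) x = (\<Sum>s\<in>S. \<Sum>t\<in>S.
     pderiv_at r (P s t) x * pderiv_at s f x * pderiv_at t g x
     + P s t x * pderiv_at r (pderiv_at s f) x * pderiv_at t g x
     + P s t x * pderiv_at s f x * pderiv_at r (pderiv_at t g) x)"
proof -
  have "coeff_bracket S P f g = restrict (\<lambda>x. \<Sum>s\<in>S. \<Sum>t\<in>S. P s t x * pderiv_at s f x * pderiv_at t g x) (coord_space S)"
    using f g by (simp add: coeff_bracket_def)
  then have "pderiv_at r (coeff_bracket S P f g) x = pderiv_at r (\<lambda>x. \<Sum>s\<in>S. \<Sum>t\<in>S. P s t x * pderiv_at s f x * pderiv_at t g x) x"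
    using pderiv_at_restrict[OF r x] by simp
  also have "\<dots> = (\<Sum>s\<in>S. \<Sum>t\<in>S. (pderiv_at r (P s t) x * pderiv_at s f x + pderiv_at r (pderiv_at s f) x * P s t x) * pderiv_at t g x
     + pderiv_at r (pderiv_at t g) x * (P s t x * pderiv_at s f x))"
  proof (rule pderiv_at_eqI, intro DERIV_sum)
    fix s t assume st: "s \<in> S" "t \<in> S"
    have d: "((\<lambda>y. h (x(r := y))) has_field_derivative pderiv_at r h x) (at (x r))" if "diff_of_order (Suc 0) S h" for h
      by (rule pderiv_at_has_derivative'[OF that r x])
    note d1 = d[OF P[OF st]] and d2 = d[OF smooth_funs_pderiv[OF f st(1)]] and d3 = d[OF smooth_funs_pderiv[OF g st(2)]]
    show "((\<lambda>y. P s t (x(r := y)) * pderiv_at s f (x(r := y)) * pderiv_at t g (x(r := y))) has_real_derivative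
            (pderiv_at r (P s t) x * pderiv_at s f x + pderiv_at r (pderiv_at s f) x * P s t x) * pderiv_at t g x +
            pderiv_at r (pderiv_at t g) x * (P s t x * pderiv_at s f x)) (at (x r))"
      using DERIV_mult[OF DERIV_mult[OF d1 d2] d3] unfolding fun_upd_triv .
  qed
  also have "\<dots> = (\<Sum>s\<in>S. \<Sum>t\<in>S.
     pderiv_at r (P s t) x * pderiv_at s f x * pderiv_at t g x
     + P s t x * pderiv_at r (pderiv_at s f) x * pderiv_at t g x
     + P s t x * pderiv_at s f x * pderiv_at r (pderiv_at t g) x)"
    by (intro sum.cong refl) (simp add: algebra_simps)
  finally show ?thesis .
qed

lemma sum_reverse4:
  fixes E :: "'s \<Rightarrow> 's \<Rightarrow> 's \<Rightarrow> 's \<Rightarrow> real"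
  shows "(\<Sum>u\<in>S. \<Sum>t\<in>S. \<Sum>s\<in>S. \<Sum>r\<in>S. E s r t u) = (\<Sum>s\<in>S. \<Sum>r\<in>S. \<Sum>t\<in>S. \<Sum>u\<in>S. E s r t u)"
proof -
  have "(\<Sum>u\<in>S. \<Sum>t\<in>S. \<Sum>s\<in>S. \<Sum>r\<in>S. E s r t u) = (\<Sum>u\<in>S. \<Sum>s\<in>S. \<Sum>t\<in>S. \<Sum>r\<in>S. E s r t u)"
    by (intro sum.cong refl sum.swap)
  also have "\<dots> = (\<Sum>s\<in>S. \<Sum>u\<in>S. \<Sum>t\<in>S. \<Sum>r\<in>S. E s r t u)" by (rule sum.swap)
  also have "\<dots> = (\<Sum>s\<in>S. \<Sum>u\<in>S. \<Sum>r\<in>S. \<Sum>t\<in>S. E s r t u)" by (intro sum.cong refl sum.swap)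
  also have "\<dots> = (\<Sum>s\<in>S. \<Sum>r\<in>S. \<Sum>u\<in>S. \<Sum>t\<in>S. E s r t u)" by (intro sum.cong refl sum.swap)
  also have "\<dots> = (\<Sum>s\<in>S. \<Sum>r\<in>S. \<Sum>t\<in>S. \<Sum>u\<in>S. E s r t u)" by (intro sum.cong refl sum.swap)
  finally show ?thesis .
qed

lemma sum_rotate3:
  fixes E :: "'s \<Rightarrow> 's \<Rightarrow> 's \<Rightarrow> real"
  shows "(\<Sum>s\<in>S. \<Sum>t\<in>S. \<Sum>u\<in>S. E s t u) = (\<Sum>s\<in>S. \<Sum>t\<in>S. \<Sum>u\<in>S. E t u s)"
proof -
  have "(\<Sum>s\<in>S. \<Sum>t\<in>S. \<Sum>u\<in>S. E t u s) = (\<Sum>t\<in>S. \<Sum>s\<in>S. \<Sum>u\<in>S. E t u s)" by (rule sum.swap)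
  also have "\<dots> = (\<Sum>t\<in>S. \<Sum>u\<in>S. \<Sum>s\<in>S. E t u s)" by (intro sum.cong refl sum.swap)
  finally show ?thesis by simp
qed

text \<open>Expanding a double bracket gives one sum with derivatives of \<open>P\<close> and two
  with second derivatives of an argument. The sums of the first kind add up to zero by the Jacobi
  identity on coordinates; those of the second kind cancel in pairs between the cyclic
  permutations.\<close>

lemma coeff_bracket_jacobi:
  assumes fin: "finite S"
    and P: "\<And>n s t. s \<in> S \<Longrightarrow> t \<in> S \<Longrightarrow> diff_of_order n S (P s t)"
    and skew: "\<And>s t x. s \<in> S \<Longrightarrow> t \<in> S \<Longrightarrow> P t s x = - P s t x"
    and jac: "\<And>s t u x. s \<in> S \<Longrightarrow> t \<in> S \<Longrightarrow> u \<in> S \<Longrightarrow> x \<in> coord_space S \<Longrightarrow>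
       (\<Sum>r\<in>S. P s r x * pderiv_at r (P t u) x) + (\<Sum>r\<in>S. P t r x * pderiv_at r (P u s) x)
       + (\<Sum>r\<in>S. P u r x * pderiv_at r (P s t) x) = 0"
    and f: "f \<in> smooth_funs S" and g: "g \<in> smooth_funs S" and h: "h \<in> smooth_funs S" and x: "x \<in> coord_space S"
  defines "B \<equiv> coeff_bracket S P"
  shows "B f (B g h) x + B g (B h f) x + B h (B f g) x = 0"
proof -
  define T1 where "T1 f g h = (\<Sum>s\<in>S. \<Sum>t\<in>S. \<Sum>u\<in>S. pderiv_at s f x * pderiv_at t g x * pderiv_at u h x * (\<Sum>r\<in>S. P s r x * pderiv_at r (P t u) x))" for f g h
  define T2 where "T2 f g h = (\<Sum>s\<in>S. \<Sum>r\<in>S. \<Sum>t\<in>S. \<Sum>u\<in>S. P s r x * P t u x * pderiv_at s f x * pderiv_at r (pderiv_at t g) x * pderiv_at u h x)" for f g h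
  define T3 where "T3 f g h = (\<Sum>s\<in>S. \<Sum>r\<in>S. \<Sum>t\<in>S. \<Sum>u\<in>S. P s r x * P t u x * pderiv_at s f x * pderiv_at t g x * pderiv_at r (pderiv_at u h) x)" for f g h
  have expand: "B f (B g h) x = T1 f g h + T2 f g h + T3 f g h"
    if f: "f \<in> smooth_funs S" and g: "g \<in> smooth_funs S" and h: "h \<in> smooth_funs S" for f g h
  proof -
    have "B f (B g h) x = (\<Sum>s\<in>S. \<Sum>r\<in>S. P s r x * pderiv_at s f x * pderiv_at r (B g h) x)"
      unfolding B_def by (rule coeff_bracket_eq[OF f coeff_bracket_smooth[OF P g h] x])
    also have "\<dots> = (\<Sum>s\<in>S. \<Sum>r\<in>S. \<Sum>t\<in>S. \<Sum>u\<in>S.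
       pderiv_at s f x * pderiv_at t g x * pderiv_at u h x * (P s r x * pderiv_at r (P t u) x)
       + P s r x * P t u x * pderiv_at s f x * pderiv_at r (pderiv_at t g) x * pderiv_at u h x
       + P s r x * P t u x * pderiv_at s f x * pderiv_at t g x * pderiv_at r (pderiv_at u h) x)"
      unfolding B_def
      by (intro sum.cong refl, subst coeff_bracket_pderiv[OF P g h], simp_all only: x)
         (simp_all only: sum_distrib_left, intro sum.cong refl, simp add: algebra_simps)
    also have "\<dots> = (\<Sum>s\<in>S. \<Sum>r\<in>S. \<Sum>t\<in>S. \<Sum>u\<in>S.
       pderiv_at s f x * pderiv_at t g x * pderiv_at u h x * (P s r x * pderiv_at r (P t u) x)) + T2 f g h + T3 f g h"
      unfolding T2_def T3_def by (simp only: sum.distrib)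
    also have "(\<Sum>s\<in>S. \<Sum>r\<in>S. \<Sum>t\<in>S. \<Sum>u\<in>S.
       pderiv_at s f x * pderiv_at t g x * pderiv_at u h x * (P s r x * pderiv_at r (P t u) x)) = T1 f g h"
    proof -
      have "(\<Sum>r\<in>S. \<Sum>t\<in>S. \<Sum>u\<in>S. pderiv_at s f x * pderiv_at t g x * pderiv_at u h x * (P s r x * pderiv_at r (P t u) x))
        = (\<Sum>t\<in>S. \<Sum>u\<in>S. \<Sum>r\<in>S. pderiv_at s f x * pderiv_at t g x * pderiv_at u h x * (P s r x * pderiv_at r (P t u) x))" for s
        by (rule trans[OF sum.swap]) (intro sum.cong refl sum.swap)
      then show ?thesis unfolding T1_def by (simp only: sum_distrib_left)
    qed
    finally show ?thesis .
  qed
  \<comment> \<open>Reversing the order of the four summation indices matches the two sums. The sign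
    comes from skew symmetry of \<open>P\<close>, the matching of second derivatives from their
    symmetry.\<close>
  have T23: "T3 h f g = - T2 f g h" if g: "g \<in> smooth_funs S" for f g h
  proof -
    have "T3 h f g = (\<Sum>u\<in>S. \<Sum>t\<in>S. \<Sum>s\<in>S. \<Sum>r\<in>S. - (P s r x * P t u x * pderiv_at s f x * pderiv_at r (pderiv_at t g) x * pderiv_at u h x))"
      unfolding T3_def
    proof (intro sum.cong refl)
      fix s r t u assume "s \<in> S" "r \<in> S" "t \<in> S" "u \<in> S"
      then have "P s r x = - P r s x" "pderiv_at r (pderiv_at u g) x = pderiv_at u (pderiv_at r g) x"
        using skew[of r s x] pderiv_at_commute[OF smooth_funs_order[OF g] _ _ x, of r u] by simp_all
      then show "P s r x * P t u x * pderiv_at s h x * pderiv_at t f x * pderiv_at r (pderiv_at u g) x =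
        - (P t u x * P r s x * pderiv_at t f x * pderiv_at u (pderiv_at r g) x * pderiv_at s h x)" by simp
    qed
    also have "\<dots> = - (\<Sum>u\<in>S. \<Sum>t\<in>S. \<Sum>s\<in>S. \<Sum>r\<in>S. P s r x * P t u x * pderiv_at s f x * pderiv_at r (pderiv_at t g) x * pderiv_at u h x)"
      by (simp only: sum_negf)
    also have "(\<Sum>u\<in>S. \<Sum>t\<in>S. \<Sum>s\<in>S. \<Sum>r\<in>S. P s r x * P t u x * pderiv_at s f x * pderiv_at r (pderiv_at t g) x * pderiv_at u h x) = T2 f g h"
      unfolding T2_def by (rule sum_reverse4)
    finally show ?thesis .
  qed
  have r1: "T1 g h f = (\<Sum>s\<in>S. \<Sum>t\<in>S. \<Sum>u\<in>S. pderiv_at s f x * pderiv_at t g x * pderiv_at u h x * (\<Sum>r\<in>S. P t r x * pderiv_at r (P u s) x))"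
    unfolding T1_def
    by (rule trans[OF sum_rotate3[of _ S]]) (intro sum.cong refl, simp only: mult_ac)
  have r2: "T1 h f g = (\<Sum>s\<in>S. \<Sum>t\<in>S. \<Sum>u\<in>S. pderiv_at s f x * pderiv_at t g x * pderiv_at u h x * (\<Sum>r\<in>S. P u r x * pderiv_at r (P s t) x))"
    unfolding T1_def by (rule trans[OF sum_rotate3[of _ S]], rule trans[OF sum_rotate3[of _ S]]) (intro sum.cong refl, simp only: mult_ac)
  have "T1 f g h + T1 g h f + T1 h f g = (\<Sum>s\<in>S. \<Sum>t\<in>S. \<Sum>u\<in>S. pderiv_at s f x * pderiv_at t g x * pderiv_at u h x *
     ((\<Sum>r\<in>S. P s r x * pderiv_at r (P t u) x) + (\<Sum>r\<in>S. P t r x * pderiv_at r (P u s) x)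
       + (\<Sum>r\<in>S. P u r x * pderiv_at r (P s t) x)))"
    unfolding r1 r2 unfolding T1_def by (simp only: sum.distrib distrib_left)
  also have "\<dots> = 0" using jac x by simp
  finally have T1: "T1 f g h + T1 g h f + T1 h f g = 0" .
  have "B f (B g h) x + B g (B h f) x + B h (B f g) x
    = (T1 f g h + T1 g h f + T1 h f g) + (T2 f g h + T3 h f g) + (T2 g h f + T3 f g h) + (T2 h f g + T3 g h f)"
    unfolding expand[OF f g h] expand[OF g h f] expand[OF h f g] by simp
  then show ?thesis unfolding T1 T23[OF f] T23[OF g] T23[OF h] by simp
qed

lemma pderiv_at_lincomb:
  assumes f: "f \<in> smooth_funs S" and g: "g \<in> smooth_funs S" and s: "s \<in> S" and x: "x \<in> coord_space S"
  shows "pderiv_at s (\<lambda>y\<in>coord_space S. c * f y + g y) x = c * pderiv_at s f x + pderiv_at s g x"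
    and "pderiv_at s (\<lambda>y\<in>coord_space S. f y * g y) x = f x * pderiv_at s g x + g x * pderiv_at s f x"
proof -
  note df = pderiv_at_has_derivative'[OF smooth_funs_order[OF f] s x]
    and dg = pderiv_at_has_derivative'[OF smooth_funs_order[OF g] s x]
  show "pderiv_at s (\<lambda>y\<in>coord_space S. c * f y + g y) x = c * pderiv_at s f x + pderiv_at s g x"
    unfolding pderiv_at_restrict[OF s x] by (rule pderiv_at_eqI) (intro DERIV_add DERIV_cmult df dg)
  show "pderiv_at s (\<lambda>y\<in>coord_space S. f y * g y) x = f x * pderiv_at s g x + g x * pderiv_at s f x"
    unfolding pderiv_at_restrict[OF s x]
    by (rule pderiv_at_eqI) (rule DERIV_cong[OF DERIV_mult[OF df dg]], simp)
qed

lemma smooth_funs_lincomb: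
  assumes f: "f \<in> smooth_funs S" and g: "g \<in> smooth_funs S"
  shows "(\<lambda>y\<in>coord_space S. c * f y + g y) \<in> smooth_funs S" "(\<lambda>y\<in>coord_space S. f y * g y) \<in> smooth_funs S"
  by (intro restrict_smooth_funs diff_of_order_add diff_of_order_mult diff_of_order_const smooth_funs_order f g)+

lemma coeff_bracket_poisson:
  assumes fin: "finite S"
    and P: "\<And>n s t. s \<in> S \<Longrightarrow> t \<in> S \<Longrightarrow> diff_of_order n S (P s t)"
    and skew: "\<And>s t x. s \<in> S \<Longrightarrow> t \<in> S \<Longrightarrow> P t s x = - P s t x"
    and jac: "\<And>s t u x. s \<in> S \<Longrightarrow> t \<in> S \<Longrightarrow> u \<in> S \<Longrightarrow> x \<in> coord_space S \<Longrightarrow>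
       (\<Sum>r\<in>S. P s r x * pderiv_at r (P t u) x) + (\<Sum>r\<in>S. P t r x * pderiv_at r (P u s) x)
       + (\<Sum>r\<in>S. P u r x * pderiv_at r (P s t) x) = 0"
  shows "poisson_bracket S (coeff_bracket S P)"
  unfolding poisson_bracket_def
proof (intro conjI ballI allI)
  let ?B = "coeff_bracket S P"
  show "?B \<in> smooth_funs S \<rightarrow>\<^sub>E smooth_funs S \<rightarrow>\<^sub>E smooth_funs S"
  proof (intro PiE_I)
    show "?B f g \<in> smooth_funs S" if "f \<in> smooth_funs S" "g \<in> smooth_funs S" for f g
      by (rule coeff_bracket_smooth[OF P that])
  qed (auto simp: coeff_bracket_def)
  fix f g h c x assume f: "f \<in> smooth_funs S" and g: "g \<in> smooth_funs S" and h: "h \<in> smooth_funs S" and x: "x \<in> coord_space S"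
  show "?B f g x = - ?B g f x"
  proof -
    have "?B g f x = (\<Sum>t\<in>S. \<Sum>s\<in>S. P s t x * pderiv_at s g x * pderiv_at t f x)"
      unfolding coeff_bracket_eq[OF g f x] by (rule sum.swap)
    also have "\<dots> = (\<Sum>s\<in>S. \<Sum>t\<in>S. - (P s t x * pderiv_at s f x * pderiv_at t g x))"
    proof (intro sum.cong refl)
      fix s t assume "s \<in> S" "t \<in> S"
      then show "P t s x * pderiv_at t g x * pderiv_at s f x = - (P s t x * pderiv_at s f x * pderiv_at t g x)"
        using skew[of s t x] by simp
    qed
    finally show ?thesis unfolding coeff_bracket_eq[OF f g x] by (simp add: sum_negf)
  qed
  show "?B (\<lambda>y\<in>coord_space S. c * f y + g y) h x = c * ?B f h x + ?B g h x"
    unfolding coeff_bracket_eq[OF f h x] coeff_bracket_eq[OF g h x]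
      coeff_bracket_eq[OF smooth_funs_lincomb(1)[OF f g] h x]
    unfolding sum_distrib_left sum.distrib[symmetric]
    by (intro sum.cong refl) (simp only: pderiv_at_lincomb(1)[OF f g _ x], simp only: algebra_simps)
  show "?B (\<lambda>y\<in>coord_space S. f y * g y) h x = f x * ?B g h x + g x * ?B f h x"
    unfolding coeff_bracket_eq[OF f h x] coeff_bracket_eq[OF g h x]
      coeff_bracket_eq[OF smooth_funs_lincomb(2)[OF f g] h x]
    unfolding sum_distrib_left sum.distrib[symmetric]
    by (intro sum.cong refl) (simp only: pderiv_at_lincomb(2)[OF f g _ x], simp only: algebra_simps)
  show "?B f (?B g h) x + ?B g (?B h f) x + ?B h (?B f g) x = 0"
    by (rule coeff_bracket_jacobi[OF fin P skew jac f g h x])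
qed

text \<open>The coefficients are quadratic in the entries, so this is the Leibniz rule for the
  bracket of the coordinate \<open>s\<close> with two products of entries. All four entries that
  occur have indices in the product set.\<close>

lemma pderiv_gsv_coeff:
  assumes S: "fst t \<in> Pset" "snd t \<in> Qset" "fst u \<in> Pset" "snd u \<in> Qset" and fin: "finite (Pset \<times> Qset)"
  shows "(\<Sum>r\<in>Pset \<times> Qset. gsv_coeff A C i j s r X * pderiv_at r (gsv_coeff A C i j t u) X) = gsv_double A C i j s t u X"
proof -
  define p where "p = C * chi (i (fst t)) (j (snd t)) (i (fst u)) (j (snd u))"
  define q where "q = A * chi (i (fst t)) (j (snd u)) (i (fst u)) (j (snd t))"
  define d where "d r v = (if r = v then 1 else 0 :: real)" for r v :: "nat \<times> nat"
  define G where "G r = gsv_coeff A C i j s r X" for r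
  have coord: "((\<lambda>y. (X(r := y)) v) has_field_derivative d r v) (at (X r))" for r v
    by (cases "r = v") (auto intro!: derivative_eq_intros simp: d_def)
  have der: "pderiv_at r (gsv_coeff A C i j t u) X =
     p * (d r t * X u + d r u * X t) - q * (d r (fst t, snd u) * X (fst u, snd t) + d r (fst u, snd t) * X (fst t, snd u))" for r
  proof (rule pderiv_at_eqI)
    show "((\<lambda>y. gsv_coeff A C i j t u (X(r := y))) has_real_derivative
     p * (d r t * X u + d r u * X t) - q * (d r (fst t, snd u) * X (fst u, snd t) + d r (fst u, snd t) * X (fst t, snd u)))
     (at (X r))"
      unfolding gsv_coeff_def p_def[symmetric] q_def[symmetric]
      using DERIV_diff[OF DERIV_cmult[OF DERIV_mult[OF coord[of r t] coord[of r u]], of p]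
        DERIV_cmult[OF DERIV_mult[OF coord[of r "(fst t, snd u)"] coord[of r "(fst u, snd t)"]], of q]]
      unfolding fun_upd_triv .
  qed
  have sum: "(\<Sum>r\<in>Pset \<times> Qset. G r * d r v) = G v" if "v \<in> Pset \<times> Qset" for v
  proof -
    have "(\<Sum>r\<in>Pset \<times> Qset. G r * d r v) = (\<Sum>r\<in>Pset \<times> Qset. if r = v then G r else 0)"
      by (intro sum.cong refl) (simp add: d_def)
    then show ?thesis using fin that by simp
  qed
  have "(\<Sum>r\<in>Pset \<times> Qset. gsv_coeff A C i j s r X * pderiv_at r (gsv_coeff A C i j t u) X) =
    p * ((\<Sum>r\<in>Pset \<times> Qset. G r * d r t) * X u + (\<Sum>r\<in>Pset \<times> Qset. G r * d r u) * X t)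
    - q * ((\<Sum>r\<in>Pset \<times> Qset. G r * d r (fst t, snd u)) * X (fst u, snd t)
         + (\<Sum>r\<in>Pset \<times> Qset. G r * d r (fst u, snd t)) * X (fst t, snd u))"
    unfolding sum_distrib_left sum_distrib_right sum.distrib[symmetric] sum_subtractf[symmetric]
    by (intro sum.cong refl) (simp only: der G_def[symmetric], simp only: algebra_simps)
  also have "\<dots> = p * (G t * X u + G u * X t) - q * (G (fst t, snd u) * X (fst u, snd t) + G (fst u, snd t) * X (fst t, snd u))"
    using S by (simp add: sum mem_Times_iff)
  also have "\<dots> = gsv_double A C i j s t u X"
    unfolding gsv_double_def p_def[symmetric] q_def[symmetric] G_def by Groebner_Basis.algebra
  finally show ?thesis .
qed

lemma gsv_coeff_smooth: "diff_of_order n S (gsv_coeff A C i j s t)"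
proof -
  have "diff_of_order n S (\<lambda>X. C * chi (i (fst s)) (j (snd s)) (i (fst t)) (j (snd t)) * (X s * X t)
     + (- A * chi (i (fst s)) (j (snd t)) (i (fst t)) (j (snd s))) * (X (fst s, snd t) * X (fst t, snd s)))"
    by (intro diff_of_order_add diff_of_order_mult diff_of_order_const diff_of_order_coord)
  then show ?thesis by (rule diff_of_order_cong) (simp add: gsv_coeff_def)
qed

lemma gsv_bracket_poisson:
  assumes i: "inj_on i {1..k}" and j: "inj_on j {1..m}" and ij: "\<And>p q. p \<in> {1..k} \<Longrightarrow> q \<in> {1..m} \<Longrightarrow> i p \<noteq> j q"
  shows "poisson_bracket (mat_index k m) (coeff_bracket (mat_index k m) (gsv_coeff A C i j))"
proof (rule coeff_bracket_poisson)
  show "finite (mat_index k m)" by (simp add: mat_index_def)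
  show "diff_of_order n (mat_index k m) (gsv_coeff A C i j s t)" for n s t by (rule gsv_coeff_smooth)
  show "gsv_coeff A C i j t s x = - gsv_coeff A C i j s t x" for s t x by (rule gsv_coeff_skew)
  fix s t u x assume s: "s \<in> mat_index k m" and t: "t \<in> mat_index k m" and u: "u \<in> mat_index k m"
  have fin: "finite ({1..k} \<times> {1..m})" by simp
  have sm: "fst s \<in> {1..k}" "snd s \<in> {1..m}" "fst t \<in> {1..k}" "snd t \<in> {1..m}" "fst u \<in> {1..k}" "snd u \<in> {1..m}"
    using s t u by (auto simp: mat_index_def)
  show "(\<Sum>r\<in>mat_index k m. gsv_coeff A C i j s r x * pderiv_at r (gsv_coeff A C i j t u) x)
     + (\<Sum>r\<in>mat_index k m. gsv_coeff A C i j t r x * pderiv_at r (gsv_coeff A C i j u s) x)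
     + (\<Sum>r\<in>mat_index k m. gsv_coeff A C i j u r x * pderiv_at r (gsv_coeff A C i j s t) x) = 0"
    unfolding mat_index_def pderiv_gsv_coeff[OF sm(3-6) fin] pderiv_gsv_coeff[OF sm(5,6,1,2) fin] pderiv_gsv_coeff[OF sm(1-4) fin]
    using gsv_jacobi_coeff[OF i j ij sm(1,3,5) sm(2,4,6), unfolded prod.collapse] by simp
qed

section \<open>Determinants over finite index sets\<close>

text \<open>Carries determinants and adjugates of matrices with numbered rows over to matrices
  indexed by the vertices of a network.\<close>

definition enumeration :: "'v set \<Rightarrow> nat \<Rightarrow> 'v" where
  "enumeration V = (SOME f. bij_betw f {0..<card V} V)"

lemma bij_betw_enumeration: "finite V \<Longrightarrow> bij_betw (enumeration V) {0..<card V} V"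
  unfolding enumeration_def using ex_bij_betw_nat_finite[of V] by (rule someI_ex)

definition index_of :: "'v set \<Rightarrow> 'v \<Rightarrow> nat" where
  "index_of V = inv_into {0..<card V} (enumeration V)"

lemma index_of:
  assumes "finite V" "v \<in> V"
  shows "index_of V v < card V" "enumeration V (index_of V v) = v"
proof -
  have "v \<in> enumeration V ` {0..<card V}" using bij_betw_enumeration[OF assms(1)] assms(2) by (simp add: bij_betw_def)
  then show "index_of V v < card V" "enumeration V (index_of V v) = v"
    unfolding index_of_def using inv_into_into[of v "enumeration V" "{0..<card V}"] f_inv_into_f[of v "enumeration V" "{0..<card V}"] by simp_all
qed

lemma index_of_eq_iff: "finite V \<Longrightarrow> v \<in> V \<Longrightarrow> y \<in> V \<Longrightarrow> index_of V v = index_of V y \<longleftrightarrow> v = y"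
  using index_of by metis

lemma sum_enumeration: "finite V \<Longrightarrow> (\<Sum>x\<in>V. f x) = (\<Sum>i\<in>{0..<card V}. f (enumeration V i))"
  using sum.reindex_bij_betw[OF bij_betw_enumeration, of V f] by simp

definition fun_mat :: "'v set \<Rightarrow> ('v \<Rightarrow> 'v \<Rightarrow> 'a) \<Rightarrow> 'a Matrix.mat" where
  "fun_mat V A = Matrix.mat (card V) (card V) (\<lambda>(i,j). A (enumeration V i) (enumeration V j))"

definition fun_det :: "'v set \<Rightarrow> ('v \<Rightarrow> 'v \<Rightarrow> 'a::comm_ring_1) \<Rightarrow> 'a" where
  "fun_det V A = Determinant.det (fun_mat V A)"

definition fun_adj :: "'v set \<Rightarrow> ('v \<Rightarrow> 'v \<Rightarrow> 'a::comm_ring_1) \<Rightarrow> 'v \<Rightarrow> 'v \<Rightarrow> 'a" where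
  "fun_adj V A v x = Matrix.index_mat (Determinant.adj_mat (fun_mat V A)) (index_of V v, index_of V x)"

lemma fun_mat_carrier: "fun_mat V A \<in> carrier_mat (card V) (card V)"
  by (simp add: fun_mat_def)

lemma index_mult_mat_sum:
  assumes "B \<in> carrier_mat n n" "C \<in> carrier_mat n n" "i < n" "j < n"
  shows "Matrix.index_mat (B * C) (i, j) = (\<Sum>k\<in>{0..<n}. Matrix.index_mat B (i,k) * Matrix.index_mat C (k,j))"
  using assms by (auto simp: scalar_prod_def intro!: sum.cong)

lemma fun_adj_left:
  assumes "finite V" "v \<in> V" "y \<in> V"
  shows "(\<Sum>x\<in>V. fun_adj V A v x * A x y) = (if v = y then fun_det V A else 0)"
proof -
  let ?M = "fun_mat V A" and ?n = "card V"
  have iV: "index_of V (enumeration V i) = i" if "i < card V" for i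
    using that bij_betw_enumeration[OF assms(1)] unfolding index_of_def bij_betw_def by (simp add: inv_into_f_f)
  have "(\<Sum>x\<in>V. fun_adj V A v x * A x y) = (\<Sum>k\<in>{0..<?n}. Matrix.index_mat (adj_mat ?M) (index_of V v, k) * Matrix.index_mat ?M (k, index_of V y))"
    unfolding sum_enumeration[OF assms(1)] fun_adj_def
    by (rule sum.cong) (use index_of[OF assms(1,3)] iV in \<open>simp_all add: fun_mat_def\<close>)
  also have "\<dots> = Matrix.index_mat (adj_mat ?M * ?M) (index_of V v, index_of V y)"
    by (rule index_mult_mat_sum[symmetric]) (use adj_mat(1)[OF fun_mat_carrier] fun_mat_carrier index_of assms in auto)
  also have "\<dots> = (if v = y then fun_det V A else 0)"
    unfolding adj_mat(3)[OF fun_mat_carrier] using index_of(1)[OF assms(1,2)] index_of(1)[OF assms(1,3)]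
    by (simp add: fun_det_def index_of_eq_iff[OF assms])
  finally show ?thesis .
qed

lemma fun_adj_right:
  assumes "finite V" "v \<in> V" "y \<in> V"
  shows "(\<Sum>x\<in>V. A v x * fun_adj V A x y) = (if v = y then fun_det V A else 0)"
proof -
  let ?M = "fun_mat V A" and ?n = "card V"
  have iV: "index_of V (enumeration V i) = i" if "i < card V" for i
    using that bij_betw_enumeration[OF assms(1)] unfolding index_of_def bij_betw_def by (simp add: inv_into_f_f)
  have "(\<Sum>x\<in>V. A v x * fun_adj V A x y) = (\<Sum>k\<in>{0..<?n}. Matrix.index_mat ?M (index_of V v, k) * Matrix.index_mat (adj_mat ?M) (k, index_of V y))"
    unfolding sum_enumeration[OF assms(1)] fun_adj_def
    by (rule sum.cong) (use index_of[OF assms(1,2)] iV in \<open>simp_all add: fun_mat_def\<close>)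
  also have "\<dots> = Matrix.index_mat (?M * adj_mat ?M) (index_of V v, index_of V y)"
    by (rule index_mult_mat_sum[symmetric]) (use adj_mat(1)[OF fun_mat_carrier] fun_mat_carrier index_of assms in auto)
  also have "\<dots> = (if v = y then fun_det V A else 0)"
    unfolding adj_mat(2)[OF fun_mat_carrier] using index_of(1)[OF assms(1,2)] index_of(1)[OF assms(1,3)]
    by (simp add: fun_det_def index_of_eq_iff[OF assms])
  finally show ?thesis .
qed

lemma fun_det_hom:
  assumes "comm_ring_hom h"
  shows "fun_det V (\<lambda>v x. h (A v x)) = h (fun_det V A)"
proof -
  interpret comm_ring_hom h by fact
  have "fun_mat V (\<lambda>v x. h (A v x)) = map_mat h (fun_mat V A)"
    by (rule eq_matI) (auto simp: fun_mat_def)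
  then show ?thesis unfolding fun_det_def by simp
qed

lemma fun_det_nonzero:
  fixes A :: "'v \<Rightarrow> 'v \<Rightarrow> real"
  assumes fin: "finite V" and inj: "\<And>g v. (\<And>v. v \<in> V \<Longrightarrow> (\<Sum>x\<in>V. A v x * g x) = 0) \<Longrightarrow> v \<in> V \<Longrightarrow> g v = 0"
  shows "fun_det V A \<noteq> 0"
proof
  assume "fun_det V A = 0"
  then obtain u where u: "u \<in> carrier_vec (card V)" "u \<noteq> 0\<^sub>v (card V)" "fun_mat V A *\<^sub>v u = 0\<^sub>v (card V)"
    unfolding fun_det_def using det_0_iff_vec_prod_zero_field[OF fun_mat_carrier] by blast
  define g where "g x = Matrix.vec_index u (index_of V x)" for x
  have iV: "index_of V (enumeration V i) = i" if "i < card V" for i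
    using that bij_betw_enumeration[OF fin] unfolding index_of_def bij_betw_def by (simp add: inv_into_f_f)
  have "(\<Sum>x\<in>V. A v x * g x) = 0" if v: "v \<in> V" for v
  proof -
    have "(\<Sum>x\<in>V. A v x * g x) = (\<Sum>k\<in>{0..<card V}. Matrix.index_mat (fun_mat V A) (index_of V v, k) * Matrix.vec_index u k)"
      unfolding sum_enumeration[OF fin] g_def
      by (rule sum.cong) (use index_of[OF fin v] iV in \<open>simp_all add: fun_mat_def\<close>)
    also have "\<dots> = Matrix.vec_index (fun_mat V A *\<^sub>v u) (index_of V v)"
      using u(1) index_of[OF fin v] fun_mat_carrier[of V A] by (auto simp: scalar_prod_def intro!: sum.cong)
    also have "\<dots> = 0" unfolding u(3) using index_of[OF fin v] by simp
    finally show ?thesis .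
  qed
  from inj[OF this] have g0: "g v = 0" if "v \<in> V" for v using that by blast
  have "u = 0\<^sub>v (card V)"
  proof (rule eq_vecI)
    fix i assume "i < dim_vec (0\<^sub>v (card V) :: real Matrix.vec)"
    then have i: "i < card V" by simp
    then have "enumeration V i \<in> V" using bij_betw_enumeration[OF fin] by (auto simp: bij_betw_def)
    from g0[OF this] show "Matrix.vec_index u i = Matrix.vec_index (0\<^sub>v (card V)) i"
      unfolding g_def iV[OF i] using i by simp
  qed (use u in simp)
  with u show False by simp
qed

text \<open>Applied to \<open>weight_polys N\<close>: determinant and adjugate of a matrix of
  polynomials in the edge weights of \<open>N\<close> are again such polynomials, as
  \<open>bm_represents\<close> demands.\<close>

definition subring :: "'a::comm_ring_1 set \<Rightarrow> bool" where
  "subring R \<longleftrightarrow> 0 \<in> R \<and> 1 \<in> R \<and> (\<forall>a\<in>R. \<forall>b\<in>R. a + b \<in> R \<and> a * b \<in> R \<and> - a \<in> R)"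

lemma det_in_subring:
  assumes R: "subring R" and A: "\<And>i j. i < n \<Longrightarrow> j < n \<Longrightarrow> Matrix.index_mat A (i,j) \<in> R" and c: "A \<in> carrier_mat n n"
  shows "Determinant.det A \<in> R"
proof -
  have sum: "(\<Sum>x\<in>B. f x) \<in> R" if "\<And>x. x \<in> B \<Longrightarrow> f x \<in> R" for B :: "(nat \<Rightarrow> nat) set" and f
    using that R by (induction B rule: infinite_finite_induct) (auto simp: subring_def)
  have prod: "(\<Prod>x\<in>B. f x) \<in> R" if "\<And>x. x \<in> B \<Longrightarrow> f x \<in> R" for B :: "nat set" and f
    using that R by (induction B rule: infinite_finite_induct) (auto simp: subring_def)
  have sg: "signof p \<in> R" for p :: "nat \<Rightarrow> nat" using R by (auto simp: sign_def subring_def)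
  show ?thesis unfolding det_def'[OF c]
  proof (rule sum)
    fix p assume "p \<in> {p. p permutes {0..<n}}"
    then have "(\<Prod>i = 0..<n. Matrix.index_mat A (i, p i)) \<in> R"
      by (intro prod A) (auto simp: permutes_in_image)
    then show "signof p * (\<Prod>i = 0..<n. Matrix.index_mat A (i, p i)) \<in> R"
      using sg[of p] R by (auto simp: subring_def)
  qed
qed

lemma fun_det_adj_in_subring:
  assumes fin: "finite V" and R: "subring R" and A: "\<And>v x. v \<in> V \<Longrightarrow> x \<in> V \<Longrightarrow> A v x \<in> R"
  shows "fun_det V A \<in> R" and "v \<in> V \<Longrightarrow> x \<in> V \<Longrightarrow> fun_adj V A v x \<in> R"
proof -
  have en: "enumeration V i \<in> V" if "i < card V" for i
    using that bij_betw_enumeration[OF fin] by (auto simp: bij_betw_def)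
  have M: "Matrix.index_mat (fun_mat V A) (i,j) \<in> R" if "i < card V" "j < card V" for i j
    using that A en by (simp add: fun_mat_def)
  then show "fun_det V A \<in> R" unfolding fun_det_def by (rule det_in_subring[OF R _ fun_mat_carrier])
  assume v: "v \<in> V" and x: "x \<in> V"
  let ?i = "index_of V x" and ?j = "index_of V v"
  have i: "?i < card V" "?j < card V" using index_of[OF fin] v x by auto
  have c: "mat_delete (fun_mat V A) ?i ?j \<in> carrier_mat (card V - 1) (card V - 1)"
    by (rule mat_delete_carrier[OF fun_mat_carrier])
  have "Determinant.det (mat_delete (fun_mat V A) ?i ?j) \<in> R"
  proof (rule det_in_subring[OF R _ c])
    fix a b assume ab: "a < card V - 1" "b < card V - 1"
    have d: "dim_row (fun_mat V A) = card V" "dim_col (fun_mat V A) = card V" using fun_mat_carrier[of V A] by auto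
    have "Matrix.index_mat (mat_delete (fun_mat V A) ?i ?j) (a, b)
      = Matrix.index_mat (fun_mat V A) (if a < ?i then a else Suc a, if b < ?j then b else Suc b)"
      unfolding mat_delete_def d using ab by simp
    also have "\<dots> \<in> R" using ab by (intro M) auto
    finally show "Matrix.index_mat (mat_delete (fun_mat V A) ?i ?j) (a, b) \<in> R" .
  qed
  moreover have "(-1) ^ n \<in> R" for n using R by (induction n) (auto simp: subring_def)
  ultimately have "cofactor (fun_mat V A) ?i ?j \<in> R" using R by (auto simp: cofactor_def subring_def)
  then show "fun_adj V A v x \<in> R"
    unfolding fun_adj_def adj_mat_def using i fun_mat_carrier[of V A] by auto
qed

section \<open>Evaluation of polynomials and their action on power series\<close>

definition meval :: "(edge \<Rightarrow>\<^sub>0 nat) \<Rightarrow> (edge \<Rightarrow> real) \<Rightarrow> real" where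
  "meval d w = (\<Prod>e\<in>Poly_Mapping.keys d. w e ^ Poly_Mapping.lookup d e)"

lemma meval_superset:
  assumes "finite A" "Poly_Mapping.keys d \<subseteq> A"
  shows "meval d w = (\<Prod>e\<in>A. w e ^ Poly_Mapping.lookup d e)"
  unfolding meval_def using assms by (intro prod.mono_neutral_left) (auto simp: in_keys_iff)

lemma meval_add: "meval (d + d') w = meval d w * meval d' w"
proof -
  let ?A = "Poly_Mapping.keys d \<union> Poly_Mapping.keys d'"
  have "Poly_Mapping.keys (d + d') \<subseteq> ?A" by (rule keys_add)
  then show ?thesis
    using meval_superset[of ?A "d + d'" w] meval_superset[of ?A d w] meval_superset[of ?A d' w]
    by (simp add: lookup_add power_add prod.distrib)
qed

lemma meval_zero [simp]: "meval 0 w = 1"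
  by (simp add: meval_def)

lemma meval_single [simp]: "meval (Poly_Mapping.single e (Suc 0)) w = w e"
  by (simp add: meval_def)

lemma peval_superset:
  assumes "finite A" "Poly_Mapping.keys P \<subseteq> A"
  shows "peval P w = (\<Sum>d\<in>A. Poly_Mapping.lookup P d * meval d w)"
  unfolding peval_def meval_def[symmetric] using assms by (intro sum.mono_neutral_left) (auto simp: in_keys_iff)

lemma peval_add: "peval (P + Q) w = peval P w + peval Q w"
proof -
  let ?A = "Poly_Mapping.keys P \<union> Poly_Mapping.keys Q"
  have "Poly_Mapping.keys (P + Q) \<subseteq> ?A" by (rule keys_add)
  then show ?thesis
    using peval_superset[of ?A "P + Q" w] peval_superset[of ?A P w] peval_superset[of ?A Q w]
    by (simp add: lookup_add sum.distrib distrib_right)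
qed

lemma peval_zero [simp]: "peval 0 w = 0"
  by (simp add: peval_def)

lemma peval_single: "peval (Poly_Mapping.single d c) w = c * meval d w"
  by (simp add: peval_def meval_def[symmetric])

lemma peval_sum: "peval (\<Sum>i\<in>A. f i) w = (\<Sum>i\<in>A. peval (f i) w)"
  by (induction A rule: infinite_finite_induct) (auto simp: peval_add)

lemma poly_mapping_sum_single:
  "P = (\<Sum>d\<in>Poly_Mapping.keys P. Poly_Mapping.single d (Poly_Mapping.lookup P d))"
proof (rule poly_mapping_eqI)
  fix k
  have "Poly_Mapping.lookup (\<Sum>d\<in>Poly_Mapping.keys P. Poly_Mapping.single d (Poly_Mapping.lookup P d)) k
    = (\<Sum>d\<in>Poly_Mapping.keys P. if d = k then Poly_Mapping.lookup P d else 0)"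
    unfolding lookup_sum by (intro sum.cong refl) (simp add: lookup_single when_def)
  also have "\<dots> = Poly_Mapping.lookup P k" by (simp add: in_keys_iff)
  finally show "Poly_Mapping.lookup P k = Poly_Mapping.lookup (\<Sum>d\<in>Poly_Mapping.keys P. Poly_Mapping.single d (Poly_Mapping.lookup P d)) k" ..
qed

lemma peval_mult: "peval (P * Q) w = peval P w * peval Q w"
proof -
  have "P * Q = (\<Sum>d\<in>Poly_Mapping.keys P. Poly_Mapping.single d (Poly_Mapping.lookup P d)) *
     (\<Sum>d\<in>Poly_Mapping.keys Q. Poly_Mapping.single d (Poly_Mapping.lookup Q d))"
    using poly_mapping_sum_single[of P] poly_mapping_sum_single[of Q] by simp
  also have "\<dots> = (\<Sum>d\<in>Poly_Mapping.keys P. \<Sum>d'\<in>Poly_Mapping.keys Q.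
      Poly_Mapping.single (d + d') (Poly_Mapping.lookup P d * Poly_Mapping.lookup Q d'))"
    by (simp add: sum_product mult_single)
  finally have "peval (P * Q) w = (\<Sum>d\<in>Poly_Mapping.keys P. \<Sum>d'\<in>Poly_Mapping.keys Q.
      Poly_Mapping.lookup P d * Poly_Mapping.lookup Q d' * meval (d + d') w)"
    by (simp add: peval_sum peval_single)
  also have "\<dots> = peval P w * peval Q w"
    unfolding peval_def meval_def[symmetric] sum_product meval_add
    by (intro sum.cong refl) (simp add: mult_ac)
  finally show ?thesis .
qed

lemma peval_one [simp]: "peval 1 w = 1"
  using peval_single[of 0 1 w] by (simp add: single_one)

lemma peval_uminus: "peval (- P) w = - peval P w"
  using peval_add[of P "- P" w] by simp

lemma peval_diff: "peval (P - Q) w = peval P w - peval Q w"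
  using peval_add[of P "- Q" w] by (simp add: peval_uminus)

lemma comm_ring_hom_peval: "comm_ring_hom (\<lambda>P. peval P w)"
  by unfold_locales (simp_all add: peval_add peval_mult)

lemma subring_weight_polys: "subring (weight_polys N)"
  unfolding subring_def
proof (intro conjI ballI)
  show "0 \<in> weight_polys N" by (simp add: weight_polys_def)
  show "1 \<in> weight_polys N" by (simp add: weight_polys_def)
  fix P Q assume P: "P \<in> weight_polys N" and Q: "Q \<in> weight_polys N"
  show "P + Q \<in> weight_polys N" using P Q keys_add[of P Q] by (auto simp: weight_polys_def)
  show "- P \<in> weight_polys N" using P by (simp add: weight_polys_def)
  have "Poly_Mapping.keys d \<subseteq> edges N" if "d \<in> Poly_Mapping.keys (P * Q)" for d
  proof -
    from keys_mult[of P Q] that obtain a b where ab: "d = a + b" "a \<in> Poly_Mapping.keys P" "b \<in> Poly_Mapping.keys Q" by blast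
    then show ?thesis using P Q keys_add[of a b] unfolding weight_polys_def by blast
  qed
  then show "P * Q \<in> weight_polys N" by (simp add: weight_polys_def)
qed

text \<open>Multiplication of a formal power series by a polynomial. Series are plain functions
  without a ring structure, so this action takes its place.\<close>

definition series_act :: "((edge \<Rightarrow>\<^sub>0 nat) \<Rightarrow>\<^sub>0 real) \<Rightarrow> ((edge \<Rightarrow>\<^sub>0 nat) \<Rightarrow> real) \<Rightarrow> (edge \<Rightarrow>\<^sub>0 nat) \<Rightarrow> real" where
  "series_act Q s d = (\<Sum>(d1, d2) | d1 + d2 = d. Poly_Mapping.lookup Q d1 * s d2)"

text \<open>The first summand is bounded by \<open>d\<close> and determined by its values on the
  support of \<open>d\<close>; the second one is then determined by cancellation.\<close>

lemma finite_decompositions: "finite {(d1, d2). d1 + d2 = (d :: 'e \<Rightarrow>\<^sub>0 nat)}"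
proof -
  let ?f = "\<lambda>(d1 :: 'e \<Rightarrow>\<^sub>0 nat, d2 :: 'e \<Rightarrow>\<^sub>0 nat). restrict (Poly_Mapping.lookup d1) (Poly_Mapping.keys d)"
  let ?D = "{(d1, d2). d1 + d2 = d}"
  have "?f ` ?D \<subseteq> PiE (Poly_Mapping.keys d) (\<lambda>e. {..Poly_Mapping.lookup d e})"
    by (auto simp: lookup_add)
  then have "finite (?f ` ?D)" by (rule finite_subset) (simp add: finite_PiE)
  moreover have "inj_on ?f ?D"
  proof (rule inj_onI)
    fix x y assume "x \<in> ?D" "y \<in> ?D" and eq: "?f x = ?f y"
    then obtain d1 d2 e1 e2 where xy: "x = (d1, d2)" "y = (e1, e2)" "d1 + d2 = d" "e1 + e2 = d" by auto
    have "Poly_Mapping.lookup d1 k = Poly_Mapping.lookup e1 k" for k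
    proof (cases "k \<in> Poly_Mapping.keys d")
      case True
      then show ?thesis using fun_cong[OF eq, of k] xy(1,2) by simp
    next
      case False
      then have "Poly_Mapping.lookup d k = 0" by (simp add: in_keys_iff)
      then show ?thesis using xy(3,4) lookup_add[of d1 d2 k] lookup_add[of e1 e2 k] by simp
    qed
    then have "d1 = e1" by (simp add: poly_mapping_eqI)
    then show "x = y" using xy by (metis add_left_cancel)
  qed
  ultimately show ?thesis by (rule finite_imageD)
qed

text \<open>Multiplication by a monomial. Subtraction of exponents is truncated, hence the explicit
  test for divisibility.\<close>

definition series_shift :: "(edge \<Rightarrow>\<^sub>0 nat) \<Rightarrow> ((edge \<Rightarrow>\<^sub>0 nat) \<Rightarrow> real) \<Rightarrow> (edge \<Rightarrow>\<^sub>0 nat) \<Rightarrow> real" where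
  "series_shift k s d = (if \<exists>d'. d = k + d' then s (d - k) else 0)"

lemma series_act_add: "series_act (P + Q) s d = series_act P s d + series_act Q s d"
  unfolding series_act_def sum.distrib[symmetric]
  by (intro sum.cong refl) (auto simp: lookup_add distrib_right)

lemma series_act_zero [simp]: "series_act 0 s d = 0"
  by (simp add: series_act_def)

lemma series_act_single: "series_act (Poly_Mapping.single k c) s d = c * series_shift k s d"
proof (cases "\<exists>d'. d = k + d'")
  case True
  then obtain d' where d': "d = k + d'" by blast
  have "series_act (Poly_Mapping.single k c) s d = (\<Sum>(d1, d2)\<in>{(k, d')}. Poly_Mapping.lookup (Poly_Mapping.single k c) d1 * s d2)"
    unfolding series_act_def
    by (rule sum.mono_neutral_right[OF finite_decompositions]) (auto simp: d' lookup_single when_def split: if_splits)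
  then show ?thesis using d' by (auto simp: series_shift_def)
next
  case False
  then show ?thesis
    unfolding series_act_def series_shift_def by (auto intro!: sum.neutral simp: lookup_single when_def)
qed

lemma series_act_sum: "series_act (\<Sum>i\<in>A. f i) s d = (\<Sum>i\<in>A. series_act (f i) s d)"
  by (induction A rule: infinite_finite_induct) (auto simp: series_act_add)

lemma series_act_keys:
  "series_act P s d = (\<Sum>k\<in>Poly_Mapping.keys P. Poly_Mapping.lookup P k * series_shift k s d)"
proof -
  have "series_act P s d = series_act (\<Sum>k\<in>Poly_Mapping.keys P. Poly_Mapping.single k (Poly_Mapping.lookup P k)) s d"
    using poly_mapping_sum_single[of P] by simp
  then show ?thesis by (simp add: series_act_sum series_act_single)
qed

lemma series_shift_shift: "series_shift k (series_shift l s) = series_shift (k + l) s"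
proof
  fix d
  show "series_shift k (series_shift l s) d = series_shift (k + l) s d"
  proof (cases "\<exists>d'. d = k + l + d'")
    case True
    then obtain d' where d': "d = k + (l + d')" by (auto simp: add.assoc)
    then show ?thesis unfolding series_shift_def d' by (auto simp: add.assoc)
  next
    case False
    have "\<not> (\<exists>d''. d - k = l + d'')" if "d = k + d'" for d'
      using False that by (auto simp: add.assoc)
    then show ?thesis using False by (auto simp: series_shift_def)
  qed
qed

lemma series_shift_sum: "series_shift k (\<lambda>d. \<Sum>i\<in>A. c i * f i d) d = (\<Sum>i\<in>A. c i * series_shift k (f i) d)"
  by (simp add: series_shift_def)

text \<open>Series form a module over the polynomials, which is all that Cramer's rule
  needs.\<close>

lemma series_act_act: "series_act P (series_act Q s) = series_act (P * Q) s"
proof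
  fix d
  have PQ: "P * Q = (\<Sum>k\<in>Poly_Mapping.keys P. \<Sum>l\<in>Poly_Mapping.keys Q.
      Poly_Mapping.single (k + l) (Poly_Mapping.lookup P k * Poly_Mapping.lookup Q l))"
  proof -
    have "P * Q = (\<Sum>d\<in>Poly_Mapping.keys P. Poly_Mapping.single d (Poly_Mapping.lookup P d)) *
       (\<Sum>d\<in>Poly_Mapping.keys Q. Poly_Mapping.single d (Poly_Mapping.lookup Q d))"
      using poly_mapping_sum_single[of P] poly_mapping_sum_single[of Q] by simp
    then show ?thesis by (simp add: sum_product mult_single)
  qed
  have "series_act P (series_act Q s) d = (\<Sum>k\<in>Poly_Mapping.keys P. Poly_Mapping.lookup P k *
     series_shift k (\<lambda>d. \<Sum>l\<in>Poly_Mapping.keys Q. Poly_Mapping.lookup Q l * series_shift l s d) d)"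
    unfolding series_act_keys[of P] series_act_keys[of Q, abs_def] ..
  also have "\<dots> = (\<Sum>k\<in>Poly_Mapping.keys P. \<Sum>l\<in>Poly_Mapping.keys Q.
      Poly_Mapping.lookup P k * Poly_Mapping.lookup Q l * series_shift (k + l) s d)"
    unfolding series_shift_sum series_shift_shift sum_distrib_left by (simp only: mult.assoc)
  also have "\<dots> = series_act (P * Q) s d"
    unfolding PQ series_act_sum series_act_single ..
  finally show "series_act P (series_act Q s) d = series_act (P * Q) s d" .
qed

lemma series_act_sum_right: "series_act P (\<lambda>d. \<Sum>i\<in>A. f i d) d = (\<Sum>i\<in>A. series_act P (f i) d)"
  unfolding series_act_def by (subst sum.swap, intro sum.cong refl) (simp add: sum_distrib_left split_def)

lemma series_act_diff_left: "series_act (P - Q) s d = series_act P s d - series_act Q s d"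
  using series_act_add[of "P - Q" Q s d] by simp

lemma series_act_cmult: "series_act P (\<lambda>d. c * s d) d = c * series_act P s d"
  unfolding series_act_def sum_distrib_left by (intro sum.cong refl) auto

lemma series_act_one [simp]: "series_act 1 s = s"
proof
  show "series_act 1 s d = s d" for d
    unfolding single_one[symmetric] series_act_single by (simp add: series_shift_def)
qed

lemma series_act_lookup_one: "series_act P (Poly_Mapping.lookup 1) = Poly_Mapping.lookup P"
proof
  fix d
  have "series_shift k (Poly_Mapping.lookup 1) d = (if k = d then 1 else 0)" for k
    by (auto simp: series_shift_def lookup_one when_def)
  then have "series_act P (Poly_Mapping.lookup 1) d = (\<Sum>k\<in>Poly_Mapping.keys P. if k = d then Poly_Mapping.lookup P k else 0)"
    unfolding series_act_keys by (intro sum.cong refl) simp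
  also have "\<dots> = Poly_Mapping.lookup P d" by (simp add: in_keys_iff)
  finally show "series_act P (Poly_Mapping.lookup 1) d = Poly_Mapping.lookup P d" .
qed

lemma bm_represents_iff:
  "bm_represents N i j P Q \<longleftrightarrow> P \<in> weight_polys N \<and> Q \<in> weight_polys N \<and> Q \<noteq> 0 \<and>
     series_act Q (bm_series N i j) = Poly_Mapping.lookup P"
  unfolding bm_represents_def series_act_def fun_eq_iff ..

text \<open>Both sides arise when the product of the two denominators acts on the same series. Hence
  the value \<open>bm\<close> does not depend on the fraction that represents the series.\<close>

lemma bm_represents_cross:
  assumes "bm_represents N i j P Q" "bm_represents N i j P' Q'"
  shows "P * Q' = P' * Q"
proof -
  have "Poly_Mapping.lookup (Q' * P) = series_act Q' (series_act Q (bm_series N i j))"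
    using assms(1) by (metis bm_represents_iff series_act_act series_act_lookup_one)
  also have "\<dots> = series_act Q (series_act Q' (bm_series N i j))"
    by (simp add: series_act_act mult.commute)
  also have "\<dots> = Poly_Mapping.lookup (Q * P')"
    using assms(2) by (metis bm_represents_iff series_act_act series_act_lookup_one)
  finally show ?thesis by (metis mult.commute lookup_inject)
qed

lemma bm_eq:
  assumes "bm_represents N i j P Q" "peval Q w \<noteq> 0"
  shows "bm N i j w = peval P w / peval Q w"
  unfolding bm_def
proof (rule the_equality)
  show "\<exists>P' Q'. bm_represents N i j P' Q' \<and> peval Q' w \<noteq> 0 \<and> peval P w / peval Q w = peval P' w / peval Q' w"
    using assms by blast
  fix r assume "\<exists>P' Q'. bm_represents N i j P' Q' \<and> peval Q' w \<noteq> 0 \<and> r = peval P' w / peval Q' w"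
  then obtain P' Q' where *: "bm_represents N i j P' Q'" "peval Q' w \<noteq> 0" "r = peval P' w / peval Q' w" by blast
  have "peval P w * peval Q' w = peval P' w * peval Q w"
    using bm_represents_cross[OF assms(1) *(1)] by (metis peval_mult)
  then show "r = peval P w / peval Q w" unfolding *(3) using assms(2) *(2) by (simp add: frac_eq_eq)
qed

section \<open>Signed path series\<close>

definition vertex_paths :: "network \<Rightarrow> complex \<Rightarrow> complex \<Rightarrow> complex list set" where
  "vertex_paths N v y = {vs. vs \<noteq> [] \<and> hd vs = v \<and> last vs = y \<and> successively (\<lambda>u v. (u, v) \<in> edges N) vs}"

definition signed_weight :: "(edge \<Rightarrow> real) \<Rightarrow> complex list \<Rightarrow> real" where
  "signed_weight \<sigma> vs = prod_list (map \<sigma> (path_edges vs))"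

definition path_series :: "network \<Rightarrow> (edge \<Rightarrow> real) \<Rightarrow> complex \<Rightarrow> complex \<Rightarrow> (edge \<Rightarrow>\<^sub>0 nat) \<Rightarrow> real" where
  "path_series N \<sigma> v y d = (\<Sum>vs | vs \<in> vertex_paths N v y \<and> path_monom vs = d. signed_weight \<sigma> vs)"

lemma path_edges_Cons: "ws \<noteq> [] \<Longrightarrow> path_edges (v # ws) = (v, hd ws) # path_edges ws"
  by (cases ws) (auto simp: path_edges_def)

lemma path_monom_Cons: "ws \<noteq> [] \<Longrightarrow> path_monom (v # ws) = Poly_Mapping.single (v, hd ws) 1 + path_monom ws"
  by (simp add: path_monom_def path_edges_Cons)

lemma path_single [simp]: "path_monom [v] = 0" "signed_weight \<sigma> [v] = 1"
  by (simp_all add: path_monom_def signed_weight_def path_edges_def)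

lemma signed_weight_Cons: "ws \<noteq> [] \<Longrightarrow> signed_weight \<sigma> (v # ws) = \<sigma> (v, hd ws) * signed_weight \<sigma> ws"
  by (simp add: signed_weight_def path_edges_Cons)

section \<open>Path series as entries of an inverse matrix\<close>

locale finite_net =
  fixes N :: network
  assumes finite_verts: "finite (verts N)" and edges_subset: "edges N \<subseteq> verts N \<times> verts N"
begin

lemma finite_edges: "finite (edges N)"
  using finite_verts edges_subset by (meson finite_SigmaI finite_subset)

text \<open>The monomial of a path determines its length through the total degree, so only finitely
  many paths share a monomial and the coefficients of the series are finite sums.\<close>

lemma vertex_path_length:
  "successively (\<lambda>u v. (u, v) \<in> edges N) vs \<Longrightarrow> vs \<noteq> [] \<Longrightarrow>
    length vs = Suc (\<Sum>e\<in>edges N. Poly_Mapping.lookup (path_monom vs) e)"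
proof (induction vs)
  case (Cons v ws)
  show ?case
  proof (cases "ws = []")
    case False
    then have e: "(v, hd ws) \<in> edges N" and s: "successively (\<lambda>u v. (u, v) \<in> edges N) ws"
      using Cons.prems by (auto simp: successively_Cons)
    have "(\<Sum>e\<in>edges N. Poly_Mapping.lookup (Poly_Mapping.single (v, hd ws) (1::nat)) e) = (\<Sum>e\<in>edges N. if (v, hd ws) = e then 1 else 0)"
      by (intro sum.cong refl) (simp add: lookup_single when_def)
    also have "\<dots> = 1" using e finite_edges by simp
    finally show ?thesis using Cons.IH[OF s False] False by (simp add: path_monom_Cons lookup_add sum.distrib)
  qed simp
qed simp

lemma vertex_path_verts:
  "successively (\<lambda>u v. (u, v) \<in> edges N) vs \<Longrightarrow> vs \<noteq> [] \<Longrightarrow> hd vs \<in> verts N \<Longrightarrow> set vs \<subseteq> verts N"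
proof (induction vs)
  case (Cons v ws)
  then show ?case using edges_subset by (cases "ws = []") (auto simp: successively_Cons)
qed simp

lemma finite_paths_monom:
  assumes "v \<in> verts N"
  shows "finite {vs. vs \<in> vertex_paths N v y \<and> path_monom vs = d}"
proof (rule finite_subset)
  show "{vs. vs \<in> vertex_paths N v y \<and> path_monom vs = d} \<subseteq>
    {vs. set vs \<subseteq> verts N \<and> length vs \<le> Suc (\<Sum>e\<in>edges N. Poly_Mapping.lookup d e)}"
    using vertex_path_length vertex_path_verts assms by (fastforce simp: vertex_paths_def)
qed (rule finite_lists_length_le[OF finite_verts])

definition edge_poly :: "(edge \<Rightarrow> real) \<Rightarrow> complex \<Rightarrow> complex \<Rightarrow> (edge \<Rightarrow>\<^sub>0 nat) \<Rightarrow>\<^sub>0 real" where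
  "edge_poly \<sigma> v x = (if (v, x) \<in> edges N then Poly_Mapping.single (Poly_Mapping.single (v, x) 1) (\<sigma> (v, x)) else 0)"

lemma path_series_step:
  assumes "(v, x) \<in> edges N"
  shows "(\<Sum>vs | vs \<in> (#) v ` vertex_paths N x y \<and> path_monom vs = d. signed_weight \<sigma> vs)
    = series_act (edge_poly \<sigma> v x) (path_series N \<sigma> x y) d"
proof (cases "\<exists>d'. d = Poly_Mapping.single (v, x) 1 + d'")
  case True
  then obtain d' where d': "d = Poly_Mapping.single (v, x) 1 + d'" by blast
  have "{vs. vs \<in> (#) v ` vertex_paths N x y \<and> path_monom vs = d} = (#) v ` {ws. ws \<in> vertex_paths N x y \<and> path_monom ws = d'}"
    by (auto simp: vertex_paths_def path_monom_Cons d')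
  then have "(\<Sum>vs | vs \<in> (#) v ` vertex_paths N x y \<and> path_monom vs = d. signed_weight \<sigma> vs)
    = (\<Sum>ws | ws \<in> vertex_paths N x y \<and> path_monom ws = d'. signed_weight \<sigma> (v # ws))"
    by (simp add: sum.reindex)
  also have "\<dots> = (\<Sum>ws | ws \<in> vertex_paths N x y \<and> path_monom ws = d'. \<sigma> (v, x) * signed_weight \<sigma> ws)"
    by (intro sum.cong refl) (auto simp: vertex_paths_def signed_weight_Cons)
  finally show ?thesis
    using assms True d' by (simp add: edge_poly_def series_act_single series_shift_def path_series_def sum_distrib_left)
next
  case False
  then have "{vs. vs \<in> (#) v ` vertex_paths N x y \<and> path_monom vs = d} = {}"
    by (auto simp: vertex_paths_def path_monom_Cons)
  moreover have "series_shift (Poly_Mapping.single (v, x) 1) (path_series N \<sigma> x y) d = 0"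
    using False by (simp add: series_shift_def)
  ultimately show ?thesis
    using assms by (simp only: sum.empty edge_poly_def series_act_single if_True mult_zero_right)
qed

text \<open>A path is trivial or consists of a first edge and a shorter path. As an identity of
  matrices this reads \<open>U = 1 + A U\<close>.\<close>

lemma path_series_rec:
  assumes v: "v \<in> verts N"
  shows "path_series N \<sigma> v y d = (if v = y then Poly_Mapping.lookup 1 d else 0)
    + (\<Sum>x\<in>verts N. series_act (edge_poly \<sigma> v x) (path_series N \<sigma> x y) d)"
proof -
  define X where "X = {x \<in> verts N. (v, x) \<in> edges N}"
  define S0 where "S0 = {vs. vs = [v] \<and> v = y \<and> d = 0}"
  define S where "S x = {vs. vs \<in> (#) v ` vertex_paths N x y \<and> path_monom vs = d}" for x
  have eq: "{vs. vs \<in> vertex_paths N v y \<and> path_monom vs = d} = S0 \<union> (\<Union>x\<in>X. S x)" (is "?L = ?R")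
  proof (rule Set.set_eqI, rule iffI)
    fix vs assume vs: "vs \<in> ?L"
    then obtain ws where ws: "vs = v # ws" by (cases vs) (auto simp: vertex_paths_def)
    show "vs \<in> ?R"
    proof (cases "ws = []")
      case True
      then show ?thesis using vs ws by (auto simp: vertex_paths_def S0_def)
    next
      case False
      then have "hd ws \<in> X" "ws \<in> vertex_paths N (hd ws) y"
        using vs ws edges_subset by (auto simp: vertex_paths_def successively_Cons X_def)
      then show ?thesis using vs ws unfolding S_def by blast
    qed
  next
    fix vs assume "vs \<in> ?R"
    then show "vs \<in> ?L" by (auto simp: vertex_paths_def successively_Cons X_def S_def S0_def)
  qed
  have fin: "finite ?L" by (rule finite_paths_monom[OF v])
  have finX: "finite X" using finite_verts by (simp add: X_def)
  have "path_series N \<sigma> v y d = (\<Sum>vs\<in>S0. signed_weight \<sigma> vs) + (\<Sum>vs\<in>(\<Union>x\<in>X. S x). signed_weight \<sigma> vs)"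
    unfolding path_series_def eq
  proof (rule sum.union_disjoint)
    show "finite (\<Union>x\<in>X. S x)" using fin unfolding eq by (rule finite_subset[rotated]) blast
    show "S0 \<inter> (\<Union>x\<in>X. S x) = {}" by (auto simp: vertex_paths_def S_def S0_def)
  qed (simp add: S0_def)
  also have "(\<Sum>vs\<in>S0. signed_weight \<sigma> vs) = (if v = y then Poly_Mapping.lookup 1 d else 0)"
    by (auto simp: lookup_one when_def S0_def)
  also have "(\<Sum>vs\<in>(\<Union>x\<in>X. S x). signed_weight \<sigma> vs) = (\<Sum>x\<in>X. \<Sum>vs\<in>S x. signed_weight \<sigma> vs)"
  proof (rule sum.UNION_disjoint[OF finX])
    show "\<forall>x\<in>X. finite (S x)"
    proof
      fix x assume "x \<in> X"
      then have "S x \<subseteq> ?L" unfolding eq by blast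
      then show "finite (S x)" using fin by (rule finite_subset)
    qed
    show "\<forall>x\<in>X. \<forall>x'\<in>X. x \<noteq> x' \<longrightarrow> S x \<inter> S x' = {}" by (auto simp: vertex_paths_def S_def S0_def)
  qed
  also have "\<dots> = (\<Sum>x\<in>X. series_act (edge_poly \<sigma> v x) (path_series N \<sigma> x y) d)"
    unfolding S_def by (intro sum.cong refl path_series_step) (simp add: X_def)
  also have "\<dots> = (\<Sum>x\<in>verts N. series_act (edge_poly \<sigma> v x) (path_series N \<sigma> x y) d)"
    by (rule sum.mono_neutral_left) (auto simp: finite_verts edge_poly_def X_def)
  finally show ?thesis .
qed

definition transfer_poly :: "(edge \<Rightarrow> real) \<Rightarrow> complex \<Rightarrow> complex \<Rightarrow> (edge \<Rightarrow>\<^sub>0 nat) \<Rightarrow>\<^sub>0 real" where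
  "transfer_poly \<sigma> v x = (if v = x then 1 else 0) - edge_poly \<sigma> v x"

definition net_det :: "(edge \<Rightarrow> real) \<Rightarrow> (edge \<Rightarrow>\<^sub>0 nat) \<Rightarrow>\<^sub>0 real" where
  "net_det \<sigma> = fun_det (verts N) (transfer_poly \<sigma>)"

definition net_adj :: "(edge \<Rightarrow> real) \<Rightarrow> complex \<Rightarrow> complex \<Rightarrow> (edge \<Rightarrow>\<^sub>0 nat) \<Rightarrow>\<^sub>0 real" where
  "net_adj \<sigma> = fun_adj (verts N) (transfer_poly \<sigma>)"

lemma transfer_poly_path_series:
  assumes "v \<in> verts N"
  shows "(\<Sum>x\<in>verts N. series_act (transfer_poly \<sigma> v x) (path_series N \<sigma> x y) d) = (if v = y then Poly_Mapping.lookup 1 d else 0)"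
proof -
  have "(\<Sum>x\<in>verts N. series_act (if v = x then 1 else 0) (path_series N \<sigma> x y) d)
    = (\<Sum>x\<in>verts N. if v = x then path_series N \<sigma> x y d else 0)"
    by (intro sum.cong refl) simp
  also have "\<dots> = path_series N \<sigma> v y d" using assms finite_verts by simp
  finally show ?thesis
    unfolding transfer_poly_def series_act_diff_left sum_subtractf using path_series_rec[OF assms, of \<sigma> y d] by simp
qed

text \<open>Cramer's rule: the system \<open>(1 - A) U = 1\<close> is multiplied from the left by
  the adjugate of \<open>1 - A\<close>.\<close>

lemma net_det_path_series:
  assumes v: "v \<in> verts N" and y: "y \<in> verts N"
  shows "series_act (net_det \<sigma>) (path_series N \<sigma> v y) = Poly_Mapping.lookup (net_adj \<sigma> v y)"
proof
  fix d
  let ?V = "verts N" and ?u = "\<lambda>x. path_series N \<sigma> x y"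
  have "series_act (net_det \<sigma>) (?u v) d = (\<Sum>x\<in>?V. series_act (if v = x then net_det \<sigma> else 0) (?u x) d)"
  proof -
    have "(\<Sum>x\<in>?V. series_act (if v = x then net_det \<sigma> else 0) (?u x) d) = (\<Sum>x\<in>?V. if v = x then series_act (net_det \<sigma>) (?u x) d else 0)"
      by (intro sum.cong refl) simp
    then show ?thesis using v finite_verts by simp
  qed
  also have "\<dots> = (\<Sum>x\<in>?V. series_act (\<Sum>z\<in>?V. net_adj \<sigma> v z * transfer_poly \<sigma> z x) (?u x) d)"
    by (intro sum.cong refl) (simp add: net_adj_def net_det_def fun_adj_left[OF finite_verts v])
  also have "\<dots> = (\<Sum>z\<in>?V. \<Sum>x\<in>?V. series_act (net_adj \<sigma> v z) (series_act (transfer_poly \<sigma> z x) (?u x)) d)"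
    unfolding series_act_sum series_act_act by (rule sum.swap)
  also have "\<dots> = (\<Sum>z\<in>?V. series_act (net_adj \<sigma> v z) (\<lambda>d. \<Sum>x\<in>?V. series_act (transfer_poly \<sigma> z x) (?u x) d) d)"
    unfolding series_act_sum_right ..
  also have "\<dots> = (\<Sum>z\<in>?V. if z = y then Poly_Mapping.lookup (net_adj \<sigma> v z) d else 0)"
  proof (intro sum.cong refl)
    fix z assume "z \<in> ?V"
    then have "(\<lambda>d. \<Sum>x\<in>?V. series_act (transfer_poly \<sigma> z x) (?u x) d) = (\<lambda>d. if z = y then Poly_Mapping.lookup 1 d else 0)"
      using transfer_poly_path_series by blast
    moreover have "series_act P (\<lambda>d. 0) d = 0" for P by (simp add: series_act_def)
    ultimately show "series_act (net_adj \<sigma> v z) (\<lambda>d. \<Sum>x\<in>?V. series_act (transfer_poly \<sigma> z x) (?u x) d) d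
      = (if z = y then Poly_Mapping.lookup (net_adj \<sigma> v z) d else 0)"
      by (auto simp: series_act_lookup_one)
  qed
  also have "\<dots> = Poly_Mapping.lookup (net_adj \<sigma> v y) d" using y finite_verts by simp
  finally show "series_act (net_det \<sigma>) (?u v) d = Poly_Mapping.lookup (net_adj \<sigma> v y) d" .
qed

lemma transfer_poly_in: "transfer_poly \<sigma> v x \<in> weight_polys N"
proof -
  have "edge_poly \<sigma> v x \<in> weight_polys N" by (auto simp: edge_poly_def weight_polys_def)
  moreover have "(if v = x then 1 else 0) \<in> weight_polys N" by (simp add: weight_polys_def)
  ultimately show ?thesis
    using subring_weight_polys[of N] unfolding subring_def transfer_poly_def diff_conv_add_uminus by blast
qed

definition net_matrix :: "(edge \<Rightarrow> real) \<Rightarrow> (edge \<Rightarrow> real) \<Rightarrow> complex \<Rightarrow> complex \<Rightarrow> real" where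
  "net_matrix \<sigma> w v x = (if (v, x) \<in> edges N then \<sigma> (v, x) * w (v, x) else 0)"

text \<open>The entry of the inverse of \<open>1 - net_matrix\<close> in the form given by Cramer's
  rule, meaningful where the determinant is nonzero.\<close>

definition net_green :: "(edge \<Rightarrow> real) \<Rightarrow> (edge \<Rightarrow> real) \<Rightarrow> complex \<Rightarrow> complex \<Rightarrow> real" where
  "net_green \<sigma> w v x = peval (net_adj \<sigma> v x) w / peval (net_det \<sigma>) w"

lemma peval_transfer_poly: "peval (transfer_poly \<sigma> v x) w = (if v = x then 1 else 0) - net_matrix \<sigma> w v x"
  by (simp add: transfer_poly_def peval_diff edge_poly_def net_matrix_def peval_single)

lemma net_det_eval: "peval (net_det \<sigma>) w = fun_det (verts N) (\<lambda>v x. (if v = x then 1 else 0) - net_matrix \<sigma> w v x)"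
  unfolding net_det_def using fun_det_hom[OF comm_ring_hom_peval[of w], of "verts N" "transfer_poly \<sigma>"]
  by (simp add: peval_transfer_poly)

lemma net_det_nonzero_eval:
  assumes "\<And>g v. (\<And>v. v \<in> verts N \<Longrightarrow> g v = (\<Sum>x\<in>verts N. net_matrix \<sigma> w v x * g x)) \<Longrightarrow> v \<in> verts N \<Longrightarrow> g v = 0"
  shows "peval (net_det \<sigma>) w \<noteq> 0"
  unfolding net_det_eval
proof (rule fun_det_nonzero[OF finite_verts])
  fix g v assume *: "\<And>v. v \<in> verts N \<Longrightarrow> (\<Sum>x\<in>verts N. ((if v = x then 1 else 0) - net_matrix \<sigma> w v x) * g x) = 0"
    and v: "v \<in> verts N"
  have "g v = (\<Sum>x\<in>verts N. net_matrix \<sigma> w v x * g x)" if "v \<in> verts N" for v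
  proof -
    have "(\<Sum>x\<in>verts N. ((if v = x then 1 else 0) - net_matrix \<sigma> w v x) * g x)
      = (\<Sum>x\<in>verts N. (if v = x then g x else 0) - net_matrix \<sigma> w v x * g x)"
      by (intro sum.cong refl) (simp add: left_diff_distrib)
    also have "\<dots> = g v - (\<Sum>x\<in>verts N. net_matrix \<sigma> w v x * g x)"
      using that finite_verts by (simp add: sum_subtractf)
    finally show ?thesis using *[OF that] by simp
  qed
  then show "g v = 0" using assms v by blast
qed

text \<open>At zero weights the matrix \<open>1 - A\<close> is the identity. Thus the determinant is
  a nonzero polynomial, even after restriction to any ray from the origin.\<close>

lemma net_det_at_zero: "peval (net_det \<sigma>) (\<lambda>e. 0) \<noteq> 0"
proof (rule net_det_nonzero_eval)
  fix g v assume *: "\<And>v. v \<in> verts N \<Longrightarrow> g v = (\<Sum>x\<in>verts N. net_matrix \<sigma> (\<lambda>e. 0) v x * g x)" and v: "v \<in> verts N"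
  have "net_matrix \<sigma> (\<lambda>e. 0) v x = 0" for x by (simp add: net_matrix_def)
  then show "g v = 0" using *[OF v] by simp
qed

lemma net_det_neq_0: "net_det \<sigma> \<noteq> 0"
  using net_det_at_zero[of \<sigma>] by auto

lemma net_green_left:
  assumes D: "peval (net_det \<sigma>) w \<noteq> 0" and v: "v \<in> verts N" and y: "y \<in> verts N"
  shows "net_green \<sigma> w v y = (if v = y then 1 else 0) + (\<Sum>x\<in>verts N. net_matrix \<sigma> w v x * net_green \<sigma> w x y)"
proof -
  have "(\<Sum>x\<in>verts N. peval (transfer_poly \<sigma> v x) w * peval (net_adj \<sigma> x y) w) = (if v = y then peval (net_det \<sigma>) w else 0)"
    using arg_cong[OF fun_adj_right[OF finite_verts v y, of "transfer_poly \<sigma>"], of "\<lambda>P. peval P w"]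
    by (simp add: peval_sum peval_mult net_adj_def net_det_def if_distrib cong: if_cong)
  moreover have "(\<Sum>x\<in>verts N. peval (transfer_poly \<sigma> v x) w * peval (net_adj \<sigma> x y) w)
    = (\<Sum>x\<in>verts N. (if v = x then peval (net_adj \<sigma> x y) w else 0) - net_matrix \<sigma> w v x * peval (net_adj \<sigma> x y) w)"
    by (intro sum.cong refl) (simp add: peval_transfer_poly left_diff_distrib)
  moreover have "\<dots> = peval (net_adj \<sigma> v y) w - (\<Sum>x\<in>verts N. net_matrix \<sigma> w v x * peval (net_adj \<sigma> x y) w)"
    using v finite_verts by (simp add: sum_subtractf)
  ultimately have "peval (net_adj \<sigma> v y) w = (if v = y then peval (net_det \<sigma>) w else 0) + (\<Sum>x\<in>verts N. net_matrix \<sigma> w v x * peval (net_adj \<sigma> x y) w)"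
    by simp
  then show ?thesis using D by (simp add: net_green_def add_divide_distrib sum_divide_distrib)
qed

lemma net_green_right:
  assumes D: "peval (net_det \<sigma>) w \<noteq> 0" and v: "v \<in> verts N" and y: "y \<in> verts N"
  shows "net_green \<sigma> w v y = (if v = y then 1 else 0) + (\<Sum>x\<in>verts N. net_green \<sigma> w v x * net_matrix \<sigma> w x y)"
proof -
  have "(\<Sum>x\<in>verts N. peval (net_adj \<sigma> v x) w * peval (transfer_poly \<sigma> x y) w) = (if v = y then peval (net_det \<sigma>) w else 0)"
    using arg_cong[OF fun_adj_left[OF finite_verts v y, of "transfer_poly \<sigma>"], of "\<lambda>P. peval P w"]
    by (simp add: peval_sum peval_mult net_adj_def net_det_def if_distrib cong: if_cong)
  moreover have "(\<Sum>x\<in>verts N. peval (net_adj \<sigma> v x) w * peval (transfer_poly \<sigma> x y) w)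
    = (\<Sum>x\<in>verts N. (if x = y then peval (net_adj \<sigma> v x) w else 0) - peval (net_adj \<sigma> v x) w * net_matrix \<sigma> w x y)"
    by (intro sum.cong refl) (simp add: peval_transfer_poly right_diff_distrib)
  moreover have "\<dots> = peval (net_adj \<sigma> v y) w - (\<Sum>x\<in>verts N. peval (net_adj \<sigma> v x) w * net_matrix \<sigma> w x y)"
    using y finite_verts by (simp add: sum_subtractf)
  ultimately have "peval (net_adj \<sigma> v y) w = (if v = y then peval (net_det \<sigma>) w else 0) + (\<Sum>x\<in>verts N. peval (net_adj \<sigma> v x) w * net_matrix \<sigma> w x y)"
    by simp
  then show ?thesis using D by (simp add: net_green_def add_divide_distrib sum_divide_distrib)
qed

text \<open>Path signs have to be multiplicative along edges only up to a factor that depends on the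
  two ends. The denominator is the same for all pairs of ends.\<close>

lemma bm_represents_signed:
  assumes sign: "\<And>vs. vs \<in> net_paths N i j \<Longrightarrow> path_sign N i j vs = c * signed_weight \<sigma> vs"
    and i: "bpt N i \<in> verts N" and j: "bpt N j \<in> verts N"
  shows "bm_represents N i j (Poly_Mapping.single 0 c * net_adj \<sigma> (bpt N i) (bpt N j)) (net_det \<sigma>)"
  unfolding bm_represents_iff
proof (intro conjI)
  note R = subring_weight_polys[of N] and fda = fun_det_adj_in_subring[OF finite_verts subring_weight_polys[of N] transfer_poly_in]
  have "Poly_Mapping.single 0 c \<in> weight_polys N" by (simp add: weight_polys_def)
  moreover have "net_adj \<sigma> (bpt N i) (bpt N j) \<in> weight_polys N" unfolding net_adj_def by (rule fda(2)[OF i j])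
  ultimately show "Poly_Mapping.single 0 c * net_adj \<sigma> (bpt N i) (bpt N j) \<in> weight_polys N"
    using R by (simp add: subring_def)
  show "net_det \<sigma> \<in> weight_polys N" unfolding net_det_def by (rule fda(1))
  show "net_det \<sigma> \<noteq> 0" by (rule net_det_neq_0)
  have "bm_series N i j = (\<lambda>d. c * path_series N \<sigma> (bpt N i) (bpt N j) d)"
  proof
    fix d
    have np: "net_paths N i j = vertex_paths N (bpt N i) (bpt N j)" by (simp add: net_paths_def vertex_paths_def)
    show "bm_series N i j d = c * path_series N \<sigma> (bpt N i) (bpt N j) d"
      unfolding bm_series_def path_series_def sum_distrib_left using sign by (intro sum.cong) (auto simp: np)
  qed
  moreover have "Poly_Mapping.lookup (Poly_Mapping.single 0 c * Q) d = c * Poly_Mapping.lookup Q d" for Q :: "(edge \<Rightarrow>\<^sub>0 nat) \<Rightarrow>\<^sub>0 real" and d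
  proof -
    have "series_act (Poly_Mapping.single 0 c) (Poly_Mapping.lookup Q) d = c * Poly_Mapping.lookup Q d"
      unfolding series_act_single by (simp add: series_shift_def)
    then show ?thesis by (metis series_act_act series_act_lookup_one)
  qed
  ultimately show "series_act (net_det \<sigma>) (bm_series N i j) = Poly_Mapping.lookup (Poly_Mapping.single 0 c * net_adj \<sigma> (bpt N i) (bpt N j))"
    by (intro ext) (simp only: series_act_cmult net_det_path_series[OF i j])
qed

lemma bm_green:
  assumes "\<And>vs. vs \<in> net_paths N i j \<Longrightarrow> path_sign N i j vs = c * signed_weight \<sigma> vs"
    and "bpt N i \<in> verts N" "bpt N j \<in> verts N" and "peval (net_det \<sigma>) w \<noteq> 0"
  shows "bm N i j w = c * net_green \<sigma> w (bpt N i) (bpt N j)"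
  using bm_eq[OF bm_represents_signed[OF assms(1-3)] assms(4)]
  by (simp add: net_green_def peval_mult peval_single)

end

section \<open>Concordance numbers and turning\<close>

text \<open>The two sides of the equation differ by 0 or by plus or minus \<open>2 * pi\<close>; the
  value -1 records that the turn from \<open>u\<close> to \<open>v\<close> passes the cut of
  \<open>Arg\<close>. The line in the definition of \<open>concordance\<close> is chosen in
  dependence on the whole curve, so signs of single edges can only be defined with respect to a
  fixed cut like this one.\<close>

definition turn :: "complex \<Rightarrow> complex \<Rightarrow> real" where
  "turn u v = (if Arg u + Arg (v / u) = Arg v then 1 else - 1)"

text \<open>The same with the cut in the direction \<open>d\<close> of the auxiliary line, for the
  comparison with the cones.\<close>

definition turn_at :: "complex \<Rightarrow> complex \<Rightarrow> complex \<Rightarrow> real" where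
  "turn_at d u v = (if Arg2pi (u / d) + Arg (v / u) = Arg2pi (v / d) then 1 else - 1)"

text \<open>Such an angle is 0 or plus or minus \<open>2 * pi\<close>. Halving it turns an additive
  count of rounds into a multiplicative sign.\<close>

lemma cis_half:
  assumes "cis \<theta> = 1" "\<bar>\<theta>\<bar> < 4 * pi"
  shows "cis (\<theta> / 2) = of_real (if \<theta> = 0 then 1 else - 1)"
proof -
  from assms(1) have "cos \<theta> = 1" by (simp add: complex_eq_iff)
  then obtain k :: int where k: "\<theta> = of_int k * 2 * pi" using cos_one_2pi_int by blast
  have "\<bar>real_of_int k\<bar> * (2 * pi) < 2 * (2 * pi)" using assms(2) unfolding k by (simp add: abs_mult)
  then have "\<bar>real_of_int k\<bar> < 2" by (rule mult_right_less_imp_less) simp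
  then have "k = -1 \<or> k = 0 \<or> k = 1" by linarith
  then show ?thesis unfolding k by (auto simp: complex_eq_iff)
qed

lemma cis_Arg2pi: "z \<noteq> 0 \<Longrightarrow> cis (Arg2pi z) = z / of_real (norm z)"
  using Arg2pi_eq[of z] by (simp add: cis_conv_exp field_simps)

lemma turn_cis:
  assumes "u \<noteq> 0" "v \<noteq> 0"
  shows "of_real (turn u v) = cis ((Arg u + Arg (v / u) - Arg v) / 2)"
proof -
  have "cis (Arg u + Arg (v / u) - Arg v) = 1"
    using assms by (simp add: cis_mult[symmetric] cis_divide[symmetric] cis_Arg sgn_eq norm_divide)
  moreover have "\<bar>Arg u + Arg (v / u) - Arg v\<bar> < 4 * pi"
    using Arg_bounded[of u] Arg_bounded[of v] Arg_bounded[of "v / u"] pi_gt_zero by (auto simp: abs_less_iff)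
  ultimately show ?thesis unfolding turn_def by (subst cis_half) auto
qed

lemma turn_at_cis:
  assumes "u \<noteq> 0" "v \<noteq> 0" "d \<noteq> 0"
  shows "of_real (turn_at d u v) = cis ((Arg2pi (u / d) + Arg (v / u) - Arg2pi (v / d)) / 2)"
proof -
  have "cis (Arg2pi (u / d) + Arg (v / u) - Arg2pi (v / d)) = 1"
    using assms by (simp add: cis_mult[symmetric] cis_divide[symmetric] cis_Arg cis_Arg2pi sgn_eq norm_divide)
  moreover have "\<bar>Arg2pi (u / d) + Arg (v / u) - Arg2pi (v / d)\<bar> < 4 * pi"
    using Arg2pi_ge_0[of "u / d"] Arg2pi_lt_2pi[of "u / d"] Arg2pi_ge_0[of "v / d"] Arg2pi_lt_2pi[of "v / d"] Arg_bounded[of "v / u"] pi_gt_zero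
    unfolding abs_less_iff by linarith
  ultimately show ?thesis unfolding turn_at_def by (subst cis_half) auto
qed

text \<open>The product of all turns of a closed curve is \<open>- 1\<close> to the power of its total turning number,
  whatever the reference direction is.\<close>

lemma turn_product_closed:
  fixes u :: "nat \<Rightarrow> complex"
  assumes u: "\<And>t. t \<le> L \<Longrightarrow> u t \<noteq> 0" and closed: "u L = u 0" and d: "d \<noteq> 0"
  shows "(\<Prod>t<L. turn_at d (u t) (u (Suc t))) = (\<Prod>t<L. turn (u t) (u (Suc t)))"
proof -
  have cis_prod: "(\<Prod>t<L. cis (f t)) = cis (\<Sum>t<L. f t)" for f :: "nat \<Rightarrow> real"
    by (induction L) (simp_all add: cis_mult)
  have tel: "(\<Sum>t<L. (a t + r t - a (Suc t)) / 2) = (\<Sum>t<L. r t) / 2" if "a L = a 0" for a r :: "nat \<Rightarrow> real"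
  proof -
    have "(\<Sum>t<L. a t - a (Suc t)) = 0" using sum_lessThan_telescope'[of a L] that by simp
    moreover have "(\<Sum>t<L. (a t + r t - a (Suc t)) / 2) = ((\<Sum>t<L. a t - a (Suc t)) + (\<Sum>t<L. r t)) / 2"
      unfolding sum.distrib[symmetric] sum_divide_distrib by (intro sum.cong refl) simp
    ultimately show ?thesis by simp
  qed
  have "of_real (\<Prod>t<L. turn_at d (u t) (u (Suc t))) = cis ((\<Sum>t<L. Arg (u (Suc t) / u t)) / 2)"
  proof -
    have "of_real (\<Prod>t<L. turn_at d (u t) (u (Suc t))) = (\<Prod>t<L. cis ((Arg2pi (u t / d) + Arg (u (Suc t) / u t) - Arg2pi (u (Suc t) / d)) / 2))"
      unfolding of_real_prod by (intro prod.cong refl turn_at_cis u d) auto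
    then show ?thesis unfolding cis_prod using tel[of "\<lambda>t. Arg2pi (u t / d)"] closed by simp
  qed
  moreover have "of_real (\<Prod>t<L. turn (u t) (u (Suc t))) = cis ((\<Sum>t<L. Arg (u (Suc t) / u t)) / 2)"
  proof -
    have "of_real (\<Prod>t<L. turn (u t) (u (Suc t))) = (\<Prod>t<L. cis ((Arg (u t) + Arg (u (Suc t) / u t) - Arg (u (Suc t))) / 2))"
      unfolding of_real_prod by (intro prod.cong refl turn_cis u) auto
    then show ?thesis unfolding cis_prod using tel[of "\<lambda>t. Arg (u t)"] closed by simp
  qed
  ultimately show ?thesis by (metis of_real_eq_iff)
qed

text \<open>The two quotients are the coordinates of \<open>d\<close> in the basis \<open>u\<close>,
  \<open>v\<close>. Points of the cone have nonnegative coordinates, the assumptions exclude zero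
  ones, and positivity of both is an open condition.\<close>

lemma cone_interior_coords:
  fixes u v d :: complex
  defines "D \<equiv> Im (cnj u * v)"
  assumes D: "D \<noteq> 0" and nc: "Im (cnj v * d) \<noteq> 0" "Im (cnj u * d) \<noteq> 0"
  shows "d \<in> cone_interior u v \<longleftrightarrow> Im (cnj d * v) / D > 0 \<and> Im (cnj u * d) / D > 0"
proof -
  have rep: "z = (Im (cnj z * v) / D) *\<^sub>R u + (Im (cnj u * z) / D) *\<^sub>R v" for z
  proof -
    have "D *\<^sub>R z = Im (cnj z * v) *\<^sub>R u + Im (cnj u * z) *\<^sub>R v"
      unfolding D_def by (simp add: complex_eq_iff algebra_simps)
    then have "(1 / D) *\<^sub>R (D *\<^sub>R z) = (1 / D) *\<^sub>R (Im (cnj z * v) *\<^sub>R u + Im (cnj u * z) *\<^sub>R v)" by simp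
    then show ?thesis using D by (simp add: scaleR_add_right)
  qed
  have uniq: "Im (cnj (s *\<^sub>R u + t *\<^sub>R v) * v) / D = s" "Im (cnj u * (s *\<^sub>R u + t *\<^sub>R v)) / D = t" for s t
    using D unfolding D_def by (simp_all add: field_simps)
  have nn: "\<not> (\<exists>c<0. v = c *\<^sub>R u)" using D unfolding D_def by auto
  have ci: "cone_interior u v = interior {s *\<^sub>R u + t *\<^sub>R v | s t. 0 \<le> s \<and> 0 \<le> t}" (is "_ = interior ?C")
    unfolding cone_interior_def by (rule if_not_P[OF nn])
  show ?thesis
  proof
    assume "d \<in> cone_interior u v"
    then have "d \<in> ?C" unfolding ci using interior_subset by blast
    then obtain s t where "d = s *\<^sub>R u + t *\<^sub>R v" "0 \<le> s" "0 \<le> t" by blast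
    then have "Im (cnj d * v) / D \<ge> 0" "Im (cnj u * d) / D \<ge> 0" using uniq by auto
    moreover have "Im (cnj d * v) = - Im (cnj v * d)" by simp
    then have "Im (cnj d * v) / D \<noteq> 0" "Im (cnj u * d) / D \<noteq> 0" using D nc by (metis divide_eq_0_iff neg_equal_0_iff_equal)+
    ultimately show "Im (cnj d * v) / D > 0 \<and> Im (cnj u * d) / D > 0"
      by (metis less_le)
  next
    assume a: "Im (cnj d * v) / D > 0 \<and> Im (cnj u * d) / D > 0"
    let ?T = "{z. Im (cnj z * v) / D > 0 \<and> Im (cnj u * z) / D > 0}"
    have "open ?T"
      by (intro open_Collect_conj open_Collect_less continuous_intros) (use D in auto)
    moreover have "?T \<subseteq> ?C"
    proof
      fix z assume "z \<in> ?T"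
      then have "0 \<le> Im (cnj z * v) / D" "0 \<le> Im (cnj u * z) / D" by (simp_all only: mem_Collect_eq less_imp_le)
      then show "z \<in> ?C" using rep[of z] by blast
    qed
    ultimately have "?T \<subseteq> interior ?C" by (simp add: interior_maximal)
    then show "d \<in> cone_interior u v" unfolding ci using a by blast
  qed
qed

lemma Arg2pi_less_pi_iff: "Im z \<noteq> 0 \<Longrightarrow> (Arg2pi z < pi \<longleftrightarrow> Im z > 0) \<and> Arg2pi z > 0 \<and> Arg2pi z \<noteq> pi"
proof -
  assume "Im z \<noteq> 0"
  then have "0 < Arg2pi z" using Arg2pi_gt_0[of z] complex_nonneg_Reals_iff by (auto simp: complex_nonneg_Reals_iff)
  moreover have "Arg2pi z < pi" "Arg2pi z \<noteq> pi" if "Im z > 0" using Arg2pi_lt_pi[of z] that \<open>0 < Arg2pi z\<close> by auto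
  moreover have "\<not> Arg2pi z < pi" "Arg2pi z \<noteq> pi" if "Im z < 0"
    using Arg2pi_lt_pi[of z] Arg2pi_le_pi[of z] that by auto
  ultimately show ?thesis using \<open>Im z \<noteq> 0\<close> by (metis linorder_neqE_linordered_idom)
qed

text \<open>The shorter turn from \<open>a\<close> to \<open>b\<close> passes the positive real axis
  either counterclockwise from the lower to the upper half plane or clockwise from the upper to the
  lower one. Exactly then the values of \<open>Arg2pi\<close> jump.\<close>

lemma turn_at_iff_aux:
  assumes a: "Im a \<noteq> 0" and b: "Im b \<noteq> 0" and D: "Im (b / a) \<noteq> 0"
  shows "Arg2pi a + Arg (b / a) \<noteq> Arg2pi b \<longleftrightarrow>
    (Im (b / a) > 0 \<and> Im a < 0 \<and> Im b > 0) \<or> (Im (b / a) < 0 \<and> Im a > 0 \<and> Im b < 0)"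
proof -
  define A B r where "A = Arg2pi a" and "B = Arg2pi b" and "r = Arg (b / a)"
  have nz: "a \<noteq> 0" "b \<noteq> 0" using a b by auto
  have "cis (A + r - B) = 1" unfolding A_def B_def r_def
    using nz by (simp add: cis_mult[symmetric] cis_divide[symmetric] cis_Arg cis_Arg2pi sgn_eq norm_divide)
  then have "cos (A + r - B) = 1" by (simp add: complex_eq_iff)
  then obtain k :: int where k: "A + r - B = of_int k * 2 * pi" using cos_one_2pi_int by blast
  have bd: "0 \<le> A" "A < 2 * pi" "0 \<le> B" "B < 2 * pi" "- pi < r" "r \<le> pi"
    unfolding A_def B_def r_def using Arg2pi_ge_0 Arg2pi_lt_2pi Arg_bounded by auto
  have "\<bar>real_of_int k\<bar> * (2 * pi) < 2 * (2 * pi)"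
  proof -
    have "\<bar>A + r - B\<bar> < 2 * (2 * pi)" using bd pi_gt_zero unfolding abs_less_iff by linarith
    then show ?thesis unfolding k by (simp add: abs_mult)
  qed
  then have "\<bar>real_of_int k\<bar> < 2" by (rule mult_right_less_imp_less) simp
  then have "k = -1 \<or> k = 0 \<or> k = 1" by linarith
  then have cases: "A + r - B = - 2 * pi \<or> A + r = B \<or> A + r - B = 2 * pi" using k by auto
  have pa: "A < pi \<longleftrightarrow> Im a > 0" "A \<noteq> pi" and pb: "B < pi \<longleftrightarrow> Im b > 0" "B \<noteq> pi"
    using Arg2pi_less_pi_iff[OF a] Arg2pi_less_pi_iff[OF b] unfolding A_def B_def by auto
  have r: "Im (b / a) > 0 \<Longrightarrow> 0 < r \<and> r < pi" "Im (b / a) < 0 \<Longrightarrow> r < 0"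
  proof -
    show "Im (b / a) > 0 \<Longrightarrow> 0 < r \<and> r < pi" unfolding r_def using Arg_lt_pi by blast
    show "Im (b / a) < 0 \<Longrightarrow> r < 0" unfolding r_def using Arg_neg_iff by blast
  qed
  consider "Im (b / a) > 0" | "Im (b / a) < 0" using D by linarith
  then show ?thesis unfolding A_def[symmetric] B_def[symmetric] r_def[symmetric]
  proof cases
    case 1
    note r1 = r(1)[OF 1]
    consider "Im a > 0" | "Im a < 0" "Im b > 0" | "Im a < 0" "Im b < 0" using a b by linarith
    then show "A + r \<noteq> B \<longleftrightarrow> (Im (b / a) > 0 \<and> Im a < 0 \<and> Im b > 0) \<or> (Im (b / a) < 0 \<and> Im a > 0 \<and> Im b < 0)"
    proof cases
      case 1 then have "A < pi" using pa by simp
      then have "A + r = B" using cases r1 bd by linarith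
      then show ?thesis using 1 \<open>Im (b / a) > 0\<close> by linarith
    next
      case 2 then have "A > pi" "B < pi" using pa pb by auto
      then have "A + r \<noteq> B" using r1 by linarith
      then show ?thesis using 2 \<open>Im (b / a) > 0\<close> by linarith
    next
      case 3 then have "A > pi" "B > pi" using pa pb by auto
      then have "A + r = B" using cases r1 bd by linarith
      then show ?thesis using 3 \<open>Im (b / a) > 0\<close> by linarith
    qed
  next
    case 2
    note r1 = r(2)[OF 2]
    consider "Im a < 0" | "Im a > 0" "Im b > 0" | "Im a > 0" "Im b < 0" using a b by linarith
    then show "A + r \<noteq> B \<longleftrightarrow> (Im (b / a) > 0 \<and> Im a < 0 \<and> Im b > 0) \<or> (Im (b / a) < 0 \<and> Im a > 0 \<and> Im b < 0)"
    proof cases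
      case 1 then have "A > pi" using pa by auto
      then have "A + r = B" using cases r1 bd by linarith
      then show ?thesis using 1 \<open>Im (b / a) < 0\<close> by linarith
    next
      case 2 then have "A < pi" "B < pi" using pa pb by auto
      then have "A + r = B" using cases r1 bd by linarith
      then show ?thesis using 2 \<open>Im (b / a) < 0\<close> by linarith
    next
      case 3 then have "A < pi" "B > pi" using pa pb by auto
      then have "A + r \<noteq> B" using r1 by linarith
      then show ?thesis using 3 \<open>Im (b / a) < 0\<close> by linarith
    qed
  qed
qed

lemma not_collinear_Im: "\<not> collinear {0, d, u} \<Longrightarrow> d \<noteq> 0 \<and> u \<noteq> 0 \<and> Im (cnj u * d) \<noteq> 0"
proof -
  assume nc: "\<not> collinear {0, d, u}"
  then have *: "d \<noteq> 0" "u \<noteq> 0" "\<And>c. u \<noteq> c *\<^sub>R d" by (auto simp: collinear_lemma)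
  moreover have "Im (cnj u * d) \<noteq> 0"
  proof
    assume i: "Im (cnj u * d) = 0"
    have "u = (Re (cnj d * u) / (norm d)^2) *\<^sub>R d"
    proof -
      have "cnj d * u = of_real (Re (cnj d * u))" using i by (simp add: complex_eq_iff algebra_simps)
      then have "d * (cnj d * u) = Re (cnj d * u) *\<^sub>R d" by (metis mult.commute scaleR_conv_of_real)
      moreover have "d * (cnj d * u) = (norm d)^2 *\<^sub>R u"
        by (simp add: mult.assoc[symmetric] complex_norm_square[symmetric] scaleR_conv_of_real)
      ultimately have "(norm d)^2 *\<^sub>R u = Re (cnj d * u) *\<^sub>R d" by simp
      then have "(1 / (norm d)^2) *\<^sub>R ((norm d)^2 *\<^sub>R u) = (1 / (norm d)^2) *\<^sub>R (Re (cnj d * u) *\<^sub>R d)" by simp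
      then show ?thesis using *(1) by simp
    qed
    then show False using *(3) by blast
  qed
  ultimately show ?thesis by blast
qed

text \<open>After division by \<open>d\<close> the line becomes the positive real axis, and the
  interior of the cone contains it exactly if the shorter turn from \<open>u\<close> to
  \<open>v\<close> sweeps over it. Parallel vectors need separate care: for equal directions the
  cone is a mere ray, for opposite ones the convention of \<open>cone_interior\<close>
  decides.\<close>

lemma cone_interior_iff_turn_at:
  assumes u: "\<not> collinear {0, d, u}" and v: "\<not> collinear {0, d, v}"
  shows "d \<in> cone_interior u v \<longleftrightarrow> turn_at d u v = - 1"
proof -
  have nz: "d \<noteq> 0" "u \<noteq> 0" "v \<noteq> 0" and iu: "Im (cnj u * d) \<noteq> 0" and iv: "Im (cnj v * d) \<noteq> 0"
    using not_collinear_Im[OF u] not_collinear_Im[OF v] by auto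
  define a b where "a = u / d" and "b = v / d"
  define q where "q = (norm d)^2"
  have q: "q > 0" using nz by (simp add: q_def)
  have ud: "u = a * d" "v = b * d" using nz by (simp_all add: a_def b_def)
  have dd: "cnj d * d = of_real q" "d * cnj d = of_real q" unfolding q_def using complex_norm_square[of d] by (simp_all add: mult.commute)
  have ia: "Im (cnj u * d) = - q * Im a"
  proof -
    have "cnj u * d = of_real q * cnj a" unfolding ud using dd by (simp add: algebra_simps)
    then show ?thesis by simp
  qed
  have ib: "Im (cnj d * v) = q * Im b" "Im (cnj v * d) = - q * Im b"
  proof -
    have "cnj d * v = of_real q * b" unfolding ud using dd by (simp add: algebra_simps)
    then show "Im (cnj d * v) = q * Im b" by simp
    have "cnj v * d = of_real q * cnj b" unfolding ud using dd by (simp add: algebra_simps)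
    then show "Im (cnj v * d) = - q * Im b" by simp
  qed
  have a0: "Im a \<noteq> 0" and b0: "Im b \<noteq> 0" using iu iv ia ib q by auto
  have ba: "v / u = b / a" using nz by (simp add: ud)
  have DD: "Im (cnj u * v) = (norm u)^2 * Im (b / a)"
  proof -
    have "cnj u * v = (norm u)^2 *\<^sub>R (v / u)"
      using nz complex_norm_square[of u] by (simp add: scaleR_conv_of_real field_simps)
    then show ?thesis by (simp add: ba)
  qed
  have t: "turn_at d u v = - 1 \<longleftrightarrow> Arg2pi a + Arg (b / a) \<noteq> Arg2pi b"
    unfolding turn_at_def a_def b_def using nz by auto
  show ?thesis
  proof (cases "Im (b / a) = 0")
    case False
    then have D: "Im (cnj u * v) \<noteq> 0" unfolding DD using nz by simp
    have pos: "(norm u)^2 > 0" using nz by simp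
    have "d \<in> cone_interior u v \<longleftrightarrow> q * Im b / ((norm u)^2 * Im (b / a)) > 0 \<and> - q * Im a / ((norm u)^2 * Im (b / a)) > 0"
      unfolding cone_interior_coords[OF D iv iu] ia ib DD ..
    also have "\<dots> \<longleftrightarrow> Im b / Im (b / a) > 0 \<and> Im a / Im (b / a) < 0"
    proof -
      have e1: "q * Im b / ((norm u)^2 * Im (b / a)) = (q / (norm u)^2) * (Im b / Im (b / a))"
        and e2: "- q * Im a / ((norm u)^2 * Im (b / a)) = - ((q / (norm u)^2) * (Im a / Im (b / a)))" by simp_all
      have "q / (norm u)^2 > 0" using q pos by simp
      then show ?thesis unfolding e1 e2 by (simp only: zero_less_mult_iff neg_0_less_iff_less mult_less_0_iff) auto
    qed
    also have "\<dots> \<longleftrightarrow> (Im (b / a) > 0 \<and> Im a < 0 \<and> Im b > 0) \<or> (Im (b / a) < 0 \<and> Im a > 0 \<and> Im b < 0)"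
      by (simp only: zero_less_divide_iff divide_less_0_iff) auto
    finally show ?thesis unfolding t turn_at_iff_aux[OF a0 b0 False] .
  next
    case True
    define c where "c = Re (b / a)"
    have bc: "b / a = of_real c" using True by (simp add: c_def complex_eq_iff)
    have a0': "a \<noteq> 0" using a0 by auto
    have vc: "v = c *\<^sub>R u" using bc ba nz by (simp add: scaleR_conv_of_real field_simps)
    have c0: "c \<noteq> 0" using vc nz by auto
    have b_eq: "b = of_real c * a" using bc a0' by (simp add: field_simps)
    consider "c < 0" | "c > 0" using c0 by linarith
    then show ?thesis
    proof cases
      case 1
      \<comment> \<open>Reading the half turn as a left turn agrees with \<open>Arg\<close> being
        \<open>pi\<close>, not \<open>- pi\<close>, on the negative reals.\<close>
      then have ci: "cone_interior u v = {d. 0 < Im (cnj u * d)}" using vc by (auto simp: cone_interior_def)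
      have l: "d \<in> cone_interior u v \<longleftrightarrow> Im a < 0" unfolding ci mem_Collect_eq ia using q by (simp add: mult_less_0_iff)
      have arg: "Arg (b / a) = pi" unfolding bc using 1 by (simp add: Arg_eq_pi)
      have "Im b = c * Im a" unfolding b_eq by simp
      then have ibs: "Im b > 0 \<longleftrightarrow> Im a < 0" using 1 by (simp add: zero_less_mult_iff)
      have "Arg2pi a + pi = Arg2pi b \<longleftrightarrow> Im a > 0"
      proof
        assume "Arg2pi a + pi = Arg2pi b"
        then have "Arg2pi a < pi" using Arg2pi_lt_2pi[of b] by linarith
        then show "Im a > 0" using Arg2pi_less_pi_iff[OF a0] by blast
      next
        assume ia0: "Im a > 0"
        have "cis (Arg2pi a + pi) = cis (Arg2pi b)"
          using a0' b0 1 by (subst cis_mult[symmetric]) (auto simp: cis_Arg2pi b_eq norm_mult field_simps)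
        then have "cis (Arg2pi a + pi - Arg2pi b) = 1" by (simp add: cis_divide[symmetric])
        then have "cos (Arg2pi a + pi - Arg2pi b) = 1" by (simp add: complex_eq_iff)
        then obtain k :: int where k: "Arg2pi a + pi - Arg2pi b = of_int k * 2 * pi" using cos_one_2pi_int by blast
        have "Arg2pi a < pi" "0 < Arg2pi a" "Arg2pi b > pi" "Arg2pi b < 2 * pi"
          using Arg2pi_less_pi_iff[OF a0] Arg2pi_less_pi_iff[OF b0] ibs ia0 Arg2pi_lt_2pi[of b] by auto
        then have "\<bar>Arg2pi a + pi - Arg2pi b\<bar> < 1 * (2 * pi)" unfolding abs_less_iff by linarith
        then have "\<bar>real_of_int k\<bar> * (2 * pi) < 1 * (2 * pi)" unfolding k by (simp add: abs_mult)
        then have "\<bar>real_of_int k\<bar> < 1" by (rule mult_right_less_imp_less) simp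
        then have "k = 0" by linarith
        then show "Arg2pi a + pi = Arg2pi b" using k by simp
      qed
      then show ?thesis unfolding l t arg using a0 by auto
    next
      case 2
      then have ci: "cone_interior u v = interior {s *\<^sub>R u + t *\<^sub>R v | s t. 0 \<le> s \<and> 0 \<le> t}"
        using vc nz by (auto simp: cone_interior_def)
      have "d \<notin> {s *\<^sub>R u + t *\<^sub>R v | s t. 0 \<le> s \<and> 0 \<le> t}"
      proof
        assume "d \<in> {s *\<^sub>R u + t *\<^sub>R v | s t. 0 \<le> s \<and> 0 \<le> t}"
        then obtain s t where "d = s *\<^sub>R u + t *\<^sub>R v" by blast
        then have "d = (s + t * c) *\<^sub>R u" unfolding vc by (simp add: scaleR_add_left)
        then have "Im (cnj u * d) = 0" by simp
        then show False using iu by simp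
      qed
      then have "d \<notin> cone_interior u v" unfolding ci using interior_subset by blast
      moreover have "Arg2pi a + Arg (b / a) = Arg2pi b"
      proof -
        have "Arg (b / a) = 0" unfolding bc using 2 by (simp add: Arg_eq_0)
        moreover have "Arg2pi b = Arg2pi a" unfolding b_eq using Arg2pi_times_of_real[OF 2] by simp
        ultimately show ?thesis by simp
      qed
      ultimately show ?thesis unfolding t by simp
    qed
  qed
qed

lemma exists_generic_direction:
  fixes U :: "complex set"
  assumes "finite U" "\<And>u. u \<in> U \<Longrightarrow> u \<noteq> 0"
  shows "\<exists>d. \<forall>u\<in>U. \<not> collinear {0, d, u}"
proof -
  \<comment> \<open>A slope different from the finitely many slopes of \<open>U\<close>. For
    vertical vectors the quotient is 0 by convention, which merely excludes one more value.\<close>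
  obtain y :: real where y: "y \<notin> (\<lambda>u. Im u / Re u) ` U"
    using ex_new_if_finite[OF infinite_UNIV_char_0, of "(\<lambda>u. Im u / Re u) ` U"] assms(1) by blast
  have "\<not> collinear {0, Complex 1 y, u}" if u: "u \<in> U" for u
  proof
    assume "collinear {0, Complex 1 y, u}"
    then obtain c where c: "u = c *\<^sub>R Complex 1 y"
      using assms(2)[OF u] by (auto simp: collinear_lemma complex_eq_iff)
    then have "c \<noteq> 0" using assms(2)[OF u] by auto
    then have "Im u / Re u = y" unfolding c by simp
    with imageI[OF u, of "\<lambda>u. Im u / Re u"] y show False by simp
  qed
  then show ?thesis by blast
qed

text \<open>For a generic direction, \<open>concordance\<close> counts modulo 2 the corners with
  \<open>turn_at\<close> equal to -1. The product of these signs around a closed curve equals the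
  one for the fixed cut.\<close>

lemma concordance_turn:
  assumes L: "length C > 0" and nz: "\<And>t. t < length C \<Longrightarrow> seg C t \<noteq> 0"
  shows "(- 1) powi (int (concordance C) - 1) = - (\<Prod>t<length C. turn (seg C t) (seg C (Suc t)))"
proof -
  let ?L = "length C"
  define d where "d = (SOME d. \<forall>t<?L. \<not> collinear {0, d, seg C t})"
  have "\<exists>d. \<forall>t<?L. \<not> collinear {0, d, seg C t}"
  proof -
    have "u \<noteq> 0" if "u \<in> seg C ` {..<?L}" for u using nz that by auto
    from exists_generic_direction[of "seg C ` {..<?L}", OF _ this] show ?thesis by auto
  qed
  then have d: "\<not> collinear {0, d, seg C t}" if "t < ?L" for t
    unfolding d_def using someI_ex[of "\<lambda>d. \<forall>t<?L. \<not> collinear {0, d, seg C t}"] that by blast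
  have segL: "seg C ?L = seg C 0" using L by (simp add: seg_def mod_Suc)
  have dS: "\<not> collinear {0, d, seg C (Suc t)}" if "t < ?L" for t
    using d[of "Suc t"] d[of 0] that segL L by (cases "Suc t = ?L") auto
  have d0: "d \<noteq> 0" using d[OF L] not_collinear_Im by blast
  define T where "T = {t. t < ?L \<and> d \<in> cone_interior (seg C t) (seg C (Suc t))}"
  have conc: "concordance C = card T mod 2"
    unfolding concordance_def Let_def d_def[symmetric] T_def ..
  \<comment> \<open>The concordance number is already reduced modulo 2, so the exponent is -1 or
    0.\<close>
  have "(- 1) powi (int (concordance C) - 1) = - ((- 1 :: real) ^ card T)"
  proof (cases "even (card T)")
    case True
    then have "concordance C = 0" unfolding conc by simp
    then show ?thesis using True by simp
  next
    case False
    then have "concordance C = 1" unfolding conc by presburger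
    then show ?thesis using False by simp
  qed
  also have "(- 1 :: real) ^ card T = (\<Prod>t<?L. turn_at d (seg C t) (seg C (Suc t)))"
  proof -
    have "(- 1 :: real) ^ card T = (\<Prod>t\<in>T. - 1)" by simp
    also have "\<dots> = (\<Prod>t<?L. if t \<in> T then - 1 else 1)"
      by (simp add: prod.If_cases T_def Int_def)
    also have "\<dots> = (\<Prod>t<?L. turn_at d (seg C t) (seg C (Suc t)))"
    proof (intro prod.cong refl)
      fix t assume "t \<in> {..<?L}"
      then have t: "t < ?L" by simp
      have "t \<in> T \<longleftrightarrow> turn_at d (seg C t) (seg C (Suc t)) = - 1"
        unfolding T_def using t cone_interior_iff_turn_at[OF d[OF t] dS[OF t]] by simp
      moreover have "turn_at d (seg C t) (seg C (Suc t)) = 1 \<or> turn_at d (seg C t) (seg C (Suc t)) = - 1"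
        by (simp add: turn_at_def)
      ultimately show "(if t \<in> T then - 1 else 1) = turn_at d (seg C t) (seg C (Suc t))" by auto
    qed
    finally show ?thesis .
  qed
  also have "\<dots> = (\<Prod>t<?L. turn (seg C t) (seg C (Suc t)))"
  proof (rule turn_product_closed[OF _ segL d0])
    fix t assume "t \<le> ?L"
    then show "seg C t \<noteq> 0" using nz[of t] nz[of 0] segL L by (cases "t = ?L") auto
  qed
  finally show ?thesis .
qed

section \<open>Turn products of lists of segments\<close>

fun turn_product :: "complex list \<Rightarrow> real" where
  "turn_product (u # v # us) = turn u v * turn_product (v # us)"
| "turn_product us = 1"

lemma turn_product_append:
  "us \<noteq> [] \<Longrightarrow> vs \<noteq> [] \<Longrightarrow> turn_product (us @ vs) = turn_product us * turn (last us) (hd vs) * turn_product vs"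
proof (induction us rule: turn_product.induct)
  case (1 u v us)
  then show ?case by simp
next
  case ("2_2" v)
  then show ?case by (cases vs) auto
qed simp

lemma turn_product_nth: "turn_product us = (\<Prod>t<length us - 1. turn (us ! t) (us ! Suc t))"
proof (induction us rule: turn_product.induct)
  case (1 u v us)
  have "(\<Prod>t<length (u # v # us) - 1. turn ((u # v # us) ! t) ((u # v # us) ! Suc t))
    = (\<Prod>t<Suc (length us). turn ((u # v # us) ! t) ((u # v # us) ! Suc t))" by simp
  also have "\<dots> = turn u v * (\<Prod>t<length us. turn ((v # us) ! t) ((v # us) ! Suc t))"
    by (subst prod.lessThan_Suc_shift) simp
  finally show ?case using 1 by simp
qed auto

lemma path_sign_turn_product:
  fixes C :: "complex list"
  assumes L: "length C > 0" and nz: "\<And>t. t < length C \<Longrightarrow> seg C t \<noteq> 0"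
  shows "(- 1) powi (int (concordance C) - 1) = - turn_product (map (seg C) [0..<length C] @ [seg C 0])"
proof -
  let ?L = "length C" and ?us = "map (seg C) [0..<length C] @ [seg C 0]"
  have segL: "seg C ?L = seg C 0" using L by (simp add: seg_def mod_Suc)
  have nth: "?us ! t = seg C t" if "t \<le> ?L" for t
    using that segL by (cases "t = ?L") (auto simp: nth_append)
  have "turn_product ?us = (\<Prod>t<?L. turn (seg C t) (seg C (Suc t)))"
    unfolding turn_product_nth by (rule prod.cong) (auto simp: nth)
  then show ?thesis using concordance_turn[OF L nz] by simp
qed

section \<open>Structure of a planar network and signs of its edges\<close>

locale planar_net =
  fixes n :: nat and I J :: "nat set" and N :: network
  assumes net: "N \<in> Net n I J" and IJ: "I \<union> J = {1..n}" and IJ_disj: "I \<inter> J = {}"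
begin

lemma net_props:
  shows bnum: "bnum N = n" and ccw: "ccw_on_circle n (bpt N)" and finite_inner: "finite (inner_verts N)"
    and inner_hull: "inner_verts N \<subseteq> interior (convex hull (bdry_verts N))"
    and edges_verts: "edges N \<subseteq> verts N \<times> verts N"
    and edge_ne: "\<And>e. e \<in> edges N \<Longrightarrow> fst e \<noteq> snd e"
    and edge_disj: "\<And>e e'. e \<in> edges N \<Longrightarrow> e' \<in> edges N \<Longrightarrow> e \<noteq> e' \<Longrightarrow>
        closed_segment (fst e) (snd e) \<inter> closed_segment (fst e') (snd e') \<subseteq> {fst e, snd e} \<inter> {fst e', snd e'}"
    and source: "\<And>i. i \<in> I \<Longrightarrow> card (out_edges N (bpt N i)) = 1" "\<And>i. i \<in> I \<Longrightarrow> in_edges N (bpt N i) = {}"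
    and sink: "\<And>j. j \<in> J \<Longrightarrow> card (in_edges N (bpt N j)) = 1" "\<And>j. j \<in> J \<Longrightarrow> out_edges N (bpt N j) = {}"
    and inner: "\<And>v. v \<in> inner_verts N \<Longrightarrow> card (in_edges N v \<union> out_edges N v) = 3"
      "\<And>v. v \<in> inner_verts N \<Longrightarrow> white N v \<or> black N v"
  using net unfolding Net_def by blast+

lemma bdry_verts_eq: "bdry_verts N = bpt N ` {1..n}"
  by (simp add: bdry_verts_def bnum)

sublocale finite_net N
proof
  show "finite (verts N)" by (simp add: verts_def bdry_verts_eq finite_inner)
qed (rule edges_verts)

lemma I_subset: "I \<subseteq> {1..n}" and J_subset: "J \<subseteq> {1..n}"
  using IJ by auto

lemma bpt_verts: "i \<in> {1..n} \<Longrightarrow> bpt N i \<in> verts N"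
  by (auto simp: verts_def bdry_verts_eq)

lemma norm_bpt: "i \<in> {1..n} \<Longrightarrow> norm (bpt N i) = 1"
  using ccw unfolding ccw_on_circle_def by auto

lemma bpt_inj: "inj_on (bpt N) {1..n}"
proof (rule inj_onI)
  have *: False if a: "i \<in> {1..n}" "j \<in> {1..n}" "bpt N i = bpt N j" "i < j" for i j
  proof -
    from ccw obtain \<theta> where \<theta>: "\<forall>i\<in>{1..n}. bpt N i = cis (\<theta> i)"
      "\<forall>i\<in>{1..n}. \<forall>j\<in>{1..n}. i < j \<longrightarrow> \<theta> i < \<theta> j \<and> \<theta> j < \<theta> i + 2 * pi" unfolding ccw_on_circle_def by blast
    have "cis (\<theta> j - \<theta> i) = 1" using \<theta>(1) a by (simp add: cis_divide[symmetric])
    then have "cos (\<theta> j - \<theta> i) = 1" by (simp add: complex_eq_iff)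
    then obtain k :: int where k: "\<theta> j - \<theta> i = of_int k * 2 * pi" using cos_one_2pi_int by blast
    have b: "0 < \<theta> j - \<theta> i" "\<theta> j - \<theta> i < 1 * (2 * pi)" using \<theta>(2)[rule_format, OF a(1,2,4)] by simp_all
    then have "real_of_int k < 1" unfolding k by (simp only: mult.assoc mult_less_cancel_right_pos pi_gt_zero zero_less_mult_iff) simp
    moreover have "0 < real_of_int k" using b(1) unfolding k by (simp add: zero_less_mult_iff)
    ultimately have "k < 1" "0 < k" by simp_all
    then show False by linarith
  qed
  fix i j assume "i \<in> {1..n}" "j \<in> {1..n}" "bpt N i = bpt N j"
  then show "i = j" using *[of i j] *[of j i] by (metis linorder_neqE_nat)
qed

lemma norm_inner: "v \<in> inner_verts N \<Longrightarrow> norm v < 1"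
proof -
  assume "v \<in> inner_verts N"
  moreover have "convex hull (bdry_verts N) \<subseteq> cball 0 1"
    by (rule hull_minimal) (auto simp: bdry_verts_eq norm_bpt)
  then have "interior (convex hull (bdry_verts N)) \<subseteq> interior (cball 0 1)" by (rule interior_mono)
  ultimately show ?thesis using inner_hull by auto
qed

lemma bpt_not_inner: "i \<in> {1..n} \<Longrightarrow> bpt N i \<notin> inner_verts N"
  using norm_bpt norm_inner by fastforce

lemma norm_verts: "v \<in> verts N \<Longrightarrow> norm v \<le> 1"
  using norm_bpt norm_inner by (fastforce simp: verts_def bdry_verts_eq)

lemma boundary_edges:
  assumes "i \<in> {1..n}"
  shows "(i \<in> I \<and> in_edges N (bpt N i) = {} \<and> card (out_edges N (bpt N i)) = 1) \<or>
    (i \<in> J \<and> out_edges N (bpt N i) = {} \<and> card (in_edges N (bpt N i)) = 1)"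
  using assms IJ source sink by blast

lemma through_inner:
  assumes "e \<in> edges N" "e' \<in> edges N" "snd e = v" "fst e' = v"
  shows "v \<in> inner_verts N"
proof (rule ccontr)
  assume "v \<notin> inner_verts N"
  then obtain i where "i \<in> {1..n}" "v = bpt N i" using assms edges_verts by (auto simp: verts_def bdry_verts_eq)
  moreover have "e \<in> in_edges N v" "e' \<in> out_edges N v" using assms by (simp_all add: in_edges_def out_edges_def)
  ultimately show False using boundary_edges[of i] by auto
qed

lemma inner_degrees:
  assumes "v \<in> inner_verts N"
  shows "finite (in_edges N v)" "finite (out_edges N v)" "in_edges N v \<inter> out_edges N v = {}"
    "card (in_edges N v) + card (out_edges N v) = 3" "white N v \<longleftrightarrow> \<not> black N v"
proof -
  show f: "finite (in_edges N v)" "finite (out_edges N v)" using finite_edges by (simp_all add: in_edges_def out_edges_def)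
  show d: "in_edges N v \<inter> out_edges N v = {}" using edge_ne by (auto simp: in_edges_def out_edges_def)
  show s: "card (in_edges N v) + card (out_edges N v) = 3"
    using inner(1)[OF assms] card_Un_disjoint[OF f d] by simp
  show "white N v \<longleftrightarrow> \<not> black N v" using s inner(2)[OF assms] by (auto simp: white_def black_def)
qed

definition in_edge :: "complex \<Rightarrow> edge" where "in_edge v = (THE e. in_edges N v = {e})"
definition out_edge :: "complex \<Rightarrow> edge" where "out_edge v = (THE e. out_edges N v = {e})"

lemma in_edge_eq: "card (in_edges N v) = 1 \<Longrightarrow> e \<in> edges N \<Longrightarrow> snd e = v \<Longrightarrow> in_edge v = e"
proof -
  assume "card (in_edges N v) = 1" "e \<in> edges N" "snd e = v"
  then have "e \<in> in_edges N v" "card (in_edges N v) = 1" by (simp_all add: in_edges_def)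
  then have "in_edges N v = {e}" by (metis card_1_singletonE singletonD)
  then show ?thesis by (simp add: in_edge_def)
qed

lemma out_edge_eq: "card (out_edges N v) = 1 \<Longrightarrow> e \<in> edges N \<Longrightarrow> fst e = v \<Longrightarrow> out_edge v = e"
proof -
  assume "card (out_edges N v) = 1" "e \<in> edges N" "fst e = v"
  then have "e \<in> out_edges N v" "card (out_edges N v) = 1" by (simp_all add: out_edges_def)
  then have "out_edges N v = {e}" by (metis card_1_singletonE singletonD)
  then show ?thesis by (simp add: out_edge_def)
qed

definition dir :: "edge \<Rightarrow> complex" where "dir e = snd e - fst e"

text \<open>Of two consecutive edges at an inner vertex one is the unique incoming or outgoing edge, so
  that the sign of the turn can be assigned to the other one.\<close>

definition tail_sign :: "edge \<Rightarrow> real" where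
  "tail_sign e = (if fst e \<in> inner_verts N \<and> white N (fst e) then turn (dir (in_edge (fst e))) (dir e) else 1)"

definition head_sign :: "edge \<Rightarrow> real" where
  "head_sign e = (if snd e \<in> inner_verts N \<and> black N (snd e) then turn (dir e) (dir (out_edge (snd e))) else 1)"

definition edge_sign :: "edge \<Rightarrow> real" where
  "edge_sign e = tail_sign e * head_sign e"

lemma turn_pm: "turn u v = 1 \<or> turn u v = - 1"
  by (simp add: turn_def)

lemma pm_mult: "x = 1 \<or> x = - 1 \<Longrightarrow> y = 1 \<or> y = - 1 \<Longrightarrow> x * y = 1 \<or> x * y = (- 1 :: real)"
  by auto

lemma edge_sign_pm: "edge_sign e = 1 \<or> edge_sign e = - 1"
  unfolding edge_sign_def by (rule pm_mult) (use turn_pm in \<open>simp_all add: tail_sign_def head_sign_def\<close>)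

lemma turn_consecutive:
  assumes "e \<in> edges N" "e' \<in> edges N" "snd e = fst e'"
  shows "turn (dir e) (dir e') = head_sign e * tail_sign e'"
proof -
  have v: "fst e' \<in> inner_verts N" using through_inner[OF assms(1,2)] assms(3) by simp
  show ?thesis
  proof (cases "white N (fst e')")
    case True
    then have "in_edge (fst e') = e" using assms by (intro in_edge_eq) (auto simp: white_def)
    then show ?thesis using True v inner_degrees(5)[OF v] assms(3) by (simp add: head_sign_def tail_sign_def)
  next
    case False
    then have "black N (fst e')" using inner_degrees(5)[OF v] by simp
    then have "out_edge (fst e') = e'" using assms by (intro out_edge_eq) (auto simp: black_def)
    then show ?thesis using False \<open>black N (fst e')\<close> v assms(3) by (simp add: head_sign_def tail_sign_def)
  qed
qed

text \<open>Every turn inside the path splits into the head sign of one edge and the tail sign of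
  the next. The tail sign of the first and the head sign of the last edge have no partner and are
  supplied on the left.\<close>

lemma turn_product_path:
  assumes "successively (\<lambda>u v. (u, v) \<in> edges N) vs" "length vs \<ge> 2"
  shows "tail_sign (hd (path_edges vs)) * turn_product (map dir (path_edges vs)) * head_sign (last (path_edges vs))
    = signed_weight edge_sign vs"
  using assms
proof (induction vs)
  case (Cons v ws)
  show ?case
  proof (cases "length ws \<ge> 2")
    case False
    then obtain x where "ws = [x]" using Cons.prems(2) by (cases ws; cases "tl ws") auto
    then show ?thesis by (simp add: path_edges_def signed_weight_def edge_sign_def)
  next
    case True
    then obtain x y zs where ws: "ws = x # y # zs" by (cases ws; cases "tl ws") auto
    have e: "(v, x) \<in> edges N" "(x, y) \<in> edges N" and s: "successively (\<lambda>u v. (u, v) \<in> edges N) ws"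
      using Cons.prems ws by auto
    have t: "turn (dir (v, x)) (dir (x, y)) = head_sign (v, x) * tail_sign (x, y)" by (rule turn_consecutive) (use e in auto)
    have "turn_product (map dir (path_edges (v # ws))) = turn (dir (v, x)) (dir (x, y)) * turn_product (map dir (path_edges ws))"
      by (simp add: path_edges_def ws)
    moreover have "hd (path_edges ws) = (x, y)" "hd (path_edges (v # ws)) = (v, x)" "last (path_edges (v # ws)) = last (path_edges ws)"
      by (auto simp: path_edges_def ws)
    moreover have "signed_weight edge_sign (v # ws) = edge_sign (v, x) * signed_weight edge_sign ws"
      using signed_weight_Cons[of ws edge_sign v] ws by simp
    moreover have "edge_sign (v, x) = tail_sign (v, x) * head_sign (v, x)" by (simp add: edge_sign_def)
    ultimately show ?thesis using Cons.IH[OF s True] t by (simp add: mult_ac)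
  qed
qed simp

text \<open>The side of the convex hull from the \<open>c\<close>-th boundary vertex to its
  counterclockwise neighbour, periodic in \<open>c\<close> with period \<open>n\<close> for positive
  \<open>c\<close>. Since truncated subtraction breaks this at 0, the predecessor of 1 is always
  given as \<open>n\<close>.\<close>

definition bseg :: "nat \<Rightarrow> complex" where
  "bseg c = bpt N (c mod n + 1) - bpt N ((c - 1) mod n + 1)"

definition corner_turn :: "nat \<Rightarrow> real" where
  "corner_turn c = turn (bseg (if c = 1 then n else c - 1)) (bseg c)"

text \<open>Partial products of the turns at the hull corners, continued beyond \<open>n\<close>.
  The product over an arc is the product of two of these signs, which separates the dependence on
  its ends.\<close>

definition corner_product :: "nat \<Rightarrow> real" where
  "corner_product x = (\<Prod>c\<in>{1..x}. corner_turn ((c - 1) mod n + 1))"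

text \<open>Collects what depends on the source alone: the turn from the hull into the first edge of
  the path, and the share of the source in the boundary arc.\<close>

definition source_sign :: "nat \<Rightarrow> real" where
  "source_sign i = corner_product (i - 1) * turn (bseg (if i = 1 then n else i - 1)) (dir (out_edge (bpt N i)))"

text \<open>The minus sign is the one from the exponent \<open>c - 1\<close> in the path
  weight.\<close>

definition sink_sign :: "nat \<Rightarrow> real" where
  "sink_sign j = - corner_product j * turn (dir (in_edge (bpt N j))) (bseg j)"

lemma corner_product_pm: "corner_product x = 1 \<or> corner_product x = - 1"
proof (induction x)
  case (Suc x)
  have "corner_product (Suc x) = corner_product x * corner_turn (x mod n + 1)"
    by (simp add: corner_product_def)
  moreover have "corner_turn (x mod n + 1) = 1 \<or> corner_turn (x mod n + 1) = - 1"
    unfolding corner_turn_def by (rule turn_pm)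
  ultimately show ?case using pm_mult[OF Suc] by simp
qed (simp add: corner_product_def)

lemma pm_square: "x = 1 \<or> x = - 1 \<Longrightarrow> x * x = (1::real)" by auto

text \<open>If \<open>i < j\<close>, the counterclockwise arc from the sink to the source passes
  from \<open>n\<close> to 1, which costs the factor of one full round. This is the only factor that
  involves both ends.\<close>

definition cross_sign :: "nat \<Rightarrow> nat \<Rightarrow> real" where
  "cross_sign i j = source_sign i * sink_sign j * (if i < j then corner_product n else 1)"

lemma bpt_next_neq:
  assumes "i \<in> I" "j \<in> J" "c \<ge> 1"
  shows "bseg c \<noteq> 0"
proof -
  have "i \<noteq> j" "i \<in> {1..n}" "j \<in> {1..n}" using assms IJ_disj I_subset J_subset by auto
  then have n2: "n \<ge> 2" by auto
  then have m: "(c - 1) mod n + 1 \<in> {1..n}" "c mod n + 1 \<in> {1..n}" by (simp_all add: Suc_le_eq)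
  obtain b where b: "c = Suc b" using assms(3) by (cases c) auto
  have "c mod n + 1 \<noteq> (c - 1) mod n + 1"
    using n2 unfolding b by (simp add: mod_Suc)
  then show ?thesis unfolding bseg_def using inj_on_eq_iff[OF bpt_inj m] by simp
qed

lemma corner_product_periodic:
  assumes "n > 0"
  shows "corner_product (n + x) = corner_product n * corner_product x"
proof (induction x)
  case (Suc x)
  have step: "corner_product (Suc y) = corner_product y * corner_turn (y mod n + 1)" for y
    by (simp add: corner_product_def)
  show ?case using Suc step[of "n + x"] step[of x] by simp
qed (simp add: corner_product_def)

lemma cyclic_index: "x \<in> {1..n} \<Longrightarrow> (x - 1) mod n + 1 = x"
  by (cases x) auto

lemma corner_product_arc:
  "j \<le> k \<Longrightarrow> (\<Prod>c\<in>{j+1..k}. corner_turn ((c - 1) mod n + 1)) = corner_product k * corner_product j"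
proof -
  assume "j \<le> k"
  then have "{1..k} = {1..j} \<union> {j+1..k}" "{1..j} \<inter> {j+1..k} = {}" by auto
  then have "corner_product k = corner_product j * (\<Prod>c\<in>{j+1..k}. corner_turn ((c - 1) mod n + 1))"
    unfolding corner_product_def by (simp add: prod.union_disjoint)
  then show ?thesis using pm_square[OF corner_product_pm[of j]] by (simp add: mult_ac)
qed

text \<open>The turns of the closed curve are those inside the path, the one at the sink, those
  along the boundary arc, and the one at the source. Only the first group depends on more than the
  two ends, and there the edge signs apply.\<close>

lemma path_sign_eq:
  assumes i: "i \<in> I" and j: "j \<in> J" and vs: "vs \<in> net_paths N i j"
  shows "path_sign N i j vs = cross_sign i j * signed_weight edge_sign vs"
proof -
  have ij: "i \<noteq> j" "i \<in> {1..n}" "j \<in> {1..n}" using i j IJ_disj I_subset J_subset by auto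
  \<comment> \<open>The number of hull sides from the sink counterclockwise to the source;
    \<open>hull_path\<close> contains the \<open>D - 1\<close> corners strictly between
    them.\<close>
  define D where "D = (i + n - j) mod n"
  have D1: "D \<ge> 1" "D < n" and Deq: "(if j < i then D = i - j else D = i + n - j)"
  proof -
    show "D < n" using ij unfolding D_def by simp
    show Deq: "(if j < i then D = i - j else D = i + n - j)"
    proof (cases "j < i")
      case True
      then have "i + n - j = (i - j) + n" by simp
      then have "D = (i - j) mod n" unfolding D_def by (metis mod_add_self2)
      moreover have "i - j < n" using ij True by auto
      ultimately show ?thesis using True by simp
    qed (use ij in \<open>simp add: D_def\<close>)
    show "D \<ge> 1" using Deq ij by (auto split: if_splits)
  qed
  define H where "H = hull_path N j i"
  have H: "H = map (\<lambda>t. bpt N ((j + t - 1) mod n + 1)) [1..<D]"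
    unfolding H_def hull_path_def bnum D_def ..
  have vsp: "vs \<noteq> []" "hd vs = bpt N i" "last vs = bpt N j" and suc: "successively (\<lambda>u v. (u, v) \<in> edges N) vs"
    using vs by (auto simp: net_paths_def)
  have bij: "bpt N i \<noteq> bpt N j" using inj_on_eq_iff[OF bpt_inj ij(2,3)] ij(1) by simp
  \<comment> \<open>A path between different vertices has an edge; \<open>Suc r\<close> is the
    number of its edges.\<close>
  obtain r where r: "length vs = Suc (Suc r)"
  proof -
    have "length vs \<noteq> 1" using vsp bij by (auto simp: length_Suc_conv)
    then show ?thesis using that[of "length vs - 2"] vsp(1) by (cases vs; cases "tl vs") auto
  qed
  define C where "C = vs @ H"
  have lenC: "length C = Suc r + D" unfolding C_def H using r D1 by simp
  have nthv: "C ! t = vs ! t" if "t < Suc (Suc r)" for t unfolding C_def using that r by (simp add: nth_append)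
  have nthh: "C ! (Suc r + t) = bpt N ((j + t - 1) mod n + 1)" if "t < D" for t
  proof (cases t)
    case 0
    have "vs ! Suc r = last vs" using r vsp(1) by (simp add: last_conv_nth)
    then show ?thesis using 0 nthv[of "Suc r"] vsp cyclic_index[OF ij(3)] by simp
  next
    case (Suc s)
    then have "C ! (Suc r + t) = H ! s" unfolding C_def using r by (simp add: nth_append)
    then show ?thesis using that Suc unfolding H by simp
  qed
  \<comment> \<open>\<open>D\<close> steps from the sink lead to the source, so the segment that
    closes the polygon is the last hull side.\<close>
  have c0: "C ! 0 = bpt N ((j + D - 1) mod n + 1)"
  proof -
    have "(j + D - 1) mod n + 1 = i"
    proof (cases "j < i")
      case True
      then have "j + D - 1 = i - 1" using Deq ij by simp
      then show ?thesis using cyclic_index[OF ij(2)] by simp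
    next
      case False
      then have "j + D - 1 = i - 1 + n" using Deq ij by simp
      then have "(j + D - 1) mod n = (i - 1) mod n" by (metis mod_add_self2)
      then show ?thesis using cyclic_index[OF ij(2)] by simp
    qed
    moreover have "C ! 0 = hd vs" using nthv[of 0] vsp(1) by (simp add: hd_conv_nth)
    ultimately show ?thesis using vsp by simp
  qed
  have segh: "seg C (Suc r + t) = bseg (j + t)" if "t < D" for t
  proof -
    have a: "(Suc r + t) mod length C = Suc r + t" using that lenC by simp
    have "C ! (Suc (Suc r + t) mod length C) = bpt N ((j + t) mod n + 1)"
    proof (cases "Suc t = D")
      case True
      then have "Suc (Suc r + t) = length C" using lenC by simp
      then have "Suc (Suc r + t) mod length C = 0" by simp
      then show ?thesis using c0 True[symmetric] by simp
    next
      case False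
      then have "Suc (Suc r + t) mod length C = Suc r + Suc t" using that lenC by simp
      then show ?thesis using nthh[of "Suc t"] that False by simp
    qed
    then show ?thesis unfolding seg_def a bseg_def using nthh[OF that] by simp
  qed
  have pe: "length (path_edges vs) = Suc r" "\<And>t. t < Suc r \<Longrightarrow> path_edges vs ! t = (vs ! t, vs ! Suc t)"
    using r by (simp_all add: path_edges_def nth_tl)
  have segv: "seg C t = dir (path_edges vs ! t)" if "t < Suc r" for t
  proof -
    have "t mod length C = t" "Suc t mod length C = Suc t" using that lenC D1 by simp_all
    then show ?thesis unfolding seg_def dir_def pe(2)[OF that] using nthv[of t] nthv[of "Suc t"] that by simp
  qed
  have pedge: "path_edges vs ! t \<in> edges N" if "t < Suc r" for t
    unfolding pe(2)[OF that] using suc that r by (simp add: successively_conv_nth)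
  have dnz: "dir e \<noteq> 0" if "e \<in> edges N" for e using edge_ne[OF that] by (simp add: dir_def)
  have segnz: "seg C t \<noteq> 0" if "t < length C" for t
  proof (cases "t < Suc r")
    case True
    then show ?thesis using segv dnz pedge by simp
  next
    case False
    then obtain s where s: "t = Suc r + s" using le_Suc_ex not_less by blast
    then show ?thesis using segh[of s] that lenC bpt_next_neq[OF i j, of "j + s"] ij by simp
  qed
  have segs: "map (seg C) [0..<length C] = map dir (path_edges vs) @ map (\<lambda>t. bseg (j + t)) [0..<D]"
  proof (rule nth_equalityI)
    show "length (map (seg C) [0..<length C]) = length (map dir (path_edges vs) @ map (\<lambda>t. bseg (j + t)) [0..<D])"
      by (simp add: lenC pe(1))
    fix t assume "t < length (map (seg C) [0..<length C])"
    then have t: "t < Suc r + D" by (simp add: lenC)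
    have l: "map (seg C) [0..<length C] ! t = seg C t" using t lenC by (simp del: upt_Suc)
    show "map (seg C) [0..<length C] ! t = (map dir (path_edges vs) @ map (\<lambda>t. bseg (j + t)) [0..<D]) ! t"
    proof (cases "t < Suc r")
      case True
      then show ?thesis unfolding l by (simp add: pe(1) nth_append segv)
    next
      case False
      then obtain s where s: "t = Suc r + s" using le_Suc_ex not_less by blast
      then have "s < D" using t by simp
      then show ?thesis unfolding l unfolding s using segh[of s] by (simp add: pe(1) nth_append)
    qed
  qed
  define PE where "PE = path_edges vs"
  have PE: "PE \<noteq> []" "length PE = Suc r" using pe(1) by (auto simp: PE_def)
  have first: "hd PE = out_edge (bpt N i)"
  proof -
    have "hd PE = path_edges vs ! 0" using PE by (simp add: hd_conv_nth PE_def)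
    moreover have "fst (path_edges vs ! 0) = bpt N i" using pe(2)[of 0] vsp by (simp add: hd_conv_nth)
    ultimately show ?thesis using out_edge_eq[OF source(1)[OF i] pedge[of 0]] by simp
  qed
  have last: "last PE = in_edge (bpt N j)"
  proof -
    have "last PE = path_edges vs ! r" using PE by (simp add: last_conv_nth PE_def)
    moreover have "snd (path_edges vs ! r) = bpt N j" using pe(2)[of r] vsp r by (simp add: last_conv_nth)
    ultimately show ?thesis using in_edge_eq[OF sink(1)[OF j] pedge[of r]] by simp
  qed
  have seg0: "seg C 0 = dir (hd PE)" using segv[of 0] PE by (simp add: hd_conv_nth PE_def)
  have tail1: "tail_sign (hd PE) = 1" and head1: "head_sign (last PE) = 1"
  proof -
    have "fst (hd PE) = bpt N i" using pe(2)[of 0] vsp PE by (simp add: hd_conv_nth PE_def)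
    then show "tail_sign (hd PE) = 1" using bpt_not_inner[OF ij(2)] by (simp add: tail_sign_def)
    have "snd (last PE) = bpt N j" using pe(2)[of r] vsp r PE by (simp add: last_conv_nth PE_def)
    then show "head_sign (last PE) = 1" using bpt_not_inner[OF ij(3)] by (simp add: head_sign_def)
  qed
  have sw: "turn_product (map dir PE) = signed_weight edge_sign vs"
    using turn_product_path[OF suc] r tail1 head1 by (simp add: PE_def)
  have bseg_mod: "bseg c = bseg ((c - 1) mod n + 1)" if "c \<ge> 1" for c
  proof -
    obtain b where b: "c = Suc b" using \<open>c \<ge> 1\<close> by (cases c) auto
    show ?thesis unfolding bseg_def b by (simp add: mod_simps)
  qed
  have corner: "turn (bseg (c - 1)) (bseg c) = corner_turn ((c - 1) mod n + 1)" if "c \<ge> 2" for c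
  proof -
    have "c = Suc (Suc (c - 2))" using that by simp
    then obtain b where b: "c = Suc (Suc b)" ..
    have n1: "n > 0" using ij by auto
    have "bseg (Suc b) = bseg (if Suc b mod n = 0 then n else Suc b mod n)"
    proof (cases "Suc b mod n = 0")
      case True
      have "bseg (Suc b) = bseg (b mod n + 1)" using bseg_mod[of "Suc b"] by simp
      moreover have "b mod n + 1 = n" using True n1 by (simp add: mod_Suc split: if_splits)
      ultimately show ?thesis using True by simp
    next
      case False
      have "bseg (Suc b) = bseg (b mod n + 1)" using bseg_mod[of "Suc b"] by simp
      moreover have "b mod n + 1 = Suc b mod n" using False by (simp add: mod_Suc split: if_splits)
      ultimately show ?thesis using False by simp
    qed
    then show ?thesis unfolding corner_turn_def b using bseg_mod[of "Suc (Suc b)"] by simp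
  qed
  have tph: "turn_product (map (\<lambda>t. bseg (j + t)) [0..<D]) = (\<Prod>c\<in>{j+1..j+D-1}. corner_turn ((c - 1) mod n + 1))"
  proof -
    have "turn_product (map (\<lambda>t. bseg (j + t)) [0..<D]) = (\<Prod>t<D-1. turn (bseg (j + t)) (bseg (j + Suc t)))"
      unfolding turn_product_nth by (rule prod.cong) auto
    also have "\<dots> = (\<Prod>t<D-1. corner_turn ((j + Suc t - 1) mod n + 1))"
    proof (intro prod.cong refl)
      fix t
      have "j + Suc t \<ge> 2" "j + Suc t - 1 = j + t" using ij by auto
      then show "turn (bseg (j + t)) (bseg (j + Suc t)) = corner_turn ((j + Suc t - 1) mod n + 1)"
        using corner[of "j + Suc t"] by simp
    qed
    also have "\<dots> = (\<Prod>c\<in>{j+1..j+D-1}. corner_turn ((c - 1) mod n + 1))"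
      by (rule prod.reindex_bij_witness[of _ "\<lambda>c. c - j - 1" "\<lambda>t. j + Suc t"]) (use D1 in auto)
    finally show ?thesis .
  qed
  have arc: "turn_product (map (\<lambda>t. bseg (j + t)) [0..<D]) = corner_product (i - 1) * corner_product j * (if i < j then corner_product n else 1)"
  proof -
    have "turn_product (map (\<lambda>t. bseg (j + t)) [0..<D]) = corner_product (j + D - 1) * corner_product j"
      unfolding tph by (rule corner_product_arc) (use D1 in simp)
    moreover have "corner_product (j + D - 1) = corner_product (i - 1) * (if i < j then corner_product n else 1)"
    proof (cases "j < i")
      case True
      then show ?thesis using Deq by simp
    next
      case False
      then have "j + D - 1 = n + (i - 1)" "i < j" using Deq ij by auto
      then show ?thesis using corner_product_periodic[of "i - 1"] ij by simp
    qed
    ultimately show ?thesis by (simp add: mult_ac)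
  qed
  have lastb: "bseg (j + (D - 1)) = bseg (if i = 1 then n else i - 1)"
  proof (cases "j < i")
    case True
    then show ?thesis using Deq ij by simp
  next
    case False
    then have e: "j + (D - 1) = n + (i - 1)" using Deq ij by auto
    show ?thesis
    proof (cases "i = 1")
      case True then show ?thesis using e by simp
    next
      case False
      have "bseg (n + (i - 1)) = bseg (i - 1)"
      proof -
        have "i = Suc (Suc (i - 2))" using False ij by auto
        then obtain a where a: "i = Suc (Suc a)" ..
        show ?thesis using bseg_mod[of "Suc (n + a)"] bseg_mod[of "Suc a"] unfolding a by simp
      qed
      then show ?thesis using e False by simp
    qed
  qed
  have "turn_product (map (seg C) [0..<length C] @ [seg C 0])
    = turn_product (map dir PE) * turn (dir (last PE)) (bseg j) * turn_product (map (\<lambda>t. bseg (j + t)) [0..<D])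
       * turn (bseg (j + (D - 1))) (dir (hd PE))"
    unfolding segs PE_def[symmetric] seg0
    using PE D1 by (simp add: turn_product_append last_map hd_map last_conv_nth)
  also have "\<dots> = signed_weight edge_sign vs * (- cross_sign i j)"
    unfolding sw arc lastb first last cross_sign_def source_sign_def sink_sign_def by (simp add: mult_ac)
  finally have "turn_product (map (seg C) [0..<length C] @ [seg C 0]) = - (cross_sign i j * signed_weight edge_sign vs)" by (simp add: mult_ac)
  moreover have "path_sign N i j vs = - turn_product (map (seg C) [0..<length C] @ [seg C 0])"
    unfolding path_sign_def H_def[symmetric] C_def[symmetric]
    by (rule path_sign_turn_product) (use lenC segnz in auto)
  ultimately show ?thesis by simp
qed

lemma cross_sign_pm:
  "cross_sign i j = 1 \<or> cross_sign i j = - 1"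
proof -
  have 1: "- corner_product j = 1 \<or> - corner_product j = - 1" using corner_product_pm[of j] by auto
  have 2: "(if i < j then corner_product n else 1) = 1 \<or> (if i < j then corner_product n else 1) = - 1"
    using corner_product_pm[of n] by simp
  show ?thesis
    unfolding cross_sign_def source_sign_def sink_sign_def
    by (intro pm_mult turn_pm corner_product_pm 1 2)
qed

text \<open>Source and sink factors are merely permuted. If the chords are parallel or have a common
  end, the factors for a full round balance as well, since their square is 1.\<close>

lemma cross_sign_exchange:
  assumes "s_par i j i' j' \<noteq> 0" "i \<noteq> j" "i \<noteq> j'" "i' \<noteq> j" "i' \<noteq> j'"
  shows "cross_sign i j * cross_sign i' j' = cross_sign i j' * cross_sign i' j"
proof -
  define P where "P = corner_product n"
  have P: "P * P = 1" unfolding P_def by (rule pm_square[OF corner_product_pm])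
  let ?e = "\<lambda>i j. if i < j then P else 1"
  have "cyc [i, i', j', j] \<or> cyc [i', i, j, j'] \<or> i = i' \<or> j = j'"
    using assms(1) unfolding s_par_def by (auto split: if_splits)
  then have "?e i j * ?e i' j' = ?e i j' * ?e i' j"
    unfolding cyc4 using assms(2-) P by (auto simp: mult_ac)
  then show ?thesis unfolding cross_sign_def P_def[symmetric] by (simp add: mult_ac)
qed

end

section \<open>Flows on a planar straight-line graph\<close>

lemma Arg_divide_right_half:
  assumes "Re p > 0" "Re q > 0"
  shows "Arg (p / q) = Arg p - Arg q"
proof -
  have nz: "p \<noteq> 0" "q \<noteq> 0" using assms by auto
  have b: "\<bar>Arg p\<bar> < pi / 2" "\<bar>Arg q\<bar> < pi / 2"
    using assms nz Re_Ln_pos_lt[of p] Re_Ln_pos_lt[of q] by (auto simp: Arg_eq_Im_Ln)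
  show ?thesis
  proof (rule Arg_unique[of "norm p / norm q"])
    have "of_real (norm p) * exp (\<i> * of_real (Arg p)) = p" "of_real (norm q) * exp (\<i> * of_real (Arg q)) = q"
      using Arg_eq[OF nz(1)] Arg_eq[OF nz(2)] by (simp_all add: mult.commute)
    then have "p / q = (of_real (norm p) * exp (\<i> * of_real (Arg p))) / (of_real (norm q) * exp (\<i> * of_real (Arg q)))" by simp
    also have "\<dots> = of_real (norm p / norm q) * exp (\<i> * of_real (Arg p - Arg q))"
      by (simp add: exp_diff right_diff_distrib)
    finally show "of_real (norm p / norm q) * exp (\<i> * of_real (Arg p - Arg q)) = p / q" ..
  qed (use b nz in auto)
qed

lemma Arg_uminus_Arg2pi:
  assumes "z \<noteq> 0" "\<not> (z \<in> \<real> \<and> 0 \<le> Re z)"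
  shows "Arg (- z) = Arg2pi z - pi"
proof (rule Arg_unique[of "norm z"])
  have "exp (\<i> * of_real (Arg2pi z - pi)) = - exp (\<i> * of_real (Arg2pi z))"
    by (simp add: right_diff_distrib exp_diff)
  then show "of_real (norm z) * exp (\<i> * of_real (Arg2pi z - pi)) = - z"
    using Arg2pi_eq[of z] by simp
  have "Arg2pi z \<noteq> 0" using assms Arg2pi_eq_0 by blast
  then show "- pi < Arg2pi z - pi" using Arg2pi_ge_0[of z] by linarith
  show "Arg2pi z - pi \<le> pi" using Arg2pi_lt_2pi[of z] by linarith
qed (use assms in simp)

text \<open>The angle sum of the triangle with corners 0, 1 and \<open>z\<close>: up to a common
  orientation, the arguments on the left are the angles at 1 and at \<open>z\<close>, while the
  angle at 0 is measured by \<open>Arg2pi\<close>. Positive real \<open>z\<close> is excluded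
  because two corners would lie in the same direction from 0.\<close>

lemma Arg_triangle:
  assumes z: "z \<noteq> 0" "\<not> (z \<in> \<real> \<and> 0 \<le> Re z)"
  shows "Arg (1 - z) - Arg (1 - 1 / z) = Arg2pi z - pi"
proof -
  define p q where "p = 1 - z" and "q = 1 - 1 / z"
  have pq: "p = - z * q" using z by (simp add: p_def q_def field_simps)
  have "z \<noteq> 1" using z by auto
  then have nz: "p \<noteq> 0" "q \<noteq> 0" using z by (auto simp: p_def q_def)
  show ?thesis
  proof (cases "Im z = 0")
    case True
    then have "z \<in> \<real>" by (simp add: complex_is_Real_iff)
    then have neg: "Re z < 0" using z by auto
    then obtain r where r: "z = of_real r" "r < 0" using True by (metis complex_is_Real_iff of_real_Re)
    have "1 - z = of_real (1 - r)" "1 - 1 / z = of_real (1 - 1 / r)" using r by simp_all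
    then have "Arg (1 - z) = 0" "Arg (1 - 1 / z) = 0" using r by (simp_all only: Arg_of_real) (auto simp: field_simps)
    moreover have "Arg2pi z = pi" using Arg2pi_eq_pi \<open>z \<in> \<real>\<close> neg by blast
    ultimately show ?thesis by simp
  next
    case False
    have "cis (Arg p - Arg q - Arg (- z)) = 1"
    proof -
      have "cis (Arg p - Arg q - Arg (- z)) = sgn p / sgn q / sgn (- z)"
        using nz z by (simp add: cis_divide[symmetric] cis_Arg)
      also have "\<dots> = 1" unfolding pq using nz z by (simp add: sgn_mult sgn_zero_iff)
      finally show ?thesis .
    qed
    then have "cos (Arg p - Arg q - Arg (- z)) = 1" by (simp add: complex_eq_iff)
    then obtain k :: int where k: "Arg p - Arg q - Arg (- z) = of_int k * 2 * pi" using cos_one_2pi_int by blast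
    have iq: "Im q = Im z / (norm z)^2" unfolding q_def by (simp add: Im_divide cmod_power2)
    have "0 < (norm z)^2" using z by simp
    then have sq: "Im q > 0 \<longleftrightarrow> Im z > 0" "Im q < 0 \<longleftrightarrow> Im z < 0"
      unfolding iq by (simp_all add: zero_less_divide_iff divide_less_0_iff)
    have "\<bar>Arg p - Arg q - Arg (- z)\<bar> < 1 * (2 * pi)"
    proof (cases "Im z > 0")
      case True
      have "Arg p < 0" "0 < Arg q" "Arg q < pi" "Arg (- z) < 0" "- pi < Arg p" "- pi < Arg (- z)"
        using True sq Arg_lt_pi[of q] Arg_neg_iff[of p] Arg_neg_iff[of "- z"] mpi_less_Arg by (auto simp: p_def)
      then show ?thesis unfolding abs_less_iff by linarith
    next
      case f: False
      then have "Im z < 0" using False by simp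
      then have "0 < Arg p" "Arg p < pi" "Arg q < 0" "- pi < Arg q" "0 < Arg (- z)" "Arg (- z) < pi"
        using sq Arg_lt_pi[of p] Arg_lt_pi[of "- z"] Arg_neg_iff[of q] mpi_less_Arg by (auto simp: p_def)
      then show ?thesis unfolding abs_less_iff by linarith
    qed
    then have "\<bar>real_of_int k\<bar> * (2 * pi) < 1 * (2 * pi)" unfolding k by (simp add: abs_mult)
    then have "\<bar>real_of_int k\<bar> < 1" by (rule mult_right_less_imp_less) simp
    then have "k = 0" by linarith
    then show ?thesis using k Arg_uminus_Arg2pi[OF z] by (simp add: p_def q_def)
  qed
qed

text \<open>The signed angle under which the edge appears from \<open>c\<close>. It is set to 0 at
  the two ends, where no angle is defined.\<close>

definition seen_angle :: "complex \<Rightarrow> edge \<Rightarrow> real" where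
  "seen_angle c e = (if c = fst e \<or> c = snd e then 0 else Arg ((snd e - c) / (fst e - c)))"

text \<open>The change of direction of the vector from \<open>x\<close> to \<open>y\<close> around
  the boundary of the rectangle of all pairs with \<open>x\<close> on \<open>e\<close> and
  \<open>y\<close> on \<open>f\<close>, one summand for each side of the rectangle.\<close>

definition edge_linking :: "edge \<Rightarrow> edge \<Rightarrow> real" where
  "edge_linking e f = seen_angle (fst f) e - seen_angle (snd f) e - seen_angle (fst e) f + seen_angle (snd e) f"

lemma edge_linking_self [simp]: "edge_linking e e = 0"
  by (simp add: edge_linking_def seen_angle_def)

text \<open>Along two disjoint segments the difference vector stays in an open half plane, so that its
  direction has winding number zero around the boundary of the product of the segments.\<close>

lemma edge_linking_disjoint:
  assumes "closed_segment (fst e) (snd e) \<inter> closed_segment (fst f) (snd f) = {}"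
  shows "edge_linking e f = 0"
proof -
  obtain a b c d where ef: "e = (a, b)" "f = (c, d)" by (cases e; cases f) auto
  have dis: "closed_segment a b \<inter> closed_segment c d = {}" using assms by (simp add: ef)
  have ne: "c \<noteq> a" "c \<noteq> b" "d \<noteq> a" "d \<noteq> b" using dis by auto
  \<comment> \<open>Multiplication by the conjugate of the normal \<open>h\<close> of a separating
    line moves all difference vectors into the right half plane, where arguments of quotients are
    differences of arguments.\<close>
  obtain h \<beta> where h: "\<forall>x\<in>closed_segment a b. inner h x < \<beta>" "\<forall>y\<in>closed_segment c d. inner h y > \<beta>"
    using separating_hyperplane_compact_closed[OF convex_closed_segment compact_segment _ convex_closed_segment closed_segment dis]
    by auto
  have pos: "Re (cnj h * (y - x)) > 0" if "x \<in> {a, b}" "y \<in> {c, d}" for x y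
  proof -
    have "inner h x < \<beta>" "inner h y > \<beta>" using h that by auto
    then have "inner h (y - x) > 0" by (simp add: inner_diff_right)
    then show ?thesis by (simp add: inner_complex_def)
  qed
  have h0: "h \<noteq> 0" using pos[of a c] by auto
  define g where "g x y = Arg (cnj h * (y - x))" for x y
  have r: "Arg ((y - x) / (y' - x')) = g x y - g x' y'" if "x \<in> {a, b}" "y \<in> {c, d}" "x' \<in> {a, b}" "y' \<in> {c, d}" for x y x' y'
  proof -
    have "(y - x) / (y' - x') = (cnj h * (y - x)) / (cnj h * (y' - x'))" using h0 by simp
    then show ?thesis unfolding g_def using Arg_divide_right_half[OF pos pos] that by metis
  qed
  have neg: "(x - y) / (x' - y') = (y - x) / (y' - x')" for x y x' y' :: complex
    by (metis minus_diff_eq minus_divide_divide)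
  have "seen_angle c e = g b c - g a c" "seen_angle d e = g b d - g a d"
    unfolding seen_angle_def ef using ne r by (simp_all add: neg[of _ c _ c] neg[of _ d _ d])
  moreover have "seen_angle a f = g a d - g a c" "seen_angle b f = g b d - g b c"
    unfolding seen_angle_def ef using ne r by auto
  ultimately show ?thesis unfolding edge_linking_def by (simp add: ef)
qed

text \<open>Reversal inverts the quotient. This negates the argument unless it is \<open>pi\<close>,
  and then the two ends lie in opposite directions from \<open>c\<close>, so that \<open>c\<close>
  is between them.\<close>

lemma seen_angle_reverse:
  assumes "c \<notin> closed_segment a b"
  shows "seen_angle c (b, a) = - seen_angle c (a, b)"
proof -
  have ne: "c \<noteq> a" "c \<noteq> b" using assms by auto
  have "Arg ((b - c) / (a - c)) \<noteq> pi"
  proof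
    assume "Arg ((b - c) / (a - c)) = pi"
    then have *: "Re ((b - c) / (a - c)) < 0" "Im ((b - c) / (a - c)) = 0" by (simp_all add: Arg_eq_pi)
    define r where "r = - Re ((b - c) / (a - c))"
    have "(b - c) / (a - c) = of_real (- r)" using * by (simp add: r_def complex_eq_iff)
    then have bc: "b - c = of_real (- r) * (a - c)" using ne by (simp add: field_simps)
    have r: "r > 0" using * by (simp add: r_def)
    have "(1 + of_real r) * c = b + of_real r * a" using bc by (simp add: algebra_simps)
    moreover have "(1 + of_real r :: complex) \<noteq> 0" using r by (simp add: complex_eq_iff)
    ultimately have "c = (b + of_real r * a) / (1 + of_real r)" by (simp add: field_simps)
    also have "\<dots> = (r / (1 + r)) *\<^sub>R a + (1 / (1 + r)) *\<^sub>R b"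
      by (simp add: scaleR_conv_of_real add_divide_distrib)
    also have "r / (1 + r) = 1 - 1 / (1 + r)" using r by (simp add: field_simps)
    finally have "c \<in> closed_segment a b"
      unfolding closed_segment_def using r by (intro CollectI exI[of _ "1 / (1 + r)"]) auto
    with assms show False by simp
  qed
  then have "Arg (inverse ((b - c) / (a - c))) = - Arg ((b - c) / (a - c))"
  proof -
    have z: "(b - c) / (a - c) \<noteq> 0" using ne by simp
    assume np: "Arg ((b - c) / (a - c)) \<noteq> pi"
    show ?thesis
    proof (rule Arg_unique[of "inverse (norm ((b - c) / (a - c)))"])
      have "inverse (of_real (norm ((b - c) / (a - c))) * exp (\<i> * of_real (Arg ((b - c) / (a - c))))) = inverse ((b - c) / (a - c))"
        using Arg_eq[OF z] by simp
      then show "of_real (inverse (norm ((b - c) / (a - c)))) * exp (\<i> * of_real (- Arg ((b - c) / (a - c)))) = inverse ((b - c) / (a - c))"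
        by (simp only: inverse_mult_distrib of_real_inverse of_real_minus mult_minus_right exp_minus)
      show "0 < inverse (norm ((b - c) / (a - c)))" using z by simp
      show "- pi < - Arg ((b - c) / (a - c))" using np Arg_le_pi[of "(b - c) / (a - c)"] by linarith
      show "- Arg ((b - c) / (a - c)) \<le> pi" using mpi_less_Arg[of "(b - c) / (a - c)"] by linarith
    qed
  qed
  then show ?thesis using ne unfolding seen_angle_def by (simp add: inverse_eq_divide)
qed

text \<open>The triangle formula after the similarity that takes \<open>v\<close> to 0 and
  \<open>x\<close> to 1.\<close>

lemma seen_angle_common:
  assumes ne: "x \<noteq> v" "y \<noteq> v" "x \<noteq> y" and z: "\<not> ((y - v) / (x - v) \<in> \<real> \<and> 0 \<le> Re ((y - v) / (x - v)))"
  shows "seen_angle x (v, y) - seen_angle y (v, x) = Arg2pi ((y - v) / (x - v)) - pi"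
proof -
  define Z where "Z = (y - v) / (x - v)"
  have Z0: "Z \<noteq> 0" using ne by (simp add: Z_def)
  have vx: "x - v \<noteq> 0" "y - v \<noteq> 0" "v - x \<noteq> 0" "v - y \<noteq> 0" using ne by auto
  have "(y - x) / (v - x) = 1 - Z" unfolding Z_def using vx by (simp add: field_simps)
  moreover have "(x - y) / (v - y) = 1 - 1 / Z" unfolding Z_def using vx by (simp add: field_simps)
  ultimately have "seen_angle x (v, y) - seen_angle y (v, x) = Arg (1 - Z) - Arg (1 - 1 / Z)"
    unfolding seen_angle_def using ne by simp
  also have "\<dots> = Arg2pi Z - pi" by (rule Arg_triangle[OF Z0 z[folded Z_def]])
  finally show ?thesis unfolding Z_def .
qed

lemma same_direction_overlap:
  fixes v x y :: complex
  assumes "x \<noteq> v" "y \<noteq> v" "(y - v) / (x - v) \<in> \<real>" "0 \<le> Re ((y - v) / (x - v))"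
  shows "x \<in> closed_segment v y \<or> y \<in> closed_segment v x"
proof -
  define r where "r = Re ((y - v) / (x - v))"
  have "(y - v) / (x - v) = of_real r" using assms(3) by (simp add: r_def)
  then have yv: "y - v = r *\<^sub>R (x - v)" using assms(1) by (simp add: scaleR_conv_of_real field_simps)
  have "r \<ge> 0" using assms(4) by (simp add: r_def)
  moreover have "r \<noteq> 0" using yv assms(2) by auto
  ultimately have r: "r > 0" by simp
  show ?thesis
  proof (cases "r \<le> 1")
    case True
    have "y = (1 - r) *\<^sub>R v + r *\<^sub>R x" using yv by (simp add: algebra_simps)
    then have "y \<in> closed_segment v x" unfolding closed_segment_def using r True by auto
    then show ?thesis ..
  next
    case False
    have "(1 / r) *\<^sub>R (y - v) = x - v" using yv r by simp
    then have "x = (1 - 1 / r) *\<^sub>R v + (1 / r) *\<^sub>R y" by (simp add: algebra_simps)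
    then have "x \<in> closed_segment v y" unfolding closed_segment_def using r False
      by (intro CollectI exI[of _ "1 / r"]) auto
    then show ?thesis ..
  qed
qed

section \<open>The angles between all pairs of edges, summed in two ways\<close>

context planar_net begin

definition divergence :: "(edge \<Rightarrow> real) \<Rightarrow> complex \<Rightarrow> real" where
  "divergence m v = (\<Sum>e\<in>out_edges N v. m e) - (\<Sum>e\<in>in_edges N v. m e)"

lemma sum_fst: "(\<Sum>v\<in>verts N. \<Sum>e\<in>out_edges N v. F e v) = (\<Sum>e\<in>edges N. F e (fst e))" for F :: "edge \<Rightarrow> complex \<Rightarrow> real"
proof -
  have "(\<Sum>v\<in>verts N. \<Sum>e\<in>out_edges N v. F e v) = (\<Sum>v\<in>verts N. \<Sum>e | e \<in> edges N \<and> fst e = v. F e (fst e))"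
    by (intro sum.cong refl) (auto simp: out_edges_def)
  also have "\<dots> = (\<Sum>e\<in>edges N. F e (fst e))"
    by (rule sum.group[OF finite_edges finite_verts]) (use edges_verts in auto)
  finally show ?thesis .
qed

lemma sum_snd: "(\<Sum>v\<in>verts N. \<Sum>e\<in>in_edges N v. F e v) = (\<Sum>e\<in>edges N. F e (snd e))" for F :: "edge \<Rightarrow> complex \<Rightarrow> real"
proof -
  have "(\<Sum>v\<in>verts N. \<Sum>e\<in>in_edges N v. F e v) = (\<Sum>v\<in>verts N. \<Sum>e | e \<in> edges N \<and> snd e = v. F e (snd e))"
    by (intro sum.cong refl) (auto simp: in_edges_def)
  also have "\<dots> = (\<Sum>e\<in>edges N. F e (snd e))"
    by (rule sum.group[OF finite_edges finite_verts]) (use edges_verts in auto)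
  finally show ?thesis .
qed

text \<open>Summation by parts on the graph.\<close>

lemma sum_divergence:
  "(\<Sum>v\<in>verts N. divergence m v * g v) = (\<Sum>e\<in>edges N. m e * (g (fst e) - g (snd e)))"
proof -
  have "(\<Sum>v\<in>verts N. divergence m v * g v) = (\<Sum>v\<in>verts N. \<Sum>e\<in>out_edges N v. m e * g v) - (\<Sum>v\<in>verts N. \<Sum>e\<in>in_edges N v. m e * g v)"
    unfolding divergence_def left_diff_distrib sum_distrib_right sum_subtractf ..
  then show ?thesis unfolding sum_fst sum_snd by (simp add: right_diff_distrib sum_subtractf)
qed

text \<open>The first way of summing: the four angles of a pair are regrouped by the vertex from
  which an edge is seen, and summation by parts replaces a flow by its divergence there.\<close>

lemma linking_sum_divergence:
  "(\<Sum>e\<in>edges N. \<Sum>f\<in>edges N. m e * m' f * edge_linking e f)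
    = (\<Sum>c\<in>verts N. divergence m' c * (\<Sum>e\<in>edges N. m e * seen_angle c e))
      - (\<Sum>a\<in>verts N. divergence m a * (\<Sum>f\<in>edges N. m' f * seen_angle a f))"
proof -
  have 1: "(\<Sum>e\<in>edges N. \<Sum>f\<in>edges N. m e * m' f * (seen_angle (fst f) e - seen_angle (snd f) e))
    = (\<Sum>c\<in>verts N. divergence m' c * (\<Sum>e\<in>edges N. m e * seen_angle c e))"
  proof -
    have "(\<Sum>c\<in>verts N. divergence m' c * (\<Sum>e\<in>edges N. m e * seen_angle c e))
      = (\<Sum>f\<in>edges N. m' f * ((\<Sum>e\<in>edges N. m e * seen_angle (fst f) e) - (\<Sum>e\<in>edges N. m e * seen_angle (snd f) e)))"
      by (rule sum_divergence)
    also have "\<dots> = (\<Sum>f\<in>edges N. \<Sum>e\<in>edges N. m e * m' f * (seen_angle (fst f) e - seen_angle (snd f) e))"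
      unfolding sum_subtractf[symmetric] sum_distrib_left by (intro sum.cong refl) (simp add: algebra_simps)
    also have "\<dots> = (\<Sum>e\<in>edges N. \<Sum>f\<in>edges N. m e * m' f * (seen_angle (fst f) e - seen_angle (snd f) e))" by (rule sum.swap)
    finally show ?thesis ..
  qed
  have 2: "(\<Sum>e\<in>edges N. \<Sum>f\<in>edges N. m e * m' f * (seen_angle (fst e) f - seen_angle (snd e) f))
    = (\<Sum>a\<in>verts N. divergence m a * (\<Sum>f\<in>edges N. m' f * seen_angle a f))"
  proof -
    have "(\<Sum>a\<in>verts N. divergence m a * (\<Sum>f\<in>edges N. m' f * seen_angle a f))
      = (\<Sum>e\<in>edges N. m e * ((\<Sum>f\<in>edges N. m' f * seen_angle (fst e) f) - (\<Sum>f\<in>edges N. m' f * seen_angle (snd e) f)))"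
      by (rule sum_divergence)
    also have "\<dots> = (\<Sum>e\<in>edges N. \<Sum>f\<in>edges N. m e * m' f * (seen_angle (fst e) f - seen_angle (snd e) f))"
      unfolding sum_subtractf[symmetric] sum_distrib_left by (intro sum.cong refl) (simp add: algebra_simps)
    finally show ?thesis ..
  qed
  show ?thesis unfolding 1[symmetric] 2[symmetric] sum_subtractf[symmetric] edge_linking_def
    by (intro sum.cong refl) (simp add: algebra_simps)
qed

definition incident :: "complex \<Rightarrow> edge set" where
  "incident v = in_edges N v \<union> out_edges N v"

definition outwards :: "complex \<Rightarrow> edge \<Rightarrow> real" where
  "outwards v e = (if fst e = v then 1 else - 1)"

lemma incident_iff: "e \<in> incident v \<longleftrightarrow> e \<in> edges N \<and> (fst e = v \<or> snd e = v)"
  by (auto simp: incident_def in_edges_def out_edges_def)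

lemma incident_ends:
  assumes "e \<in> incident v"
  shows "edge_dir v e \<noteq> 0" "outwards v e = 1 \<and> e = (v, v + edge_dir v e) \<or> outwards v e = - 1 \<and> e = (v + edge_dir v e, v)"
    "closed_segment (fst e) (snd e) = closed_segment v (v + edge_dir v e)"
    "{fst e, snd e} = {v, v + edge_dir v e}"
  using assms edge_ne[of e] by (cases e; auto simp: incident_iff edge_dir_def outwards_def closed_segment_commute)+

text \<open>Two edges that leave \<open>v\<close> in the same direction would overlap, with the
  nearer end on the other edge. Disjointness only allows common ends, and equal ends would give a
  common segment, which is infinite.\<close>

lemma incident_distinct:
  assumes e: "e \<in> incident v" and f: "f \<in> incident v" and ne: "e \<noteq> f"
  shows "\<not> (edge_dir v f / edge_dir v e \<in> \<real> \<and> 0 \<le> Re (edge_dir v f / edge_dir v e))"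
    and "v + edge_dir v e \<notin> closed_segment v (v + edge_dir v f)"
proof -
  have ee: "e \<in> edges N" "f \<in> edges N" using e f by (auto simp: incident_iff)
  have sub: "closed_segment v (v + edge_dir v e) \<inter> closed_segment v (v + edge_dir v f) \<subseteq> {fst e, snd e} \<inter> {fst f, snd f}"
    using edge_disj[OF ee ne] unfolding incident_ends(3)[OF e] incident_ends(3)[OF f] .
  have xy: "v + edge_dir v e \<noteq> v + edge_dir v f"
  proof
    assume eq: "v + edge_dir v e = v + edge_dir v f"
    have "closed_segment v (v + edge_dir v e) \<subseteq> {fst e, snd e}" using sub unfolding eq by blast
    moreover have "infinite (closed_segment v (v + edge_dir v e))"
      using incident_ends(1)[OF e] by simp
    ultimately show False by (meson finite.emptyI finite.insertI finite_subset)
  qed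
  have n1: "v + edge_dir v e \<notin> closed_segment v (v + edge_dir v f)"
  proof
    assume "v + edge_dir v e \<in> closed_segment v (v + edge_dir v f)"
    then have "v + edge_dir v e \<in> {v, v + edge_dir v f}" using sub incident_ends(4)[OF f] by auto
    then show False using incident_ends(1)[OF e] xy by auto
  qed
  have n2: "v + edge_dir v f \<notin> closed_segment v (v + edge_dir v e)"
  proof
    assume "v + edge_dir v f \<in> closed_segment v (v + edge_dir v e)"
    then have "v + edge_dir v f \<in> {v, v + edge_dir v e}" using sub incident_ends(4)[OF e] by auto
    then show False using incident_ends(1)[OF f] xy by auto
  qed
  show "v + edge_dir v e \<notin> closed_segment v (v + edge_dir v f)" by (rule n1)
  show "\<not> (edge_dir v f / edge_dir v e \<in> \<real> \<and> 0 \<le> Re (edge_dir v f / edge_dir v e))"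
    using same_direction_overlap[of "v + edge_dir v e" v "v + edge_dir v f"] n1 n2 incident_ends(1)[OF e] incident_ends(1)[OF f] by auto
qed

text \<open>Angles seen from the common vertex are 0 by convention. The remaining two are the ones
  of \<open>seen_angle_common\<close>, with signs for edges that point towards
  \<open>v\<close>.\<close>

lemma edge_linking_incident:
  assumes e: "e \<in> incident v" and f: "f \<in> incident v" and ne: "e \<noteq> f"
  shows "edge_linking e f = outwards v e * outwards v f * (cw_angle v f e - pi)"
proof -
  define x y where "x = v + edge_dir v e" and "y = v + edge_dir v f"
  have xv: "x \<noteq> v" "y \<noteq> v" using incident_ends(1)[OF e] incident_ends(1)[OF f] by (auto simp: x_def y_def)
  have ns: "x \<notin> closed_segment v y" "y \<notin> closed_segment v x"
    unfolding x_def y_def by (rule incident_distinct(2)[OF e f ne], rule incident_distinct(2)[OF f e ne[symmetric]])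
  then have xy: "x \<noteq> y" by auto
  have q: "(y - v) / (x - v) = edge_dir v f / edge_dir v e" by (simp add: x_def y_def)
  have main: "seen_angle x (v, y) - seen_angle y (v, x) = cw_angle v f e - pi"
    using seen_angle_common[OF xv xy] incident_distinct(1)[OF e f ne] unfolding q cw_angle_def by simp
  have se: "seen_angle y e = outwards v e * seen_angle y (v, x)"
    using incident_ends(2)[OF e] seen_angle_reverse[OF ns(2)] unfolding x_def[symmetric] by auto
  have sf: "seen_angle x f = outwards v f * seen_angle x (v, y)"
    using incident_ends(2)[OF f] seen_angle_reverse[OF ns(1)] unfolding y_def[symmetric] by auto
  have z: "seen_angle v e = 0" "seen_angle v f = 0" using e f by (auto simp: seen_angle_def incident_iff)
  have "edge_linking e f = outwards v e * seen_angle x f - outwards v f * seen_angle y e"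
    using incident_ends(2)[OF e] incident_ends(2)[OF f] z unfolding x_def[symmetric] y_def[symmetric] edge_linking_def by auto
  also have "\<dots> = outwards v e * outwards v f * (seen_angle x (v, y) - seen_angle y (v, x))"
    unfolding se sf by (simp add: algebra_simps)
  finally show ?thesis unfolding main .
qed

lemma common_vertex_unique:
  assumes "e \<in> incident v" "f \<in> incident v" "e \<in> incident u" "f \<in> incident u" "e \<noteq> f"
  shows "u = v"
proof (rule ccontr)
  assume "u \<noteq> v"
  then have "v + edge_dir v e = u" "v + edge_dir v f = u"
    using assms(1-4) by (auto simp: incident_iff edge_dir_def)
  then show False using incident_distinct(2)[OF assms(1,2,5)] by simp
qed

text \<open>The second way of summing: pairs without a common vertex contribute nothing, and two
  distinct edges have at most one vertex in common, to which their term is assigned.\<close>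

lemma linking_sum_local:
  "(\<Sum>e\<in>edges N. \<Sum>f\<in>edges N. m e * m' f * edge_linking e f)
    = (\<Sum>v\<in>verts N. \<Sum>e\<in>incident v. \<Sum>f\<in>incident v - {e}. m e * outwards v e * (m' f * outwards v f) * (cw_angle v f e - pi))"
proof -
  define T where "T e f = m e * m' f * edge_linking e f" for e f
  have local: "T e f = (\<Sum>v\<in>verts N. if e \<in> incident v \<and> f \<in> incident v \<and> f \<noteq> e then T e f else 0)"
    if ef: "e \<in> edges N" "f \<in> edges N" for e f
  proof (cases "e = f")
    case True
    then show ?thesis by (simp add: T_def)
  next
    case False
    show ?thesis
    proof (cases "\<exists>v. e \<in> incident v \<and> f \<in> incident v")
      case True
      then obtain v where v: "e \<in> incident v" "f \<in> incident v" by blast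
      then have "v \<in> verts N" using edges_verts by (auto simp: incident_iff)
      moreover have "(e \<in> incident u \<and> f \<in> incident u \<and> f \<noteq> e) \<longleftrightarrow> u = v" for u
        using common_vertex_unique[OF v] v False by blast
      ultimately show ?thesis using finite_verts by simp
    next
      case no: False
      then have "{fst e, snd e} \<inter> {fst f, snd f} = {}" using ef by (auto simp: incident_iff)
      then have "edge_linking e f = 0"
        using edge_disj[OF ef False] by (intro edge_linking_disjoint) blast
      moreover have "(\<Sum>v\<in>verts N. if e \<in> incident v \<and> f \<in> incident v \<and> f \<noteq> e then T e f else 0) = 0"
        by (intro sum.neutral ballI) (use no in auto)
      ultimately show ?thesis by (simp add: T_def)
    qed
  qed
  have "(\<Sum>e\<in>edges N. \<Sum>f\<in>edges N. T e f)
    = (\<Sum>e\<in>edges N. \<Sum>f\<in>edges N. \<Sum>v\<in>verts N. if e \<in> incident v \<and> f \<in> incident v \<and> f \<noteq> e then T e f else 0)"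
    by (intro sum.cong refl local)
  also have "\<dots> = (\<Sum>e\<in>edges N. \<Sum>v\<in>verts N. \<Sum>f\<in>edges N. if e \<in> incident v \<and> f \<in> incident v \<and> f \<noteq> e then T e f else 0)"
    by (intro sum.cong refl sum.swap)
  also have "\<dots> = (\<Sum>v\<in>verts N. \<Sum>e\<in>edges N. \<Sum>f\<in>edges N. if e \<in> incident v \<and> f \<in> incident v \<and> f \<noteq> e then T e f else 0)"
    by (rule sum.swap)
  also have "\<dots> = (\<Sum>v\<in>verts N. \<Sum>e\<in>incident v. \<Sum>f\<in>incident v - {e}. m e * outwards v e * (m' f * outwards v f) * (cw_angle v f e - pi))"
  proof (rule sum.cong[OF refl])
    fix v
    have sub: "incident v \<subseteq> edges N" by (auto simp: incident_iff)
    have "(\<Sum>e\<in>edges N. \<Sum>f\<in>edges N. if e \<in> incident v \<and> f \<in> incident v \<and> f \<noteq> e then T e f else 0)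
      = (\<Sum>e\<in>incident v. \<Sum>f\<in>edges N. if e \<in> incident v \<and> f \<in> incident v \<and> f \<noteq> e then T e f else 0)"
      by (rule sum.mono_neutral_right[OF finite_edges sub]) auto
    also have "\<dots> = (\<Sum>e\<in>incident v. \<Sum>f\<in>incident v - {e}. T e f)"
    proof (rule sum.cong[OF refl])
      fix e assume e: "e \<in> incident v"
      have "(\<Sum>f\<in>edges N. if e \<in> incident v \<and> f \<in> incident v \<and> f \<noteq> e then T e f else 0)
        = (\<Sum>f\<in>incident v - {e}. if e \<in> incident v \<and> f \<in> incident v \<and> f \<noteq> e then T e f else 0)"
        by (rule sum.mono_neutral_right[OF finite_edges]) (use sub in auto)
      also have "\<dots> = (\<Sum>f\<in>incident v - {e}. T e f)" using e by (intro sum.cong refl) auto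
      finally show "(\<Sum>f\<in>edges N. if e \<in> incident v \<and> f \<in> incident v \<and> f \<noteq> e then T e f else 0) = (\<Sum>f\<in>incident v - {e}. T e f)" .
    qed
    also have "\<dots> = (\<Sum>e\<in>incident v. \<Sum>f\<in>incident v - {e}. m e * outwards v e * (m' f * outwards v f) * (cw_angle v f e - pi))"
      unfolding T_def by (intro sum.cong refl) (simp add: edge_linking_incident[OF _ _ not_sym])
    finally show "(\<Sum>e\<in>edges N. \<Sum>f\<in>edges N. if e \<in> incident v \<and> f \<in> incident v \<and> f \<noteq> e then T e f else 0)
      = (\<Sum>e\<in>incident v. \<Sum>f\<in>incident v - {e}. m e * outwards v e * (m' f * outwards v f) * (cw_angle v f e - pi))" .
  qed
  finally show ?thesis unfolding T_def .
qed

end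

section \<open>The contribution of a single vertex\<close>

context planar_net begin

lemma cw_angle_incident:
  assumes e: "e \<in> incident v" and f: "f \<in> incident v" and ne: "e \<noteq> f"
  shows "0 < cw_angle v e f" "cw_angle v e f < 2 * pi" "cw_angle v f e = 2 * pi - cw_angle v e f"
proof -
  let ?z = "edge_dir v e / edge_dir v f"
  have nr: "\<not> (?z \<in> \<real> \<and> 0 \<le> Re ?z)" by (rule incident_distinct(1)[OF f e ne[symmetric]])
  then show p: "0 < cw_angle v e f" unfolding cw_angle_def using Arg2pi_eq_0[of ?z] Arg2pi_ge_0[of ?z] by linarith
  show "cw_angle v e f < 2 * pi" unfolding cw_angle_def by (rule Arg2pi_lt_2pi)
  have inv: "edge_dir v f / edge_dir v e = inverse ?z" by simp
  show "cw_angle v f e = 2 * pi - cw_angle v e f"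
  proof (cases "?z \<in> \<real>")
    case True
    then have "Arg2pi ?z = pi" using nr by (simp add: Arg2pi_real)
    then show ?thesis unfolding cw_angle_def inv Arg2pi_inverse using True by simp
  next
    case False
    then show ?thesis unfolding cw_angle_def inv Arg2pi_inverse by simp
  qed
qed

lemma cw_angle_diff:
  assumes e: "e \<in> incident v" and f: "f \<in> incident v" and g: "g \<in> incident v"
    and lt: "cw_angle v e f \<le> cw_angle v e g"
  shows "cw_angle v f g = cw_angle v e g - cw_angle v e f"
proof -
  note nz = incident_ends(1)[OF e] incident_ends(1)[OF f] incident_ends(1)[OF g]
  have "edge_dir v f / edge_dir v g = (edge_dir v e / edge_dir v g) / (edge_dir v e / edge_dir v f)" using nz by simp
  then show ?thesis unfolding cw_angle_def using Arg2pi_divide[of "edge_dir v e / edge_dir v f" "edge_dir v e / edge_dir v g"] nz lt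
    by (simp add: cw_angle_def)
qed

text \<open>The choice is possible because the other two edges have different clockwise angles from
  the first one; equal angles would mean equal directions.\<close>

lemma flag_edge_props:
  assumes v: "v \<in> inner_verts N"
  defines "h \<equiv> flag_edge N v"
  shows "h ` {1, 2, 3} = incident v" "h 1 \<in> (if white N v then in_edges N v else out_edges N v)"
    "0 < cw_angle v (h 1) (h 2)" "cw_angle v (h 1) (h 2) < cw_angle v (h 1) (h 3)"
proof -
  let ?P = "\<lambda>h :: nat \<Rightarrow> edge. h ` {1, 2, 3} = in_edges N v \<union> out_edges N v \<and>
     h 1 \<in> (if white N v then in_edges N v else out_edges N v) \<and>
     0 < cw_angle v (h 1) (h 2) \<and> cw_angle v (h 1) (h 2) < cw_angle v (h 1) (h 3)"
  have c3: "card (incident v) = 3" using inner(1)[OF v] by (simp add: incident_def)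
  have "(if white N v then in_edges N v else out_edges N v) \<noteq> {}"
    using inner_degrees(5)[OF v] by (auto simp: white_def black_def)
  then obtain s where s: "s \<in> (if white N v then in_edges N v else out_edges N v)" by blast
  then have si: "s \<in> incident v" by (auto simp: incident_def split: if_splits)
  then have "card (incident v - {s}) = 2" using c3 by simp
  then obtain f g where fg: "incident v - {s} = {f, g}" "f \<noteq> g" by (auto simp: card_2_iff)
  then have f: "f \<in> incident v" "g \<in> incident v" "f \<noteq> s" "g \<noteq> s" by auto
  have ne: "cw_angle v s f \<noteq> cw_angle v s g"
  proof
    assume "cw_angle v s f = cw_angle v s g"
    then have "cw_angle v f g = 0" using cw_angle_diff[OF si f(1,2)] by simp
    then show False using cw_angle_incident(1)[OF f(1,2) fg(2)] by simp
  qed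
  have ex: "?P (\<lambda>i. if i = 1 then s else if i = 2 then a else b)"
    if "incident v - {s} = {a, b}" "cw_angle v s a < cw_angle v s b" "a \<in> incident v" "a \<noteq> s" for a b
    using that s si cw_angle_incident(1)[OF si that(3) that(4)[symmetric]] by (auto simp: incident_def)
  have "\<exists>h. ?P h"
  proof (cases "cw_angle v s f < cw_angle v s g")
    case True
    then show ?thesis using ex[OF fg(1) True f(1,3)] by blast
  next
    case False
    then have "cw_angle v s g < cw_angle v s f" using ne by simp
    moreover have "incident v - {s} = {g, f}" using fg(1) by auto
    ultimately show ?thesis using ex[of g f] f by blast
  qed
  then have "?P h" unfolding h_def flag_edge_def by (rule someI_ex)
  then show "h ` {1, 2, 3} = incident v" "h 1 \<in> (if white N v then in_edges N v else out_edges N v)"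
    "0 < cw_angle v (h 1) (h 2)" "cw_angle v (h 1) (h 2) < cw_angle v (h 1) (h 3)"
    by (simp_all only: incident_def)
qed

lemma flag_edge_distinct:
  assumes v: "v \<in> inner_verts N"
  defines "h \<equiv> flag_edge N v"
  shows "h 1 \<in> incident v" "h 2 \<in> incident v" "h 3 \<in> incident v" "h 1 \<noteq> h 2" "h 1 \<noteq> h 3" "h 2 \<noteq> h 3"
    "incident v = {h 1, h 2, h 3}" "incident v - {h 1} = {h 2, h 3}"
proof -
  have im: "h ` {1, 2, 3} = incident v" using flag_edge_props(1)[OF v] by (simp add: h_def)
  then show "h 1 \<in> incident v" "h 2 \<in> incident v" "h 3 \<in> incident v" "incident v = {h 1, h 2, h 3}" by auto
  have "card (h ` {1, 2, 3}) = card {1, 2, 3 :: nat}" using inner(1)[OF v] unfolding im incident_def by simp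
  then have "inj_on h {1, 2, 3}" by (intro eq_card_imp_inj_on) auto
  then show ne: "h 1 \<noteq> h 2" "h 1 \<noteq> h 3" "h 2 \<noteq> h 3" by (auto simp: inj_on_def)
  then show "incident v - {h 1} = {h 2, h 3}" unfolding im[symmetric] by auto
qed

lemma flag_edge_white:
  assumes v: "v \<in> inner_verts N" and w: "white N v"
  defines "h \<equiv> flag_edge N v"
  shows "in_edges N v = {h 1}" "out_edges N v = {h 2, h 3}"
proof -
  have "h 1 \<in> in_edges N v" "card (in_edges N v) = 1" using flag_edge_props(2)[OF v] w by (simp_all add: h_def white_def)
  then show i: "in_edges N v = {h 1}" by (metis card_1_singletonE singletonD)
  show "out_edges N v = {h 2, h 3}"
    unfolding flag_edge_distinct(8)[OF v, folded h_def, symmetric] incident_def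
    using inner_degrees(3)[OF v] i by auto
qed

lemma flag_edge_black:
  assumes v: "v \<in> inner_verts N" and w: "\<not> white N v"
  defines "h \<equiv> flag_edge N v"
  shows "out_edges N v = {h 1}" "in_edges N v = {h 2, h 3}"
proof -
  have "h 1 \<in> out_edges N v" "card (out_edges N v) = 1"
    using flag_edge_props(2)[OF v] w inner_degrees(5)[OF v] by (simp_all add: h_def black_def)
  then show i: "out_edges N v = {h 1}" by (metis card_1_singletonE singletonD)
  show "in_edges N v = {h 2, h 3}"
    unfolding flag_edge_distinct(8)[OF v, folded h_def, symmetric] incident_def
    using inner_degrees(3)[OF v] i by auto
qed

lemma divergence_outwards: "divergence m v = (\<Sum>e\<in>incident v. m e * outwards v e)"
proof -
  have fin: "finite (in_edges N v)" "finite (out_edges N v)" using finite_edges by (auto simp: in_edges_def out_edges_def)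
  have "in_edges N v \<inter> out_edges N v = {}" using edge_ne by (auto simp: in_edges_def out_edges_def)
  then have "(\<Sum>e\<in>incident v. m e * outwards v e) = (\<Sum>e\<in>in_edges N v. m e * outwards v e) + (\<Sum>e\<in>out_edges N v. m e * outwards v e)"
    unfolding incident_def using fin by (intro sum.union_disjoint)
  also have "(\<Sum>e\<in>in_edges N v. m e * outwards v e) = (\<Sum>e\<in>in_edges N v. - m e)"
    using edge_ne by (intro sum.cong refl) (auto simp: in_edges_def outwards_def)
  also have "(\<Sum>e\<in>out_edges N v. m e * outwards v e) = (\<Sum>e\<in>out_edges N v. m e)"
    by (intro sum.cong refl) (auto simp: out_edges_def outwards_def)
  finally show ?thesis by (simp add: divergence_def sum_negf)
qed

definition flag_wedge :: "complex \<Rightarrow> (edge \<Rightarrow> real) \<Rightarrow> (edge \<Rightarrow> real) \<Rightarrow> real" where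
  "flag_wedge v m m' = m (flag_edge N v 2) * m' (flag_edge N v 3) - m (flag_edge N v 3) * m' (flag_edge N v 2)"

text \<open>Conservation eliminates the flow in the first flag. Then the actual angles
  \<open>A\<close> and \<open>B\<close> drop out and only the multiples of \<open>pi\<close> remain,
  so the result depends on the cyclic order of the flags but not on the drawing.\<close>

lemma local_linking_inner:
  assumes v: "v \<in> inner_verts N" and d: "divergence m v = 0" "divergence m' v = 0"
  shows "(\<Sum>e\<in>incident v. \<Sum>f\<in>incident v - {e}. m e * outwards v e * (m' f * outwards v f) * (cw_angle v f e - pi))
    = pi * flag_wedge v m m'"
proof -
  define h where "h = flag_edge N v"
  note hd = flag_edge_distinct[OF v, folded h_def]
  define \<mu> \<mu>' where "\<mu> k = m (h k) * outwards v (h k)" and "\<mu>' k = m' (h k) * outwards v (h k)" for k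
  define A B where "A = cw_angle v (h 1) (h 2)" and "B = cw_angle v (h 1) (h 3)"
  have AB: "A < B" using flag_edge_props(4)[OF v] by (simp add: A_def B_def h_def)
  have c21: "cw_angle v (h 2) (h 1) = 2 * pi - A" and c31: "cw_angle v (h 3) (h 1) = 2 * pi - B"
    unfolding A_def B_def by (rule cw_angle_incident(3); use hd in simp)+
  have c23: "cw_angle v (h 2) (h 3) = B - A"
    using cw_angle_diff[OF hd(1-3)] AB unfolding A_def B_def by simp
  have c32: "cw_angle v (h 3) (h 2) = 2 * pi - (B - A)"
    unfolding c23[symmetric] by (rule cw_angle_incident(3)) (use hd in simp_all)
  have s: "\<mu> 1 = - \<mu> 2 - \<mu> 3" "\<mu>' 1 = - \<mu>' 2 - \<mu>' 3"
    using d hd(4-6) unfolding divergence_outwards hd(7) \<mu>_def \<mu>'_def by simp_all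
  have out23: "outwards v (h 2) = outwards v (h 3)"
  proof (cases "white N v")
    case True
    then show ?thesis using flag_edge_white(2)[OF v True] by (auto simp: h_def out_edges_def outwards_def)
  next
    case False
    have "h 2 \<in> in_edges N v" "h 3 \<in> in_edges N v" using flag_edge_black(2)[OF v False] by (auto simp: h_def)
    then show ?thesis using edge_ne[of "h 2"] edge_ne[of "h 3"] by (auto simp: in_edges_def outwards_def)
  qed
  have oo: "outwards v (h 3) * outwards v (h 3) = 1" by (simp add: outwards_def)
  have e1: "incident v - {h 1} = {h 2, h 3}" "incident v - {h 2} = {h 1, h 3}" "incident v - {h 3} = {h 1, h 2}"
    unfolding hd(7) using hd(4-6) by auto
  have "(\<Sum>e\<in>incident v. \<Sum>f\<in>incident v - {e}. m e * outwards v e * (m' f * outwards v f) * (cw_angle v f e - pi))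
    = (\<mu> 1 * \<mu>' 2 * (pi - A) + \<mu> 1 * \<mu>' 3 * (pi - B)) + (\<mu> 2 * \<mu>' 1 * (A - pi) + \<mu> 2 * \<mu>' 3 * (pi - (B - A)))
      + (\<mu> 3 * \<mu>' 1 * (B - pi) + \<mu> 3 * \<mu>' 2 * ((B - A) - pi))"
  proof -
    have "(\<Sum>e\<in>incident v. G e) = G (h 1) + G (h 2) + G (h 3)" for G :: "edge \<Rightarrow> real"
      unfolding hd(7) using hd(4-6) by simp
    then show ?thesis using hd(4-6)
      by (simp add: e1 c21 c31 c23 c32 A_def[symmetric] B_def[symmetric] \<mu>_def \<mu>'_def del: One_nat_def)
  qed
  also have "\<dots> = pi * (\<mu> 2 * \<mu>' 3 - \<mu> 3 * \<mu>' 2)" unfolding s by (simp add: algebra_simps)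
  also have "\<mu> 2 * \<mu>' 3 - \<mu> 3 * \<mu>' 2 = (m (h 2) * m' (h 3) - m (h 3) * m' (h 2)) * (outwards v (h 3) * outwards v (h 3))"
    unfolding \<mu>_def \<mu>'_def out23 by (simp add: algebra_simps)
  finally show ?thesis unfolding oo flag_wedge_def h_def[symmetric] by simp
qed

lemma incident_boundary: "i \<in> {1..n} \<Longrightarrow> \<exists>e. incident (bpt N i) = {e}"
  using boundary_edges[of i] unfolding incident_def by (auto simp: card_1_singleton_iff)

lemma verts_split: "(\<Sum>v\<in>verts N. g v) = (\<Sum>v\<in>inner_verts N. g v) + (\<Sum>i\<in>{1..n}. g (bpt N i))" for g :: "complex \<Rightarrow> real"
proof -
  have "verts N = inner_verts N \<union> bpt N ` {1..n}" by (auto simp: verts_def bdry_verts_eq)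
  moreover have "inner_verts N \<inter> bpt N ` {1..n} = {}" using bpt_not_inner by auto
  ultimately have "(\<Sum>v\<in>verts N. g v) = (\<Sum>v\<in>inner_verts N. g v) + (\<Sum>v\<in>bpt N ` {1..n}. g v)"
    by (simp add: sum.union_disjoint finite_inner)
  then show ?thesis by (simp only: sum.reindex[OF bpt_inj] o_def)
qed

lemma linking_sum_inner:
  assumes "\<And>v. v \<in> inner_verts N \<Longrightarrow> divergence m v = 0" "\<And>v. v \<in> inner_verts N \<Longrightarrow> divergence m' v = 0"
  shows "(\<Sum>e\<in>edges N. \<Sum>f\<in>edges N. m e * m' f * edge_linking e f) = pi * (\<Sum>v\<in>inner_verts N. flag_wedge v m m')"
proof -
  have b: "(\<Sum>e\<in>incident (bpt N i). \<Sum>f\<in>incident (bpt N i) - {e}. m e * outwards (bpt N i) e * (m' f * outwards (bpt N i) f) * (cw_angle (bpt N i) f e - pi)) = 0"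
    if i: "i \<in> {1..n}" for i
  proof -
    obtain e where "incident (bpt N i) = {e}" using incident_boundary[OF i] by blast
    then show ?thesis by simp
  qed
  show ?thesis unfolding linking_sum_local verts_split sum_distrib_left
    using b by (simp add: local_linking_inner assms)
qed

text \<open>Seen from a boundary point, the closed disk lies in a half plane, so directions have a
  continuous argument there; the value at the boundary point itself is chosen such that its edge is
  seen under angle zero.\<close>

definition boundary_arg :: "complex \<Rightarrow> complex \<Rightarrow> real" where
  "boundary_arg c z = (if z = c then Arg (1 - (c + edge_dir c (THE e. incident c = {e})) / c) else Arg (1 - z / c))"

lemma Re_one_minus_pos:
  fixes c z :: complex
  assumes "norm c = 1" "norm z \<le> 1" "z \<noteq> c"
  shows "Re (1 - z / c) > 0"
proof -
  have n: "norm (z / c) \<le> 1" using assms by (simp add: norm_divide)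
  have "z / c \<noteq> 1" using assms by auto
  have "Re (z / c) \<le> norm (z / c)" by (rule complex_Re_le_cmod)
  moreover have "Re (z / c) \<noteq> 1"
  proof
    assume r: "Re (z / c) = 1"
    then have "(Im (z / c))^2 \<le> 0" using n by (simp add: cmod_def)
    then have "Im (z / c) = 0" by simp
    then show False using r \<open>z / c \<noteq> 1\<close> by (simp add: complex_eq_iff)
  qed
  ultimately have "Re (z / c) < 1" using n by linarith
  then show ?thesis by simp
qed

text \<open>From a boundary point all other vertices are seen in an open half plane, so the angle of
  an edge is a difference of values of a potential. For the edge at the point itself, the special
  value of \<open>boundary_arg\<close> makes both sides 0.\<close>

lemma seen_angle_boundary:
  assumes i: "i \<in> {1..n}" and e: "e \<in> edges N"
  shows "seen_angle (bpt N i) e = boundary_arg (bpt N i) (snd e) - boundary_arg (bpt N i) (fst e)"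
proof -
  let ?c = "bpt N i"
  have nc: "norm ?c = 1" by (rule norm_bpt[OF i])
  then have c0: "?c \<noteq> 0" by auto
  have nv: "norm (fst e) \<le> 1" "norm (snd e) \<le> 1" using e edges_verts norm_verts by auto
  show ?thesis
  proof (cases "e \<in> incident ?c")
    case True
    then have inc: "incident ?c = {e}" using incident_boundary[OF i] by auto
    have the: "(THE e. incident ?c = {e}) = e" using inc by (auto intro!: the_equality)
    have x: "?c + edge_dir ?c e \<noteq> ?c" using incident_ends(1)[OF True] by simp
    have "boundary_arg ?c ?c = boundary_arg ?c (?c + edge_dir ?c e)" using x by (simp add: boundary_arg_def the)
    moreover have "seen_angle ?c e = 0" using True by (auto simp: seen_angle_def incident_iff)
    ultimately show ?thesis using incident_ends(2)[OF True] by (metis diff_self fst_conv snd_conv)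
  next
    case False
    then have ne: "fst e \<noteq> ?c" "snd e \<noteq> ?c" using e by (auto simp: incident_iff)
    have "(snd e - ?c) / (fst e - ?c) = (1 - snd e / ?c) / (1 - fst e / ?c)"
    proof -
      have eq: "1 - snd e / ?c = (snd e - ?c) * (- 1 / ?c)" "1 - fst e / ?c = (fst e - ?c) * (- 1 / ?c)"
        using c0 by (simp_all add: field_simps)
      have "- 1 / ?c \<noteq> 0" using c0 by simp
      then show ?thesis unfolding eq by (rule mult_divide_mult_cancel_right[symmetric])
    qed
    then have "Arg ((snd e - ?c) / (fst e - ?c)) = Arg (1 - snd e / ?c) - Arg (1 - fst e / ?c)"
      using Arg_divide_right_half[OF Re_one_minus_pos[OF nc nv(2) ne(2)] Re_one_minus_pos[OF nc nv(1) ne(1)]] by simp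
    then show ?thesis using ne by (auto simp: seen_angle_def boundary_arg_def)
  qed
qed

text \<open>The triangle formula for the centre and two boundary points. The angle at the centre
  splits into a function of \<open>a\<close> and a function of \<open>b\<close>, and only
  \<open>pi * sg a b\<close> couples the two.\<close>

lemma boundary_arg_diff:
  obtains \<theta> :: "nat \<Rightarrow> real" where "\<And>a b. a \<in> {1..n} \<Longrightarrow> b \<in> {1..n} \<Longrightarrow>
    boundary_arg (bpt N a) (bpt N b) - boundary_arg (bpt N b) (bpt N a) = \<theta> b - \<theta> a + pi * sg a b"
proof -
  from ccw obtain \<theta> where \<theta>: "\<forall>i\<in>{1..n}. bpt N i = cis (\<theta> i)"
      "\<forall>i\<in>{1..n}. \<forall>j\<in>{1..n}. i < j \<longrightarrow> \<theta> i < \<theta> j \<and> \<theta> j < \<theta> i + 2 * pi" unfolding ccw_on_circle_def by blast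
  have *: "boundary_arg (bpt N a) (bpt N b) - boundary_arg (bpt N b) (bpt N a) = \<theta> b - \<theta> a - pi"
    if ab: "a \<in> {1..n}" "b \<in> {1..n}" "a < b" for a b
  proof -
    have th: "\<theta> a < \<theta> b" "\<theta> b < \<theta> a + 2 * pi" using \<theta>(2)[rule_format, OF ab] by auto
    have ne: "bpt N a \<noteq> bpt N b" using inj_on_eq_iff[OF bpt_inj ab(1,2)] ab(3) by simp
    have nz: "bpt N a \<noteq> 0" "bpt N b \<noteq> 0" using norm_bpt[OF ab(1)] norm_bpt[OF ab(2)] by auto
    define z where "z = bpt N b / bpt N a"
    have zc: "z = cis (\<theta> b - \<theta> a)" using \<theta>(1) ab by (simp add: z_def cis_divide)
    have arg: "Arg2pi z = \<theta> b - \<theta> a"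
      by (rule Arg2pi_unique[of 1]) (use th zc in \<open>simp_all add: cis_conv_exp\<close>)
    have z0: "z \<noteq> 0" using nz by (simp add: z_def)
    have "\<not> (z \<in> \<real> \<and> 0 \<le> Re z)" using arg th Arg2pi_eq_0[of z] by auto
    from Arg_triangle[OF z0 this] show ?thesis
      using ne arg by (simp add: boundary_arg_def z_def)
  qed
  have "boundary_arg (bpt N a) (bpt N b) - boundary_arg (bpt N b) (bpt N a) = \<theta> b - \<theta> a + pi * sg a b"
    if ab: "a \<in> {1..n}" "b \<in> {1..n}" for a b
  proof -
    consider "a < b" | "a = b" | "b < a" by linarith
    then show ?thesis using *[OF ab] *[OF ab(2,1)] by cases (auto simp: sg_def)
  qed
  then show ?thesis by (rule that)
qed

theorem planar_flow_wedge:
  assumes d: "\<And>v. v \<in> inner_verts N \<Longrightarrow> divergence m v = 0" and d': "\<And>v. v \<in> inner_verts N \<Longrightarrow> divergence m' v = 0"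
  shows "(\<Sum>v\<in>inner_verts N. flag_wedge v m m')
    = (\<Sum>a\<in>{1..n}. \<Sum>b\<in>{1..n}. divergence m (bpt N a) * divergence m' (bpt N b) * sg a b)"
proof -
  define D D' where "D a = divergence m (bpt N a)" and "D' a = divergence m' (bpt N a)" for a
  obtain \<theta> where \<theta>: "\<And>a b. a \<in> {1..n} \<Longrightarrow> b \<in> {1..n} \<Longrightarrow>
    boundary_arg (bpt N a) (bpt N b) - boundary_arg (bpt N b) (bpt N a) = \<theta> b - \<theta> a + pi * sg a b"
    using boundary_arg_diff by blast
  have seen: "(\<Sum>e\<in>edges N. m e * seen_angle (bpt N b) e) = - (\<Sum>a\<in>{1..n}. divergence m (bpt N a) * boundary_arg (bpt N b) (bpt N a))"
    if "b \<in> {1..n}" and "\<And>v. v \<in> inner_verts N \<Longrightarrow> divergence m v = 0" for b m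
  proof -
    have "(\<Sum>e\<in>edges N. m e * seen_angle (bpt N b) e) = - (\<Sum>e\<in>edges N. m e * (boundary_arg (bpt N b) (fst e) - boundary_arg (bpt N b) (snd e)))"
      unfolding sum_negf[symmetric] by (intro sum.cong refl) (simp add: seen_angle_boundary[OF that(1)] algebra_simps)
    also have "\<dots> = - (\<Sum>v\<in>verts N. divergence m v * boundary_arg (bpt N b) v)" by (simp add: sum_divergence)
    finally show ?thesis unfolding verts_split using that(2) by simp
  qed
  \<comment> \<open>Summation by parts with the constant function 1. As the total divergence
    vanishes, the terms with \<theta> disappear, and with them the positions of the boundary
    points.\<close>
  have tot: "(\<Sum>a\<in>{1..n}. D a) = 0" "(\<Sum>a\<in>{1..n}. D' a) = 0"
    using sum_divergence[of m "\<lambda>_. 1"] sum_divergence[of m' "\<lambda>_. 1"] d d' unfolding verts_split D_def D'_def by simp_all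
  have "pi * (\<Sum>v\<in>inner_verts N. flag_wedge v m m') = (\<Sum>b\<in>{1..n}. D' b * (\<Sum>e\<in>edges N. m e * seen_angle (bpt N b) e))
      - (\<Sum>a\<in>{1..n}. D a * (\<Sum>f\<in>edges N. m' f * seen_angle (bpt N a) f))"
  proof -
    have z: "(\<Sum>v\<in>verts N. divergence m v * X v) = (\<Sum>a\<in>{1..n}. D a * X (bpt N a))"
      "(\<Sum>v\<in>verts N. divergence m' v * X v) = (\<Sum>a\<in>{1..n}. D' a * X (bpt N a))" for X
      unfolding verts_split D_def D'_def using d d' by simp_all
    have "pi * (\<Sum>v\<in>inner_verts N. flag_wedge v m m') = (\<Sum>e\<in>edges N. \<Sum>f\<in>edges N. m e * m' f * edge_linking e f)"
      by (rule linking_sum_inner[OF d d', symmetric])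
    then show ?thesis unfolding linking_sum_divergence z .
  qed
  also have "\<dots> = (\<Sum>b\<in>{1..n}. D' b * - (\<Sum>a\<in>{1..n}. D a * boundary_arg (bpt N b) (bpt N a)))
      - (\<Sum>a\<in>{1..n}. D a * - (\<Sum>b\<in>{1..n}. D' b * boundary_arg (bpt N a) (bpt N b)))"
    unfolding D_def D'_def using seen[OF _ d] seen[OF _ d'] by simp
  also have "(\<Sum>b\<in>{1..n}. D' b * - (\<Sum>a\<in>{1..n}. D a * boundary_arg (bpt N b) (bpt N a)))
    = (\<Sum>a\<in>{1..n}. \<Sum>b\<in>{1..n}. - (D a * D' b * boundary_arg (bpt N b) (bpt N a)))"
    unfolding sum_negf[symmetric] sum_distrib_left by (subst sum.swap) (simp add: mult_ac)
  also have "(\<Sum>a\<in>{1..n}. \<Sum>b\<in>{1..n}. - (D a * D' b * boundary_arg (bpt N b) (bpt N a)))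
      - (\<Sum>a\<in>{1..n}. D a * - (\<Sum>b\<in>{1..n}. D' b * boundary_arg (bpt N a) (bpt N b)))
    = (\<Sum>a\<in>{1..n}. \<Sum>b\<in>{1..n}. D a * D' b * (boundary_arg (bpt N a) (bpt N b) - boundary_arg (bpt N b) (bpt N a)))"
    unfolding sum_negf[symmetric] sum_distrib_left sum_subtractf[symmetric] by (intro sum.cong refl) (simp add: algebra_simps)
  also have "\<dots> = (\<Sum>a\<in>{1..n}. \<Sum>b\<in>{1..n}. D a * (D' b * \<theta> b) - D a * \<theta> a * D' b + pi * (D a * D' b * sg a b))"
    by (intro sum.cong refl) (simp add: \<theta> algebra_simps)
  also have "\<dots> = (\<Sum>a\<in>{1..n}. D a) * (\<Sum>b\<in>{1..n}. D' b * \<theta> b) - (\<Sum>a\<in>{1..n}. D a * \<theta> a) * (\<Sum>b\<in>{1..n}. D' b)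
      + pi * (\<Sum>a\<in>{1..n}. \<Sum>b\<in>{1..n}. D a * D' b * sg a b)"
  proof -
    have "(\<Sum>a\<in>{1..n}. D a) * (\<Sum>b\<in>{1..n}. D' b * \<theta> b) = (\<Sum>a\<in>{1..n}. \<Sum>b\<in>{1..n}. D a * (D' b * \<theta> b))"
      and "(\<Sum>a\<in>{1..n}. D a * \<theta> a) * (\<Sum>b\<in>{1..n}. D' b) = (\<Sum>a\<in>{1..n}. \<Sum>b\<in>{1..n}. D a * \<theta> a * D' b)"
      by (rule sum_product)+
    then show ?thesis by (simp only: sum.distrib sum_subtractf sum_distrib_left)
  qed
  finally have "pi * (\<Sum>v\<in>inner_verts N. flag_wedge v m m') = pi * (\<Sum>a\<in>{1..n}. \<Sum>b\<in>{1..n}. D a * D' b * sg a b)"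
    unfolding tot by simp
  then have "(\<Sum>v\<in>inner_verts N. flag_wedge v m m') = (\<Sum>a\<in>{1..n}. \<Sum>b\<in>{1..n}. D a * D' b * sg a b)"
    by (rule iffD1[OF mult_left_cancel[OF pi_neq_zero]])
  then show ?thesis unfolding D_def D'_def .
qed

end

section \<open>Derivatives of the boundary measurements\<close>

definition peval_deriv :: "edge \<Rightarrow> ((edge \<Rightarrow>\<^sub>0 nat) \<Rightarrow>\<^sub>0 real) \<Rightarrow> (edge \<Rightarrow> real) \<Rightarrow> real" where
  "peval_deriv e P w = (\<Sum>d\<in>Poly_Mapping.keys P. Poly_Mapping.lookup P d *
     (real (Poly_Mapping.lookup d e) * w e ^ (Poly_Mapping.lookup d e - 1) *
       (\<Prod>e'\<in>Poly_Mapping.keys d - {e}. w e' ^ Poly_Mapping.lookup d e')))"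

lemma meval_upd:
  "meval d (w(e := t)) = t ^ Poly_Mapping.lookup d e * (\<Prod>e'\<in>Poly_Mapping.keys d - {e}. w e' ^ Poly_Mapping.lookup d e')"
proof -
  let ?R = "\<Prod>e'\<in>Poly_Mapping.keys d - {e}. w e' ^ Poly_Mapping.lookup d e'"
  have r: "(\<Prod>e'\<in>Poly_Mapping.keys d - {e}. (w(e := t)) e' ^ Poly_Mapping.lookup d e') = ?R"
    by (intro prod.cong refl) auto
  show ?thesis
  proof (cases "e \<in> Poly_Mapping.keys d")
    case True
    then show ?thesis unfolding meval_def using r by (simp add: prod.remove[OF finite_keys True])
  next
    case False
    then have "Poly_Mapping.keys d - {e} = Poly_Mapping.keys d" "Poly_Mapping.lookup d e = 0" by (auto simp: in_keys_iff)
    then show ?thesis unfolding meval_def using r by simp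
  qed
qed

lemma peval_has_derivative:
  "((\<lambda>t. peval P (w(e := t))) has_field_derivative peval_deriv e P w) (at (w e))"
  unfolding peval_def peval_deriv_def meval_def[symmetric] meval_upd
  by (auto intro!: derivative_eq_intros sum.cong simp: mult_ac)

lemma isCont_peval:
  assumes "\<And>e. isCont (\<lambda>s. w s e) (a :: real)"
  shows "isCont (\<lambda>s. peval P (w s)) a"
  unfolding peval_def using assms by (intro continuous_intros) auto

lemma isCont_peval_deriv:
  assumes "\<And>e. isCont (\<lambda>s. w s e) (a :: real)"
  shows "isCont (\<lambda>s. peval_deriv e P (w s)) a"
  unfolding peval_deriv_def using assms by (intro continuous_intros) auto

lemma eventually_peval_upd:
  assumes "peval Q w \<noteq> 0"
  shows "\<forall>\<^sub>F t in nhds (w e). peval Q (w(e := t)) \<noteq> 0"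
proof -
  have "isCont (\<lambda>t. peval Q (w(e := t))) (w e)"
    by (rule DERIV_isCont[OF peval_has_derivative])
  then have "((\<lambda>t. peval Q (w(e := t))) \<longlongrightarrow> peval Q (w(e := w e))) (nhds (w e))"
    using tendsto_at_iff_tendsto_nhds[of "\<lambda>t. peval Q (w(e := t))" "w e"] unfolding isCont_def by (rule iffD1[rotated])
  then have "((\<lambda>t. peval Q (w(e := t))) \<longlongrightarrow> peval Q w) (nhds (w e))"
    unfolding fun_upd_triv .
  then show ?thesis by (rule tendsto_imp_eventually_ne[OF _ assms])
qed

text \<open>On the ray through \<open>w\<close>, the polynomial becomes one in a single variable
  with nonzero constant term, which has only finitely many roots.\<close>

lemma eventually_peval_line:
  assumes "peval Q (\<lambda>e. 0) \<noteq> 0"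
  shows "\<forall>\<^sub>F s in at (1::real). peval Q (\<lambda>e. s * w e) \<noteq> 0"
proof -
  define deg where "deg d = (\<Sum>e\<in>Poly_Mapping.keys d. Poly_Mapping.lookup d e)" for d :: "edge \<Rightarrow>\<^sub>0 nat"
  define p where "p = (\<Sum>d\<in>Poly_Mapping.keys Q. Polynomial.monom (Poly_Mapping.lookup Q d * meval d w) (deg d))"
  have p: "poly p s = peval Q (\<lambda>e. s * w e)" for s
  proof -
    have "meval d (\<lambda>e. s * w e) = s ^ deg d * meval d w" for d
      unfolding meval_def deg_def by (simp add: power_mult_distrib prod.distrib power_sum)
    then show ?thesis unfolding p_def peval_def meval_def[symmetric]
      by (simp add: poly_sum poly_monom mult_ac)
  qed
  have "p \<noteq> 0" using p[of 0] assms by auto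
  then have fin: "finite {s. poly p s = 0}" by (rule poly_roots_finite)
  have "open (- ({s. poly p s = 0} - {1}))" using fin by (intro open_Compl finite_imp_closed) simp
  then have "\<forall>\<^sub>F s in at 1. s \<in> - ({s. poly p s = 0} - {1})"
    by (rule eventually_at_in_open') simp
  moreover have "\<forall>\<^sub>F s in at (1::real). s \<noteq> 1" by (simp add: eventually_at_filter)
  ultimately show ?thesis by eventually_elim (auto simp: p)
qed

definition quotient_deriv :: "edge \<Rightarrow> ((edge \<Rightarrow>\<^sub>0 nat) \<Rightarrow>\<^sub>0 real) \<Rightarrow> ((edge \<Rightarrow>\<^sub>0 nat) \<Rightarrow>\<^sub>0 real) \<Rightarrow> (edge \<Rightarrow> real) \<Rightarrow> real" where
  "quotient_deriv e P Q w = (peval_deriv e P w * peval Q w - peval P w * peval_deriv e Q w) / (peval Q w * peval Q w)"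

lemma bm_has_derivative:
  assumes "bm_represents N i j P Q" "peval Q w \<noteq> 0"
  shows "((\<lambda>t. bm N i j (w(e := t))) has_field_derivative quotient_deriv e P Q w) (at (w e))"
proof -
  have "((\<lambda>t. peval P (w(e := t)) / peval Q (w(e := t))) has_field_derivative quotient_deriv e P Q w) (at (w e))"
    using DERIV_divide[OF peval_has_derivative[of P w e] peval_has_derivative[of Q w e]] assms(2)
    by (simp add: quotient_deriv_def)
  moreover have "\<forall>\<^sub>F t in nhds (w e). bm N i j (w(e := t)) = peval P (w(e := t)) / peval Q (w(e := t))"
    using eventually_peval_upd[OF assms(2), of e] by eventually_elim (rule bm_eq[OF assms(1)])
  ultimately show ?thesis using DERIV_cong_ev[OF refl _ refl] by fastforce
qed

context finite_net begin

text \<open>The resolvent identity \<open>G' - G = G' (A' - A) G\<close>, where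
  \<open>A' - A\<close> has the single nonzero entry of the edge \<open>e\<close>. It is obtained by
  evaluating the matrix product \<open>G' G\<close> with the two recursions.\<close>

lemma net_green_resolvent:
  assumes D: "peval (net_det \<sigma>) w \<noteq> 0" and D': "peval (net_det \<sigma>) (w(e := t)) \<noteq> 0"
    and e: "e \<in> edges N" and u: "u \<in> verts N" and v: "v \<in> verts N"
  shows "net_green \<sigma> (w(e := t)) u v - net_green \<sigma> w u v
    = (t - w e) * (net_green \<sigma> (w(e := t)) u (fst e) * \<sigma> e * net_green \<sigma> w (snd e) v)"
proof -
  let ?V = "verts N"
  define G G' A A' where "G = net_green \<sigma> w" and "G' = net_green \<sigma> (w(e := t))"
    and "A = net_matrix \<sigma> w" and "A' = net_matrix \<sigma> (w(e := t))"
  have 1: "(\<Sum>a\<in>?V. G' u a * G a v) = G' u v + (\<Sum>a\<in>?V. \<Sum>b\<in>?V. G' u a * A a b * G b v)"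
  proof -
    have "(\<Sum>a\<in>?V. G' u a * G a v) = (\<Sum>a\<in>?V. (if a = v then G' u a else 0) + (\<Sum>b\<in>?V. G' u a * A a b * G b v))"
    proof (rule sum.cong[OF refl])
      fix a assume "a \<in> ?V"
      then show "G' u a * G a v = (if a = v then G' u a else 0) + (\<Sum>b\<in>?V. G' u a * A a b * G b v)"
        using net_green_left[OF D _ v, of a] unfolding G_def[symmetric] A_def[symmetric]
        by (simp add: distrib_left sum_distrib_left mult.assoc)
    qed
    then show ?thesis using v finite_verts by (simp add: sum.distrib)
  qed
  have 2: "(\<Sum>a\<in>?V. G' u a * G a v) = G u v + (\<Sum>a\<in>?V. \<Sum>b\<in>?V. G' u a * A' a b * G b v)"
  proof -
    have "(\<Sum>b\<in>?V. G' u b * G b v) = (\<Sum>b\<in>?V. (if u = b then G b v else 0) + (\<Sum>a\<in>?V. G' u a * A' a b * G b v))"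
    proof (rule sum.cong[OF refl])
      fix b assume "b \<in> ?V"
      then show "G' u b * G b v = (if u = b then G b v else 0) + (\<Sum>a\<in>?V. G' u a * A' a b * G b v)"
        using net_green_right[OF D' u, of b] unfolding G'_def[symmetric] A'_def[symmetric]
        by (simp add: distrib_right sum_distrib_right)
    qed
    also have "\<dots> = G u v + (\<Sum>b\<in>?V. \<Sum>a\<in>?V. G' u a * A' a b * G b v)"
      using u finite_verts by (simp add: sum.distrib)
    also have "(\<Sum>b\<in>?V. \<Sum>a\<in>?V. G' u a * A' a b * G b v) = (\<Sum>a\<in>?V. \<Sum>b\<in>?V. G' u a * A' a b * G b v)" by (rule sum.swap)
    finally show ?thesis .
  qed
  have fe: "fst e \<in> ?V" "snd e \<in> ?V" using e edges_subset by auto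
  have diff: "G' u a * A' a b * G b v - G' u a * A a b * G b v
    = (if a = fst e then if b = snd e then (t - w e) * (G' u a * \<sigma> e * G b v) else 0 else 0)" for a b
    using e by (cases e) (auto simp: A_def A'_def net_matrix_def algebra_simps)
  have "G' u v - G u v = (\<Sum>a\<in>?V. \<Sum>b\<in>?V. G' u a * A' a b * G b v - G' u a * A a b * G b v)"
    using 1 2 by (simp add: sum_subtractf)
  also have "\<dots> = (t - w e) * (G' u (fst e) * \<sigma> e * G (snd e) v)"
  proof -
    have "(\<Sum>b\<in>?V. if a = fst e then if b = snd e then (t - w e) * (G' u a * \<sigma> e * G b v) else 0 else 0)
      = (if a = fst e then (t - w e) * (G' u a * \<sigma> e * G (snd e) v) else 0)" for a
      using fe finite_verts by simp
    then show ?thesis unfolding diff using fe finite_verts by simp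
  qed
  finally show ?thesis unfolding G_def G'_def .
qed

lemma net_green_has_derivative:
  assumes D: "peval (net_det \<sigma>) w \<noteq> 0" and e: "e \<in> edges N" and u: "u \<in> verts N" and v: "v \<in> verts N"
  shows "((\<lambda>t. net_green \<sigma> (w(e := t)) u v) has_field_derivative
     net_green \<sigma> w u (fst e) * \<sigma> e * net_green \<sigma> w (snd e) v) (at (w e))"
proof -
  have "isCont (\<lambda>t. net_green \<sigma> (w(e := t)) u (fst e)) (w e)"
    unfolding net_green_def
    by (intro isCont_divide DERIV_isCont[OF peval_has_derivative]) (use D in simp)
  then have "((\<lambda>t. net_green \<sigma> (w(e := t)) u (fst e) * \<sigma> e * net_green \<sigma> w (snd e) v) \<longlongrightarrow>
     net_green \<sigma> w u (fst e) * \<sigma> e * net_green \<sigma> w (snd e) v) (at (w e))"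
    by (intro tendsto_intros) (simp add: isCont_def)
  moreover have "\<forall>\<^sub>F t in at (w e). net_green \<sigma> (w(e := t)) u (fst e) * \<sigma> e * net_green \<sigma> w (snd e) v
    = (net_green \<sigma> (w(e := t)) u v - net_green \<sigma> (w(e := w e)) u v) / (t - w e)"
  proof -
    have "\<forall>\<^sub>F t in at (w e). peval (net_det \<sigma>) (w(e := t)) \<noteq> 0"
      using eventually_peval_upd[OF D, of e] by (simp add: eventually_at_filter eventually_mono)
    moreover have "\<forall>\<^sub>F t in at (w e). t \<noteq> w e" by (simp add: eventually_at_filter)
    ultimately show ?thesis
    proof eventually_elim
      case (elim t)
      then show ?case using net_green_resolvent[OF D elim(1) e u v] by simp
    qed
  qed
  ultimately show ?thesis unfolding has_field_derivative_iff by (rule Lim_transform_eventually)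
qed

lemma net_matrix_sum:
  assumes v: "v \<in> verts N"
  shows "(\<Sum>x\<in>verts N. net_matrix \<sigma> w v x * g x) = (\<Sum>e\<in>out_edges N v. \<sigma> e * w e * g (snd e))"
proof -
  have "out_edges N v = Pair v ` {x \<in> verts N. (v, x) \<in> edges N}" using edges_subset by (auto simp: out_edges_def)
  then have "(\<Sum>e\<in>out_edges N v. \<sigma> e * w e * g (snd e)) = (\<Sum>x | x \<in> verts N \<and> (v, x) \<in> edges N. \<sigma> (v, x) * w (v, x) * g x)"
    by (simp add: sum.reindex inj_on_def)
  also have "\<dots> = (\<Sum>x\<in>verts N. if (v, x) \<in> edges N then \<sigma> (v, x) * w (v, x) * g x else 0)"
    by (simp add: sum.inter_filter[OF finite_verts])
  also have "\<dots> = (\<Sum>x\<in>verts N. net_matrix \<sigma> w v x * g x)"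
    by (intro sum.cong refl) (simp add: net_matrix_def)
  finally show ?thesis ..
qed

end

section \<open>The flow of a boundary measurement\<close>

context planar_net begin

definition green :: "(edge \<Rightarrow> real) \<Rightarrow> complex \<Rightarrow> complex \<Rightarrow> real" where
  "green = net_green edge_sign"

text \<open>The weight of \<open>e\<close> times the derivative of the Green function: a term for
  arriving at the tail, one for the edge, and one for going on from the head. On the level of series
  it counts each path with the number of its passages through \<open>e\<close>.\<close>

definition flow :: "(edge \<Rightarrow> real) \<Rightarrow> nat \<Rightarrow> nat \<Rightarrow> edge \<Rightarrow> real" where
  "flow w i j e = green w (bpt N i) (fst e) * (edge_sign e * w e) * green w (snd e) (bpt N j)"

lemma I_in: "i \<in> I \<Longrightarrow> i \<in> {1..n}" and J_in: "j \<in> J \<Longrightarrow> j \<in> {1..n}"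
  using IJ by auto

lemma bm_eq_green:
  assumes "i \<in> I" "j \<in> J" "peval (net_det edge_sign) w \<noteq> 0"
  shows "bm N i j w = cross_sign i j * green w (bpt N i) (bpt N j)"
  unfolding green_def using assms
  by (intro bm_green path_sign_eq bpt_verts I_in J_in)

lemma bm_represents_exists:
  assumes "i \<in> I" "j \<in> J"
  shows "\<exists>P Q. bm_represents N i j P Q"
  using bm_represents_signed[OF path_sign_eq[OF assms] bpt_verts[OF I_in[OF assms(1)]] bpt_verts[OF J_in[OF assms(2)]]] by blast

lemma weighted_deriv_flow:
  assumes ij: "i \<in> I" "j \<in> J" and D: "peval (net_det edge_sign) w \<noteq> 0" and e: "e \<in> edges N"
    and PQ: "bm_represents N i j P Q" "peval Q w \<noteq> 0"
  shows "w e * quotient_deriv e P Q w = cross_sign i j * flow w i j e"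
proof -
  note iv = bpt_verts[OF I_in[OF ij(1)]] and jv = bpt_verts[OF J_in[OF ij(2)]]
  have "((\<lambda>t. cross_sign i j * green (w(e := t)) (bpt N i) (bpt N j)) has_field_derivative
     cross_sign i j * (green w (bpt N i) (fst e) * edge_sign e * green w (snd e) (bpt N j))) (at (w e))"
    unfolding green_def by (intro DERIV_cmult net_green_has_derivative[OF D e iv jv])
  moreover have "\<forall>\<^sub>F t in nhds (w e). bm N i j (w(e := t)) = cross_sign i j * green (w(e := t)) (bpt N i) (bpt N j)"
    using eventually_peval_upd[OF D, of e] by eventually_elim (rule bm_eq_green[OF ij])
  ultimately have "((\<lambda>t. bm N i j (w(e := t))) has_field_derivative
     cross_sign i j * (green w (bpt N i) (fst e) * edge_sign e * green w (snd e) (bpt N j))) (at (w e))"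
    using DERIV_cong_ev[OF refl _ refl] by fastforce
  then have "quotient_deriv e P Q w = cross_sign i j * (green w (bpt N i) (fst e) * edge_sign e * green w (snd e) (bpt N j))"
    using bm_has_derivative[OF PQ] DERIV_unique by blast
  then show ?thesis by (simp add: flow_def mult_ac)
qed

text \<open>By the recursion for the first edge, the outflow at \<open>v\<close> lacks the paths
  that end at \<open>v\<close>; by the recursion for the last edge, the inflow lacks those that
  start at \<open>v\<close>. Otherwise both are the product of the two Green functions.\<close>

lemma divergence_flow:
  assumes ij: "i \<in> {1..n}" "j \<in> {1..n}" and D: "peval (net_det edge_sign) w \<noteq> 0" and v: "v \<in> verts N"
  shows "divergence (flow w i j) v = green w (bpt N i) (bpt N j) * ((if v = bpt N i then 1 else 0) - (if v = bpt N j then 1 else 0))"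
proof -
  let ?A = "net_matrix edge_sign w" and ?V = "verts N"
  note iv = bpt_verts[OF ij(1)] and jv = bpt_verts[OF ij(2)]
  have out: "(\<Sum>e\<in>out_edges N v. flow w i j e) = green w (bpt N i) v * (\<Sum>y\<in>?V. ?A v y * green w y (bpt N j))"
    unfolding net_matrix_sum[OF v] sum_distrib_left
    by (rule sum.cong[OF refl]) (simp add: flow_def out_edges_def mult_ac)
  have inn: "(\<Sum>e\<in>in_edges N v. flow w i j e) = (\<Sum>x\<in>?V. green w (bpt N i) x * ?A x v) * green w v (bpt N j)"
  proof -
    have "in_edges N v = (\<lambda>x. (x, v)) ` {x \<in> ?V. (x, v) \<in> edges N}" using edges_verts by (auto simp: in_edges_def)
    then have "(\<Sum>e\<in>in_edges N v. flow w i j e) = (\<Sum>x | x \<in> ?V \<and> (x, v) \<in> edges N. flow w i j (x, v))"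
      by (simp add: sum.reindex inj_on_def)
    also have "\<dots> = (\<Sum>x\<in>?V. if (x, v) \<in> edges N then flow w i j (x, v) else 0)"
      by (simp add: sum.inter_filter[OF finite_verts])
    also have "\<dots> = (\<Sum>x\<in>?V. (green w (bpt N i) x * ?A x v) * green w v (bpt N j))"
      by (intro sum.cong refl) (simp add: flow_def net_matrix_def)
    finally show ?thesis by (simp add: sum_distrib_right)
  qed
  have l: "(\<Sum>y\<in>?V. ?A v y * green w y (bpt N j)) = green w v (bpt N j) - (if v = bpt N j then 1 else 0)"
    using net_green_left[OF D v jv] unfolding green_def by simp
  have r: "(\<Sum>x\<in>?V. green w (bpt N i) x * ?A x v) = green w (bpt N i) v - (if bpt N i = v then 1 else 0)"
    using net_green_right[OF D iv v] unfolding green_def by simp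
  show ?thesis unfolding divergence_def out inn l r by (auto simp: algebra_simps)
qed

lemma divergence_flow_inner:
  assumes "i \<in> {1..n}" "j \<in> {1..n}" "peval (net_det edge_sign) w \<noteq> 0" "v \<in> inner_verts N"
  shows "divergence (flow w i j) v = 0"
  using divergence_flow[OF assms(1-3), of v] assms(4) bpt_not_inner[OF assms(1)] bpt_not_inner[OF assms(2)]
  by (auto simp: verts_def)

text \<open>The divergences are point masses of opposite sign at source and sink, so the boundary
  sum collapses to the four signs that make up \<open>chi\<close>.\<close>

lemma flow_wedge_sum:
  assumes ij: "i \<in> {1..n}" "j \<in> {1..n}" "i' \<in> {1..n}" "j' \<in> {1..n}" and D: "peval (net_det edge_sign) w \<noteq> 0"
  shows "(\<Sum>v\<in>inner_verts N. flag_wedge v (flow w i j) (flow w i' j'))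
    = 2 * chi i j i' j' * (green w (bpt N i) (bpt N j) * green w (bpt N i') (bpt N j'))"
proof -
  define g g' where "g = green w (bpt N i) (bpt N j)" and "g' = green w (bpt N i') (bpt N j')"
  define \<delta> where "\<delta> a b = (if a = b then 1 else 0 :: real)" for a b :: nat
  have d: "divergence (flow w i j) (bpt N a) = g * (\<delta> a i - \<delta> a j)" "divergence (flow w i' j') (bpt N a) = g' * (\<delta> a i' - \<delta> a j')"
    if "a \<in> {1..n}" for a
    using divergence_flow[OF ij(1,2) D bpt_verts[OF that]] divergence_flow[OF ij(3,4) D bpt_verts[OF that]]
      inj_on_eq_iff[OF bpt_inj that] ij by (simp_all add: g_def g'_def \<delta>_def)
  have \<delta>: "(\<Sum>a\<in>{1..n}. \<delta> a b * f a) = f b" if "b \<in> {1..n}" for b and f :: "nat \<Rightarrow> real"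
  proof -
    have "(\<Sum>a\<in>{1..n}. \<delta> a b * f a) = (\<Sum>a\<in>{1..n}. if a = b then f a else 0)" by (intro sum.cong refl) (simp add: \<delta>_def)
    then show ?thesis using that by simp
  qed
  have "(\<Sum>v\<in>inner_verts N. flag_wedge v (flow w i j) (flow w i' j'))
    = (\<Sum>a\<in>{1..n}. \<Sum>b\<in>{1..n}. divergence (flow w i j) (bpt N a) * divergence (flow w i' j') (bpt N b) * sg a b)"
    by (rule planar_flow_wedge) (use divergence_flow_inner ij D in auto)
  also have "\<dots> = (\<Sum>a\<in>{1..n}. \<Sum>b\<in>{1..n}. g * g' * (\<delta> a i * (\<delta> b i' * sg a b) - \<delta> a i * (\<delta> b j' * sg a b)
      - \<delta> a j * (\<delta> b i' * sg a b) + \<delta> a j * (\<delta> b j' * sg a b)))"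
    by (intro sum.cong refl) (simp add: d algebra_simps)
  also have "\<dots> = g * g' * (sg i i' - sg i j' - sg j i' + sg j j')"
    unfolding sum_distrib_left[symmetric] sum.distrib sum_subtractf by (simp only: \<delta> ij)
  also have "\<dots> = 2 * chi i j i' j' * (g * g')" by (simp add: chi_def algebra_simps)
  finally show ?thesis unfolding g_def g'_def .
qed

text \<open>At a white vertex the second and third flags are outgoing: the factor for the source is
  common to both, and the factor that distinguishes them involves the sink, so exchanging sinks
  swaps the two terms. At a black vertex the distinguishing factor involves the source instead, and
  nothing changes.\<close>

lemma flag_wedge_exchange:
  assumes v: "v \<in> inner_verts N"
  shows "flag_wedge v (flow w i j') (flow w i' j) = (if white N v then - flag_wedge v (flow w i j) (flow w i' j') else flag_wedge v (flow w i j) (flow w i' j'))"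
proof (cases "white N v")
  case True
  have "flag_edge N v 2 \<in> out_edges N v" "flag_edge N v 3 \<in> out_edges N v" using flag_edge_white(2)[OF v True] by auto
  then have "fst (flag_edge N v 2) = v" "fst (flag_edge N v 3) = v" by (auto simp: out_edges_def)
  then show ?thesis using True by (simp add: flag_wedge_def flow_def algebra_simps)
next
  case False
  have "flag_edge N v 2 \<in> in_edges N v" "flag_edge N v 3 \<in> in_edges N v" using flag_edge_black(2)[OF v False] by auto
  then have "snd (flag_edge N v 2) = v" "snd (flag_edge N v 3) = v" by (auto simp: in_edges_def)
  then show ?thesis using False by (simp add: flag_wedge_def flow_def algebra_simps)
qed

end

section \<open>Brackets of the boundary measurements\<close>

context planar_net begin

text \<open>The flag bracket in logarithmic coordinates, as a bilinear form in the logarithmic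
  derivatives with respect to the edge weights.\<close>

definition flag_form :: "(nat \<Rightarrow> nat \<Rightarrow> real) \<Rightarrow> (nat \<Rightarrow> nat \<Rightarrow> real) \<Rightarrow> (edge \<Rightarrow> real) \<Rightarrow> (edge \<Rightarrow> real) \<Rightarrow> real" where
  "flag_form a b L L' = (\<Sum>v\<in>inner_verts N. \<Sum>k\<in>{1..3}. \<Sum>l\<in>{1..3}.
     (if white N v then a k l else b k l) * L (flag_edge N v k) * L' (flag_edge N v l))"

lemma flag_edge_in:
  assumes "v \<in> inner_verts N" "k \<in> {1..3}"
  shows "flag_edge N v k \<in> edges N" "v = fst (flag_edge N v k) \<or> v = snd (flag_edge N v k)"
proof -
  have "k = 1 \<or> k = 2 \<or> k = 3" using assms(2) by auto
  then have "flag_edge N v k \<in> incident v" using flag_edge_distinct(1-3)[OF assms(1)] by blast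
  then show "flag_edge N v k \<in> edges N" "v = fst (flag_edge N v k) \<or> v = snd (flag_edge N v k)"
    by (auto simp: incident_iff)
qed

lemma flag_form_cong:
  assumes "\<And>e. e \<in> edges N \<Longrightarrow> L e = K e" "\<And>e. e \<in> edges N \<Longrightarrow> L' e = K' e"
  shows "flag_form a b L L' = flag_form a b K K'"
  unfolding flag_form_def
proof (rule sum.cong[OF refl], rule sum.cong[OF refl], rule sum.cong[OF refl])
  fix v k l assume "v \<in> inner_verts N" "k \<in> {1..3::nat}" "l \<in> {1..3::nat}"
  then show "(if white N v then a k l else b k l) * L (flag_edge N v k) * L' (flag_edge N v l)
    = (if white N v then a k l else b k l) * K (flag_edge N v k) * K' (flag_edge N v l)"
    using assms(1)[OF flag_edge_in(1)] assms(2)[OF flag_edge_in(1)] by simp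
qed

lemma flag_form_sum_left:
  "flag_form a b (\<lambda>e. \<Sum>s\<in>S. u s * L s e) L' = (\<Sum>s\<in>S. u s * flag_form a b (L s) L')"
proof (induction S rule: infinite_finite_induct)
  case (insert s S)
  have "flag_form a b (\<lambda>e. \<Sum>s\<in>insert s S. u s * L s e) L' = u s * flag_form a b (L s) L' + flag_form a b (\<lambda>e. \<Sum>s\<in>S. u s * L s e) L'"
    unfolding flag_form_def sum_distrib_left sum.distrib[symmetric]
    by (rule sum.cong[OF refl], rule sum.cong[OF refl], rule sum.cong[OF refl]) (simp add: insert.hyps algebra_simps)
  then show ?case using insert by simp
qed (simp_all add: flag_form_def)

lemma flag_form_sum_right:
  "flag_form a b L (\<lambda>e. \<Sum>s\<in>S. u s * L' s e) = (\<Sum>s\<in>S. u s * flag_form a b L (L' s))"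
proof (induction S rule: infinite_finite_induct)
  case (insert s S)
  have "flag_form a b L (\<lambda>e. \<Sum>s\<in>insert s S. u s * L' s e) = u s * flag_form a b L (L' s) + flag_form a b L (\<lambda>e. \<Sum>s\<in>S. u s * L' s e)"
    unfolding flag_form_def sum_distrib_left sum.distrib[symmetric]
    by (rule sum.cong[OF refl], rule sum.cong[OF refl], rule sum.cong[OF refl]) (simp add: insert.hyps algebra_simps)
  then show ?case using insert by simp
qed (simp_all add: flag_form_def)

lemma flag_form_scale: "flag_form a b (\<lambda>e. c * L e) (\<lambda>e. c' * L' e) = c * c' * flag_form a b L L'"
  unfolding flag_form_def sum_distrib_left
  by (rule sum.cong[OF refl], rule sum.cong[OF refl], rule sum.cong[OF refl]) (simp add: mult_ac)

lemma divergence_zero_flags: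
  assumes v: "v \<in> inner_verts N" and d: "divergence m v = 0"
  shows "m (flag_edge N v 1) = m (flag_edge N v 2) + m (flag_edge N v 3)"
proof (cases "white N v")
  case True
  then show ?thesis using d flag_edge_white[OF v True] flag_edge_distinct(4-6)[OF v]
    by (simp add: divergence_def)
next
  case False
  then show ?thesis using d flag_edge_black[OF v False] flag_edge_distinct(4-6)[OF v]
    by (simp add: divergence_def)
qed

text \<open>The origin of \<alpha> and \<beta>. If the first component is the sum of the other two,
  the wedge of components 1 and 3 equals that of 2 and 3, and the wedge of 1 and 2 is its
  negative.\<close>

lemma skew3_form:
  fixes c :: "nat \<Rightarrow> nat \<Rightarrow> real"
  assumes c: "skew3 c" and x: "x 1 = x 2 + x 3" and y: "y 1 = y 2 + y 3"
  shows "(\<Sum>k\<in>{1..3}. \<Sum>l\<in>{1..3}. c k l * x k * y l) = (c 2 3 + c 1 3 - c 1 2) * (x 2 * y 3 - x 3 * y 2)"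
proof -
  have s: "c k l = - c l k" if "k \<in> {1, 2, 3}" "l \<in> {1, 2, 3}" for k l
    by (rule c[unfolded skew3_def, rule_format]) (use that in auto)
  have z: "c k k = 0" if "k \<in> {1, 2, 3}" for k using s[OF that that] by linarith
  have z': "c 1 1 = 0" "c 2 2 = 0" "c 3 3 = 0" by (rule z; simp)+
  have s': "c 2 1 = - c 1 2" "c 3 1 = - c 1 3" "c 3 2 = - c 2 3" by (rule s; simp)+
  have "{1..3} = {1, 2, 3 :: nat}" by auto
  then have S: "(\<Sum>k\<in>{1..3}. f k) = f 1 + (f 2 + f 3)" for f :: "nat \<Rightarrow> real"
    by (simp del: One_nat_def)
  show ?thesis unfolding S z' s' x y by (simp only: algebra_simps)
qed

lemma flag_form_flow:
  assumes ab: "skew3 a" "skew3 b"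
    and ij: "i \<in> {1..n}" "j \<in> {1..n}" "i' \<in> {1..n}" "j' \<in> {1..n}" and D: "peval (net_det edge_sign) w \<noteq> 0"
  defines "\<alpha> \<equiv> a 2 3 + a 1 3 - a 1 2" and "\<beta> \<equiv> b 2 3 + b 1 3 - b 1 2"
  shows "flag_form a b (flow w i j) (flow w i' j')
    = (\<alpha> + \<beta>) * chi i j i' j' * (green w (bpt N i) (bpt N j) * green w (bpt N i') (bpt N j'))
      - (\<alpha> - \<beta>) * chi i j' i' j * (green w (bpt N i) (bpt N j') * green w (bpt N i') (bpt N j))"
proof -
  define T where "T v = flag_wedge v (flow w i j) (flow w i' j')" for v
  define W B where "W = (\<Sum>v\<in>inner_verts N. if white N v then T v else 0)" and "B = (\<Sum>v\<in>inner_verts N. if white N v then 0 else T v)"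
  have "W + B = (\<Sum>v\<in>inner_verts N. T v)" unfolding W_def B_def sum.distrib[symmetric] by (rule sum.cong[OF refl]) simp
  then have 1: "W + B = 2 * chi i j i' j' * (green w (bpt N i) (bpt N j) * green w (bpt N i') (bpt N j'))"
    unfolding T_def flow_wedge_sum[OF ij D] .
  have "B - W = (\<Sum>v\<in>inner_verts N. flag_wedge v (flow w i j') (flow w i' j))"
    unfolding W_def B_def sum_subtractf[symmetric] by (rule sum.cong[OF refl]) (subst flag_wedge_exchange, simp_all add: T_def)
  then have 2: "B - W = 2 * chi i j' i' j * (green w (bpt N i) (bpt N j') * green w (bpt N i') (bpt N j))"
    unfolding flow_wedge_sum[OF ij(1,4,3,2) D] .
  have "flag_form a b (flow w i j) (flow w i' j') = (\<Sum>v\<in>inner_verts N. \<alpha> * (if white N v then T v else 0) + \<beta> * (if white N v then 0 else T v))"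
    unfolding flag_form_def
  proof (rule sum.cong[OF refl])
    fix v assume v: "v \<in> inner_verts N"
    define c where "c = (if white N v then a else b)"
    have c: "(if white N v then a k l else b k l) = c k l" for k l by (simp add: c_def)
    have "skew3 c" using ab by (simp add: c_def)
    from skew3_form[OF this, of "\<lambda>k. flow w i j (flag_edge N v k)" "\<lambda>k. flow w i' j' (flag_edge N v k)"]
    show "(\<Sum>k\<in>{1..3}. \<Sum>l\<in>{1..3}. (if white N v then a k l else b k l) * flow w i j (flag_edge N v k) * flow w i' j' (flag_edge N v l))
      = \<alpha> * (if white N v then T v else 0) + \<beta> * (if white N v then 0 else T v)"
      unfolding c using divergence_zero_flags[OF v divergence_flow_inner[OF _ _ D v]] ij
      by (simp add: T_def flag_wedge_def c_def \<alpha>_def \<beta>_def)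
  qed
  also have "\<dots> = \<alpha> * W + \<beta> * B" unfolding W_def B_def by (simp add: sum.distrib sum_distrib_left)
  also have "\<dots> = (\<alpha> + \<beta>) * ((W + B) / 2) - (\<alpha> - \<beta>) * ((B - W) / 2)" by (simp add: field_simps)
  finally show ?thesis unfolding 1 2 by simp
qed

definition log_deriv :: "((edge \<Rightarrow>\<^sub>0 nat) \<Rightarrow>\<^sub>0 real) \<Rightarrow> ((edge \<Rightarrow>\<^sub>0 nat) \<Rightarrow>\<^sub>0 real) \<Rightarrow> (edge \<Rightarrow> real) \<Rightarrow> edge \<Rightarrow> real" where
  "log_deriv P Q w e = w e * quotient_deriv e P Q w"

lemma flag_form_log_deriv_generic:
  assumes ab: "skew3 a" "skew3 b"
    and ij: "i \<in> I" "j \<in> J" "i' \<in> I" "j' \<in> J" and D: "peval (net_det edge_sign) w \<noteq> 0"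
    and PQ: "bm_represents N i j P Q" "peval Q w \<noteq> 0" and PQ': "bm_represents N i' j' P' Q'" "peval Q' w \<noteq> 0"
  defines "\<alpha> \<equiv> a 2 3 + a 1 3 - a 1 2" and "\<beta> \<equiv> b 2 3 + b 1 3 - b 1 2"
  shows "flag_form a b (log_deriv P Q w) (log_deriv P' Q' w)
    = (\<alpha> + \<beta>) * chi i j i' j' * (bm N i j w * bm N i' j' w) - (\<alpha> - \<beta>) * chi i j' i' j * (bm N i j' w * bm N i' j w)"
proof -
  define c where "c = cross_sign"
  have ijn: "i \<in> {1..n}" "j \<in> {1..n}" "i' \<in> {1..n}" "j' \<in> {1..n}" using ij I_in J_in by blast+
  have ne: "i \<noteq> j" "i \<noteq> j'" "i' \<noteq> j" "i' \<noteq> j'" using ij IJ_disj by auto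
  \<comment> \<open>The signs are only known to agree where \<open>s_par\<close> is nonzero;
    elsewhere the term carries the factor 0.\<close>
  have c: "c i j * c i' j' = c i j' * c i' j \<or> chi i j' i' j = 0"
    using cross_sign_exchange[of i j i' j', OF _ ne] unfolding s_par_eq[OF ne] c_def by auto
  have "flag_form a b (log_deriv P Q w) (log_deriv P' Q' w) = flag_form a b (\<lambda>e. c i j * flow w i j e) (\<lambda>e. c i' j' * flow w i' j' e)"
    unfolding log_deriv_def c_def
    by (rule flag_form_cong) (rule weighted_deriv_flow[OF ij(1,2) D _ PQ] weighted_deriv_flow[OF ij(3,4) D _ PQ'], assumption)+
  also have "\<dots> = (\<alpha> + \<beta>) * chi i j i' j' * (c i j * green w (bpt N i) (bpt N j) * (c i' j' * green w (bpt N i') (bpt N j')))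
      - (\<alpha> - \<beta>) * (chi i j' i' j * (c i j * c i' j')) * (green w (bpt N i) (bpt N j') * green w (bpt N i') (bpt N j))"
    unfolding flag_form_scale flag_form_flow[OF ab ijn D, folded \<alpha>_def \<beta>_def] by (simp add: algebra_simps)
  also have "chi i j' i' j * (c i j * c i' j') = chi i j' i' j * (c i j' * c i' j)" using c by auto
  finally show ?thesis using ij D by (simp add: bm_eq_green c_def mult_ac)
qed

text \<open>At zeros of the determinant, the identity follows by continuity along the ray through the weights.\<close>

lemma flag_form_log_deriv:
  assumes ab: "skew3 a" "skew3 b"
    and ij: "i \<in> I" "j \<in> J" "i' \<in> I" "j' \<in> J"
    and PQ: "\<And>i j. i \<in> I \<Longrightarrow> j \<in> J \<Longrightarrow> bm_represents N i j (P i j) (Q i j)" "\<And>i j. i \<in> I \<Longrightarrow> j \<in> J \<Longrightarrow> peval (Q i j) w \<noteq> 0"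
  defines "\<alpha> \<equiv> a 2 3 + a 1 3 - a 1 2" and "\<beta> \<equiv> b 2 3 + b 1 3 - b 1 2"
  shows "flag_form a b (log_deriv (P i j) (Q i j) w) (log_deriv (P i' j') (Q i' j') w)
    = (\<alpha> + \<beta>) * chi i j i' j' * (bm N i j w * bm N i' j' w) - (\<alpha> - \<beta>) * chi i j' i' j * (bm N i j' w * bm N i' j w)"
proof -
  \<comment> \<open>Unlike \<open>green\<close>, which may have a pole at \<open>w\<close>, these
    fractions are continuous along the ray at \<open>w\<close>, so the defect \<open>val\<close> can
    be followed to the limit.\<close>
  define R where "R i j w = peval (P i j) w / peval (Q i j) w" for i j w
  define val where "val w = flag_form a b (log_deriv (P i j) (Q i j) w) (log_deriv (P i' j') (Q i' j') w)
    - ((\<alpha> + \<beta>) * chi i j i' j' * (R i j w * R i' j' w) - (\<alpha> - \<beta>) * chi i j' i' j * (R i j' w * R i' j w))" for w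
  define sw where "sw s = (\<lambda>e. s * w e)" for s :: real
  have sw1: "sw 1 = w" by (simp add: sw_def)
  have csw: "isCont (\<lambda>s. sw s e) 1" for e unfolding sw_def by (intro continuous_intros)
  have cQ: "isCont (\<lambda>s. peval X (sw s)) 1" for X by (rule isCont_peval[OF csw])
  have cD: "isCont (\<lambda>s. peval_deriv e X (sw s)) 1" for X e by (rule isCont_peval_deriv[OF csw])
  have nz: "peval (Q i j) (sw 1) \<noteq> 0" if "i \<in> I" "j \<in> J" for i j unfolding sw1 using PQ(2) that .
  have cR: "isCont (\<lambda>s. R i j (sw s)) 1" if "i \<in> I" "j \<in> J" for i j
    unfolding R_def by (intro isCont_divide cQ nz that)
  have cL: "isCont (\<lambda>s. log_deriv (P i j) (Q i j) (sw s) e) 1" if "i \<in> I" "j \<in> J" for i j e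
    unfolding log_deriv_def quotient_deriv_def
    by (intro isCont_divide isCont_mult isCont_diff cQ cD csw) (simp add: nz that)
  have "isCont (\<lambda>s. val (sw s)) 1"
    unfolding val_def flag_form_def
    by (intro continuous_diff continuous_mult continuous_sum continuous_const cR cL ij)
  then have lim: "((\<lambda>s. val (sw s)) \<longlongrightarrow> val (sw 1)) (at 1)" by (simp only: isCont_def)
  have nzQ: "\<forall>\<^sub>F s in at 1. peval (Q i j) (sw s) \<noteq> 0" if "i \<in> I" "j \<in> J" for i j
    using tendsto_imp_eventually_ne[OF cQ[unfolded isCont_def] nz[OF that]] .
  have "\<forall>\<^sub>F s in at 1. val (sw s) = 0"
    using eventually_peval_line[OF net_det_at_zero, of edge_sign w] nzQ[OF ij(1,2)] nzQ[OF ij(3,4)] nzQ[OF ij(1,4)] nzQ[OF ij(3,2)]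
  proof eventually_elim
    case (elim s)
    have D: "peval (net_det edge_sign) (sw s) \<noteq> 0" using elim(1) by (simp add: sw_def)
    have e: "R i j (sw s) = bm N i j (sw s)" if "i \<in> I" "j \<in> J" "peval (Q i j) (sw s) \<noteq> 0" for i j
      using bm_eq[OF PQ(1)[OF that(1,2)] that(3)] by (simp add: R_def)
    show ?case unfolding val_def
      using flag_form_log_deriv_generic[OF ab ij D PQ(1)[OF ij(1,2)] elim(2) PQ(1)[OF ij(3,4)] elim(3), folded \<alpha>_def \<beta>_def]
        e[OF ij(1,2) elim(2)] e[OF ij(3,4) elim(3)] e[OF ij(1,4) elim(4)] e[OF ij(3,2) elim(5)] by simp
  qed
  then have "((\<lambda>s. val (sw s)) \<longlongrightarrow> 0) (at 1)" by (rule tendsto_eventually)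
  with lim have "val w = 0" using tendsto_unique[OF _ lim] sw1 by auto
  moreover have "R i j w = bm N i j w" if "i \<in> I" "j \<in> J" for i j
    using bm_eq[OF PQ(1)[OF that] PQ(2)[OF that]] by (simp add: R_def)
  ultimately show ?thesis using ij by (simp add: val_def)
qed

end

section \<open>From flag coordinates to the matrix of boundary measurements\<close>

lemma nth_elem_in:
  assumes "finite A" "p \<in> {1..card A}"
  shows "nth_elem A p \<in> A"
proof -
  have "sorted_list_of_set A ! (p - 1) \<in> set (sorted_list_of_set A)"
    using assms by (intro nth_mem) auto
  then show ?thesis using assms by (simp add: nth_elem_def)
qed

lemma nth_elem_inj: "finite A \<Longrightarrow> inj_on (nth_elem A) {1..card A}"
proof (rule inj_onI)
  fix p q assume "finite A" "p \<in> {1..card A}" "q \<in> {1..card A}" "nth_elem A p = nth_elem A q"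
  then have "p - 1 = q - 1" using nth_eq_iff_index_eq[of "sorted_list_of_set A" "p - 1" "q - 1"]
    by (auto simp: nth_elem_def)
  then show "p = q" using \<open>p \<in> {1..card A}\<close> \<open>q \<in> {1..card A}\<close> by force
qed

context planar_net begin

lemma finite_IJ: "finite I" "finite J"
  using I_subset J_subset finite_subset by blast+

lemma exists_flag_preimage:
  assumes "w \<in> weight_space N"
  shows "\<exists>x. x \<in> flag_space N \<and> weights N x = w"
proof -
  define x where "x = (\<lambda>s\<in>flags N. if fst s = fst (snd s) then w (snd s) else 1)"
  have "w e \<noteq> 0" if "e \<in> edges N" for e using PiE_mem[OF assms[unfolded weight_space_def] that] by simp
  then have "x \<in> flag_space N" unfolding x_def flag_space_def by (intro restrict_PiE_iff[THEN iffD2]) (auto simp: flags_def)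
  moreover have "weights N x = w"
  proof
    fix e
    show "weights N x e = w e"
    proof (cases "e \<in> edges N")
      case True
      then have "(fst e, e) \<in> flags N" "(snd e, e) \<in> flags N" by (auto simp: flags_def)
      then show ?thesis using True edge_ne[OF True] by (simp add: weights_def x_def)
    next
      case False
      then show ?thesis using assms PiE_arb[of w "edges N" _ e] by (simp add: weights_def weight_space_def)
    qed
  qed
  ultimately show ?thesis by blast
qed

abbreviation (input) mats :: "(nat \<times> nat) set" where "mats \<equiv> mat_index (card I) (card J)"

lemma mats_nth: "(p, q) \<in> mats \<Longrightarrow> nth_elem I p \<in> I \<and> nth_elem J q \<in> J"
  using nth_elem_in[OF finite_IJ(1)] nth_elem_in[OF finite_IJ(2)] by (auto simp: mat_index_def)

text \<open>A flag coordinate enters exactly one edge weight, as a factor next to the coordinate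
  \<open>y\<close> of the other flag of the edge. Hence the logarithmic derivatives with respect to
  the flag and to the edge weight agree, and the chain rule gives the sum.\<close>

lemma flag_deriv_pullback:
  assumes f: "f \<in> smooth_funs mats" and e: "e \<in> edges N" and v: "v = fst e \<or> v = snd e"
    and PQ: "\<And>i j. i \<in> I \<Longrightarrow> j \<in> J \<Longrightarrow> bm_represents N i j (P i j) (Q i j)"
      "\<And>i j. i \<in> I \<Longrightarrow> j \<in> J \<Longrightarrow> peval (Q i j) (weights N x) \<noteq> 0"
  shows "x (v, e) * pderiv_at (v, e) ((f \<circ> bm_map I J N) \<circ> weights N) x
    = (\<Sum>(p, q)\<in>mats. pderiv_at (p, q) f (bm_map I J N (weights N x))
        * log_deriv (P (nth_elem I p) (nth_elem J q)) (Q (nth_elem I p) (nth_elem J q)) (weights N x) e)"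
proof -
  define w where "w = weights N x"
  define y where "y = x (if v = fst e then snd e else fst e, e)"
  have we: "w e = x (v, e) * y" using v e by (auto simp: w_def weights_def y_def)
  have upd: "weights N (x((v, e) := t)) = w(e := t * y)" for t
    using v e edge_ne[OF e] by (auto simp: w_def weights_def y_def fun_eq_iff)
  define \<gamma> where "\<gamma> t = bm_map I J N (w(e := t * y))" for t
  have \<gamma>: "\<gamma> t \<in> coord_space mats" for t by (simp add: \<gamma>_def bm_map_def coord_space_def)
  have \<gamma>0: "\<gamma> (x (v, e)) = bm_map I J N w" by (simp add: \<gamma>_def we[symmetric])
  define D where "D s = (case s of (p, q) \<Rightarrow> quotient_deriv e (P (nth_elem I p) (nth_elem J q)) (Q (nth_elem I p) (nth_elem J q)) w * y)" for s
  have d: "((\<lambda>t. \<gamma> t s) has_field_derivative D s) (at (x (v, e)))" if s: "s \<in> mats" for s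
  proof -
    obtain p q where pq: "s = (p, q)" by force
    let ?i = "nth_elem I p" and ?j = "nth_elem J q"
    have ij: "?i \<in> I" "?j \<in> J" using mats_nth s pq by auto
    have 1: "((\<lambda>t. bm N ?i ?j (w(e := t))) has_field_derivative quotient_deriv e (P ?i ?j) (Q ?i ?j) w) (at (x (v, e) * y))"
      using bm_has_derivative[OF PQ(1)[OF ij] PQ(2)[OF ij], folded w_def, of e] unfolding we .
    have 2: "((\<lambda>t. t * y) has_field_derivative y) (at (x (v, e)))" by (auto intro!: derivative_eq_intros)
    have "((\<lambda>t. bm N ?i ?j (w(e := t * y))) has_field_derivative D s) (at (x (v, e)))"
      using DERIV_chain2[OF 1 2] by (simp add: D_def pq)
    then show ?thesis using s by (simp add: \<gamma>_def bm_map_def pq)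
  qed
  have "((\<lambda>t. f (\<gamma> t)) has_field_derivative (\<Sum>s\<in>mats. pderiv_at s f (\<gamma> (x (v, e))) * D s)) (at (x (v, e)))"
    by (rule chain_rule_coord_space[OF _ smooth_funs_order[OF f] \<gamma> d]) (simp_all add: mat_index_def)
  then have "pderiv_at (v, e) ((f \<circ> bm_map I J N) \<circ> weights N) x = (\<Sum>s\<in>mats. pderiv_at s f (bm_map I J N w) * D s)"
    unfolding pderiv_at_def using \<gamma>0 by (simp add: o_def upd \<gamma>_def[symmetric] DERIV_imp_deriv)
  then show ?thesis unfolding w_def[symmetric]
    by (simp add: sum_distrib_left D_def log_deriv_def we case_prod_unfold mult_ac)
qed

text \<open>The chain rule makes both arguments linear combinations of logarithmic derivatives of
  matrix entries, so bilinearity reduces everything to the brackets of two entries. Of the chosen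
  preimage only its edge weights matter.\<close>

lemma bm_map_poisson_gsv:
  assumes ab: "skew3 a" "skew3 b"
  defines "\<alpha> \<equiv> a 2 3 + a 1 3 - a 1 2" and "\<beta> \<equiv> b 2 3 + b 1 3 - b 1 2"
  shows "bm_map_poisson I J a b (coeff_bracket mats (gsv_coeff (\<alpha> - \<beta>) (\<alpha> + \<beta>) (nth_elem I) (nth_elem J))) N"
  unfolding bm_map_poisson_def
proof (intro conjI ballI)
  fix i j assume "i \<in> I" "j \<in> J" then show "\<exists>P Q. bm_represents N i j P Q" by (rule bm_represents_exists)
next
  fix f g w assume f: "f \<in> smooth_funs mats" and g: "g \<in> smooth_funs mats" and w: "w \<in> bm_domain I J N"
  define x where "x = (SOME x. x \<in> flag_space N \<and> weights N x = w)"
  have x: "weights N x = w"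
    using someI_ex[OF exists_flag_preimage[of w]] w unfolding x_def bm_domain_def by simp
  have "\<forall>i j. \<exists>P Q. i \<in> I \<and> j \<in> J \<longrightarrow> bm_represents N i j P Q \<and> peval Q w \<noteq> 0"
    using w unfolding bm_domain_def bm_defined_def by blast
  then obtain P Q where "\<forall>i j. i \<in> I \<and> j \<in> J \<longrightarrow> bm_represents N i j (P i j) (Q i j) \<and> peval (Q i j) w \<noteq> 0"
    by (simp only: choice_iff) blast
  then have PQ: "\<And>i j. i \<in> I \<Longrightarrow> j \<in> J \<Longrightarrow> bm_represents N i j (P i j) (Q i j)"
     "\<And>i j. i \<in> I \<Longrightarrow> j \<in> J \<Longrightarrow> peval (Q i j) w \<noteq> 0" by blast+
  let ?M = "bm_map I J N w" and ?i = "\<lambda>s. nth_elem I (fst s)" and ?j = "\<lambda>s. nth_elem J (snd s)"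
  define L where "L s = log_deriv (P (?i s) (?j s)) (Q (?i s) (?j s)) w" for s
  have M: "?M \<in> coord_space mats" by (simp add: bm_map_def coord_space_def)
  have pb: "x (v, flag_edge N v k) * pderiv_at (v, flag_edge N v k) ((h \<circ> bm_map I J N) \<circ> weights N) x
      = (\<Sum>s\<in>mats. pderiv_at s h ?M * L s (flag_edge N v k))"
    if "h \<in> smooth_funs mats" "v \<in> inner_verts N" "k \<in> {1..3}" for h v k
    using flag_deriv_pullback[OF that(1) flag_edge_in[OF that(2,3)] PQ(1), where x = x, unfolded x, OF _ _ PQ(2)]
    by (simp add: L_def case_prod_unfold)
  have "net_bracket N a b (f \<circ> bm_map I J N) (g \<circ> bm_map I J N) w
    = flag_form a b (\<lambda>e. \<Sum>s\<in>mats. pderiv_at s f ?M * L s e) (\<lambda>e. \<Sum>s\<in>mats. pderiv_at s g ?M * L s e)"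
    unfolding net_bracket_def flag_bracket_def flag_form_def x_def[symmetric] Let_def
  proof (rule sum.cong[OF refl], rule sum.cong[OF refl], rule sum.cong[OF refl])
    fix v k l assume v: "v \<in> inner_verts N" and k: "k \<in> {1..3::nat}" and l: "l \<in> {1..3::nat}"
    show "(if white N v then a k l else b k l) * x (v, flag_edge N v k) * x (v, flag_edge N v l) *
        pderiv_at (v, flag_edge N v k) ((f \<circ> bm_map I J N) \<circ> weights N) x *
        pderiv_at (v, flag_edge N v l) ((g \<circ> bm_map I J N) \<circ> weights N) x
      = (if white N v then a k l else b k l) * (\<Sum>s\<in>mats. pderiv_at s f ?M * L s (flag_edge N v k)) *
        (\<Sum>s\<in>mats. pderiv_at s g ?M * L s (flag_edge N v l))"
      unfolding pb[OF f v k, symmetric] pb[OF g v l, symmetric] by (simp only: mult_ac)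
  qed
  also have "\<dots> = (\<Sum>s\<in>mats. \<Sum>t\<in>mats. pderiv_at s f ?M * (pderiv_at t g ?M * flag_form a b (L s) (L t)))"
    unfolding flag_form_sum_left flag_form_sum_right sum_distrib_left ..
  also have "\<dots> = (\<Sum>s\<in>mats. \<Sum>t\<in>mats. gsv_coeff (\<alpha> - \<beta>) (\<alpha> + \<beta>) (nth_elem I) (nth_elem J) s t ?M * pderiv_at s f ?M * pderiv_at t g ?M)"
  proof (rule sum.cong[OF refl], rule sum.cong[OF refl])
    fix s t assume s: "s \<in> mats" and t: "t \<in> mats"
    have ij: "?i s \<in> I" "?j s \<in> J" "?i t \<in> I" "?j t \<in> J" using mats_nth s t by (cases s, cases t, auto)+
    have st: "(fst s, snd t) \<in> mats" "(fst t, snd s) \<in> mats" using s t by (auto simp: mat_index_def)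
    have "flag_form a b (L s) (L t) = gsv_coeff (\<alpha> - \<beta>) (\<alpha> + \<beta>) (nth_elem I) (nth_elem J) s t ?M"
      using flag_form_log_deriv[OF ab ij, of P Q w, OF PQ, folded \<alpha>_def \<beta>_def] s t st
      unfolding L_def gsv_coeff_def by (simp add: bm_map_def case_prod_unfold)
    then show "pderiv_at s f ?M * (pderiv_at t g ?M * flag_form a b (L s) (L t))
      = gsv_coeff (\<alpha> - \<beta>) (\<alpha> + \<beta>) (nth_elem I) (nth_elem J) s t ?M * pderiv_at s f ?M * pderiv_at t g ?M"
      by (simp add: mult_ac)
  qed
  finally show "net_bracket N a b (f \<circ> bm_map I J N) (g \<circ> bm_map I J N) w
    = coeff_bracket mats (gsv_coeff (\<alpha> - \<beta>) (\<alpha> + \<beta>) (nth_elem I) (nth_elem J)) f g ?M"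
    using coeff_bracket_eq[OF f g M] by simp
qed

end

section \<open>Ladder networks\<close>

definition cnext :: "nat \<Rightarrow> nat \<Rightarrow> nat" where
  "cnext n s = (if s = n then 1 else Suc s)"

lemma cnext_in: "s \<in> {1..n} \<Longrightarrow> cnext n s \<in> {1..n}"
  by (auto simp: cnext_def)

lemma cnext_power:
  assumes "s \<in> {1..n}" "d < n"
  shows "(cnext n ^^ d) s = (if s + d \<le> n then s + d else s + d - n)"
  using assms(2) by (induction d) (use assms(1) in \<open>auto simp: cnext_def\<close>)

definition transvect :: "nat \<Rightarrow> nat \<Rightarrow> real \<Rightarrow> (nat \<Rightarrow> real) \<Rightarrow> nat \<Rightarrow> real" where
  "transvect i j x F = F(i := F i + x * F j)"

definition rung_step :: "nat \<Rightarrow> nat \<times> real \<Rightarrow> (nat \<Rightarrow> real) \<Rightarrow> nat \<Rightarrow> real" where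
  "rung_step n = (\<lambda>(z, t). transvect z (cnext n z) t)"

fun transvect_steps :: "nat \<Rightarrow> nat \<Rightarrow> nat \<Rightarrow> real \<Rightarrow> (nat \<times> real) list" where
  "transvect_steps n 0 i x = []"
| "transvect_steps n (Suc 0) i x = [(i, x)]"
| "transvect_steps n (Suc (Suc d)) i x = transvect_steps n (Suc d) (cnext n i) (- 1) @ [(i, - x)]
     @ transvect_steps n (Suc d) (cnext n i) 1 @ [(i, x)]"

text \<open>A transvection over a longer distance is a commutator of transvections over shorter distances.\<close>

lemma fold_transvect_steps:
  assumes "i \<in> {1..n}" "1 \<le> d" "d < n"
  shows "fold (rung_step n) (transvect_steps n d i x) F = transvect i ((cnext n ^^ d) i) x F"
  using assms
proof (induction n d i x arbitrary: F rule: transvect_steps.induct)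
  case (3 n d i x)
  define k j where "k = cnext n i" and "j = (cnext n ^^ Suc d) k"
  have k: "k \<in> {1..n}" using cnext_in[OF 3(3)] by (simp add: k_def)
  have j: "(cnext n ^^ Suc (Suc d)) i = j" by (simp only: j_def k_def funpow_Suc_right o_def)
  \<comment> \<open>The commutator formula needs three different positions; \<open>d < n\<close>
    prevents the walk from closing up.\<close>
  have ne: "i \<noteq> k" "i \<noteq> j" "k \<noteq> j"
    using cnext_power[OF 3(3,5)] cnext_power[OF k, of "Suc d"] 3(3,5) k unfolding j by (auto simp: j_def[symmetric] k_def cnext_def split: if_splits)
  have IH: "fold (rung_step n) (transvect_steps n (Suc d) k y) F = transvect k j y F" if "y = -1 \<or> y = 1" for F y
    using 3(1)[of F] 3(2)[of F] k 3(5) that unfolding k_def[symmetric] j_def[symmetric] by auto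
  have R: "rung_step n (i, y) F = transvect i k y F" for y F by (simp add: rung_step_def k_def)
  have "fold (rung_step n) (transvect_steps n (Suc (Suc d)) i x) F
    = transvect i k x (transvect k j 1 (transvect i k (- x) (transvect k j (- 1) F)))"
    by (simp add: k_def[symmetric] IH R)
  also have "\<dots> = transvect i j x F" using ne by (simp add: transvect_def fun_eq_iff algebra_simps)
  finally show ?case unfolding j .
qed (simp_all add: rung_step_def)

text \<open>A single network has to serve all matrices, so the number of rungs must not depend on
  the coefficient.\<close>

lemma transvect_steps_length: "\<exists>c. \<forall>i x. length (transvect_steps n d i x) = c"
proof (induction d)
  case (Suc d)
  then obtain c where "\<forall>i x. length (transvect_steps n d i x) = c" ..
  then show ?case by (cases d) auto
qed simp

lemma transvect_steps_range: "i \<in> {1..n} \<Longrightarrow> fst ` set (transvect_steps n d i x) \<subseteq> {1..n}"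
  by (induction n d i x rule: transvect_steps.induct) (use cnext_in in fastforce)+

text \<open>The coordinates that are read lie in \<open>J\<close> and those that are changed lie in
  \<open>I\<close>, so no transvection disturbs another and their effects add up.\<close>

lemma fold_transvects:
  assumes "set ps \<subseteq> I \<times> J" "distinct ps" "I \<inter> J = {}"
  shows "fold (\<lambda>(i, j). transvect i j (X i j)) ps F s = F s + (\<Sum>(i, j)\<in>set ps. if i = s then X i j * F j else 0)"
  using assms(1,2)
proof (induction ps arbitrary: F)
  case (Cons p ps)
  obtain i j where p: "p = (i, j)" by force
  define F' where "F' = transvect i j (X i j) F"
  have "(\<Sum>(i, j)\<in>set ps. if i = s then X i j * F' j else 0) = (\<Sum>(i, j)\<in>set ps. if i = s then X i j * F j else 0)"
    using Cons.prems(1) assms(3) by (intro sum.cong refl) (auto simp: F'_def transvect_def p)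
  then show ?case using Cons by (auto simp: p F'_def[symmetric]) (auto simp: F'_def transvect_def)
qed simp

text \<open>\<open>L\<close> comes before \<open>X\<close> in the quantifiers: the matrix only
  enters the coefficients, while the number of steps is the sum of lengths that depend on the cyclic
  distances alone.\<close>

lemma exists_rung_steps:
  assumes IJ: "I \<union> J = {1..n}" "I \<inter> J = {}"
  shows "\<exists>L. \<forall>X. \<exists>xs. length xs = L \<and> fst ` set xs \<subseteq> {1..n} \<and>
    (\<forall>F s. fold (rung_step n) xs F s = F s + (if s \<in> I then \<Sum>j\<in>J. X s j * F j else 0))"
proof -
  have fin: "finite I" "finite J" using IJ(1) by (metis finite_Un finite_atLeastAtMost)+
  then obtain ps where ps: "set ps = I \<times> J" "distinct ps"
    using finite_distinct_list[OF finite_cartesian_product] by blast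
  \<comment> \<open>The number of counterclockwise steps from \<open>i\<close> to
    \<open>j\<close>.\<close>
  define dist where "dist i j = (if i \<le> j then j - i else j + n - i)" for i j :: nat
  have d: "i \<in> {1..n} \<and> 1 \<le> dist i j \<and> dist i j < n \<and> (cnext n ^^ dist i j) i = j" if "(i, j) \<in> I \<times> J" for i j
  proof -
    have r: "i \<in> {1..n}" "j \<in> {1..n}" "i \<noteq> j" using that IJ by auto
    then have "1 \<le> dist i j" "dist i j < n" by (auto simp: dist_def)
    then show ?thesis using r cnext_power[OF r(1), of "dist i j"] by (auto simp: dist_def split: if_splits)
  qed
  define steps where "steps X = concat (map (\<lambda>(i, j). transvect_steps n (dist i j) i (X i j)) ps)" for X :: "nat \<Rightarrow> nat \<Rightarrow> real"
  define c where "c d = length (transvect_steps n d 0 0)" for d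
  have c: "length (transvect_steps n d i x) = c d" for d i x
    using transvect_steps_length[of n d] unfolding c_def by auto
  have len: "length (steps X) = sum_list (map (\<lambda>(i, j). c (dist i j)) ps)" for X
    by (simp add: steps_def length_concat o_def case_prod_unfold c)
  have rng: "fst ` set (steps X) \<subseteq> {1..n}" for X
  proof -
    have "fst ` set (transvect_steps n (dist i j) i (X i j)) \<subseteq> {1..n}" if "(i, j) \<in> set ps" for i j
      using transvect_steps_range d that ps(1) by blast
    then show ?thesis unfolding steps_def by fastforce
  qed
  have "fold (rung_step n) (steps X) F s = F s + (if s \<in> I then \<Sum>j\<in>J. X s j * F j else 0)" for X F s
  proof -
    have "fold (rung_step n) (concat (map (\<lambda>(i, j). transvect_steps n (dist i j) i (X i j)) qs)) F
      = fold (\<lambda>(i, j). transvect i j (X i j)) qs F" if "set qs \<subseteq> I \<times> J" for qs F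
      using that
    proof (induction qs arbitrary: F)
      case (Cons q qs)
      then obtain i j where q: "q = (i, j)" "(i, j) \<in> I \<times> J" by auto
      show ?case using Cons fold_transvect_steps d[OF q(2)] by (simp add: q(1))
    qed simp
    then have "fold (rung_step n) (steps X) F s = F s + (\<Sum>(i, j)\<in>I \<times> J. if i = s then X i j * F j else 0)"
      using fold_transvects[OF _ ps(2) IJ(2), of X F s] ps(1) by (simp add: steps_def)
    also have "(\<Sum>(i, j)\<in>I \<times> J. if i = s then X i j * F j else 0) = (\<Sum>i\<in>I. if i = s then \<Sum>j\<in>J. X i j * F j else 0)"
      by (subst sum.cartesian_product[symmetric]) (intro sum.cong refl, simp)
    also have "\<dots> = (if s \<in> I then \<Sum>j\<in>J. X s j * F j else 0)" using fin by simp
    finally show ?thesis .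
  qed
  then show ?thesis using len rng by blast
qed

section \<open>Drawing the ladder in the disk\<close>

locale ladder =
  fixes n L :: nat and I J :: "nat set"
  assumes n3: "3 \<le> n" and IJ: "I \<union> J = {1..n}" and IJ_disj: "I \<inter> J = {}"
begin

text \<open>The first three boundary points are the third roots of unity, so that the origin is an inner
  point of the convex hull; consecutive boundary points are less than a half turn apart.\<close>

definition angle :: "nat \<Rightarrow> real" where
  "angle s = (if s \<le> 2 then 2 * pi / 3 * (real s - 1) else 4 * pi / 3 + 2 * pi / 3 * ((real s - 3) / (real n - 2)))"

lemma angle_gap:
  assumes "1 \<le> s"
  shows "angle s < angle (Suc s)" "angle (Suc s) < angle s + pi"
proof -
  have n: "real n - 2 \<ge> 1" using n3 by simp
  consider "s = 1" | "s = 2" | "s \<ge> 3" using assms by linarith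
  then have "angle s < angle (Suc s) \<and> angle (Suc s) < angle s + pi"
  proof cases
    case 3
    have "(real (Suc s) - 3) / (real n - 2) = (real s - 3) / (real n - 2) + 1 / (real n - 2)"
      by (simp add: add_divide_distrib[symmetric])
    then have "angle (Suc s) - angle s = 2 * pi / 3 * (1 / (real n - 2))"
      using 3 by (simp only: angle_def) (simp add: distrib_left)
    moreover have "0 < 1 / (real n - 2)" "1 / (real n - 2) \<le> 1" using n by auto
    then have "0 < 2 * pi / 3 * (1 / (real n - 2))" "2 * pi / 3 * (1 / (real n - 2)) \<le> 2 * pi / 3 * 1"
      by (intro mult_pos_pos mult_left_mono; simp)+
    ultimately show ?thesis using pi_gt_zero by linarith
  qed (use pi_gt_zero in \<open>simp_all add: angle_def\<close>)
  then show "angle s < angle (Suc s)" "angle (Suc s) < angle s + pi" by auto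
qed

lemma angle_ends: "angle 1 = 0" "angle (Suc n) = 2 * pi"
  using n3 by (simp_all add: angle_def)

lemma angle_mono: "1 \<le> s \<Longrightarrow> s < t \<Longrightarrow> angle s < angle t"
proof (induction t)
  case (Suc t)
  then show ?case using angle_gap(1)[of t] by (cases "s = t") (auto intro: less_trans)
qed simp

lemma angle_range:
  assumes "s \<in> {1..n}"
  shows "0 \<le> angle s" "angle s < 2 * pi"
  using angle_mono[of 1 s] angle_mono[of s "Suc n"] angle_ends assms by (cases "s = 1"; force)+

lemma cis_cnext: "s \<in> {1..n} \<Longrightarrow> cis (angle (cnext n s)) = cis (angle (Suc s))"
  using angle_ends by (auto simp: cnext_def)

text \<open>Nonnegative combinations of two consecutive directions, with positive coefficient at the
  first, fill a half-open sector. These sectors partition the punctured plane, since the gaps are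
  less than a half turn.\<close>

lemma sector_polar:
  assumes s: "s \<in> {1..n}" and x: "0 < x" and y: "0 \<le> y"
  shows "\<exists>r>0. \<exists>\<psi>. angle s \<le> \<psi> \<and> \<psi> < angle (Suc s) \<and>
    x *\<^sub>R cis (angle s) + y *\<^sub>R cis (angle (Suc s)) = r *\<^sub>R cis \<psi>"
proof -
  define \<delta> where "\<delta> = angle (Suc s) - angle s"
  have d: "0 < \<delta>" "\<delta> < pi" using angle_gap[of s] s by (auto simp: \<delta>_def)
  define w where "w = x *\<^sub>R 1 + y *\<^sub>R cis \<delta>"
  have w: "x *\<^sub>R cis (angle s) + y *\<^sub>R cis (angle (Suc s)) = cis (angle s) * w"
    by (simp add: w_def \<delta>_def distrib_left cis_mult)
  have sin: "sin \<delta> > 0" using d by (intro sin_gt_zero) auto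
  define \<phi> where "\<phi> = Arg w"
  have im: "Im (w * cis (- \<delta>)) < 0"
  proof -
    have "w * cis (- \<delta>) = x *\<^sub>R cis (- \<delta>) + y *\<^sub>R 1" by (simp add: w_def distrib_right cis_mult)
    then show ?thesis using sin x by simp
  qed
  then have w0: "w \<noteq> 0" by auto
  then have wpol: "w = norm w *\<^sub>R cis \<phi>" using rcis_cmod_Arg[of w] by (simp add: rcis_def \<phi>_def scaleR_conv_of_real)
  have "0 \<le> Im w" using sin y by (simp add: w_def)
  then have "0 \<le> \<phi>" unfolding \<phi>_def by (simp add: Arg_less_0)
  have "\<phi> \<le> pi" unfolding \<phi>_def by (rule Arg_le_pi)
  have "w * cis (- \<delta>) = norm w *\<^sub>R cis (\<phi> - \<delta>)" by (subst wpol) (simp add: cis_mult)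
  then have "sin (\<phi> - \<delta>) < 0" using im w0 by (simp add: mult_less_0_iff)
  then have "\<phi> < \<delta>" using sin_ge_zero[of "\<phi> - \<delta>"] \<open>\<phi> \<le> pi\<close> d by (cases "\<phi> < \<delta>") auto
  have "x *\<^sub>R cis (angle s) + y *\<^sub>R cis (angle (Suc s)) = norm w *\<^sub>R cis (angle s + \<phi>)"
    unfolding w by (subst wpol) (simp add: cis_mult)
  then show ?thesis using w0 \<open>0 \<le> \<phi>\<close> \<open>\<phi> < \<delta>\<close>
    by (intro exI[of _ "norm w"] conjI exI[of _ "angle s + \<phi>"]) (auto simp: \<delta>_def)
qed

text \<open>The polar angle determines the sector, and within a sector the two directions form a
  basis. All intersections of edges are decided in these coordinates.\<close>

lemma sector_unique:
  assumes s: "s \<in> {1..n}" and x: "0 < x" and y: "0 \<le> y" and s': "s' \<in> {1..n}" and x': "0 < x'" and y': "0 \<le> y'"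
    and eq: "x *\<^sub>R cis (angle s) + y *\<^sub>R cis (angle (Suc s)) = x' *\<^sub>R cis (angle s') + y' *\<^sub>R cis (angle (Suc s'))"
  shows "s = s' \<and> x = x' \<and> y = y'"
proof -
  obtain r \<psi> where r: "r > 0" "angle s \<le> \<psi>" "\<psi> < angle (Suc s)"
    "x *\<^sub>R cis (angle s) + y *\<^sub>R cis (angle (Suc s)) = r *\<^sub>R cis \<psi>" using sector_polar[OF s x y] by blast
  obtain r' \<psi>' where r': "r' > 0" "angle s' \<le> \<psi>'" "\<psi>' < angle (Suc s')"
    "x' *\<^sub>R cis (angle s') + y' *\<^sub>R cis (angle (Suc s')) = r' *\<^sub>R cis \<psi>'" using sector_polar[OF s' x' y'] by blast
  have e: "r *\<^sub>R cis \<psi> = r' *\<^sub>R cis \<psi>'" using eq r r' by simp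
  from arg_cong[OF this, of norm] have "r = r'" using r(1) r'(1) by simp
  with e r(1) have c: "cis \<psi> = cis \<psi>'" by simp
  have top: "angle (Suc t) \<le> 2 * pi" if "t \<in> {1..n}" for t
    using that angle_range(2)[of "Suc t"] angle_ends(2) by (cases "t = n") auto
  have rng: "0 \<le> \<psi>" "\<psi> < 2 * pi" "0 \<le> \<psi>'" "\<psi>' < 2 * pi"
    using r(2,3) r'(2,3) angle_range(1)[OF s] angle_range(1)[OF s'] top[OF s] top[OF s'] by linarith+
  have A: "Arg2pi (cis a) = a" if "0 \<le> a" "a < 2 * pi" for a
    by (rule Arg2pi_unique[of 1]) (use that in \<open>simp_all add: cis_conv_exp\<close>)
  have "\<psi> = \<psi>'" using A[OF rng(1,2)] A[OF rng(3,4)] unfolding c by simp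
  have "s = s'"
  proof (rule ccontr)
    assume "s \<noteq> s'"
    then consider "Suc s \<le> s'" | "Suc s' \<le> s" by linarith
    then show False
    proof cases
      case 1
      then have "angle (Suc s) \<le> angle s'" using angle_mono[of "Suc s" s'] by (cases "Suc s = s'") auto
      then show False using r r' \<open>\<psi> = \<psi>'\<close> by simp
    next
      case 2
      then have "angle (Suc s') \<le> angle s" using angle_mono[of "Suc s'" s] by (cases "Suc s' = s") auto
      then show False using r r' \<open>\<psi> = \<psi>'\<close> by simp
    qed
  qed
  define \<delta> where "\<delta> = angle (Suc s) - angle s"
  have sin: "sin \<delta> > 0" using angle_gap[of s] s by (intro sin_gt_zero) (auto simp: \<delta>_def)
  have im: "Im ((a *\<^sub>R cis (angle s) + b *\<^sub>R cis (angle (Suc s))) * cis (- angle s)) = b * sin \<delta>" for a b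
    by (simp only: distrib_right scaleR_left_distrib mult_scaleR_left cis_mult) (simp add: \<delta>_def)
  have e: "x *\<^sub>R cis (angle s) + y *\<^sub>R cis (angle (Suc s)) = x' *\<^sub>R cis (angle s) + y' *\<^sub>R cis (angle (Suc s))"
    using eq \<open>s = s'\<close> by simp
  have "y * sin \<delta> = y' * sin \<delta>"
    using arg_cong[OF e, of "\<lambda>z. Im (z * cis (- angle s))"] unfolding im .
  then have y: "y = y'" using sin by simp
  have "x *\<^sub>R cis (angle s) = x' *\<^sub>R cis (angle s)" using eq y \<open>s = s'\<close> by simp
  then have "x = x'" by simp
  with y \<open>s = s'\<close> show ?thesis by simp
qed

text \<open>Equally spaced radii. The shift by 1 keeps height 0 away from the origin, and the
  denominator puts the topmost height on the unit circle.\<close>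

definition radius :: "nat \<Rightarrow> real" where
  "radius h = (real h + 1) / (2 * real L + 2)"

lemma radius_pos: "0 < radius h" and radius_less: "radius h < radius h' \<longleftrightarrow> h < h'"
  and radius_top: "radius (Suc (2 * L)) = 1"
  by (simp_all add: radius_def divide_less_cancel zero_less_divide_iff)

lemma radius_le: "radius h \<le> radius h' \<longleftrightarrow> h \<le> h'"
  by (simp only: not_less[symmetric] radius_less)

lemma radius_eq: "radius h = radius h' \<longleftrightarrow> h = h'"
  using radius_le[of h h'] radius_le[of h' h] by (auto intro: antisym)

definition pos :: "nat \<times> nat \<Rightarrow> complex" where
  "pos = (\<lambda>(s, h). radius h *\<^sub>R cis (angle s))"

definition wire :: "nat \<Rightarrow> nat \<Rightarrow> (nat \<times> nat) \<times> (nat \<times> nat)" where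
  "wire s h = (if s \<in> I then ((s, Suc h), (s, h)) else ((s, h), (s, Suc h)))"

text \<open>For \<open>l = 0\<close> both ends have height 0 because of truncated subtraction.\<close>

definition rung :: "nat \<Rightarrow> nat \<Rightarrow> (nat \<times> nat) \<times> (nat \<times> nat)" where
  "rung s l = ((s, 2 * l - 1), (cnext n s, 2 * l))"

definition lverts :: "(nat \<times> nat) set" where "lverts = {1..n} \<times> {..Suc (2 * L)}"

text \<open>The rungs with \<open>l = 0\<close> form a closed ring through the inner ends of the
  wires. They give these ends degree three and later receive weight 0.\<close>

definition ledges :: "((nat \<times> nat) \<times> (nat \<times> nat)) set" where
  "ledges = case_prod wire ` ({1..n} \<times> {..2 * L}) \<union> case_prod rung ` ({1..n} \<times> {..L})"

lemma ledges_cases: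
  assumes "e \<in> ledges"
  obtains (wire) s h where "s \<in> {1..n}" "h \<le> 2 * L" "e = wire s h"
    | (rung) s l where "s \<in> {1..n}" "l \<le> L" "e = rung s l"
  using assms unfolding ledges_def by auto

lemma wire_in: "s \<in> {1..n} \<Longrightarrow> h \<le> 2 * L \<Longrightarrow> wire s h \<in> ledges"
  and rung_in: "s \<in> {1..n} \<Longrightarrow> l \<le> L \<Longrightarrow> rung s l \<in> ledges"
  unfolding ledges_def by force+

lemma ledges_subset: "ledges \<subseteq> lverts \<times> lverts"
proof
  fix e assume "e \<in> ledges"
  then show "e \<in> lverts \<times> lverts"
  proof (cases rule: ledges_cases)
    case (rung s l)
    then show ?thesis using cnext_in[OF rung(1)] by (auto simp: lverts_def rung_def)
  qed (auto simp: lverts_def wire_def)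
qed

lemma cnext_neq: "s \<in> {1..n} \<Longrightarrow> cnext n s \<noteq> s"
  using n3 by (auto simp: cnext_def)

lemma ledge_irrefl:
  assumes "e \<in> ledges"
  shows "fst e \<noteq> snd e"
  using assms
proof (cases rule: ledges_cases)
  case (rung s l)
  then show ?thesis using cnext_neq[OF rung(1)] by (auto simp: rung_def)
qed (auto simp: wire_def)

lemma pos_coords: "pos (s, h) = radius h *\<^sub>R cis (angle s) + 0 *\<^sub>R cis (angle (Suc s))"
  by (simp add: pos_def)

lemma pos_inj: "inj_on pos lverts"
proof (rule inj_onI)
  fix u v assume uv: "u \<in> lverts" "v \<in> lverts" and eq: "pos u = pos v"
  obtain s h s' h' where st: "u = (s, h)" "v = (s', h')" by force
  from sector_unique[OF _ radius_pos order_refl _ radius_pos order_refl, of s s' h h'] eq uv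
  show "u = v" unfolding st pos_coords by (auto simp: lverts_def radius_eq)
qed

definition segm :: "(nat \<times> nat) \<times> (nat \<times> nat) \<Rightarrow> complex set" where
  "segm e = closed_segment (pos (fst e)) (pos (snd e))"

lemma wire_segm:
  assumes "z \<in> segm (wire s h)"
  obtains x where "radius h \<le> x" "x \<le> radius (Suc h)" "z = x *\<^sub>R cis (angle s) + 0 *\<^sub>R cis (angle (Suc s))"
proof -
  have "z \<in> closed_segment (pos (s, h)) (pos (s, Suc h))"
    using assms unfolding segm_def wire_def by (auto simp: closed_segment_commute split: if_splits)
  then obtain u where u: "0 \<le> u" "u \<le> 1" "z = (1 - u) *\<^sub>R pos (s, h) + u *\<^sub>R pos (s, Suc h)" by (auto simp: in_segment)
  define x where "x = radius h + u * (radius (Suc h) - radius h)"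
  have "0 \<le> radius (Suc h) - radius h" using radius_less[of h "Suc h"] by simp
  then have "0 \<le> u * (radius (Suc h) - radius h)" "u * (radius (Suc h) - radius h) \<le> 1 * (radius (Suc h) - radius h)"
    using u by (intro mult_nonneg_nonneg mult_right_mono; simp)+
  then have "radius h \<le> x" "x \<le> radius (Suc h)" by (simp_all add: x_def)
  moreover have "z = x *\<^sub>R cis (angle s) + 0 *\<^sub>R cis (angle (Suc s))"
    unfolding u(3) pos_def x_def by (simp add: scaleR_add_left[symmetric] algebra_simps del: scaleR_left_diff_distrib)
  ultimately show thesis by (rule that)
qed

text \<open>A rung is cut out of its sector by a linear equation whose intercepts are the two radii.
  The far end is separate because it already belongs to the next half-open sector.\<close>

lemma rung_segm:
  assumes "z \<in> segm (rung s l)" and s: "s \<in> {1..n}"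
  obtains "z = pos (cnext n s, 2 * l)" | x y where "0 < x" "0 \<le> y" "x / radius (2 * l - 1) + y / radius (2 * l) = 1"
    "z = x *\<^sub>R cis (angle s) + y *\<^sub>R cis (angle (Suc s))"
proof -
  obtain u where u: "0 \<le> u" "u \<le> 1" "z = (1 - u) *\<^sub>R pos (s, 2 * l - 1) + u *\<^sub>R pos (cnext n s, 2 * l)"
    using assms(1) by (auto simp: segm_def rung_def in_segment)
  show thesis
  proof (cases "u = 1")
    case True
    then show thesis using u(3) that(1) by simp
  next
    case False
    define x y where "x = (1 - u) * radius (2 * l - 1)" and "y = u * radius (2 * l)"
    have "0 < x" "0 \<le> y" using u False radius_pos by (auto simp: x_def y_def less_imp_le)
    moreover have "x / radius (2 * l - 1) + y / radius (2 * l) = 1"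
      using radius_pos[of "2 * l - 1"] radius_pos[of "2 * l"] by (simp add: x_def y_def)
    moreover have "z = x *\<^sub>R cis (angle s) + y *\<^sub>R cis (angle (Suc s))"
      unfolding u(3) pos_def x_def y_def using cis_cnext[OF s] by simp
    ultimately show thesis by (rule that(2))
  qed
qed

lemma radius_between:
  assumes "radius h \<le> radius k" "radius k \<le> radius (Suc h)"
  shows "k = h \<or> k = Suc h"
  using assms by (auto simp: radius_le)

lemma wire_ends: "v = (s, h) \<or> v = (s, Suc h) \<Longrightarrow> v \<in> {fst (wire s h), snd (wire s h)}"
  by (auto simp: wire_def)

text \<open>In sector coordinates, wires on a common ray meet only in an end, a wire meets a rung
  only where one coordinate vanishes or at the far end of the rung, and two rungs in a sector are
  parts of lines whose intercepts grow with the level.\<close>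

lemma ledges_disjoint:
  assumes e: "e \<in> ledges" and e': "e' \<in> ledges" and ne: "e \<noteq> e'" and z: "z \<in> segm e" "z \<in> segm e'"
  shows "z \<in> pos ` {fst e, snd e}"
  using e
proof (cases rule: ledges_cases)
  case (wire s h)
  obtain x where x: "radius h \<le> x" "x \<le> radius (Suc h)" "z = x *\<^sub>R cis (angle s) + 0 *\<^sub>R cis (angle (Suc s))"
    using z(1) unfolding wire(3) by (rule wire_segm)
  then have x0: "0 < x" using radius_pos[of h] by simp
  have end_: "z \<in> pos ` {fst e, snd e}" if "x = radius k" for k
  proof -
    have "z = pos (s, k)" using x(3) that by (simp add: pos_def)
    moreover have "k = h \<or> k = Suc h" using radius_between x(1,2) that by simp
    ultimately show ?thesis using wire_ends[of "(s, k)" s h] unfolding wire(3) by blast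
  qed
  show ?thesis using e'
  proof (cases rule: ledges_cases)
    case (wire s' h')
    obtain x' where x': "radius h' \<le> x'" "x' \<le> radius (Suc h')" "z = x' *\<^sub>R cis (angle s') + 0 *\<^sub>R cis (angle (Suc s'))"
      using z(2) unfolding wire(3) by (rule wire_segm)
    then have x0': "0 < x'" using radius_pos[of h'] by simp
    have "s = s'" "x = x'" using sector_unique[OF \<open>s \<in> {1..n}\<close> x0 order_refl wire(1) x0' order_refl] x(3) x'(3) by auto
    with ne \<open>e = wire s h\<close> wire(3) have "h \<noteq> h'" by auto
    then have "h < h' \<or> h' < h" by linarith
    then have "x = radius h \<or> x = radius (Suc h)"
    proof
      assume "h < h'"
      then have "radius (Suc h) \<le> radius h'" by (simp add: radius_le)
      then show ?thesis using x x' \<open>x = x'\<close> by simp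
    next
      assume "h' < h"
      then have "radius (Suc h') \<le> radius h" by (simp add: radius_le)
      then show ?thesis using x x' \<open>x = x'\<close> by simp
    qed
    then show ?thesis using end_ by blast
  next
    case (rung s' l)
    from z(2) rung(1) show ?thesis unfolding rung(3)
    proof (cases rule: rung_segm)
      case 1
      then have "x = radius (2 * l)"
        using sector_unique[OF \<open>s \<in> {1..n}\<close> x0 order_refl cnext_in[OF rung(1)] radius_pos order_refl] x(3) by (auto simp: pos_coords)
      then show ?thesis by (rule end_)
    next
      case (2 x' y')
      then have "s = s'" "x = x'" "y' = 0" using sector_unique[OF \<open>s \<in> {1..n}\<close> x0 order_refl rung(1) 2(1,2)] x(3) by auto
      then have "x = radius (2 * l - 1)" using 2(3) radius_pos[of "2 * l - 1"] by (simp add: field_simps)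
      then show ?thesis by (rule end_)
    qed
  qed
next
  case (rung s l)
  have fin: ?thesis if "z = x *\<^sub>R cis (angle s) + 0 *\<^sub>R cis (angle (Suc s))" "x / radius (2 * l - 1) + 0 / radius (2 * l) = 1" for x
  proof -
    have "x = radius (2 * l - 1)" using that(2) radius_pos[of "2 * l - 1"] by (simp add: field_simps)
    then have "z = pos (s, 2 * l - 1)" using that(1) by (simp add: pos_def)
    then show ?thesis unfolding rung(3) by (simp add: rung_def)
  qed
  from z(1) rung(1) show ?thesis unfolding rung(3)
  proof (cases rule: rung_segm)
    case 1
    then show "z \<in> pos ` {fst (rung s l), snd (rung s l)}" by (simp add: rung_def)
  next
    case (2 x y)
    have fin': "z \<in> pos ` {fst (rung s l), snd (rung s l)}" if "y = 0" using fin[of x] 2(3,4) that rung(3) by simp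
    show "z \<in> pos ` {fst (rung s l), snd (rung s l)}" using e'
    proof (cases rule: ledges_cases)
      case (wire s' h')
      obtain x' where x': "radius h' \<le> x'" "x' \<le> radius (Suc h')" "z = x' *\<^sub>R cis (angle s') + 0 *\<^sub>R cis (angle (Suc s'))"
        using z(2) unfolding wire(3) by (rule wire_segm)
      then have x0': "0 < x'" using radius_pos[of h'] by simp
      have "y = 0" using sector_unique[OF rung(1) 2(1,2) wire(1) x0' order_refl] x'(3) 2(4) by auto
      then show ?thesis by (rule fin')
    next
      case r': (rung s' l')
      from z(2) r'(1) show ?thesis unfolding r'(3)
      proof (cases rule: rung_segm)
        case 1
        then have "y = 0"
          using sector_unique[OF rung(1) 2(1,2) cnext_in[OF r'(1)] radius_pos order_refl] 2(4) by (auto simp: pos_coords)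
        then show ?thesis by (rule fin')
      next
        case (2 x' y')
        have eq: "s = s'" "x = x'" "y = y'"
          using sector_unique[OF rung(1) \<open>0 < x\<close> \<open>0 \<le> y\<close> r'(1) 2(1,2)] 2(4) \<open>z = x *\<^sub>R cis (angle s) + y *\<^sub>R cis (angle (Suc s))\<close> by auto
        \<comment> \<open>The first intercept grows strictly even from level 0, where truncation
          puts it at height 0 while level 1 starts at height 1.\<close>
        have False if "l < l'" "x / radius (2 * l - 1) + y / radius (2 * l) = 1" "x / radius (2 * l' - 1) + y / radius (2 * l') = 1" for l l'
        proof -
          have "radius (2 * l - 1) < radius (2 * l' - 1)" "radius (2 * l) \<le> radius (2 * l')" using that(1) by (auto simp: radius_less radius_le)
          then have "x / radius (2 * l' - 1) < x / radius (2 * l - 1)" "y / radius (2 * l') \<le> y / radius (2 * l)"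
            using \<open>0 < x\<close> \<open>0 \<le> y\<close> radius_pos by (intro divide_strict_left_mono divide_left_mono mult_pos_pos; simp)+
          then show False using that by simp
        qed
        moreover have "l \<noteq> l'" using ne rung(3) r'(3) eq(1) by auto
        ultimately show ?thesis
          using \<open>x / radius (2 * l - 1) + y / radius (2 * l) = 1\<close> 2(3) eq by (metis linorder_neqE_nat)
      qed
    qed
  qed
qed

end

section \<open>Degrees of the ladder and its membership in \<open>Net\<close>\<close>

definition cprev :: "nat \<Rightarrow> nat \<Rightarrow> nat" where
  "cprev n s = (if s = 1 then n else s - 1)"

lemma cprev_in: "s \<in> {1..n} \<Longrightarrow> cprev n s \<in> {1..n}"
  by (auto simp: cprev_def)

lemma cnext_eq_iff: "s \<in> {1..n} \<Longrightarrow> p \<in> {1..n} \<Longrightarrow> cnext n p = s \<longleftrightarrow> p = cprev n s"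
  by (auto simp: cprev_def cnext_def)

context ladder begin

definition lout :: "nat \<times> nat \<Rightarrow> ((nat \<times> nat) \<times> (nat \<times> nat)) set" where "lout v = {e \<in> ledges. fst e = v}"
definition lin :: "nat \<times> nat \<Rightarrow> ((nat \<times> nat) \<times> (nat \<times> nat)) set" where "lin v = {e \<in> ledges. snd e = v}"

lemma lout_eq:
  assumes s: "s \<in> {1..n}"
  shows "lout (s, h) = wire s ` {k. k \<le> 2 * L \<and> (if s \<in> I then Suc k = h else k = h)} \<union> rung s ` {l. l \<le> L \<and> 2 * l - 1 = h}"
  (is "_ = ?R")
proof (rule Set.set_eqI, rule iffI)
  fix e assume "e \<in> lout (s, h)"
  then have e: "e \<in> ledges" "fst e = (s, h)" by (simp_all add: lout_def)
  from e(1) show "e \<in> ?R"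
  proof (cases rule: ledges_cases)
    case (wire s' k)
    then show ?thesis using e(2) by (intro UnI1) (auto simp: wire_def split: if_splits)
  next
    case (rung s' l)
    then show ?thesis using e(2) by (intro UnI2) (auto simp: rung_def)
  qed
next
  fix e assume "e \<in> ?R"
  then show "e \<in> lout (s, h)"
    using wire_in[OF s] rung_in[OF s] unfolding lout_def by (auto simp: wire_def rung_def split: if_splits)
qed

lemma lin_eq:
  assumes s: "s \<in> {1..n}"
  shows "lin (s, h) = wire s ` {k. k \<le> 2 * L \<and> (if s \<in> I then k = h else Suc k = h)} \<union> rung (cprev n s) ` {l. l \<le> L \<and> 2 * l = h}"
  (is "_ = ?R")
proof (rule Set.set_eqI, rule iffI)
  fix e assume "e \<in> lin (s, h)"
  then have e: "e \<in> ledges" "snd e = (s, h)" by (simp_all add: lin_def)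
  from e(1) show "e \<in> ?R"
  proof (cases rule: ledges_cases)
    case (wire s' k)
    then show ?thesis using e(2) by (intro UnI1) (auto simp: wire_def split: if_splits)
  next
    case (rung s' l)
    then have "s' = cprev n s" using e(2) cnext_eq_iff[OF s rung(1)] by (simp add: rung_def)
    then show ?thesis using e(2) rung by (intro UnI2) (auto simp: rung_def)
  qed
next
  fix e assume "e \<in> ?R"
  moreover have "cnext n (cprev n s) = s" using cnext_eq_iff[OF s cprev_in[OF s]] by simp
  ultimately show "e \<in> lin (s, h)"
    using wire_in[OF s] rung_in[OF cprev_in[OF s]] unfolding lin_def by (auto simp: wire_def rung_def split: if_splits)
qed

lemma lout_cases:
  assumes s: "s \<in> {1..n}"
  shows "lout (s, 0) = (if s \<in> I then {rung s 0} else {wire s 0, rung s 0})"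
    and "m < L \<Longrightarrow> lout (s, Suc (2 * m)) = (if s \<in> I then {wire s (2 * m), rung s (Suc m)} else {wire s (Suc (2 * m)), rung s (Suc m)})"
    and "m < L \<Longrightarrow> lout (s, 2 * Suc m) = (if s \<in> I then {wire s (Suc (2 * m))} else {wire s (2 * Suc m)})"
    and "lout (s, Suc (2 * L)) = (if s \<in> I then {wire s (2 * L)} else {})"
proof -
  have 0: "{l. l \<le> L \<and> 2 * l - 1 = 0} = {0}" "{k. k \<le> 2 * L \<and> k = 0} = {0}" by auto
  show "lout (s, 0) = (if s \<in> I then {rung s 0} else {wire s 0, rung s 0})" unfolding lout_eq[OF s] 0 by (simp add: 0 insert_commute)
  { assume m: "m < L"
    have l: "{l. l \<le> L \<and> 2 * l - 1 = Suc (2 * m)} = {Suc m}" "{l. l \<le> L \<and> 2 * l - 1 = 2 * Suc m} = {}"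
      using m by (auto, presburger+)
    have k: "{k. k \<le> 2 * L \<and> Suc k = Suc (2 * m)} = {2 * m}" "{k. k \<le> 2 * L \<and> k = Suc (2 * m)} = {Suc (2 * m)}"
      "{k. k \<le> 2 * L \<and> Suc k = 2 * Suc m} = {Suc (2 * m)}" "{k. k \<le> 2 * L \<and> k = 2 * Suc m} = {2 * Suc m}"
      using m by auto
    show "lout (s, Suc (2 * m)) = (if s \<in> I then {wire s (2 * m), rung s (Suc m)} else {wire s (Suc (2 * m)), rung s (Suc m)})"
      "lout (s, 2 * Suc m) = (if s \<in> I then {wire s (Suc (2 * m))} else {wire s (2 * Suc m)})"
      unfolding lout_eq[OF s] l using k by (simp_all split del: if_split add: if_distrib cong: if_cong) auto }
  have l: "{l. l \<le> L \<and> 2 * l - 1 = Suc (2 * L)} = {}" by auto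
  have k: "{k. k \<le> 2 * L \<and> Suc k = Suc (2 * L)} = {2 * L}" "{k. k \<le> 2 * L \<and> k = Suc (2 * L)} = {}" by auto
  show "lout (s, Suc (2 * L)) = (if s \<in> I then {wire s (2 * L)} else {})"
    unfolding lout_eq[OF s] l using k by auto
qed

lemma lin_cases:
  assumes s: "s \<in> {1..n}"
  shows "lin (s, 0) = (if s \<in> I then {wire s 0, rung (cprev n s) 0} else {rung (cprev n s) 0})"
    and "m < L \<Longrightarrow> lin (s, Suc (2 * m)) = (if s \<in> I then {wire s (Suc (2 * m))} else {wire s (2 * m)})"
    and "m < L \<Longrightarrow> lin (s, 2 * Suc m) = (if s \<in> I then {wire s (2 * Suc m), rung (cprev n s) (Suc m)} else {wire s (Suc (2 * m)), rung (cprev n s) (Suc m)})"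
    and "lin (s, Suc (2 * L)) = (if s \<in> I then {} else {wire s (2 * L)})"
proof -
  have 0: "{l. l \<le> L \<and> 2 * l = 0} = {0}" "{k. k \<le> 2 * L \<and> k = 0} = {0}" by auto
  show "lin (s, 0) = (if s \<in> I then {wire s 0, rung (cprev n s) 0} else {rung (cprev n s) 0})" unfolding lin_eq[OF s] 0 by (simp add: 0 insert_commute)
  { assume m: "m < L"
    have l: "{l. l \<le> L \<and> 2 * l = Suc (2 * m)} = {}" "{l. l \<le> L \<and> 2 * l = 2 * Suc m} = {Suc m}"
      using m by (auto, presburger+)
    have k: "{k. k \<le> 2 * L \<and> Suc k = Suc (2 * m)} = {2 * m}" "{k. k \<le> 2 * L \<and> k = Suc (2 * m)} = {Suc (2 * m)}"
      "{k. k \<le> 2 * L \<and> Suc k = 2 * Suc m} = {Suc (2 * m)}" "{k. k \<le> 2 * L \<and> k = 2 * Suc m} = {2 * Suc m}"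
      using m by auto
    show "lin (s, Suc (2 * m)) = (if s \<in> I then {wire s (Suc (2 * m))} else {wire s (2 * m)})"
      "lin (s, 2 * Suc m) = (if s \<in> I then {wire s (2 * Suc m), rung (cprev n s) (Suc m)} else {wire s (Suc (2 * m)), rung (cprev n s) (Suc m)})"
      unfolding lin_eq[OF s] l using k by (simp_all split del: if_split add: if_distrib cong: if_cong) auto }
  have l: "{l. l \<le> L \<and> 2 * l = Suc (2 * L)} = {}" by auto
  have k: "{k. k \<le> 2 * L \<and> Suc k = Suc (2 * L)} = {2 * L}" "{k. k \<le> 2 * L \<and> k = Suc (2 * L)} = {}" by auto
  show "lin (s, Suc (2 * L)) = (if s \<in> I then {} else {wire s (2 * L)})"
    unfolding lin_eq[OF s] l using k by auto
qed

lemma level_cases: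
  assumes "h \<le> 2 * L"
  obtains "h = 0" | m where "m < L" "h = Suc (2 * m)" | m where "m < L" "h = 2 * Suc m"
proof -
  consider "h = 0" | "odd h" | "even h" "h > 0" by auto
  then show thesis
  proof cases
    case 2
    then show thesis using assms that(2)[of "h div 2"] by (auto elim!: oddE)
  next
    case 3
    then obtain j where "h = 2 * j" "j > 0" by (auto elim!: evenE)
    then show thesis using assms that(3)[of "j - 1"] by auto
  qed (use that(1) in auto)
qed

lemma wire_neq_rung: "s \<in> {1..n} \<Longrightarrow> p \<in> {1..n} \<Longrightarrow> wire s h \<noteq> rung p l"
  using cnext_neq[of p] by (auto simp: wire_def rung_def)

text \<open>Above height 0 an inner vertex has two pieces of its wire, one entering and one leaving,
  and one end of a rung. At height 0 there are one piece of wire and two rungs, again one entering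
  and one leaving.\<close>

lemma ladder_degrees:
  assumes s: "s \<in> {1..n}" and h: "h \<le> 2 * L"
  shows "card (lin (s, h)) + card (lout (s, h)) = 3" "card (lin (s, h)) = 1 \<or> card (lout (s, h)) = 1"
proof -
  note ne = wire_neq_rung[OF s s] wire_neq_rung[OF s cprev_in[OF s]]
  have "card (lin (s, h)) + card (lout (s, h)) = 3 \<and> (card (lin (s, h)) = 1 \<or> card (lout (s, h)) = 1)"
    using h
  proof (cases rule: level_cases)
    case 1
    then show ?thesis using lout_cases(1)[OF s] lin_cases(1)[OF s] ne by (cases "s \<in> I") simp_all
  next
    case (2 m)
    then show ?thesis using lout_cases(2)[OF s 2(1)] lin_cases(2)[OF s 2(1)] ne by (cases "s \<in> I") simp_all
  next
    case (3 m)
    then show ?thesis using lout_cases(3)[OF s 3(1)] lin_cases(3)[OF s 3(1)] ne by (cases "s \<in> I") simp_all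
  qed
  then show "card (lin (s, h)) + card (lout (s, h)) = 3" "card (lin (s, h)) = 1 \<or> card (lout (s, h)) = 1" by auto
qed

definition lnet :: network where
  "lnet = \<lparr>bnum = n, bpt = \<lambda>i. pos (i, Suc (2 * L)), inner_verts = pos ` ({1..n} \<times> {..2 * L}),
     edges = map_prod pos pos ` ledges\<rparr>"

lemma lnet_sel [simp]: "bnum lnet = n" "bpt lnet i = pos (i, Suc (2 * L))" "inner_verts lnet = pos ` ({1..n} \<times> {..2 * L})"
  "edges lnet = map_prod pos pos ` ledges"
  by (simp_all add: lnet_def)

lemma bdry_lnet: "bdry_verts lnet = pos ` ({1..n} \<times> {Suc (2 * L)})"
  unfolding bdry_verts_def by (auto simp: image_iff)

lemma verts_lnet: "verts lnet = pos ` lverts"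
proof -
  have "lverts = {1..n} \<times> {Suc (2 * L)} \<union> {1..n} \<times> {..2 * L}" unfolding lverts_def by auto
  then show ?thesis unfolding verts_def bdry_lnet by (simp add: image_Un)
qed

lemma lnet_edges_inj: "inj_on (map_prod pos pos) ledges"
  by (rule inj_on_subset[OF map_prod_inj_on[OF pos_inj pos_inj] ledges_subset])

lemma ledge_lverts: "e \<in> ledges \<Longrightarrow> fst e \<in> lverts" "e \<in> ledges \<Longrightarrow> snd e \<in> lverts"
  using ledges_subset by (auto simp: mem_Times_iff dest!: subsetD)

lemma lnet_out: "v \<in> lverts \<Longrightarrow> out_edges lnet (pos v) = map_prod pos pos ` lout v"
  and lnet_in: "v \<in> lverts \<Longrightarrow> in_edges lnet (pos v) = map_prod pos pos ` lin v"
proof -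
  assume v: "v \<in> lverts"
  have "fst (map_prod pos pos e) = pos v \<longleftrightarrow> fst e = v" "snd (map_prod pos pos e) = pos v \<longleftrightarrow> snd e = v" if "e \<in> ledges" for e
    using inj_on_eq_iff[OF pos_inj _ v] ledge_lverts[OF that] by auto
  then have "{e \<in> ledges. fst (map_prod pos pos e) = pos v} = lout v" "{e \<in> ledges. snd (map_prod pos pos e) = pos v} = lin v"
    unfolding lout_def lin_def by blast+
  moreover have "{b \<in> f ` A. P b} = f ` {a \<in> A. P (f a)}" for f :: "(nat \<times> nat) \<times> (nat \<times> nat) \<Rightarrow> edge" and A P by auto
  ultimately
  show "out_edges lnet (pos v) = map_prod pos pos ` lout v" "in_edges lnet (pos v) = map_prod pos pos ` lin v"
    unfolding out_edges_def in_edges_def lnet_sel by simp_all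
qed

lemma lnet_cards:
  assumes "v \<in> lverts"
  shows "card (out_edges lnet (pos v)) = card (lout v)" "card (in_edges lnet (pos v)) = card (lin v)"
  unfolding lnet_out[OF assms] lnet_in[OF assms]
  by (rule card_image, rule inj_on_subset[OF lnet_edges_inj], force simp: lout_def lin_def)+

lemma interior_disc_zero: "0 \<in> interior (convex hull (bdry_verts lnet))"
proof -
  let ?p = "\<lambda>i. pos (i, Suc (2 * L))"
  have b: "?p i = cis (angle i)" for i by (simp add: pos_def radius_top)
  have p: "?p 1 = 1" "?p 2 = cis (2 * pi / 3)" "?p 3 = cis (4 * pi / 3)"
    unfolding b by (simp_all add: angle_def)
  have v: "cis (2 * pi / 3) = Complex (- 1 / 2) (sqrt 3 / 2)" "cis (4 * pi / 3) = Complex (- 1 / 2) (- sqrt 3 / 2)"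
  proof -
    have "cos (2 * pi / 3) = - cos (pi / 3)" "sin (2 * pi / 3) = sin (pi / 3)"
      using cos_pi_minus[of "pi / 3"] sin_pi_minus[of "pi / 3"] by (simp_all add: field_simps)
    moreover have "cos (4 * pi / 3) = - cos (pi / 3)" "sin (4 * pi / 3) = - sin (pi / 3)"
      using cos_periodic_pi[of "pi / 3"] sin_periodic_pi[of "pi / 3"] by (simp_all add: field_simps)
    ultimately show "cis (2 * pi / 3) = Complex (- 1 / 2) (sqrt 3 / 2)" "cis (4 * pi / 3) = Complex (- 1 / 2) (- sqrt 3 / 2)"
      by (simp_all add: complex_eq_iff cos_60 sin_60)
  qed
  have nc: "\<not> collinear {?p 1, ?p 2, ?p 3}"
  proof
    assume "collinear {?p 1, ?p 2, ?p 3}"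
    then have "collinear {?p 2, ?p 1, ?p 3}" by (simp add: insert_commute)
    then have "collinear {0, ?p 2 - ?p 1, ?p 3 - ?p 1}"
      using collinear_3[of "?p 2" "?p 1" "?p 3"] by (simp only: NO_MATCH_def simp_thms)
    then show False unfolding p v by (auto simp: collinear_lemma complex_eq_iff)
  qed
  \<comment> \<open>The origin is the barycentre of the three roots of unity, whence the weights
    1/3.\<close>
  have "0 \<in> interior (convex hull {?p 1, ?p 2, ?p 3})"
    unfolding interior_convex_hull_3_minimal[OF nc DIM_complex]
    by (rule CollectI, rule exI[of _ "1/3"], rule exI[of _ "1/3"], rule exI[of _ "1/3"])
      (simp only: p v, simp add: complex_eq_iff)
  moreover have "{?p 1, ?p 2, ?p 3} \<subseteq> bdry_verts lnet" using n3 unfolding bdry_lnet by auto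
  ultimately show ?thesis using interior_mono[OF hull_mono] by blast
qed

text \<open>Each inner vertex lies strictly between a boundary vertex and the interior point 0 of
  the hull, or closer to 0.\<close>

lemma lnet_inner_hull: "inner_verts lnet \<subseteq> interior (convex hull (bdry_verts lnet))"
proof
  fix z assume "z \<in> inner_verts lnet"
  then obtain s h where sh: "s \<in> {1..n}" "h \<le> 2 * L" "z = pos (s, h)" by auto
  have b: "pos (s, Suc (2 * L)) \<in> convex hull (bdry_verts lnet)"
    using sh(1) unfolding bdry_lnet by (intro hull_inc) auto
  have "z = pos (s, Suc (2 * L)) - (1 - radius h) *\<^sub>R (pos (s, Suc (2 * L)) - 0)"
    unfolding sh(3) pos_def prod.case radius_top by (simp add: algebra_simps)
  moreover have "0 < 1 - radius h" "1 - radius h \<le> 1"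
    using sh(2) radius_less[of h "Suc (2 * L)"] radius_pos[of h] by (simp_all add: radius_top)
  ultimately show "z \<in> interior (convex hull (bdry_verts lnet))"
    using mem_interior_convex_shrink[OF convex_convex_hull interior_disc_zero b] by simp
qed

lemma lnet_in_Net: "lnet \<in> Net n I J"
  unfolding Net_def
proof (intro CollectI conjI ballI impI)
  show "bnum lnet = n" by simp
  show "ccw_on_circle n (bpt lnet)"
    unfolding ccw_on_circle_def
  proof (intro exI[of _ angle] conjI ballI impI)
    fix i show "bpt lnet i = cis (angle i)" by (simp add: pos_def radius_top)
  next
    fix i j assume "i \<in> {1..n}" "j \<in> {1..n}" "i < j"
    then show "angle i < angle j" "angle j < angle i + 2 * pi"
      using angle_mono[of i j] angle_range(1)[of i] angle_range(2)[of j] by auto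
  qed
  show "finite (inner_verts lnet)" by simp
  show "inner_verts lnet \<subseteq> interior (convex hull (bdry_verts lnet))" by (rule lnet_inner_hull)
  show "edges lnet \<subseteq> verts lnet \<times> verts lnet" using ledge_lverts by (auto simp: verts_lnet)
next
  fix e assume "e \<in> edges lnet"
  then obtain a where a: "a \<in> ledges" "e = map_prod pos pos a" by auto
  then show "fst e \<noteq> snd e" using ledge_irrefl[OF a(1)] inj_on_eq_iff[OF pos_inj] ledge_lverts[OF a(1)] by (cases a) auto
next
  fix e e' assume "e \<in> edges lnet" "e' \<in> edges lnet" and ne: "e \<noteq> e'"
  then obtain a a' where a: "a \<in> ledges" "e = map_prod pos pos a" and a': "a' \<in> ledges" "e' = map_prod pos pos a'"
    unfolding lnet_sel by (elim imageE)
  have "a \<noteq> a'" using ne a a' by auto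
  then show "closed_segment (fst e) (snd e) \<inter> closed_segment (fst e') (snd e') \<subseteq> {fst e, snd e} \<inter> {fst e', snd e'}"
    using ledges_disjoint[OF a(1) a'(1)] ledges_disjoint[OF a'(1) a(1)] unfolding a(2) a'(2) segm_def
    by (cases a, cases a') auto
next
  fix i assume i: "i \<in> I"
  then have s: "i \<in> {1..n}" and v: "(i, Suc (2 * L)) \<in> lverts" using IJ by (auto simp: lverts_def)
  show "card (out_edges lnet (bpt lnet i)) = 1" "in_edges lnet (bpt lnet i) = {}"
    using lnet_cards[OF v] lnet_in[OF v] lout_cases(4)[OF s] lin_cases(4)[OF s] i by simp_all
next
  fix j assume j: "j \<in> J"
  then have s: "j \<in> {1..n}" and v: "(j, Suc (2 * L)) \<in> lverts" "j \<notin> I" using IJ IJ_disj by (auto simp: lverts_def)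
  show "card (in_edges lnet (bpt lnet j)) = 1" "out_edges lnet (bpt lnet j) = {}"
    using lnet_cards[OF v(1)] lnet_out[OF v(1)] lout_cases(4)[OF s] lin_cases(4)[OF s] v(2) by simp_all
next
  fix z assume "z \<in> inner_verts lnet"
  then obtain s h where sh: "s \<in> {1..n}" "h \<le> 2 * L" "z = pos (s, h)" by auto
  then have v: "(s, h) \<in> lverts" by (auto simp: lverts_def)
  note d = ladder_degrees[OF sh(1,2)]
  have fin: "finite (in_edges lnet z)" "finite (out_edges lnet z)"
    unfolding in_edges_def out_edges_def by (simp_all add: ledges_def)
  have "in_edges lnet z \<inter> out_edges lnet z = {}"
  proof -
    have "lin (s, h) \<inter> lout (s, h) = {}" using ledge_irrefl by (force simp: lin_def lout_def)
    then show ?thesis unfolding sh(3) lnet_in[OF v] lnet_out[OF v]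
      using inj_on_image_Int[OF lnet_edges_inj, of "lin (s, h)" "lout (s, h)"] by (auto simp: lin_def lout_def)
  qed
  then show "card (in_edges lnet z \<union> out_edges lnet z) = 3"
    using card_Un_disjoint[OF fin] d(1) lnet_cards[OF v] sh(3) by simp
  show "white lnet z \<or> black lnet z"
    unfolding white_def black_def sh(3) lnet_cards[OF v] by (rule d(2))
qed

end

sublocale ladder \<subseteq> net: planar_net n I J lnet
  by unfold_locales (rule lnet_in_Net IJ IJ_disj)+

section \<open>Solving the network equations of the ladder\<close>

context ladder begin

text \<open>With these signs a rung acts by the same transvection for both orientations of its wire.\<close>

definition lweight :: "(nat \<times> real) list \<Rightarrow> (nat \<times> nat) \<times> (nat \<times> nat) \<Rightarrow> real" where
  "lweight xs = (\<lambda>((s, h), (s', h')). if s = s' then 1 else if h' = 0 then 0 else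
     (case xs ! (h' div 2 - 1) of (z, t) \<Rightarrow> if s = z then if s \<in> I then t else - t else 0))"

lemma lweight_wire: "lweight xs (wire s h) = 1"
  by (simp add: lweight_def wire_def)

lemma lweight_rung:
  assumes "s \<in> {1..n}"
  shows "lweight xs (rung s 0) = 0"
    "lweight xs (rung s (Suc m)) = (case xs ! m of (z, t) \<Rightarrow> if s = z then if s \<in> I then t else - t else 0)"
  using cnext_neq[OF assms] by (auto simp: lweight_def rung_def)

definition source_term :: "(nat \<Rightarrow> real) \<Rightarrow> nat \<times> nat \<Rightarrow> real" where
  "source_term \<gamma> = (\<lambda>(s, h). if s \<in> J \<and> h = Suc (2 * L) then \<gamma> s else 0)"

text \<open>The values of a solution of the network equations along the circle at height \<open>2 * l\<close>
  arise from those at height 0 by the first \<open>l\<close> transvections.\<close>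

lemma ladder_solution:
  assumes len: "length xs = L" and rng: "fst ` set xs \<subseteq> {1..n}"
    and act: "\<And>F s. fold (rung_step n) xs F s = F s + (if s \<in> I then \<Sum>j\<in>J. X s j * F j else 0)"
    and sys: "\<And>v. v \<in> lverts \<Longrightarrow> G v = source_term \<gamma> v + (\<Sum>e\<in>lout v. lweight xs e * G (snd e))"
  shows "\<And>i. i \<in> I \<Longrightarrow> G (i, Suc (2 * L)) = (\<Sum>j\<in>J. X i j * \<gamma> j)"
    and "(\<And>j. j \<in> J \<Longrightarrow> \<gamma> j = 0) \<Longrightarrow> v \<in> lverts \<Longrightarrow> G v = 0"
proof -
  have In: "s \<in> {1..n}" if "s \<in> I" for s using that IJ by auto
  have Jn: "s \<in> {1..n} \<and> s \<notin> I" if "s \<in> J" for s using that IJ IJ_disj by auto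
  have side: "s \<in> I \<or> s \<in> J" if "s \<in> {1..n}" for s using that IJ by blast
  have lv: "(s, h) \<in> lverts" if "s \<in> {1..n}" "h \<le> Suc (2 * L)" for s h using that by (simp add: lverts_def)
  have st: "source_term \<gamma> (s, h) = 0" if "h \<le> 2 * L \<or> s \<in> I" for s h
    using that IJ_disj by (auto simp: source_term_def)
  define r where "r s m = lweight xs (rung s (Suc m)) * G (cnext n s, 2 * Suc m)" for s m
  have snd_rung: "snd (rung s l) = (cnext n s, 2 * l)" for s l by (simp add: rung_def)
  have snd_wire: "snd (wire s h) = (if s \<in> I then (s, h) else (s, Suc h))" for s h by (simp add: wire_def)
  \<comment> \<open>Only the rung of level 0 leaves the foot of a source wire, and its weight is 0.
    So the fold starts with zeros on \<open>I\<close>.\<close>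
  have src0: "G (s, 0) = 0" if s: "s \<in> I" for s
    using sys[OF lv[OF In[OF s]], of 0] st[of 0 s] lout_cases(1)[OF In[OF s]] lweight_rung(1)[OF In[OF s]] s by simp
  have src1: "G (s, Suc (2 * m)) = G (s, 2 * m) + r s m" if s: "s \<in> I" and m: "m < L" for s m
    using sys[OF lv[OF In[OF s]], of "Suc (2 * m)"] st[of "Suc (2 * m)" s] lout_cases(2)[OF In[OF s] m] s m
      wire_neq_rung[OF In[OF s] In[OF s]] by (simp add: lweight_wire snd_wire snd_rung r_def)
  have src2: "G (s, 2 * Suc m) = G (s, Suc (2 * m))" if s: "s \<in> I" and m: "m < L" for s m
    using sys[OF lv[OF In[OF s]], of "2 * Suc m"] st[of "2 * Suc m" s] lout_cases(3)[OF In[OF s] m] s m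
    by (simp add: lweight_wire snd_wire)
  have src3: "G (s, Suc (2 * L)) = G (s, 2 * L)" if s: "s \<in> I" for s
    using sys[OF lv[OF In[OF s]], of "Suc (2 * L)"] st[of "Suc (2 * L)" s] lout_cases(4)[OF In[OF s]] s
    by (simp add: lweight_wire snd_wire)
  have snk1: "G (s, Suc (2 * m)) = G (s, 2 * Suc m) + r s m" if s: "s \<in> J" and m: "m < L" for s m
  proof -
    have s': "s \<in> {1..n}" "s \<notin> I" using Jn[OF s] by auto
    show ?thesis using sys[OF lv[OF s'(1)], of "Suc (2 * m)"] st[of "Suc (2 * m)" s] lout_cases(2)[OF s'(1) m] s'(2) m
      wire_neq_rung[OF s'(1) s'(1)] by (simp add: lweight_wire snd_wire snd_rung r_def)
  qed
  have snk2: "G (s, 2 * m) = G (s, Suc (2 * m))" if s: "s \<in> J" and m: "m \<le> L" for s m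
  proof -
    have s': "s \<in> {1..n}" "s \<notin> I" using Jn[OF s] by auto
    show ?thesis
    proof (cases m)
      case 0
      then show ?thesis using sys[OF lv[OF s'(1)], of 0] st[of 0 s] lout_cases(1)[OF s'(1)] lweight_rung(1)[OF s'(1)] s'(2)
        wire_neq_rung[OF s'(1) s'(1)] by (simp add: lweight_wire snd_wire)
    next
      case (Suc k)
      then show ?thesis using sys[OF lv[OF s'(1)], of "2 * Suc k"] st[of "2 * Suc k" s] lout_cases(3)[OF s'(1), of k] s'(2) m
        by (simp add: lweight_wire snd_wire)
    qed
  qed
  have snk3: "G (s, Suc (2 * L)) = \<gamma> s" if s: "s \<in> J" for s
  proof -
    have s': "s \<in> {1..n}" "s \<notin> I" using Jn[OF s] by auto
    show ?thesis using sys[OF lv[OF s'(1)], of "Suc (2 * L)"] lout_cases(4)[OF s'(1)] s s'(2) by (simp add: source_term_def)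
  qed
  define F where "F l s = (if s \<in> {1..n} then G (s, 2 * l) else 0)" for l s
  \<comment> \<open>On a source wire the outer value is the inner one plus the rung term; on a sink
    wire the equation reads the other way, and the negative weight restores the sign.\<close>
  have step: "F (Suc m) = rung_step n (xs ! m) (F m)" if m: "m < L" for m
  proof -
    obtain z t where zt: "xs ! m = (z, t)" by force
    have "(z, t) \<in> set xs" using m len zt by (metis nth_mem)
    then have z: "z \<in> {1..n}" using rng by force
    have F: "F (Suc m) s = F m s + (if s = z then t * G (cnext n s, 2 * Suc m) else 0)" if s: "s \<in> {1..n}" for s
    proof -
      have "r s m = (if s = z then if s \<in> I then t * G (cnext n s, 2 * Suc m) else - t * G (cnext n s, 2 * Suc m) else 0)"
        unfolding r_def lweight_rung(2)[OF s] zt by simp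
      moreover have "s \<in> I \<and> G (s, 2 * Suc m) = G (s, 2 * m) + r s m \<or> s \<notin> I \<and> G (s, 2 * m) = G (s, 2 * Suc m) + r s m"
      proof (cases "s \<in> I")
        case True
        then show ?thesis using src1[OF True m] src2[OF True m] by simp
      next
        case False
        then have j: "s \<in> J" using side s by auto
        show ?thesis using snk1[OF j m] snk2[OF j less_imp_le[OF m]] False by simp
      qed
      ultimately show ?thesis using s by (auto simp: F_def split: if_splits)
    qed
    \<comment> \<open>The rung reads its neighbour at the upper height, but only wire
      \<open>z\<close> changes at this level, so the lower height has the same value.\<close>
    have "G (cnext n z, 2 * Suc m) = F m (cnext n z)"
      using F[OF cnext_in[OF z]] cnext_neq[OF z] cnext_in[OF z] by (simp add: F_def)
    then show ?thesis using F z by (auto simp: fun_eq_iff zt rung_step_def transvect_def F_def)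
  qed
  have fold: "F l = fold (rung_step n) (take l xs) (F 0)" if "l \<le> L" for l
    using that
  proof (induction l)
    case (Suc l)
    then show ?case using step[of l] len by (simp add: take_Suc_conv_app_nth)
  qed simp
  have FL: "F L s = F 0 s + (if s \<in> I then \<Sum>j\<in>J. X s j * F 0 j else 0)" for s
    using fold[OF order_refl] act[of "F 0" s] len by simp
  have F0I: "F 0 s = 0" if "s \<in> I" for s using src0[OF that] by (simp add: F_def)
  \<comment> \<open>The boundary condition for sinks sits at the outer end, the start of the fold at
    the inner one. Since the whole product leaves the coordinates in \<open>J\<close> unchanged, the
    values at both ends agree.\<close>
  have F0J: "F 0 s = \<gamma> s" if s: "s \<in> J" for s
  proof -
    have "F 0 s = F L s" using FL[of s] Jn[OF s] by simp
    then show ?thesis using snk2[OF s order_refl] snk3[OF s] Jn[OF s] by (simp add: F_def)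
  qed
  show "G (i, Suc (2 * L)) = (\<Sum>j\<in>J. X i j * \<gamma> j)" if i: "i \<in> I" for i
    using src3[OF i] FL[of i] F0I[OF i] F0J i In[OF i] by (simp add: F_def)
  assume \<gamma>: "\<And>j. j \<in> J \<Longrightarrow> \<gamma> j = 0" and v: "v \<in> lverts"
  have F0: "F 0 s = 0" for s
    using F0I[of s] F0J[of s] \<gamma>[of s] side[of s] by (cases "s \<in> {1..n}") (auto simp: F_def)
  have Fl: "F l s = 0" if "l \<le> L" for l s
    using that
  proof (induction l arbitrary: s)
    case (Suc l)
    then show ?case using step[of l] by (cases "xs ! l") (simp add: rung_step_def transvect_def)
  qed (rule F0)
  then have even0: "G (s, 2 * l) = 0" if "l \<le> L" "s \<in> {1..n}" for l s
    using that by (metis F_def)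
  obtain s h where sh: "v = (s, h)" by force
  then have s: "s \<in> {1..n}" and h: "h \<le> Suc (2 * L)" using v by (auto simp: lverts_def)
  show "G v = 0"
  proof (cases "h \<le> 2 * L")
    case True
    then show ?thesis
    proof (cases rule: level_cases)
      case 1
      then show ?thesis using even0[of 0 s] s sh by simp
    next
      case (2 m)
      then show ?thesis using even0[of m s] even0[of "Suc m" s] src2[of s m] snk2[of s m] side[OF s] s sh by auto
    next
      case (3 m)
      then show ?thesis using even0[of "Suc m" s] s sh by simp
    qed
  next
    case False
    then have "h = Suc (2 * L)" using h by simp
    then show ?thesis using side[OF s] src3[of s] snk3[of s] even0[of L s] \<gamma> s sh by auto
  qed
qed

text \<open>A column of the Green function solves the network equations with a unit source at one
  sink; the solution determines its values at the sources. Uniqueness of the solution for zero data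
  gives the nonzero determinant.\<close>

lemma ladder_green:
  assumes len: "length xs = L" and rng: "fst ` set xs \<subseteq> {1..n}"
    and act: "\<And>F s. fold (rung_step n) xs F s = F s + (if s \<in> I then \<Sum>j\<in>J. X s j * F j else 0)"
  shows "\<exists>w. w \<in> extensional (edges lnet) \<and> peval (net.net_det net.edge_sign) w \<noteq> 0 \<and>
    (\<forall>i\<in>I. \<forall>j\<in>J. net.green w (bpt lnet i) (bpt lnet j) = X i j)"
proof -
  \<comment> \<open>The edge sign is put into the weight in order to cancel the one in
    \<open>net_matrix\<close>.\<close>
  define w where "w = (\<lambda>e\<in>edges lnet. net.edge_sign e * lweight xs (inv_into ledges (map_prod pos pos) e))"
  have ext: "w \<in> extensional (edges lnet)" unfolding w_def by (rule restrict_extensional)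
  have w: "net.edge_sign (map_prod pos pos e) * w (map_prod pos pos e) = lweight xs e" if "e \<in> ledges" for e
    using net.edge_sign_pm[of "map_prod pos pos e"] inv_into_f_f[OF lnet_edges_inj that] imageI[OF that, of "map_prod pos pos"] by (auto simp: w_def)
  have sum: "(\<Sum>x\<in>verts lnet. net.net_matrix net.edge_sign w (pos v) x * g x) = (\<Sum>e\<in>lout v. lweight xs e * g (pos (snd e)))"
    if "v \<in> lverts" for v g
  proof -
    have "pos v \<in> verts lnet" using that by (simp add: verts_lnet)
    then have "(\<Sum>x\<in>verts lnet. net.net_matrix net.edge_sign w (pos v) x * g x)
      = (\<Sum>e\<in>out_edges lnet (pos v). net.edge_sign e * w e * g (snd e))"
      by (rule net.net_matrix_sum)
    also have "\<dots> = (\<Sum>e\<in>lout v. net.edge_sign (map_prod pos pos e) * w (map_prod pos pos e) * g (snd (map_prod pos pos e)))"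
      unfolding lnet_out[OF that]
      by (rule sum.reindex[unfolded o_def], rule inj_on_subset[OF lnet_edges_inj]) (simp add: lout_def)
    also have "\<dots> = (\<Sum>e\<in>lout v. lweight xs e * g (pos (snd e)))"
      by (rule sum.cong[OF refl]) (simp add: w lout_def)
    finally show ?thesis .
  qed
  have D: "peval (net.net_det net.edge_sign) w \<noteq> 0"
  proof (rule net.net_det_nonzero_eval)
    fix g u assume g: "\<And>v. v \<in> verts lnet \<Longrightarrow> g v = (\<Sum>x\<in>verts lnet. net.net_matrix net.edge_sign w v x * g x)"
      and u: "u \<in> verts lnet"
    from u obtain v where v: "v \<in> lverts" "u = pos v" unfolding verts_lnet by auto
    have "g (pos v) = 0"
    proof (rule ladder_solution(2)[OF len rng act, where G = "\<lambda>v. g (pos v)" and \<gamma> = "\<lambda>_. 0"])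
      fix v assume v: "v \<in> lverts"
      then show "g (pos v) = source_term (\<lambda>_. 0) v + (\<Sum>e\<in>lout v. lweight xs e * g (pos (snd e)))"
        using g[of "pos v"] sum[OF v] by (simp add: verts_lnet source_term_def split: prod.split)
    qed (use v in auto)
    then show "g u = 0" using v(2) by simp
  qed
  have "net.green w (bpt lnet i) (bpt lnet j) = X i j" if i: "i \<in> I" and j: "j \<in> J" for i j
  proof -
    have fJ: "finite J" using IJ by (metis finite_Un finite_atLeastAtMost)
    have bj: "(j, Suc (2 * L)) \<in> lverts" using j IJ by (auto simp: lverts_def)
    define g where "g v = net.green w v (bpt lnet j)" for v
    have "g (pos (i, Suc (2 * L))) = (\<Sum>j'\<in>J. X i j' * (if j' = j then 1 else 0))"
    proof (rule ladder_solution(1)[OF len rng act _ i, where G = "\<lambda>v. g (pos v)" and \<gamma> = "\<lambda>j'. if j' = j then 1 else 0"])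
      fix v assume v: "v \<in> lverts"
      have "pos v \<in> verts lnet" "bpt lnet j \<in> verts lnet" using v bj by (simp_all add: verts_lnet)
      from net.net_green_left[OF D this]
      have "g (pos v) = (if pos v = bpt lnet j then 1 else 0) + (\<Sum>x\<in>verts lnet. net.net_matrix net.edge_sign w (pos v) x * g x)"
        unfolding g_def net.green_def .
      then have "g (pos v) = (if pos v = bpt lnet j then 1 else 0) + (\<Sum>e\<in>lout v. lweight xs e * g (pos (snd e)))"
        unfolding sum[OF v] .
      moreover have "pos v = bpt lnet j \<longleftrightarrow> v = (j, Suc (2 * L))" using inj_on_eq_iff[OF pos_inj v bj] by simp
      ultimately show "g (pos v) = source_term (\<lambda>j'. if j' = j then 1 else 0) v + (\<Sum>e\<in>lout v. lweight xs e * g (pos (snd e)))"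
        using j by (cases v) (auto simp: source_term_def)
    qed
    also have "\<dots> = (\<Sum>j'\<in>J. if j' = j then X i j' else 0)" by (intro sum.cong refl) simp
    also have "\<dots> = X i j" using fJ j by simp
    finally show ?thesis by (simp add: g_def)
  qed
  with D ext show ?thesis by blast
qed

end

section \<open>Density of the boundary measurements\<close>

context planar_net begin

text \<open>Weights with zeros are not admissible. Adding a small constant to all of them makes them
  nonzero, keeps the determinant nonzero and changes the Green function only slightly.\<close>

lemma bm_approx:
  assumes w: "w \<in> extensional (edges N)" and D: "peval (net_det edge_sign) w \<noteq> 0" and \<epsilon>: "0 < \<epsilon>"
  shows "\<exists>w'\<in>bm_domain I J N. \<forall>i\<in>I. \<forall>j\<in>J. \<bar>bm N i j w' - cross_sign i j * green w (bpt N i) (bpt N j)\<bar> < \<epsilon>"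
proof -
  define W where "W t = (\<lambda>e\<in>edges N. w e + t)" for t
  have W0: "W 0 = w" using w by (auto simp: W_def fun_eq_iff extensional_def)
  have cW: "isCont (\<lambda>t. W t e) 0" for e by (cases "e \<in> edges N") (auto simp: W_def intro!: continuous_intros)
  have D0: "peval (net_det edge_sign) (W 0) \<noteq> 0" using D by (simp add: W0)
  have "isCont (\<lambda>t. peval (net_det edge_sign) (W t)) 0" by (rule isCont_peval[OF cW])
  then have eD: "\<forall>\<^sub>F t in at 0. peval (net_det edge_sign) (W t) \<noteq> 0"
    using tendsto_imp_eventually_ne[OF _ D0] by (simp add: isCont_def)
  have eW: "\<forall>\<^sub>F t in at 0. \<forall>e\<in>edges N. W t e \<noteq> 0"
  proof (rule eventually_ball_finite[OF finite_edges], rule ballI)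
    fix e assume e: "e \<in> edges N"
    have "open (- ({- w e} - {0}))" by (intro open_Compl finite_imp_closed) simp
    then have "\<forall>\<^sub>F t in at 0. t \<in> - ({- w e} - {0})" by (rule eventually_at_in_open') simp
    moreover have "\<forall>\<^sub>F t in at (0::real). t \<noteq> 0" by (simp add: eventually_at_filter)
    ultimately show "\<forall>\<^sub>F t in at 0. W t e \<noteq> 0" by eventually_elim (use e in \<open>auto simp: W_def\<close>)
  qed
  have eG: "\<forall>\<^sub>F t in at 0. \<forall>i\<in>I. \<forall>j\<in>J. \<bar>cross_sign i j * green (W t) (bpt N i) (bpt N j) - cross_sign i j * green w (bpt N i) (bpt N j)\<bar> < \<epsilon>"
  proof (intro eventually_ball_finite finite_IJ ballI)
    fix i j
    have "isCont (\<lambda>t. cross_sign i j * green (W t) (bpt N i) (bpt N j)) 0"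
      unfolding green_def net_green_def by (intro continuous_intros isCont_peval cW D0)
    then have "((\<lambda>t. cross_sign i j * green (W t) (bpt N i) (bpt N j)) \<longlongrightarrow> cross_sign i j * green w (bpt N i) (bpt N j)) (at 0)"
      by (simp add: isCont_def W0)
    from tendstoD[OF this \<epsilon>]
    show "\<forall>\<^sub>F t in at 0. \<bar>cross_sign i j * green (W t) (bpt N i) (bpt N j) - cross_sign i j * green w (bpt N i) (bpt N j)\<bar> < \<epsilon>"
      by (simp add: dist_real_def)
  qed
  have "\<forall>\<^sub>F t in at (0::real). W t \<in> bm_domain I J N \<and>
    (\<forall>i\<in>I. \<forall>j\<in>J. \<bar>bm N i j (W t) - cross_sign i j * green w (bpt N i) (bpt N j)\<bar> < \<epsilon>)"
    using eD eW eG
  proof eventually_elim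
    case (elim t)
    have "W t \<in> weight_space N" using elim(2) by (auto simp: weight_space_def W_def)
    moreover have "bm_defined N i j (W t)" if "i \<in> I" "j \<in> J" for i j
      unfolding bm_defined_def
      using bm_represents_signed[OF path_sign_eq[OF that] bpt_verts[OF I_in[OF that(1)]] bpt_verts[OF J_in[OF that(2)]]] elim(1) by blast
    ultimately have "W t \<in> bm_domain I J N" by (simp add: bm_domain_def)
    then show ?case using elim(3) bm_eq_green[OF _ _ elim(1)] by simp
  qed
  from eventually_happens[OF this] show ?thesis by auto
qed

lemma bm_dense:
  assumes "\<And>X. \<exists>w. w \<in> extensional (edges N) \<and> peval (net_det edge_sign) w \<noteq> 0 \<and>
    (\<forall>i\<in>I. \<forall>j\<in>J. green w (bpt N i) (bpt N j) = X i j)" and "0 < \<epsilon>"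
  shows "\<exists>w\<in>bm_domain I J N. \<forall>i\<in>I. \<forall>j\<in>J. \<bar>bm N i j w - X i j\<bar> < \<epsilon>"
proof -
  \<comment> \<open>The prescribed matrix contains the signs by which \<open>bm\<close> and
    \<open>green\<close> differ; they square to 1.\<close>
  from assms(1)[of "\<lambda>i j. cross_sign i j * X i j"] obtain w where w: "w \<in> extensional (edges N)"
    "peval (net_det edge_sign) w \<noteq> 0" "\<forall>i\<in>I. \<forall>j\<in>J. green w (bpt N i) (bpt N j) = cross_sign i j * X i j" by blast
  have "cross_sign i j * (cross_sign i j * X i j) = X i j" for i j using cross_sign_pm[of i j] by auto
  then have "cross_sign i j * green w (bpt N i) (bpt N j) = X i j" if "i \<in> I" "j \<in> J" for i j
    using w(3) that by (simp only:)
  with bm_approx[OF w(1,2) assms(2)] show ?thesis by simp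
qed

end

text \<open>The ladder needs three boundary points, because the hull of two points has empty
  interior. For one source and one sink, a single edge already realises every value.\<close>

lemma exists_dense_edge:
  assumes ij: "i \<in> {1, 2::nat}" "j \<in> {1, 2}" "i \<noteq> j"
  shows "\<exists>N\<in>Net 2 {i} {j}. \<forall>X. \<forall>\<epsilon>>0. \<exists>w\<in>bm_domain {i} {j} N. \<bar>bm N i j w - X\<bar> < \<epsilon>"
proof -
  define b where "b t = (if t = 1 then 1 else - 1 :: complex)" for t :: nat
  define N where "N = \<lparr>bnum = 2, bpt = b, inner_verts = {}, edges = {(b i, b j)}\<rparr>"
  have N: "bnum N = 2" "bpt N = b" "inner_verts N = {}" "edges N = {(b i, b j)}" by (simp_all add: N_def)
  have bij: "b i \<noteq> b j" using ij by (auto simp: b_def)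
  have r: "{1..2} = {1, 2::nat}" by auto
  have "{1..2} = {i, j}" unfolding r using ij by auto
  then have vs: "verts N = {b i, b j}" by (simp add: verts_def bdry_verts_def N)
  have oe: "out_edges N (b i) = {(b i, b j)}" "out_edges N (b j) = {}" "in_edges N (b i) = {}" "in_edges N (b j) = {(b i, b j)}"
    using bij by (auto simp: out_edges_def in_edges_def N)
  have ccw: "ccw_on_circle 2 b" unfolding ccw_on_circle_def r
    by (rule exI[of _ "\<lambda>t. if t = 1 then 0 else pi"]) (simp add: b_def)
  have net: "N \<in> Net 2 {i} {j}"
    unfolding Net_def using ccw bij vs oe by (simp add: N)
  interpret planar_net 2 "{i}" "{j}" N by unfold_locales (use net ij in auto)
  have "\<exists>w. w \<in> extensional (edges N) \<and> peval (net_det edge_sign) w \<noteq> 0 \<and>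
    (\<forall>i\<in>{i}. \<forall>j\<in>{j}. green w (bpt N i) (bpt N j) = X i j)" for X
  proof -
    define e where "e = (b i, b j)"
    define w where "w = (\<lambda>e\<in>edges N. edge_sign e * X i j)"
    have we: "edge_sign e * w e = X i j" using edge_sign_pm[of e] by (auto simp: w_def N e_def)
    have sum: "(\<Sum>x\<in>verts N. net_matrix edge_sign w (b i) x * g x) = X i j * g (b j)"
      "(\<Sum>x\<in>verts N. net_matrix edge_sign w (b j) x * g x) = 0" for g
      using net_matrix_sum[of "b i" edge_sign w g] net_matrix_sum[of "b j" edge_sign w g] we unfolding oe vs
      by (simp_all add: e_def)
    have D: "peval (net_det edge_sign) w \<noteq> 0"
    proof (rule net_det_nonzero_eval)
      fix g v assume g: "\<And>v. v \<in> verts N \<Longrightarrow> g v = (\<Sum>x\<in>verts N. net_matrix edge_sign w v x * g x)" and v: "v \<in> verts N"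
      have "g (b j) = 0" "g (b i) = X i j * g (b j)" using g[of "b j"] g[of "b i"] unfolding sum by (simp_all add: vs)
      then show "g v = 0" using v by (auto simp: vs)
    qed
    have bv: "b i \<in> verts N" "b j \<in> verts N" by (simp_all add: vs)
    have "green w (b j) (b j) = 1" "green w (b i) (b j) = X i j * green w (b j) (b j)"
      using net_green_left[OF D bv(2,2)] net_green_left[OF D bv(1,2)] bij unfolding green_def[symmetric] sum by simp_all
    then show ?thesis using D by (intro exI[of _ w]) (simp add: w_def N)
  qed
  from bm_dense[OF this] have "\<exists>w\<in>bm_domain {i} {j} N. \<bar>bm N i j w - X\<bar> < \<epsilon>" if "0 < \<epsilon>" for X \<epsilon>
    using that by simp
  then show ?thesis using net by blast
qed

text \<open>The network is chosen before the matrix and the tolerance, so the image of a single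
  measurement map is dense.\<close>

lemma exists_dense_network:
  assumes IJ: "I \<union> J = {1..n}" "I \<inter> J = {}" and ne: "I \<noteq> {}" "J \<noteq> {}"
  shows "\<exists>N\<in>Net n I J. \<forall>X. \<forall>\<epsilon>>0. \<exists>w\<in>bm_domain I J N. \<forall>i\<in>I. \<forall>j\<in>J. \<bar>bm N i j w - X i j\<bar> < \<epsilon>"
proof (cases "n \<ge> 3")
  case True
  obtain L where L: "\<forall>X. \<exists>xs. length xs = L \<and> fst ` set xs \<subseteq> {1..n} \<and>
    (\<forall>F s. fold (rung_step n) xs F s = F s + (if s \<in> I then \<Sum>j\<in>J. X s j * F j else 0))"
    using exists_rung_steps[OF IJ] by (elim exE)
  interpret ladder n L I J by unfold_locales (use True IJ in auto)
  have "\<exists>w. w \<in> extensional (edges lnet) \<and> peval (net.net_det net.edge_sign) w \<noteq> 0 \<and>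
    (\<forall>i\<in>I. \<forall>j\<in>J. net.green w (bpt lnet i) (bpt lnet j) = X i j)" for X
  proof -
    from L[rule_format, of X] obtain xs where xs: "length xs = L" "fst ` set xs \<subseteq> {1..n}"
      "\<forall>F s. fold (rung_step n) xs F s = F s + (if s \<in> I then \<Sum>j\<in>J. X s j * F j else 0)" by (elim exE conjE)
    show ?thesis by (rule ladder_green[OF xs(1,2) xs(3)[rule_format]])
  qed
  from net.bm_dense[OF this]
  have "\<forall>X. \<forall>\<epsilon>>0. \<exists>w\<in>bm_domain I J lnet. \<forall>i\<in>I. \<forall>j\<in>J. \<bar>bm lnet i j w - X i j\<bar> < \<epsilon>" by simp
  then show ?thesis by (rule bexI[OF _ lnet_in_Net])
next
  case False
  obtain i j where ij: "i \<in> I" "j \<in> J" using ne by blast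
  then have "i \<noteq> j" "i \<in> {1..n}" "j \<in> {1..n}" using IJ by auto
  then have n: "n = 2" using False by auto
  then have ij2: "i \<in> {1, 2}" "j \<in> {1, 2}" using \<open>i \<in> {1..n}\<close> \<open>j \<in> {1..n}\<close> by auto
  have "{1..2} = {i, j}" using ij2 \<open>i \<noteq> j\<close> by auto
  then have I: "I = {i}" and J: "J = {j}" using ij IJ n by auto
  obtain N where N: "N \<in> Net 2 {i} {j}" "\<forall>X. \<forall>\<epsilon>>0. \<exists>w\<in>bm_domain {i} {j} N. \<bar>bm N i j w - X\<bar> < \<epsilon>"
    using exists_dense_edge[OF ij2 \<open>i \<noteq> j\<close>] by blast
  have "\<forall>X. \<forall>\<epsilon>>0. \<exists>w\<in>bm_domain I J N. \<forall>i\<in>I. \<forall>j\<in>J. \<bar>bm N i j w - X i j\<bar> < \<epsilon>"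
    using N(2) unfolding I J by simp
  then show ?thesis using N(1) unfolding n I J by (rule bexI)
qed

section \<open>Uniqueness of the bracket\<close>

lemma poisson_bracket_in: "poisson_bracket S B \<Longrightarrow> B \<in> smooth_funs S \<rightarrow>\<^sub>E smooth_funs S \<rightarrow>\<^sub>E smooth_funs S"
  unfolding poisson_bracket_def by (rule conjunct1)

lemma poisson_bracket_ext:
  assumes "poisson_bracket S B" "poisson_bracket S B'"
    and eq: "\<And>f g x. f \<in> smooth_funs S \<Longrightarrow> g \<in> smooth_funs S \<Longrightarrow> x \<in> coord_space S \<Longrightarrow> B f g x = B' f g x"
  shows "B = B'"
proof (rule PiE_ext[OF poisson_bracket_in[OF assms(1)] poisson_bracket_in[OF assms(2)]])
  fix f assume f: "f \<in> smooth_funs S"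
  note Bf = PiE_mem[OF poisson_bracket_in[OF assms(1)] f] PiE_mem[OF poisson_bracket_in[OF assms(2)] f]
  show "B f = B' f"
  proof (rule PiE_ext[OF Bf])
    fix g assume g: "g \<in> smooth_funs S"
    have "B f g \<in> extensional (coord_space S)" "B' f g \<in> extensional (coord_space S)"
      using PiE_mem[OF Bf(1) g] PiE_mem[OF Bf(2) g] by (simp_all add: smooth_funs_iff)
    then show "B f g = B' f g" using eq[OF f g] by (rule extensionalityI)
  qed
qed

text \<open>A derivation kills constants, and on a one-point space every function is constant. This
  settles the case where \<open>I\<close> or \<open>J\<close> is empty without any network.\<close>

lemma poisson_bracket_point:
  assumes B: "poisson_bracket {} B" and f: "f \<in> smooth_funs {}" and h: "h \<in> smooth_funs {}" and x: "x \<in> coord_space {}"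
  shows "B f h x = 0"
proof -
  let ?c = "\<lambda>c :: real. \<lambda>y\<in>coord_space ({} :: 'a set). c"
  have cs: "coord_space {} = {x}" using x by (auto simp: coord_space_def)
  have c: "?c r \<in> smooth_funs {}" for r by (intro restrict_smooth_funs diff_of_order_const)
  have mult: "(\<lambda>y\<in>coord_space {}. ?c r y * ?c r y) = ?c (r * r)" for r by (auto simp: fun_eq_iff)
  have leibniz: "B (\<lambda>y\<in>coord_space {}. f y * g y) h x = f x * B g h x + g x * B f h x"
    and lin: "B (\<lambda>y\<in>coord_space {}. r * f y + g y) h x = r * B f h x + B g h x"
    if "f \<in> smooth_funs {}" "g \<in> smooth_funs {}" for f g r
    using B that h x unfolding poisson_bracket_def by blast+
  have 1: "B (?c 1) h x = 0" using leibniz[OF c c, of 1 1] x unfolding mult by simp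
  have 0: "B (?c 0) h x = 0" using leibniz[OF c c, of 0 0] x unfolding mult by simp
  have "f = (\<lambda>y\<in>coord_space {}. f x * ?c 1 y + ?c 0 y)"
    by (rule extensionalityI[of _ "coord_space {}"]) (use f in \<open>auto simp: smooth_funs_iff cs\<close>)
  then have "B f h x = B (\<lambda>y\<in>coord_space {}. f x * ?c 1 y + ?c 0 y) h x" by simp
  also have "\<dots> = 0" unfolding lin[OF c c] 1 0 by simp
  finally show ?thesis .
qed

text \<open>Compatibility expresses both brackets by the same bracket of the network at every point
  of the dense image, and continuity extends the equality to all matrices.\<close>

lemma bm_map_poisson_unique:
  assumes IJ: "I \<union> J = {1..n}" "I \<inter> J = {}"
    and B: "poisson_bracket (mat_index (card I) (card J)) B" "\<And>N. N \<in> Net n I J \<Longrightarrow> bm_map_poisson I J a b B N"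
    and B': "poisson_bracket (mat_index (card I) (card J)) B'" "\<And>N. N \<in> Net n I J \<Longrightarrow> bm_map_poisson I J a b B' N"
  shows "B = B'"
proof (rule poisson_bracket_ext[OF B(1) B'(1)])
  let ?S = "mat_index (card I) (card J)"
  fix f g X assume f: "f \<in> smooth_funs ?S" and g: "g \<in> smooth_funs ?S" and X: "X \<in> coord_space ?S"
  have fin: "finite I" "finite J" using IJ(1) by (metis finite_Un finite_atLeastAtMost)+
  show "B f g X = B' f g X"
  proof (cases "I = {} \<or> J = {}")
    case True
    then have S: "?S = {}" by (auto simp: mat_index_def)
    show ?thesis
      using poisson_bracket_point[OF B(1)[unfolded S] f[unfolded S] g[unfolded S] X[unfolded S]]
        poisson_bracket_point[OF B'(1)[unfolded S] f[unfolded S] g[unfolded S] X[unfolded S]] by simp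
  next
    case False
    then have ne: "I \<noteq> {}" "J \<noteq> {}" by auto
    obtain N where N: "N \<in> Net n I J"
      and dense: "\<forall>X. \<forall>\<epsilon>>0. \<exists>w\<in>bm_domain I J N. \<forall>i\<in>I. \<forall>j\<in>J. \<bar>bm N i j w - X i j\<bar> < \<epsilon>"
      using exists_dense_network[OF IJ ne] by (elim bexE)
    define Y where "Y i j = X (inv_into {1..card I} (nth_elem I) i, inv_into {1..card J} (nth_elem J) j)" for i j
    have Y: "Y (nth_elem I p) (nth_elem J q) = X (p, q)" if "(p, q) \<in> ?S" for p q
      using that inv_into_f_f[OF nth_elem_inj[OF fin(1)]] inv_into_f_f[OF nth_elem_inj[OF fin(2)]]
      by (auto simp: Y_def mat_index_def)
    define P where "P r w \<longleftrightarrow> w \<in> bm_domain I J N \<and> (\<forall>i\<in>I. \<forall>j\<in>J. \<bar>bm N i j w - Y i j\<bar> < 1 / real (Suc r))" for r w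
    have "\<exists>w. P r w" for r
      using dense[rule_format, of "1 / real (Suc r)" Y] by (auto simp: P_def)
    then obtain w where w: "P r (w r)" for r using choice[of P] by blast
    have lim: "(\<lambda>r. bm_map I J N (w r)) \<longlonglongrightarrow> X"
      unfolding tendsto_fun_iff
    proof
      fix s
      show "(\<lambda>r. bm_map I J N (w r) s) \<longlonglongrightarrow> X s"
      proof (cases "s \<in> ?S")
        case True
        obtain p q where s: "s = (p, q)" by force
        have pq: "nth_elem I p \<in> I" "nth_elem J q \<in> J"
          using True s nth_elem_in[OF fin(1)] nth_elem_in[OF fin(2)] by (auto simp: mat_index_def)
        have "\<bar>bm_map I J N (w r) s - X s\<bar> \<le> 1 / real (Suc r)" for r
        proof -
          have "\<bar>bm N (nth_elem I p) (nth_elem J q) (w r) - Y (nth_elem I p) (nth_elem J q)\<bar> < 1 / real (Suc r)"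
            using w[of r] pq unfolding P_def by blast
          then show ?thesis using True Y[of p q] unfolding s by (simp add: bm_map_def)
        qed
        then have "(\<lambda>r. \<bar>bm_map I J N (w r) s - X s\<bar>) \<longlonglongrightarrow> 0"
          using tendsto_sandwich[OF _ _ tendsto_const LIMSEQ_inverse_real_of_nat] by (simp add: inverse_eq_divide)
        then show ?thesis by (rule LIM_zero_cancel[OF tendsto_rabs_zero_cancel])
      next
        case False
        have "bm_map I J N (w r) s = X s" for r
          using False PiE_arb[OF X[unfolded coord_space_def] False] by (simp add: bm_map_def)
        then show ?thesis by simp
      qed
    qed
    have cont: "(\<lambda>r. h (bm_map I J N (w r))) \<longlonglongrightarrow> h X" if "h \<in> smooth_funs ?S" for h
    proof (rule continuous_on_tendsto_compose[OF _ lim X])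
      show "continuous_on (coord_space ?S) h" using that unfolding smooth_funs_def by (elim CollectE conjE) (drule spec[of _ "[]"], simp)
      show "\<forall>\<^sub>F r in sequentially. bm_map I J N (w r) \<in> coord_space ?S" by (simp add: bm_map_def coord_space_def)
    qed
    \<comment> \<open>Brackets of smooth functions are smooth by the definition of a Poisson
      bracket, hence continuous, which is what passing to the limit requires.\<close>
    have "B f g \<in> smooth_funs ?S" "B' f g \<in> smooth_funs ?S"
      using PiE_mem[OF PiE_mem[OF poisson_bracket_in f] g] B(1) B'(1) by blast+
    note lims = cont[OF this(1)] cont[OF this(2)]
    have "B f g (bm_map I J N (w r)) = B' f g (bm_map I J N (w r))" for r
    proof -
      have "w r \<in> bm_domain I J N" using w[of r] by (simp add: P_def)
      then have "net_bracket N a b (f \<circ> bm_map I J N) (g \<circ> bm_map I J N) (w r) = B f g (bm_map I J N (w r))"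
        "net_bracket N a b (f \<circ> bm_map I J N) (g \<circ> bm_map I J N) (w r) = B' f g (bm_map I J N (w r))"
        using bm_map_poisson_def[THEN iffD1, OF B(2)[OF N], THEN conjunct2] bm_map_poisson_def[THEN iffD1, OF B'(2)[OF N], THEN conjunct2] f g
        by blast+
      then show ?thesis by simp
    qed
    with lims(1) have "(\<lambda>r. B' f g (bm_map I J N (w r))) \<longlonglongrightarrow> B f g X" by simp
    then show ?thesis using lims(2) by (rule LIMSEQ_unique)
  qed
qed

theorem theorem3p3:
  fixes n k m :: nat and I J :: "nat set"
  assumes "I \<union> J = {1..n}" and "I \<inter> J = {}" and "k = card I" and "m = card J"
  shows "\<exists>F :: real \<Rightarrow> real \<Rightarrow> (nat \<times> nat) bracket.
    (\<forall>\<alpha> \<beta>. poisson_bracket (mat_index k m) (F \<alpha> \<beta>) \<and>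
       (\<forall>p\<in>{1..k}. \<forall>p'\<in>{1..k}. \<forall>q\<in>{1..m}. \<forall>q'\<in>{1..m}. \<forall>X\<in>coord_space (mat_index k m).
          F \<alpha> \<beta> (entry k m p q) (entry k m p' q') X =
            (\<alpha> - \<beta>) * s_par (nth_elem I p) (nth_elem J q) (nth_elem I p') (nth_elem J q')
              * X (p, q') * X (p', q)
            + (\<alpha> + \<beta>) * s_cross (nth_elem I p) (nth_elem J q) (nth_elem I p') (nth_elem J q')
              * X (p, q) * X (p', q'))) \<and>
    (\<forall>a b. skew3 a \<and> skew3 b \<longrightarrow>
       {B. poisson_bracket (mat_index k m) B \<and> (\<forall>N\<in>Net n I J. bm_map_poisson I J a b B N)}
         = {F (a 2 3 + a 1 3 - a 1 2) (b 2 3 + b 1 3 - b 1 2)})"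
proof -
  define F where "F \<alpha> \<beta> = coeff_bracket (mat_index k m) (gsv_coeff (\<alpha> - \<beta>) (\<alpha> + \<beta>) (nth_elem I) (nth_elem J))" for \<alpha> \<beta>
  have fin: "finite I" "finite J" using assms(1) by (metis finite_Un finite_atLeastAtMost)+
  have inI: "nth_elem I p \<in> I" if "p \<in> {1..k}" for p using nth_elem_in[OF fin(1)] that assms(3) by simp
  have inJ: "nth_elem J q \<in> J" if "q \<in> {1..m}" for q using nth_elem_in[OF fin(2)] that assms(4) by simp
  have ne: "nth_elem I p \<noteq> nth_elem J q" if "p \<in> {1..k}" "q \<in> {1..m}" for p q
    using inI[OF that(1)] inJ[OF that(2)] assms(2) by auto
  have poisson: "poisson_bracket (mat_index k m) (F \<alpha> \<beta>)" for \<alpha> \<beta>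
    unfolding F_def using nth_elem_inj[OF fin(1)] nth_elem_inj[OF fin(2)] ne assms(3,4)
    by (intro gsv_bracket_poisson) simp_all
  have entries: "F \<alpha> \<beta> (entry k m p q) (entry k m p' q') X =
      (\<alpha> - \<beta>) * s_par (nth_elem I p) (nth_elem J q) (nth_elem I p') (nth_elem J q') * X (p, q') * X (p', q)
      + (\<alpha> + \<beta>) * s_cross (nth_elem I p) (nth_elem J q) (nth_elem I p') (nth_elem J q') * X (p, q) * X (p', q')"
    if p: "p \<in> {1..k}" and p': "p' \<in> {1..k}" and q: "q \<in> {1..m}" and q': "q' \<in> {1..m}"
      and X: "X \<in> coord_space (mat_index k m)" for \<alpha> \<beta> p p' q q' X
  proof -
    let ?S = "mat_index k m" and ?P = "gsv_coeff (\<alpha> - \<beta>) (\<alpha> + \<beta>) (nth_elem I) (nth_elem J)"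
    have S: "(p, q) \<in> ?S" "(p', q') \<in> ?S" and finS: "finite ?S" using p p' q q' by (simp_all add: mat_index_def)
    have "F \<alpha> \<beta> (entry k m p q) (entry k m p' q') X
      = (\<Sum>s\<in>?S. \<Sum>t\<in>?S. ?P s t X * pderiv_at s (entry k m p q) X * pderiv_at t (entry k m p' q') X)"
      unfolding F_def by (intro coeff_bracket_eq entry_smooth S X)
    also have "\<dots> = (\<Sum>s\<in>?S. \<Sum>t\<in>?S. if t = (p', q') then if s = (p, q) then ?P s t X else 0 else 0)"
      by (rule sum.cong[OF refl], rule sum.cong[OF refl]) (simp add: pderiv_at_entry X)
    also have "\<dots> = ?P (p, q) (p', q') X" using S finS by simp
    finally show ?thesis
      unfolding s_par_eq[OF ne[OF p q] ne[OF p q'] ne[OF p' q] ne[OF p' q']] s_cross_eq[OF ne[OF p q] ne[OF p q'] ne[OF p' q] ne[OF p' q']]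
      by (simp add: gsv_coeff_def mult_ac)
  qed
  have compat: "bm_map_poisson I J a b (F (a 2 3 + a 1 3 - a 1 2) (b 2 3 + b 1 3 - b 1 2)) N"
    if "skew3 a" "skew3 b" "N \<in> Net n I J" for a b N
  proof -
    interpret planar_net n I J N by unfold_locales (rule that(3) assms(1,2))+
    show ?thesis using bm_map_poisson_gsv[OF that(1,2)] unfolding F_def assms(3,4) .
  qed
  have unique: "B = B'" if "poisson_bracket (mat_index k m) B" "\<forall>N\<in>Net n I J. bm_map_poisson I J a b B N"
    "poisson_bracket (mat_index k m) B'" "\<forall>N\<in>Net n I J. bm_map_poisson I J a b B' N" for a b B B'
    using bm_map_poisson_unique[OF assms(1,2)] that unfolding assms(3,4) by blast
  have set_eq: "{B. poisson_bracket (mat_index k m) B \<and> (\<forall>N\<in>Net n I J. bm_map_poisson I J a b B N)}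
      = {F (a 2 3 + a 1 3 - a 1 2) (b 2 3 + b 1 3 - b 1 2)}" if "skew3 a" "skew3 b" for a b
    using poisson compat[OF that] unique by blast
  show ?thesis
    by (rule exI[of _ F]) (use poisson entries set_eq in blast)
qed

end
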